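(* For each $\Phi\in C_c((0,\infty)\times[-1,1])$ and each $h'\in[-1,1]$, $$\frac{1}{|\ln\epsilon|}\int_\epsilon^{1/4}\Phi(T_r(h',\omega))\frac{dr}{r}\longrightarrow\int_0^\infty\int_{-1}^1\Phi(S,h)\,P(S,h|h')\,dS\,dh$$ for a.e. $\omega\in\mathbb S^1$ as $\epsilon\to0^+$, where $$P(S,h|h')=\frac{3}{\pi^2 S\eta}\Big((S\eta)\wedge(1-S)_+ +(\eta S-|1-S|)_+ +\big((S-\tfrac12S\eta)\wedge(1+\tfrac12S\eta)-(\tfrac12S+\tfrac12S\zeta)\vee1\big)_+ +\big((S-\tfrac12S\eta)\wedge1-(\tfrac12S+\tfrac12S\zeta)\vee(1-\tfrac12S\eta)\big)_+\Big),$$ with $\zeta=\tfrac12|h+h'|$, $\eta=\tfrac12|h-h'|$, $a\wedge b=\min(a,b)$, $a\vee b=\max(a,b)$, $z_+=\max(z,0)$. Equivalently, for each $(S,h,h')\in[0,\infty)\times(-1,1)\times(-1,1)$ with $|h'|\le h$, $$P(S,h|h')=\frac{3}{\pi^2}\left(1\wedge\frac{1}{h-h'}\Big(\frac2S-(1+h')\Big)_+\right).$$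
   Context: Periodic Lorentz gas: for $0<r<\tfrac12$, $Z_r=\{x\in\mathbb R^2:\operatorname{dist}(x,\mathbb Z^2)>r\}$. A point particle moves at unit speed in straight lines in $Z_r$ and is specularly reflected on $\partial Z_r$. For $(x,\omega)$ with $x\in Z_r$ or $x\in\partial Z_r$, $\omega\in\mathbb S^1$, let $\tau_r(x,\omega)=\inf\{t>0: x+t\omega\in\partial Z_r\}$ (the exit time). For $x\in\partial Z_r$ let $n_x$ be the unit normal to $\partial Z_r$ pointing into $Z_r$; set $\Gamma_r^+=\{(x,\omega)\in\partial Z_r\times\mathbb S^1:\omega\cdot n_x>0\}$, $\Gamma_r^0=\{(x,\omega):\omega\cdot n_x=0\}$. The impact parameter is $h_r(x,\omega)=\sin(\widehat{\omega,n_x})$, the sine of the oriented angle (with a fixed orientation) between $n_x$ and $\omega$. The map $(x,\omega)\mapsto(h_r(x,\omega),\omega)$ is a bijection from $(\Gamma_r^+\cup\Gamma_r^0)/\mathbb Z^2$ (quotient by integer translations in $x$) onto $[-1,1]\times\mathbb S^1$; $Y_r$ denotes its inverse. The transfer map $T_r:[-1,1]\times\mathbb S^1\to(0,\infty)\times[-1,1]$ is $T_r(h',\omega)=(2r\tau_r(Y_r(h',\omega)),\,h_r(x_1,\omega_1))$ where, writing $Y_r(h',\omega)=(x_0,\omega)$, $x_1=x_0+\tau_r(x_0,\omega)\omega$ is the next collision point and $\omega_1$ the direction after reflection at $x_1$ (the impact parameter at $x_1$ is the same computed with incoming or outgoing direction). *)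

theory Defs
  imports "HOL-Analysis.Analysis"
begin

definition lattice :: "(real \<times> real) set" where
  "lattice = {x. \<exists>a b::int. x = (of_int a, of_int b)}"

definition Zr :: "real \<Rightarrow> (real \<times> real) set" where
  "Zr r = {x. infdist x lattice > r}"

definition bdryZ :: "real \<Rightarrow> (real \<times> real) set" where
  "bdryZ r = frontier (Zr r)"

definition exit_time :: "real \<Rightarrow> real \<times> real \<Rightarrow> real \<times> real \<Rightarrow> real" where
  "exit_time r x \<omega> = Inf {t. t > 0 \<and> x + t *\<^sub>R \<omega> \<in> bdryZ r}"

definition obst_center :: "real \<Rightarrow> real \<times> real \<Rightarrow> real \<times> real" where
  "obst_center r x = (SOME p. p \<in> lattice \<and> dist x p = r)"

definition normal :: "real \<Rightarrow> real \<times> real \<Rightarrow> real \<times> real" where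
  "normal r x = (1 / r) *\<^sub>R (x - obst_center r x)"

text \<open>Impact parameter: sine of the oriented (counterclockwise) angle from n_x
  to omega, i.e. the 2D cross product n_x \<times> omega of the two unit vectors.\<close>
definition impact :: "real \<Rightarrow> real \<times> real \<Rightarrow> real \<times> real \<Rightarrow> real" where
  "impact r x \<omega> = fst (normal r x) * snd \<omega> - snd (normal r x) * fst \<omega>"

definition reflect :: "real \<Rightarrow> real \<times> real \<Rightarrow> real \<times> real \<Rightarrow> real \<times> real" where
  "reflect r x \<omega> = \<omega> - (2 * (\<omega> \<bullet> normal r x)) *\<^sub>R normal r x"

text \<open>Y_r: inverse of (x, omega) \<mapsto> (h_r(x, omega), omega) on (Gamma^+ \<union> Gamma^0)/Z^2;
  the class mod Z^2 is represented by the point x on the obstacle centred at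
  the origin.\<close>
definition Yr :: "real \<Rightarrow> real \<Rightarrow> real \<times> real \<Rightarrow> real \<times> real" where
  "Yr r h' \<omega> = (THE x. x \<in> bdryZ r \<and> obst_center r x = 0 \<and>
                        \<omega> \<bullet> normal r x \<ge> 0 \<and> impact r x \<omega> = h')"

definition transfer :: "real \<Rightarrow> real \<Rightarrow> real \<times> real \<Rightarrow> real \<times> real" where
  "transfer r h' \<omega> =
     (let x0 = Yr r h' \<omega>; \<tau> = exit_time r x0 \<omega>; x1 = x0 + \<tau> *\<^sub>R \<omega>
      in (2 * r * \<tau>, impact r x1 (reflect r x1 \<omega>)))"

definition pos_part :: "real \<Rightarrow> real" where
  "pos_part z = max z 0"

definition Pker :: "real \<Rightarrow> real \<Rightarrow> real \<Rightarrow> real" where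
  "Pker S h h' =
    (let \<zeta> = \<bar>h + h'\<bar> / 2; \<eta> = \<bar>h - h'\<bar> / 2 in
     3 / (pi ^ 2 * S * \<eta>) *
      ( min (S * \<eta>) (pos_part (1 - S))
      + pos_part (\<eta> * S - \<bar>1 - S\<bar>)
      + pos_part (min (S - S * \<eta> / 2) (1 + S * \<eta> / 2) - max (S / 2 + S * \<zeta> / 2) 1)
      + pos_part (min (S - S * \<eta> / 2) 1 - max (S / 2 + S * \<zeta> / 2) (1 - S * \<eta> / 2))))"

definition dir :: "real \<Rightarrow> real \<times> real" where
  "dir \<theta> = (cos \<theta>, sin \<theta>)"

end

theory Submission
  imports Defs
begin

text \<open>In the coordinates across and along \<open>\<omega>\<close>, the next obstacle is the one centred at the first lattice
  point, in the direction \<open>\<omega>\<close>, of a strip of width \<open>2 r\<close>. If \<open>p\<close>, \<open>q\<close> is a lattice basis whose points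
  lie beyond the two sides of the strip while \<open>p + q\<close> lies in it, that point is \<open>p + q\<close>. The bases that
  occur consist of convergents and semiconvergents of the slope \<open>y\<close> of \<open>\<omega>\<close>, so that the integral over
  \<open>dr / r\<close> splits into pieces, each a function of one iterate of the natural extension
  \<open>(y, z) \<mapsto> (frac (1 / y), 1 / (\<lfloor>1 / y\<rfloor> + z))\<close> of the Gauss map, with invariant measure
  \<open>dy dz / (1 + y z)\<^sup>2\<close>. The logarithmic average is thus a Birkhoff average, divided by the growth rate of
  \<open>- ln\<close> of the convergents' offsets, given by the integral \<open>pi\<^sup>2 / 12\<close> of \<open>- ln y\<close> (Levy's constant).

  The square of the natural extension is used, as one step exchanges the two sides of the strip.
  Limits along a direction do not depend on the past \<open>z\<close>, because changing \<open>z\<close> moves the rescaled free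
  path by \<open>O(r)\<close> only. Hence convergence needs just two ingredients: Garsia's maximal inequality and a
  zero-one law for invariant sets of slopes \<open>y\<close>, which follows from the contraction of the inverse
  branches.

  In the spatial average, the coordinates \<open>c\<close> (offset of \<open>p + q\<close>) and \<open>x = 1 / (\<lfloor>1 / y\<rfloor> + z)\<close> turn the
  union over all branches into the unit interval for \<open>x\<close>. The density at \<open>(S, h)\<close> is the measure of the
  \<open>x\<close> for which the strip contains neither \<open>p\<close> nor \<open>q\<close>, namely
  \<open>min 1 ((2 / S - (1 + h'))\<^sub>+ / (h - h'))\<close> for \<open>\<bar>h'\<bar> \<le> h\<close>.\<close>

section \<open>The kernel\<close>

text \<open>The lattice seen from a direction of slope \<open>y\<close> has past
  \<open>z = y\<close>, and this diagonal is a null set for the invariant measure, so an almost sure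
  statement about pairs \<open>(y, z)\<close> says nothing about it. Independence of
  \<open>z\<close> therefore does double duty: it makes the events depend on \<open>y\<close> alone,
  and it carries the limit from some \<open>z\<close> to the diagonal. A cut-off at radius
  \<epsilon> must be traded for a number of steps. The offset \<open>U n\<close> and the height
  \<open>V (n + 1)\<close> have product between 1/2 and 1, so for \<Phi> supported in
  \<open>[s0, S0]\<close> the two ways of cutting differ only on radii in a fixed multiplicative
  window, at bounded cost in \<open>dr / r\<close>. The constant \<open>3 / pi\<^sup>2\<close> is
  \<open>(1 / 2) / (pi\<^sup>2 / 6)\<close>: the half comes from \<open>S = 2 s\<close>, and
  \<open>pi\<^sup>2 / 6\<close> is Levy's integral for two steps. The mass \<open>ln 2\<close> of
  the measure divides both averages and cancels. Most integrals are taken in \<open>ennreal\<close>,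
  where Fubini and sums exchange under measurability alone; a signed \<Phi> is split at the very
  end.\<close>

definition void :: "real \<Rightarrow> real \<Rightarrow> real \<Rightarrow> real" where
  "void S h h' = min 1 (pos_part (2 / S - max (1 + h') (1 - h)) / (h - h'))"

lemma Pker_swap: "Pker S h h' = Pker S h' h"
  by (simp add: Pker_def Let_def add.commute abs_minus_commute)

text \<open>With \<open>s = S / 2\<close>, \<open>x = S * \<eta> / 2\<close>,
  \<open>z = S * \<zeta> / 2\<close> the four terms of the kernel become piecewise linear, and
  \<open>x + z \<le> s\<close> encodes \<open>\<eta> + \<zeta> \<le> 1\<close>. The six case
  distinctions place the breakpoints; what remains in each case is linear arithmetic.\<close>

lemma Pker_aux:
  fixes s x z :: real
  assumes "s > 0" "x > 0" "z \<ge> 0" "x + z \<le> s"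
  shows "min (2 * x) (pos_part (1 - 2 * s)) + pos_part (2 * x - \<bar>1 - 2 * s\<bar>)
      + pos_part (min (2 * s - x) (1 + x) - max (s + z) 1)
      + pos_part (min (2 * s - x) 1 - max (s + z) (1 - x))
     = min (2 * x) (pos_part (1 - s - z + x))"
  using assms unfolding pos_part_def
  by (cases "2 * s \<le> 1"; cases "2 * x \<le> 2 * s - 1"; cases "s + z \<le> 1";
      cases "s + z \<le> 1 - x"; cases "2 * s - x \<le> 1"; cases "s + z \<le> 1 + x";
      simp add: abs_if; simp add: min_def max_def)

lemma Pker_eq_void:
  assumes "S > 0" "h' < h" "\<bar>h\<bar> \<le> 1" "\<bar>h'\<bar> \<le> 1"
  shows "Pker S h h' = 3 / pi ^ 2 * void S h h'"
proof -
  define X where "X = S * (\<bar>h - h'\<bar> / 2)"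
  define Z where "Z = S * (\<bar>h + h'\<bar> / 2)"
  have X: "X > 0" using assms by (simp add: X_def)
  have Z: "Z \<ge> 0" using assms by (simp add: Z_def)
  have "\<bar>h - h'\<bar> / 2 + \<bar>h + h'\<bar> / 2 \<le> 1"
    using assms(2-) by (auto simp: abs_if field_simps split: if_splits)
  hence "S * (\<bar>h - h'\<bar> / 2 + \<bar>h + h'\<bar> / 2) \<le> S * 1"
    using assms by (intro mult_left_mono) auto
  hence XZ: "X + Z \<le> S" by (simp add: X_def Z_def algebra_simps)
  have "Pker S h h' = 3 / (pi\<^sup>2 * X) *
      ( min X (pos_part (1 - S)) + pos_part (X - \<bar>1 - S\<bar>)
      + pos_part (min (S - X / 2) (1 + X / 2) - max (S / 2 + Z / 2) 1)
      + pos_part (min (S - X / 2) 1 - max (S / 2 + Z / 2) (1 - X / 2)))"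
    by (simp add: Pker_def Let_def X_def Z_def mult.assoc mult.commute mult.left_commute)
  also have "\<dots> = 3 / (pi\<^sup>2 * X) * min X (pos_part (1 - S / 2 - Z / 2 + X / 2))"
    using Pker_aux[of "S / 2" "X / 2" "Z / 2"] X Z XZ assms(1) by simp
  also have "1 - S / 2 - Z / 2 + X / 2 = 1 - S / 2 - (Z - X) / 2"
    by (simp add: field_simps)
  also have "3 / (pi\<^sup>2 * X) * min X (pos_part (1 - S / 2 - (Z - X) / 2))
      = 3 / pi\<^sup>2 * (min X (pos_part (1 - S / 2 - (Z - X) / 2)) / X)"
    by simp
  also have "\<dots> = 3 / pi\<^sup>2 * min 1 (pos_part (1 - S / 2 - (Z - X) / 2) / X)"
    using X by (auto simp: min_def)
  \<comment> \<open>For \<open>h' < h\<close> one has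
    \<open>\<zeta> - \<eta> = max h' (- h)\<close>, according to the sign of \<open>h + h'\<close>.
    This is the origin of the maximum in \<open>void\<close>.\<close>
  also have "Z - X = S * (max (1 + h') (1 - h) - 1)"
    using assms by (cases "h + h' \<ge> 0") (auto simp: X_def Z_def field_simps)
  also have "1 - S / 2 - S * (max (1 + h') (1 - h) - 1) / 2
             = (S / 2) * (2 / S - max (1 + h') (1 - h))"
    using assms by (simp add: field_simps)
  also have "pos_part \<dots> = (S / 2) * pos_part (2 / S - max (1 + h') (1 - h))"
    using assms unfolding pos_part_def by (subst max_mult_distrib_left) auto
  also have "\<dots> / X = pos_part (2 / S - max (1 + h') (1 - h)) / (h - h')"
    using assms by (simp add: X_def field_simps)
  finally show ?thesis by (simp add: void_def)
qed

lemma Pker_explicit: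
  assumes "S \<ge> 0" "h \<in> {-1<..<1}" "h' \<in> {-1<..<1}" "\<bar>h'\<bar> \<le> h"
  shows "Pker S h h' = 3 / pi ^ 2 * min 1 ((1 / (h - h')) * pos_part (2 / S - (1 + h')))"
proof (cases "S = 0 \<or> h = h'")
  \<comment> \<open>Division by zero is zero, so \<open>Pker\<close> vanishes here. So does the
    right-hand side, through \<open>1 / (h - h')\<close> or through
    \<open>2 / S - (1 + h') = - (1 + h') < 0\<close>.\<close>
  case True
  thus ?thesis using assms by (auto simp: Pker_def Let_def pos_part_def)
next
  case False
  hence "S > 0" "h' < h" using assms by auto
  moreover have "max (1 + h') (1 - h) = 1 + h'" using assms by auto
  ultimately show ?thesis using assms by (subst Pker_eq_void) (auto simp: void_def)
qed

section \<open>Garsia's maximal inequality\<close>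

text \<open>The maximum of the partial sums with at most \<open>n\<close> terms along the orbit,
  computed by splitting off the first step. In this form Garsia's inequality can be read off the
  defining equation.\<close>

primrec max_ergodic_sum :: "('a \<Rightarrow> 'a) \<Rightarrow> ('a \<Rightarrow> real) \<Rightarrow> nat \<Rightarrow> 'a \<Rightarrow> real" where
  "max_ergodic_sum S g 0 x = 0"
| "max_ergodic_sum S g (Suc n) x = max 0 (g x + max_ergodic_sum S g n (S x))"

lemma max_ergodic_sum_nonneg: "0 \<le> max_ergodic_sum S g n x"
  by (cases n) auto

lemma max_ergodic_sum_mono: "max_ergodic_sum S g n x \<le> max_ergodic_sum S g (Suc n) x"
proof (induction n arbitrary: x)
  case (Suc n)
  show ?case using Suc.IH[of "S x"] by auto
qed auto

lemma sum_le_max_ergodic_sum: "(\<Sum>i<n. g ((S ^^ i) x)) \<le> max_ergodic_sum S g n x"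
proof (induction n arbitrary: x)
  case (Suc n)
  have "(\<Sum>i<Suc n. g ((S ^^ i) x)) = g x + (\<Sum>i<n. g ((S ^^ i) (S x)))"
    by (subst sum.lessThan_Suc_shift) (simp add: funpow_swap1)
  thus ?case using Suc.IH[of "S x"] by auto
qed auto

text \<open>Says that the limsup of the Birkhoff averages exceeds \<open>c\<close>. The strict
  margin \<open>d > c\<close> makes the event insensitive to errors of size \<open>o(n)\<close>,
  which is how it is later moved between different pasts.\<close>

definition freq_above :: "('a \<Rightarrow> 'a) \<Rightarrow> ('a \<Rightarrow> real) \<Rightarrow> real \<Rightarrow> 'a \<Rightarrow> bool" where
  "freq_above S f c x \<longleftrightarrow>
     (\<exists>d>c. \<exists>\<^sub>F n in sequentially. d * real n < (\<Sum>i<n. f ((S ^^ i) x)))"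

locale mpt = finite_measure M for M :: "'a measure" +
  fixes S :: "'a \<Rightarrow> 'a"
  assumes S[measurable]: "S \<in> M \<rightarrow>\<^sub>M M" and distr_S: "distr M M S = M"
begin

lemma integrable_comp_S: "integrable M f \<Longrightarrow> integrable M (\<lambda>x. f (S x))"
  for f :: "'a \<Rightarrow> real"
  using integrable_distr_eq[OF S, of f] distr_S by (metis borel_measurable_integrable)

lemma integral_comp_S: "integrable M f \<Longrightarrow> (\<integral>x. f (S x) \<partial>M) = (\<integral>x. f x \<partial>M)"
  for f :: "'a \<Rightarrow> real"
  using integral_distr[OF S, of f] distr_S by (metis borel_measurable_integrable)

lemma integrable_max_ergodic_sum:
  "integrable M g \<Longrightarrow> integrable M (max_ergodic_sum S g n)" for g :: "'a \<Rightarrow> real"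
proof (induction n)
  case 0
  have "max_ergodic_sum S g 0 = (\<lambda>_. 0)" by (simp add: fun_eq_iff)
  thus ?case by simp
next
  case (Suc n)
  have "max_ergodic_sum S g (Suc n) = (\<lambda>x. max 0 (g x + max_ergodic_sum S g n (S x)))"
    by (simp add: fun_eq_iff)
  thus ?case using Suc integrable_comp_S[of "max_ergodic_sum S g n"] by auto
qed

text \<open>Garsia's argument: where the maximum over \<open>n + 1\<close> steps at \<open>x\<close>
  is positive, \<open>g x\<close> is that maximum minus the \<open>n\<close>-step maximum at
  \<open>S x\<close>, hence at least the drop of the \<open>n + 1\<close>-step maximum from
  \<open>x\<close> to \<open>S x\<close>; elsewhere this drop is at most 0. The drop integrates to 0
  by invariance, and dominated convergence lets the sets of positivity exhaust the space.\<close>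

lemma maximal_ergodic:
  fixes g :: "'a \<Rightarrow> real"
  assumes g: "integrable M g" and pos: "AE x in M. \<exists>n. 0 < (\<Sum>i<n. g ((S ^^ i) x))"
  shows "0 \<le> (\<integral>x. g x \<partial>M)"
proof -
  let ?G = "max_ergodic_sum S g"
  have intG[intro]: "integrable M (?G n)" for n
    using integrable_max_ergodic_sum[OF g] .
  have [measurable]: "?G n \<in> borel_measurable M" "g \<in> borel_measurable M" for n
    using g intG[of n] by auto
  have ge: "0 \<le> (\<integral>x. (if ?G (Suc n) x > 0 then g x else 0) \<partial>M)" for n
  proof -
    have "0 = (\<integral>x. ?G (Suc n) x \<partial>M) - (\<integral>x. ?G (Suc n) (S x) \<partial>M)"
      using integral_comp_S[OF intG, of "Suc n"] by (simp del: max_ergodic_sum.simps)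
    also have "\<dots> = (\<integral>x. ?G (Suc n) x - ?G (Suc n) (S x) \<partial>M)"
      by (rule Bochner_Integration.integral_diff[symmetric]) (intro intG integrable_comp_S)+
    also have "\<dots> \<le> (\<integral>x. (if ?G (Suc n) x > 0 then g x else 0) \<partial>M)"
    proof (rule integral_mono)
      show "integrable M (\<lambda>x. ?G (Suc n) x - ?G (Suc n) (S x))"
        by (intro Bochner_Integration.integrable_diff integrable_comp_S intG)
      show "integrable M (\<lambda>x. if ?G (Suc n) x > 0 then g x else 0)"
        by (rule Bochner_Integration.integrable_bound[OF g]) auto
      fix x
      show "?G (Suc n) x - ?G (Suc n) (S x) \<le> (if ?G (Suc n) x > 0 then g x else 0)"
        using max_ergodic_sum_nonneg[of S g "Suc n" "S x"] max_ergodic_sum_mono[of S g n "S x"]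
        by (auto simp del: max_ergodic_sum.simps simp: max_ergodic_sum.simps(2)[of S g n x])
    qed
    finally show ?thesis .
  qed
  have "(\<lambda>n. \<integral>x. (if ?G (Suc n) x > 0 then g x else 0) \<partial>M) \<longlonglongrightarrow> (\<integral>x. g x \<partial>M)"
  proof (rule integral_dominated_convergence[where w = "\<lambda>x. \<bar>g x\<bar>"])
    show "AE x in M. (\<lambda>n. if ?G (Suc n) x > 0 then g x else 0) \<longlonglongrightarrow> g x"
    proof (rule AE_mp[OF pos], rule AE_I2, rule impI)
      fix x assume "\<exists>n. 0 < (\<Sum>i<n. g ((S ^^ i) x))"
      then obtain N where N: "0 < ?G N x"
        using sum_le_max_ergodic_sum[of g S x] by (meson less_le_trans)
      have "?G N x \<le> ?G n x" if "n \<ge> N" for n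
        using that by (rule lift_Suc_mono_le[of "\<lambda>n. ?G n x", rotated])
          (rule max_ergodic_sum_mono)
      hence "\<forall>\<^sub>F n in sequentially. (if ?G (Suc n) x > 0 then g x else 0) = g x"
        using N by (intro eventually_sequentiallyI[of N])
          (smt (verit) Suc_leD le_SucI)
      thus "(\<lambda>n. if ?G (Suc n) x > 0 then g x else 0) \<longlonglongrightarrow> g x"
        by (rule tendsto_eventually)
    qed
  qed (use g in auto)
  thus ?thesis by (rule LIMSEQ_le_const) (use ge in blast)
qed

text \<open>If the event held almost everywhere, almost every orbit would have a positive partial
  sum of \<open>f - c\<close>, and the maximal inequality on the whole space would contradict the
  choice of \<open>c\<close>. The zero-one alternative replaces the usual restriction to an
  invariant set.\<close>

lemma freq_above_bound:
  assumes f: "integrable M f"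
    and zo: "(AE x in M. freq_above S f c x) \<or> (AE x in M. \<not> freq_above S f c x)"
    and c: "(\<integral>x. f x \<partial>M) < c * measure M (space M)"
  shows "AE x in M. \<not> freq_above S f c x"
proof (rule ccontr)
  assume "\<not> ?thesis"
  with zo have B: "AE x in M. freq_above S f c x" by blast
  have "0 \<le> (\<integral>x. f x - c \<partial>M)"
  proof (rule maximal_ergodic)
    show "integrable M (\<lambda>x. f x - c)" using f by auto
    show "AE x in M. \<exists>n. 0 < (\<Sum>i<n. f ((S ^^ i) x) - c)"
    proof (rule AE_mp[OF B], rule AE_I2, rule impI)
      fix x assume "freq_above S f c x"
      then obtain d where d: "d > c" "\<exists>\<^sub>F n in sequentially. d * real n < (\<Sum>i<n. f ((S ^^ i) x))"
        by (auto simp: freq_above_def)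
      obtain n where "d * real n < (\<Sum>i<n. f ((S ^^ i) x))"
        using frequently_ex[OF d(2)] by blast
      moreover have "c * real n \<le> d * real n" using d by (intro mult_right_mono) auto
      ultimately show "\<exists>n. 0 < (\<Sum>i<n. f ((S ^^ i) x) - c)"
        by (intro exI[of _ n]) (simp add: sum_subtractf mult.commute)
    qed
  qed
  thus False using c f by (simp add: mult.commute)
qed

text \<open>Ergodicity enters only through the events on which the limsup of the averages of
  \<open>f\<close> or of \<open>- f\<close> exceeds a level. Levels \<open>1 / (k + 1)\<close> above
  the mean suffice, so only countably many null sets are discarded.\<close>

theorem birkhoff_zero_one:
  assumes f: "integrable M f" and pos: "measure M (space M) > 0"
    and zo: "\<And>c. (AE x in M. freq_above S f c x) \<or> (AE x in M. \<not> freq_above S f c x)"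
    and zo': "\<And>c. (AE x in M. freq_above S (\<lambda>x. - f x) c x) \<or>
                    (AE x in M. \<not> freq_above S (\<lambda>x. - f x) c x)"
  shows "AE x in M. (\<lambda>n. (\<Sum>i<n. f ((S ^^ i) x)) / real n)
           \<longlonglongrightarrow> (\<integral>x. f x \<partial>M) / measure M (space M)"
proof -
  define L where "L = (\<integral>x. f x \<partial>M) / measure M (space M)"
  have a: "AE x in M. \<not> freq_above S f (L + 1 / real (Suc k)) x" for k
    by (rule freq_above_bound[OF f zo]) (use pos in \<open>simp add: L_def distrib_right\<close>)
  have b: "AE x in M. \<not> freq_above S (\<lambda>x. - f x) (- L + 1 / real (Suc k)) x" for k
    by (rule freq_above_bound[OF _ zo']) (use f pos in \<open>auto simp: L_def left_diff_distrib distrib_right\<close>)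
  have "AE x in M. \<forall>k. \<not> freq_above S f (L + 1 / real (Suc k)) x \<and>
      \<not> freq_above S (\<lambda>x. - f x) (- L + 1 / real (Suc k)) x"
    using a b by (auto simp: AE_all_countable)
  thus ?thesis unfolding L_def[symmetric]
  proof (rule AE_mp, intro AE_I2 impI)
    fix x assume *: "\<forall>k. \<not> freq_above S f (L + 1 / real (Suc k)) x \<and>
      \<not> freq_above S (\<lambda>x. - f x) (- L + 1 / real (Suc k)) x"
    let ?s = "\<lambda>n. \<Sum>i<n. f ((S ^^ i) x)"
    show "(\<lambda>n. ?s n / real n) \<longlonglongrightarrow> L"
    proof (rule LIMSEQ_I)
      fix e :: real assume "e > 0"
      then obtain k where k: "1 / real (Suc k) < e / 2"
        using nat_approx_posE[of "e / 2"] by auto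
      have 1: "\<forall>\<^sub>F n in sequentially. \<not> ((L + e / 2) * real n < ?s n)"
        using * k unfolding freq_above_def not_frequently[symmetric]
        by (metis add_strict_left_mono)
      have 2: "\<forall>\<^sub>F n in sequentially. \<not> ((- L + e / 2) * real n < (\<Sum>i<n. - f ((S ^^ i) x)))"
        using * k unfolding freq_above_def not_frequently[symmetric]
        by (metis add_strict_left_mono)
      have "\<forall>\<^sub>F n in sequentially. norm (?s n / real n - L) < e"
        using 1 2 eventually_gt_at_top[of 0]
      proof eventually_elim
        case (elim n)
        hence "?s n / real n \<le> L + e / 2" "L - e / 2 \<le> ?s n / real n"
          by (auto simp: field_simps sum_negf)
        thus ?case using \<open>e > 0\<close> by (auto simp: abs_less_iff)
      qed
      thus "\<exists>no. \<forall>n\<ge>no. norm (?s n / real n - L) < e"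
        by (simp add: eventually_sequentially)
    qed
  qed
qed

end

section \<open>The natural extension of the Gauss map\<close>

lemma nn_integral_substitution_antimono:
  fixes f :: "real \<Rightarrow> ennreal"
  assumes [measurable]: "f \<in> borel_measurable borel"
    and der: "\<And>x. x \<in> {a..b} \<Longrightarrow> (g has_real_derivative - g' x) (at x)"
    and cont: "continuous_on {a..b} g'" and nonneg: "\<And>x. x \<in> {a..b} \<Longrightarrow> g' x \<ge> 0"
    and ab: "a < b"
  shows "(\<integral>\<^sup>+x. f x * indicator {g b..g a} x \<partial>lborel)
       = (\<integral>\<^sup>+x. f (g x) * ennreal (g' x) * indicator {a..b} x \<partial>lborel)"
proof -
  have "(\<integral>\<^sup>+x. f x * indicator {g b..g a} x \<partial>lborel)
      = (\<integral>\<^sup>+x. f (- x) * indicator {g b..g a} (- x) \<partial>lborel)"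
    by (subst nn_integral_real_affine[where c = "-1" and t = 0]) auto
  also have "\<dots> = (\<integral>\<^sup>+x. f (- x) * indicator {- g a.. - g b} x \<partial>lborel)"
    by (intro nn_integral_cong) (auto simp: indicator_def)
  also have "\<dots> = (\<integral>\<^sup>+x. f (- (- g x)) * ennreal (g' x) * indicator {a..b} x \<partial>lborel)"
  proof (rule nn_integral_substitution_aux[where g = "\<lambda>x. - g x" and f = "\<lambda>x. f (- x)"])
    show "((\<lambda>x. - g x) has_real_derivative g' x) (at x)" if "x \<in> {a..b}" for x
      using DERIV_minus[OF der[OF that]] by simp
  qed (use assms in auto)
  finally show ?thesis by simp
qed

lemma nn_integral_Icc_Ioo:
  fixes f :: "real \<Rightarrow> ennreal"
  shows "(\<integral>\<^sup>+x. f x * indicator {a..b} x \<partial>lborel) = (\<integral>\<^sup>+x. f x * indicator {a<..<b} x \<partial>lborel)"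
proof (rule nn_integral_cong_AE)
  have "AE x in lborel. x \<noteq> a \<and> x \<noteq> b"
    using AE_lborel_singleton[of a] AE_lborel_singleton[of b] by auto
  thus "AE x in lborel. f x * indicator {a..b} x = f x * indicator {a<..<b} x"
    by eventually_elim (auto simp: indicator_def)
qed

lemma nn_integral_inverse_shift:
  fixes f :: "real \<Rightarrow> ennreal"
  assumes [measurable]: "f \<in> borel_measurable borel" and k: "k > 0"
  shows "(\<integral>\<^sup>+x. f x * indicator {1 / (k + 1)<..<1 / k} x \<partial>lborel)
       = (\<integral>\<^sup>+t. f (1 / (k + t)) * ennreal (1 / (k + t)\<^sup>2) * indicator {0<..<1} t \<partial>lborel)"
proof -
  have "(\<integral>\<^sup>+x. f x * indicator {1 / (k + 1)..1 / (k + 0)} x \<partial>lborel)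
       = (\<integral>\<^sup>+t. f (1 / (k + t)) * ennreal (1 / (k + t)\<^sup>2) * indicator {0..1} t \<partial>lborel)"
  proof (rule nn_integral_substitution_antimono)
    show "((\<lambda>t. 1 / (k + t)) has_real_derivative - (1 / (k + x)\<^sup>2)) (at x)" if "x \<in> {0..1}" for x
      using that k by (auto intro!: derivative_eq_intros simp: power2_eq_square)
    show "continuous_on {0..1} (\<lambda>t. 1 / (k + t)\<^sup>2)"
      using k by (intro continuous_intros) (auto simp: add_nonneg_eq_0_iff)
  qed auto
  thus ?thesis by (simp add: nn_integral_Icc_Ioo)
qed

lemma AE_not_inverse_nat: "AE x in lborel. x \<notin> range (\<lambda>k. 1 / real (Suc k))"
  by (intro AE_not_in countable_imp_null_set_lborel) auto

lemma inverse_nat_interval: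
  fixes x :: real
  assumes "0 < x" "x < 1" "x \<notin> range (\<lambda>k. 1 / real (Suc k))"
  shows "\<exists>k. x \<in> {1 / (real (Suc k) + 1)<..<1 / real (Suc k)}"
proof -
  define n where "n = nat \<lfloor>1 / x\<rfloor>"
  have "1 / x > 1" using assms by simp
  hence n: "n \<ge> 1" "real n \<le> 1 / x" "1 / x < real n + 1"
    unfolding n_def by (auto simp: le_nat_iff) linarith+
  then obtain k where k: "n = Suc k" by (cases n) auto
  have "real n \<noteq> 1 / x" using assms k by (auto simp: field_simps)
  with n have "real n < 1 / x" by auto
  with n(3) show ?thesis using assms k
    by (intro exI[of _ k]) (auto simp: field_simps)
qed

lemma inverse_nat_interval_unique:
  fixes x :: real
  assumes "x \<in> {1 / (real (Suc j) + 1)<..<1 / real (Suc j)}"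
    "x \<in> {1 / (real (Suc k) + 1)<..<1 / real (Suc k)}"
  shows "j = k"
proof -
  have "x > 0" using assms(1) by (smt (verit) divide_pos_pos greaterThanLessThan_iff of_nat_0_less_iff zero_less_Suc)
  hence "real (Suc j) < 1 / x" "1 / x < real (Suc j) + 1" "real (Suc k) < 1 / x" "1 / x < real (Suc k) + 1"
    using assms by (auto simp: field_simps)
  hence "real j < real (Suc k)" "real k < real (Suc j)" by linarith+
  thus ?thesis by linarith
qed

lemma nn_integral_unit_split:
  fixes f :: "real \<Rightarrow> ennreal"
  assumes [measurable]: "f \<in> borel_measurable borel"
  shows "(\<integral>\<^sup>+x. f x * indicator {0<..<1} x \<partial>lborel)
       = (\<Sum>k. \<integral>\<^sup>+x. f x * indicator {1 / (real (Suc k) + 1)<..<1 / real (Suc k)} x \<partial>lborel)"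
proof -
  let ?I = "\<lambda>k. {1 / (real (Suc k) + 1)<..<1 / real (Suc k)}"
  have "(\<integral>\<^sup>+x. f x * indicator {0<..<1} x \<partial>lborel) = (\<integral>\<^sup>+x. (\<Sum>k. f x * indicator (?I k) x) \<partial>lborel)"
  proof (rule nn_integral_cong_AE, rule AE_mp[OF AE_not_inverse_nat], rule AE_I2, rule impI)
    fix x :: real assume x: "x \<notin> range (\<lambda>k. 1 / real (Suc k))"
    show "f x * indicator {0<..<1} x = (\<Sum>k. f x * indicator (?I k) x)"
    proof (cases "0 < x \<and> x < 1")
      case True
      then obtain k where k: "x \<in> ?I k" using inverse_nat_interval[OF _ _ x] by blast
      have "(\<Sum>j. f x * indicator (?I j) x) = (\<Sum>j\<in>{k}. f x * indicator (?I j) x)"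
        by (rule suminf_finite) (use inverse_nat_interval_unique[OF _ k] in \<open>auto simp: indicator_def\<close>)
      also have "\<dots> = f x * indicator (?I k) x"
        by (simp only: sum.insert sum.empty finite.emptyI empty_iff not_False_eq_True add_0_right)
      also have "\<dots> = f x" by (simp only: indicator_simps(1)[OF k] mult_1_right)
      finally show ?thesis using True by (metis greaterThanLessThan_iff indicator_simps(1) mult.right_neutral)
    next
      case False
      have "1 / real (Suc k) \<le> 1" "0 < 1 / (real (Suc k) + 1)" for k by auto
      hence "x \<notin> ?I k" for k using False
        by (smt (verit) greaterThanLessThan_iff)
      hence "indicator (?I k) x = (0 :: ennreal)" for k by (rule indicator_simps(2))
      moreover have "indicator {0<..<1} x = (0 :: ennreal)" using False by simp
      ultimately show ?thesis by (simp only: mult_zero_right suminf_zero)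
    qed
  qed
  also have "\<dots> = (\<Sum>k. \<integral>\<^sup>+x. f x * indicator (?I k) x \<partial>lborel)"
    by (rule nn_integral_suminf) auto
  finally show ?thesis .
qed

lemma nn_integral_gauss_branches:
  fixes f :: "real \<Rightarrow> ennreal"
  assumes [measurable]: "f \<in> borel_measurable borel"
  shows "(\<integral>\<^sup>+x. f x * indicator {0<..<1} x \<partial>lborel)
       = (\<Sum>k. \<integral>\<^sup>+t. f (1 / (real (Suc k) + t)) * ennreal (1 / (real (Suc k) + t)\<^sup>2) * indicator {0<..<1} t \<partial>lborel)"
  unfolding nn_integral_unit_split[OF assms]
  by (intro suminf_cong nn_integral_inverse_shift) auto

section \<open>The natural extension and the invariance of its density\<close>

definition gauss :: "real \<Rightarrow> real" where
  "gauss y = frac (1 / y)"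

definition gauss_digit :: "real \<Rightarrow> real" where
  "gauss_digit y = of_int \<lfloor>1 / y\<rfloor>"

definition gauss_ext :: "real \<times> real \<Rightarrow> real \<times> real" where
  "gauss_ext = (\<lambda>(y, z). (gauss y, 1 / (gauss_digit y + z)))"

definition gauss_ext_measure :: "(real \<times> real) measure" where
  "gauss_ext_measure = density (lborel \<Otimes>\<^sub>M lborel)
     (\<lambda>(y, z). ennreal (1 / (1 + y * z)\<^sup>2) * indicator ({0<..<1} \<times> {0<..<1}) (y, z))"

lemma gauss_measurable[measurable]: "gauss \<in> borel_measurable borel"
  unfolding gauss_def[abs_def] frac_def by measurable

lemma gauss_digit_measurable[measurable]: "gauss_digit \<in> borel_measurable borel"
  unfolding gauss_digit_def[abs_def] by measurable

lemma gauss_ext_measurable[measurable]: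
  "gauss_ext \<in> borel \<Otimes>\<^sub>M borel \<rightarrow>\<^sub>M borel \<Otimes>\<^sub>M borel"
  unfolding gauss_ext_def by measurable

lemma sets_gauss_ext_measure[measurable_cong]:
  "sets gauss_ext_measure = sets (borel \<Otimes>\<^sub>M borel)"
  unfolding gauss_ext_measure_def by (simp cong: sets_pair_measure_cong)

lemma nn_integral_gauss_ext_measure:
  assumes [measurable]: "f \<in> borel_measurable (borel \<Otimes>\<^sub>M borel)"
  shows "(\<integral>\<^sup>+p. f p \<partial>gauss_ext_measure)
     = (\<integral>\<^sup>+y. (\<integral>\<^sup>+z. f (y, z) * ennreal (1 / (1 + y * z)\<^sup>2) * indicator {0<..<1} z \<partial>lborel)
          * indicator {0<..<1} y \<partial>lborel)"
proof -
  have "(\<integral>\<^sup>+p. f p \<partial>gauss_ext_measure)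
     = (\<integral>\<^sup>+p. f p * ((case p of (y, z) \<Rightarrow> ennreal (1 / (1 + y * z)\<^sup>2)) * indicator ({0<..<1} \<times> {0<..<1}) p) \<partial>(lborel \<Otimes>\<^sub>M lborel))"
    unfolding gauss_ext_measure_def
    by (subst nn_integral_density) (auto simp: split_beta' mult.commute)
  also have "\<dots> = (\<integral>\<^sup>+y. \<integral>\<^sup>+z. f (y, z) * (ennreal (1 / (1 + y * z)\<^sup>2) * indicator ({0<..<1} \<times> {0<..<1}) (y, z)) \<partial>lborel \<partial>lborel)"
    by (subst lborel.nn_integral_fst[symmetric]) auto
  also have "\<dots> = (\<integral>\<^sup>+y. (\<integral>\<^sup>+z. (f (y, z) * ennreal (1 / (1 + y * z)\<^sup>2) * indicator {0<..<1} z) * indicator {0<..<1} y \<partial>lborel) \<partial>lborel)"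
    by (intro nn_integral_cong) (auto simp: indicator_def)
  also have "\<dots> = (\<integral>\<^sup>+y. (\<integral>\<^sup>+z. f (y, z) * ennreal (1 / (1 + y * z)\<^sup>2) * indicator {0<..<1} z \<partial>lborel)
          * indicator {0<..<1} y \<partial>lborel)"
    by (intro nn_integral_cong nn_integral_multc) auto
  finally show ?thesis .
qed

lemma gauss_ext_branch:
  assumes "0 < t" "t < 1"
  shows "gauss (1 / (real (Suc k) + t)) = t" "gauss_digit (1 / (real (Suc k) + t)) = real (Suc k)"
proof -
  have f: "\<lfloor>real (Suc k) + t\<rfloor> = int (Suc k)" using assms by (simp add: floor_unique)
  have "frac (real (Suc k) + t) = t" unfolding frac_def f by simp
  thus "gauss (1 / (real (Suc k) + t)) = t" by (simp add: gauss_def)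
  show "gauss_digit (1 / (real (Suc k) + t)) = real (Suc k)"
    unfolding gauss_digit_def using f by simp
qed

text \<open>On the branch \<open>y = 1 / (K + t)\<close> the new past is
  \<open>w = 1 / (K + z)\<close>. Both \<open>(1 + t w) (K + z)\<close> and
  \<open>(1 + z / (K + t)) (K + t)\<close> equal \<open>K + t + z\<close>, so density times Jacobian
  agrees before and after the step. For fixed \<open>t\<close> the intervals of \<open>w\<close>
  over all \<open>K\<close> tile \<open>(0, 1)\<close> up to endpoints, which gives back the full
  measure.\<close>

lemma nn_integral_gauss_ext:
  assumes f[measurable]: "f \<in> borel_measurable (borel \<Otimes>\<^sub>M borel)"
  shows "(\<integral>\<^sup>+p. f (gauss_ext p) \<partial>gauss_ext_measure) = (\<integral>\<^sup>+p. f p \<partial>gauss_ext_measure)"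
proof -
  let ?I = "indicator {0<..<1} :: real \<Rightarrow> ennreal"
  let ?K = "\<lambda>k. real (Suc k)"
  have "(\<integral>\<^sup>+p. f (gauss_ext p) \<partial>gauss_ext_measure)
    = (\<integral>\<^sup>+y. (\<integral>\<^sup>+z. f (gauss_ext (y, z)) * ennreal (1 / (1 + y * z)\<^sup>2) * ?I z \<partial>lborel) * ?I y \<partial>lborel)"
    by (rule nn_integral_gauss_ext_measure) measurable
  also have "\<dots> = (\<Sum>k. \<integral>\<^sup>+t. (\<integral>\<^sup>+z. f (gauss_ext (1 / (?K k + t), z)) * ennreal (1 / (1 + 1 / (?K k + t) * z)\<^sup>2) * ?I z \<partial>lborel)
       * ennreal (1 / (?K k + t)\<^sup>2) * ?I t \<partial>lborel)"
    by (rule nn_integral_gauss_branches) measurable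
  also have "\<dots> = (\<Sum>k. \<integral>\<^sup>+t. (\<integral>\<^sup>+w. (f (t, w) * ennreal (1 / (1 + t * w)\<^sup>2)) * indicator {1 / (?K k + 1)<..<1 / ?K k} w \<partial>lborel) * ?I t \<partial>lborel)"
  proof (intro suminf_cong nn_integral_cong)
    fix k :: nat and t :: real
    show "(\<integral>\<^sup>+z. f (gauss_ext (1 / (?K k + t), z)) * ennreal (1 / (1 + 1 / (?K k + t) * z)\<^sup>2) * ?I z \<partial>lborel)
       * ennreal (1 / (?K k + t)\<^sup>2) * ?I t
      = (\<integral>\<^sup>+w. (f (t, w) * ennreal (1 / (1 + t * w)\<^sup>2)) * indicator {1 / (?K k + 1)<..<1 / ?K k} w \<partial>lborel) * ?I t"
    proof (cases "0 < t \<and> t < 1")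
      case True
      have "(\<integral>\<^sup>+w. (f (t, w) * ennreal (1 / (1 + t * w)\<^sup>2)) * indicator {1 / (?K k + 1)<..<1 / ?K k} w \<partial>lborel)
         = (\<integral>\<^sup>+z. (f (t, 1 / (?K k + z)) * ennreal (1 / (1 + t * (1 / (?K k + z)))\<^sup>2)) * ennreal (1 / (?K k + z)\<^sup>2) * ?I z \<partial>lborel)"
        by (rule nn_integral_inverse_shift) auto
      also have "\<dots> = (\<integral>\<^sup>+z. (f (gauss_ext (1 / (?K k + t), z)) * ennreal (1 / (1 + 1 / (?K k + t) * z)\<^sup>2) * ?I z)
         * ennreal (1 / (?K k + t)\<^sup>2) \<partial>lborel)"
      proof (intro nn_integral_cong)
        fix z :: real
        show "(f (t, 1 / (?K k + z)) * ennreal (1 / (1 + t * (1 / (?K k + z)))\<^sup>2)) * ennreal (1 / (?K k + z)\<^sup>2) * ?I z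
          = (f (gauss_ext (1 / (?K k + t), z)) * ennreal (1 / (1 + 1 / (?K k + t) * z)\<^sup>2) * ?I z) * ennreal (1 / (?K k + t)\<^sup>2)"
        proof (cases "0 < z \<and> z < 1")
          case z: True
          have p: "?K k + z > 0" "?K k + t > 0" using z True by auto
          have "(1 + t * (1 / (?K k + z))) * (?K k + z) = ?K k + t + z"
            "(1 + 1 / (?K k + t) * z) * (?K k + t) = ?K k + t + z"
            using p by (auto simp: field_simps simp del: of_nat_Suc)
          hence "(1 + t * (1 / (?K k + z)))\<^sup>2 * (?K k + z)\<^sup>2 = (1 + 1 / (?K k + t) * z)\<^sup>2 * (?K k + t)\<^sup>2"
            by (metis power_mult_distrib)
          hence "1 / (1 + t * (1 / (?K k + z)))\<^sup>2 * (1 / (?K k + z)\<^sup>2) = 1 / (1 + 1 / (?K k + t) * z)\<^sup>2 * (1 / (?K k + t)\<^sup>2)"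
            by simp
          hence "ennreal (1 / (1 + t * (1 / (?K k + z)))\<^sup>2) * ennreal (1 / (?K k + z)\<^sup>2)
             = ennreal (1 / (1 + 1 / (?K k + t) * z)\<^sup>2) * ennreal (1 / (?K k + t)\<^sup>2)"
            by (metis ennreal_mult' zero_le_divide_1_iff zero_le_power2)
          moreover have "gauss_ext (1 / (?K k + t), z) = (t, 1 / (?K k + z))"
            unfolding gauss_ext_def using gauss_ext_branch[of t k] True by simp
          ultimately show ?thesis by (simp add: mult.assoc mult.left_commute mult.commute)
        qed auto
      qed
      also have "\<dots> = (\<integral>\<^sup>+z. f (gauss_ext (1 / (?K k + t), z)) * ennreal (1 / (1 + 1 / (?K k + t) * z)\<^sup>2) * ?I z \<partial>lborel)
         * ennreal (1 / (?K k + t)\<^sup>2)"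
        by (rule nn_integral_multc) measurable
      finally show ?thesis using True by simp
    qed auto
  qed
  also have "\<dots> = (\<integral>\<^sup>+t. (\<Sum>k. (\<integral>\<^sup>+w. (f (t, w) * ennreal (1 / (1 + t * w)\<^sup>2)) * indicator {1 / (?K k + 1)<..<1 / ?K k} w \<partial>lborel) * ?I t) \<partial>lborel)"
    by (rule nn_integral_suminf[symmetric]) measurable
  also have "\<dots> = (\<integral>\<^sup>+t. (\<integral>\<^sup>+w. f (t, w) * ennreal (1 / (1 + t * w)\<^sup>2) * ?I w \<partial>lborel) * ?I t \<partial>lborel)"
    by (intro nn_integral_cong, subst ennreal_suminf_multc, subst nn_integral_unit_split[symmetric]) auto
  also have "\<dots> = (\<integral>\<^sup>+p. f p \<partial>gauss_ext_measure)"
    by (rule nn_integral_gauss_ext_measure[symmetric]) measurable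
  finally show ?thesis .
qed

section \<open>Irrational points and the inverse of the natural extension\<close>

definition unit_irr :: "real set" where
  "unit_irr = {y. 0 < y \<and> y < 1 \<and> y \<notin> \<rat>}"

lemma AE_unit_irr: "AE y in lborel. 0 < y \<and> y < 1 \<longrightarrow> y \<in> unit_irr"
proof -
  have "AE y in lborel. y \<notin> (\<rat> :: real set)"
    by (intro AE_not_in countable_imp_null_set_lborel countable_rat)
  thus ?thesis by eventually_elim (auto simp: unit_irr_def)
qed

lemma unit_irrD: "y \<in> unit_irr \<Longrightarrow> 0 < y" "y \<in> unit_irr \<Longrightarrow> y < 1"
  by (auto simp: unit_irr_def)

lemma gauss_digit_ge_1: "0 < y \<Longrightarrow> y < 1 \<Longrightarrow> 1 \<le> gauss_digit y"
  by (simp add: gauss_digit_def)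

lemma gauss_unit_irr: assumes "y \<in> unit_irr" shows "gauss y \<in> unit_irr"
proof -
  have "1 / y \<notin> \<rat>"
  proof
    assume "1 / y \<in> \<rat>"
    hence "inverse (1 / y) \<in> \<rat>" by (rule Rats_inverse)
    thus False using assms by (simp add: unit_irr_def)
  qed
  have *: "frac (1 / y) \<notin> \<rat>"
  proof
    assume "frac (1 / y) \<in> \<rat>"
    hence "frac (1 / y) + of_int \<lfloor>1 / y\<rfloor> \<in> \<rat>" by (intro Rats_add) auto
    thus False using \<open>1 / y \<notin> \<rat>\<close> by (simp add: frac_def)
  qed
  hence "frac (1 / y) \<noteq> 0" by (metis Rats_0)
  thus ?thesis using * frac_lt_1[of "1 / y"] frac_ge_0[of "1 / y"]
    by (auto simp: unit_irr_def gauss_def less_le)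
qed

lemma gauss_eq: "gauss y = 1 / y - gauss_digit y"
  by (simp add: gauss_def frac_def gauss_digit_def)

lemma gauss_of_branch:
  assumes "0 < y" "y < 1"
  shows "gauss (1 / (gauss_digit z + y)) = y"
proof -
  have "\<lfloor>gauss_digit z + y\<rfloor> = \<lfloor>1 / z\<rfloor>"
    using assms by (simp add: gauss_digit_def floor_unique)
  thus ?thesis by (simp add: gauss_def frac_def gauss_digit_def)
qed

text \<open>The inverse of the natural extension on irrational points: the digit removed from
  \<open>y\<close> was stored as the first digit of the past and is put back. Exchanging the
  coordinates conjugates the two maps, and the density is symmetric, so invariance is
  inherited.\<close>

definition gauss_back :: "real \<times> real \<Rightarrow> real \<times> real" where
  "gauss_back = (\<lambda>(y, z). (1 / (gauss_digit z + y), gauss z))"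

lemma gauss_back_conv: "gauss_back p = prod.swap (gauss_ext (prod.swap p))"
  by (cases p) (simp add: gauss_back_def gauss_ext_def)

lemma gauss_back_measurable[measurable]:
  "gauss_back \<in> borel \<Otimes>\<^sub>M borel \<rightarrow>\<^sub>M borel \<Otimes>\<^sub>M borel"
  unfolding gauss_back_def by measurable

interpretation lborel_pair: pair_sigma_finite "lborel :: real measure" "lborel :: real measure" ..

lemma nn_integral_gauss_ext_measure_swap:
  assumes f[measurable]: "f \<in> borel_measurable (borel \<Otimes>\<^sub>M borel)"
  shows "(\<integral>\<^sup>+p. f (prod.swap p) \<partial>gauss_ext_measure) = (\<integral>\<^sup>+p. f p \<partial>gauss_ext_measure)"
proof -
  let ?I = "indicator {0<..<1} :: real \<Rightarrow> ennreal"
  have m[measurable]: "prod.swap \<in> borel \<Otimes>\<^sub>M borel \<rightarrow>\<^sub>M borel \<Otimes>\<^sub>M (borel :: real measure)"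
    unfolding prod.swap_def[abs_def] by measurable
  have "(\<integral>\<^sup>+p. f (prod.swap p) \<partial>gauss_ext_measure)
     = (\<integral>\<^sup>+y. (\<integral>\<^sup>+z. f (z, y) * ennreal (1 / (1 + y * z)\<^sup>2) * ?I z \<partial>lborel) * ?I y \<partial>lborel)"
    by (subst nn_integral_gauss_ext_measure) auto
  also have "\<dots> = (\<integral>\<^sup>+y. (\<integral>\<^sup>+z. f (z, y) * ennreal (1 / (1 + y * z)\<^sup>2) * ?I z * ?I y \<partial>lborel) \<partial>lborel)"
    by (intro nn_integral_cong nn_integral_multc[symmetric]) auto
  also have "\<dots> = (\<integral>\<^sup>+z. (\<integral>\<^sup>+y. f (z, y) * ennreal (1 / (1 + y * z)\<^sup>2) * ?I z * ?I y \<partial>lborel) \<partial>lborel)"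
    by (rule lborel_pair.Fubini') measurable
  also have "\<dots> = (\<integral>\<^sup>+z. (\<integral>\<^sup>+y. f (z, y) * ennreal (1 / (1 + z * y)\<^sup>2) * ?I y * ?I z \<partial>lborel) \<partial>lborel)"
    by (intro nn_integral_cong) (auto simp: mult_ac)
  also have "\<dots> = (\<integral>\<^sup>+z. (\<integral>\<^sup>+y. f (z, y) * ennreal (1 / (1 + z * y)\<^sup>2) * ?I y \<partial>lborel) * ?I z \<partial>lborel)"
    by (intro nn_integral_cong nn_integral_multc) auto
  also have "\<dots> = (\<integral>\<^sup>+p. f p \<partial>gauss_ext_measure)"
    by (rule nn_integral_gauss_ext_measure[symmetric]) auto
  finally show ?thesis .
qed

lemma nn_integral_gauss_back:
  assumes f[measurable]: "f \<in> borel_measurable (borel \<Otimes>\<^sub>M borel)"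
  shows "(\<integral>\<^sup>+p. f (gauss_back p) \<partial>gauss_ext_measure) = (\<integral>\<^sup>+p. f p \<partial>gauss_ext_measure)"
proof -
  have m[measurable]: "prod.swap \<in> borel \<Otimes>\<^sub>M borel \<rightarrow>\<^sub>M borel \<Otimes>\<^sub>M (borel :: real measure)"
    unfolding prod.swap_def[abs_def] by measurable
  have "(\<integral>\<^sup>+p. f (gauss_back p) \<partial>gauss_ext_measure)
    = (\<integral>\<^sup>+p. f (prod.swap (gauss_ext p)) \<partial>gauss_ext_measure)"
    unfolding gauss_back_conv
    by (rule nn_integral_gauss_ext_measure_swap[of "\<lambda>p. f (prod.swap (gauss_ext p))"]) measurable
  also have "\<dots> = (\<integral>\<^sup>+p. f (prod.swap p) \<partial>gauss_ext_measure)"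
    by (rule nn_integral_gauss_ext[of "\<lambda>p. f (prod.swap p)"]) measurable
  also have "\<dots> = (\<integral>\<^sup>+p. f p \<partial>gauss_ext_measure)"
    by (rule nn_integral_gauss_ext_measure_swap) measurable
  finally show ?thesis .
qed

lemma space_gauss_ext_measure[simp]: "space gauss_ext_measure = UNIV"
  by (simp add: gauss_ext_measure_def space_pair_measure)

text \<open>On the unit square \<open>(1 + y z)\<^sup>2\<close> lies between 1 and 4. These crude
  bounds give finiteness and positivity of the mass.\<close>

lemma emeasure_gauss_ext_measure_bounds:
  "emeasure gauss_ext_measure UNIV \<le> 1" "emeasure gauss_ext_measure UNIV \<ge> ennreal (1 / 4)"
proof -
  let ?I = "indicator {0<..<1} :: real \<Rightarrow> ennreal"
  have e: "emeasure gauss_ext_measure UNIV = (\<integral>\<^sup>+p. 1 \<partial>gauss_ext_measure)"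
    by simp
  also have "\<dots> = (\<integral>\<^sup>+y. (\<integral>\<^sup>+z. 1 * ennreal (1 / (1 + y * z)\<^sup>2) * ?I z \<partial>lborel) * ?I y \<partial>lborel)"
    by (rule nn_integral_gauss_ext_measure) auto
  finally have eq: "emeasure gauss_ext_measure UNIV = \<dots>" .
  have "\<dots> \<le> (\<integral>\<^sup>+y. (\<integral>\<^sup>+z. ?I z \<partial>lborel) * ?I y \<partial>lborel)"
  proof (intro nn_integral_mono)
    fix y :: real
    show "(\<integral>\<^sup>+z. 1 * ennreal (1 / (1 + y * z)\<^sup>2) * ?I z \<partial>lborel) * ?I y \<le> (\<integral>\<^sup>+z. ?I z \<partial>lborel) * ?I y"
    proof (cases "0 < y \<and> y < 1")
      case True
      have "(\<integral>\<^sup>+z. 1 * ennreal (1 / (1 + y * z)\<^sup>2) * ?I z \<partial>lborel) \<le> (\<integral>\<^sup>+z. ?I z \<partial>lborel)"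
      proof (intro nn_integral_mono)
        fix z :: real
        show "1 * ennreal (1 / (1 + y * z)\<^sup>2) * ?I z \<le> ?I z"
        proof (cases "0 < z \<and> z < 1")
          case z: True
          have "1 \<le> (1 + y * z)\<^sup>2" using True z by (intro one_le_power) auto
          hence "1 / (1 + y * z)\<^sup>2 \<le> 1" by (auto simp: divide_le_eq)
          thus ?thesis using z by (simp add: ennreal_le_1)
        qed auto
      qed
      thus ?thesis by (rule mult_right_mono) auto
    qed auto
  qed
  also have "\<dots> = 1" by simp
  finally show "emeasure gauss_ext_measure UNIV \<le> 1" using eq by simp
  have "ennreal (1 / 4) = (\<integral>\<^sup>+y. (\<integral>\<^sup>+z. ennreal (1 / 4) * ?I z \<partial>lborel) * ?I y \<partial>lborel)"
    by (simp add: nn_integral_cmult)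
  also have "\<dots> \<le> (\<integral>\<^sup>+y. (\<integral>\<^sup>+z. 1 * ennreal (1 / (1 + y * z)\<^sup>2) * ?I z \<partial>lborel) * ?I y \<partial>lborel)"
  proof (intro nn_integral_mono)
    fix y :: real
    show "(\<integral>\<^sup>+z. ennreal (1 / 4) * ?I z \<partial>lborel) * ?I y \<le> (\<integral>\<^sup>+z. 1 * ennreal (1 / (1 + y * z)\<^sup>2) * ?I z \<partial>lborel) * ?I y"
    proof (cases "0 < y \<and> y < 1")
      case True
      have "(\<integral>\<^sup>+z. ennreal (1 / 4) * ?I z \<partial>lborel) \<le> (\<integral>\<^sup>+z. 1 * ennreal (1 / (1 + y * z)\<^sup>2) * ?I z \<partial>lborel)"
      proof (intro nn_integral_mono)
        fix z :: real
        show "ennreal (1 / 4) * ?I z \<le> 1 * ennreal (1 / (1 + y * z)\<^sup>2) * ?I z"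
        proof (cases "0 < z \<and> z < 1")
          case z: True
          have "y * z < 1 * 1" using True z by (intro mult_strict_mono) auto
          hence "(1 + y * z)\<^sup>2 \<le> 2\<^sup>2" using True z by (intro power_mono) auto
          moreover have "0 < (1 + y * z)\<^sup>2" using True z by (smt (verit) mult_pos_pos zero_less_power)
          ultimately show ?thesis using z by (auto intro!: ennreal_leI simp: field_simps)
        qed auto
      qed
      thus ?thesis by (rule mult_right_mono) auto
    qed auto
  qed
  finally show "emeasure gauss_ext_measure UNIV \<ge> ennreal (1 / 4)" using eq by simp
qed

lemma finite_gauss_ext_measure: "finite_measure gauss_ext_measure"
  using emeasure_gauss_ext_measure_bounds(1) by (intro finite_measureI) (auto simp: top_unique)

lemma measure_gauss_ext_measure_pos: "measure gauss_ext_measure UNIV > 0"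
proof -
  interpret finite_measure gauss_ext_measure by (rule finite_gauss_ext_measure)
  show ?thesis using emeasure_gauss_ext_measure_bounds(2)
    by (simp add: emeasure_eq_measure ennreal_le_iff2)
qed

lemma distr_gauss_ext: "distr gauss_ext_measure gauss_ext_measure gauss_ext = gauss_ext_measure"
proof (rule measure_eqI)
  fix A assume "A \<in> sets (distr gauss_ext_measure gauss_ext_measure gauss_ext)"
  hence A[measurable]: "A \<in> sets (borel \<Otimes>\<^sub>M borel)" by (simp add: sets_gauss_ext_measure)
  have "emeasure (distr gauss_ext_measure gauss_ext_measure gauss_ext) A
     = (\<integral>\<^sup>+p. indicator A p \<partial>distr gauss_ext_measure gauss_ext_measure gauss_ext)"
    by (subst nn_integral_indicator) (auto simp: sets_gauss_ext_measure)
  also have "\<dots> = (\<integral>\<^sup>+p. indicator A (gauss_ext p) \<partial>gauss_ext_measure)"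
    by (rule nn_integral_distr) measurable
  also have "\<dots> = (\<integral>\<^sup>+p. indicator A p \<partial>gauss_ext_measure)"
    by (rule nn_integral_gauss_ext) measurable
  also have "\<dots> = emeasure gauss_ext_measure A"
    by (subst nn_integral_indicator) (auto simp: sets_gauss_ext_measure)
  finally show "emeasure (distr gauss_ext_measure gauss_ext_measure gauss_ext) A = emeasure gauss_ext_measure A" .
qed simp

lemma mpt_gauss_ext2: "mpt gauss_ext_measure (gauss_ext \<circ> gauss_ext)"
proof -
  interpret finite_measure gauss_ext_measure by (rule finite_gauss_ext_measure)
  show ?thesis
  proof
    show [measurable]: "gauss_ext \<circ> gauss_ext \<in> gauss_ext_measure \<rightarrow>\<^sub>M gauss_ext_measure"
      by measurable
    have [measurable]: "gauss_ext \<in> gauss_ext_measure \<rightarrow>\<^sub>M gauss_ext_measure" by measurable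
    show "distr gauss_ext_measure gauss_ext_measure (gauss_ext \<circ> gauss_ext) = gauss_ext_measure"
      using distr_distr[of gauss_ext gauss_ext_measure gauss_ext_measure gauss_ext gauss_ext_measure]
      by (simp add: distr_gauss_ext)
  qed
qed

lemma AE_gauss_ext_measure_iff:
  assumes [measurable]: "Measurable.pred (borel \<Otimes>\<^sub>M borel) P"
  shows "(AE p in gauss_ext_measure. P p) \<longleftrightarrow>
    (AE y in lborel. 0 < y \<and> y < 1 \<longrightarrow> (AE z in lborel. 0 < z \<and> z < 1 \<longrightarrow> P (y, z)))"
proof -
  have pos: "1 + y * z \<noteq> 0" if "0 < y" "0 < z" for y z :: real
    using that by (smt (verit) mult_pos_pos)
  have "(AE p in gauss_ext_measure. P p) \<longleftrightarrow>
    (AE p in lborel \<Otimes>\<^sub>M lborel. 0 < (case p of (y, z) \<Rightarrow> ennreal (1 / (1 + y * z)\<^sup>2) * indicator ({0<..<1} \<times> {0<..<1}) (y, z)) \<longrightarrow> P p)"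
    unfolding gauss_ext_measure_def by (subst AE_density) auto
  also have "\<dots> \<longleftrightarrow> (AE p in lborel \<Otimes>\<^sub>M lborel. 0 < fst p \<and> fst p < 1 \<longrightarrow> 0 < snd p \<and> snd p < 1 \<longrightarrow> P (fst p, snd p))"
    by (rule arg_cong[where f = "\<lambda>Q. AE p in lborel \<Otimes>\<^sub>M lborel. Q p"])
       (auto simp: fun_eq_iff indicator_def ennreal_zero_less_mult_iff pos)
  also have "\<dots> \<longleftrightarrow> (AE y in lborel. AE z in lborel. 0 < y \<and> y < 1 \<longrightarrow> 0 < z \<and> z < 1 \<longrightarrow> P (y, z))"
    by (rule lborel_pair.AE_pair_iff[symmetric]) measurable
  also have "\<dots> \<longleftrightarrow> (AE y in lborel. 0 < y \<and> y < 1 \<longrightarrow> (AE z in lborel. 0 < z \<and> z < 1 \<longrightarrow> P (y, z)))"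
    by simp
  finally show ?thesis .
qed

lemma unit_irr_sets[measurable]: "unit_irr \<in> sets borel"
proof -
  have "unit_irr = {0<..<1} - \<rat>" by (auto simp: unit_irr_def)
  moreover
  have "(\<rat> :: real set) \<in> sets borel"
    by (rule sets.countable[OF _ countable_rat]) simp
  hence "{0<..<1} - \<rat> \<in> sets (borel :: real measure)" by (intro sets.Diff) simp_all
  ultimately show ?thesis by metis
qed

lemma AE_gauss_ext_measure_irr:
  "AE p in gauss_ext_measure. fst p \<in> unit_irr \<and> snd p \<in> unit_irr"
proof (subst AE_gauss_ext_measure_iff)
  have "AE z in lborel. 0 < z \<and> z < 1 \<longrightarrow> fst (y, z) \<in> unit_irr \<and> snd (y, z) \<in> unit_irr"
    if "y \<in> unit_irr" for y
    using AE_unit_irr by eventually_elim (use that in auto)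
  thus "AE y in lborel. 0 < y \<and> y < 1 \<longrightarrow>
     (AE z in lborel. 0 < z \<and> z < 1 \<longrightarrow> fst (y, z) \<in> unit_irr \<and> snd (y, z) \<in> unit_irr)"
    by (intro eventually_mono[OF AE_unit_irr]) blast
qed measurable

section \<open>Zero-one law\<close>

text \<open>Outer regularity for the set and for its complement encloses the set between the closed
  \<open>- T2\<close> and the open \<open>T1\<close>, with a gap of measure below \<delta>. An
  Urysohn function that is 1 on the former and 0 off the latter differs from the indicator only in
  the gap.\<close>

lemma continuous_approx_pred:
  assumes [measurable]: "Measurable.pred borel P" and \<delta>: "\<delta> > (0::real)"
  obtains \<phi> :: "real \<Rightarrow> real" where "continuous_on UNIV \<phi>"
    "(\<integral>\<^sup>+y. ennreal \<bar>of_bool (P y) - \<phi> y\<bar> \<partial>lborel) \<le> ennreal \<delta>"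
proof -
  define E where "E = {y. P y}"
  have E[measurable]: "E \<in> sets borel" unfolding E_def by measurable
  have "E \<in> sets lebesgue" "- E \<in> sets lebesgue" by (auto intro!: sets_completionI_sets)
  then obtain T1 T2 where T: "open T1" "E \<subseteq> T1" "emeasure lebesgue (T1 - E) < ennreal (\<delta> / 2)"
      "open T2" "- E \<subseteq> T2" "emeasure lebesgue (T2 - (- E)) < ennreal (\<delta> / 2)"
    using sets_lebesgue_outer_open[of E "\<delta> / 2"] sets_lebesgue_outer_open[of "- E" "\<delta> / 2"] \<delta>
    by (metis half_gt_zero)
  have [measurable]: "T1 \<in> sets borel" "T2 \<in> sets borel" using T by auto
  have "closed (- T2)" "closed (- T1)" "(- T2) \<inter> (- T1) = {}" using T by auto
  then obtain f :: "real \<Rightarrow> real" where f: "continuous_on UNIV f"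
      "\<And>x. f x \<in> closed_segment 1 0" "\<And>x. x \<in> - T2 \<Longrightarrow> f x = 1" "\<And>x. x \<in> - T1 \<Longrightarrow> f x = 0"
    using Urysohn[of "- T2" "- T1" "1::real" 0] by metis
  have f01: "0 \<le> f x" "f x \<le> 1" for x using f(2)[of x] by (auto simp: closed_segment_eq_real_ivl split: if_splits)
  have "(\<integral>\<^sup>+y. ennreal \<bar>of_bool (P y) - f y\<bar> \<partial>lborel)
     \<le> (\<integral>\<^sup>+y. indicator (T1 - E) y + indicator (T2 - (- E)) y \<partial>lborel)"
  proof (rule nn_integral_mono)
    fix y
    have "\<bar>of_bool (P y) - f y\<bar> \<le> 1" using f01[of y] by auto
    moreover have "of_bool (P y) = f y" if "y \<notin> T1 \<or> y \<notin> T2" using that T(2,5) f(3,4)[of y] by (auto simp: E_def)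
    ultimately show "ennreal \<bar>of_bool (P y) - f y\<bar> \<le> indicator (T1 - E) y + indicator (T2 - (- E)) y"
      by (cases "y \<in> T1 \<and> y \<in> T2"; cases "y \<in> E") (auto simp: ennreal_le_1)
  qed
  also have "\<dots> = emeasure lborel (T1 - E) + emeasure lborel (T2 - (- E))"
    by (subst nn_integral_add) auto
  also have "\<dots> \<le> ennreal (\<delta> / 2) + ennreal (\<delta> / 2)"
    using T by (intro add_mono) auto
  also have "\<dots> = ennreal \<delta>" using \<delta> by (subst ennreal_plus[symmetric]) auto
  finally show ?thesis using that f by blast
qed

definition gauss_back2 :: "real \<times> real \<Rightarrow> real \<times> real" where
  "gauss_back2 p = gauss_back (gauss_back p)"

lemma gauss_back_fst_bounds:
  assumes "0 < y" "y < 1" "z \<in> unit_irr"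
  shows "0 < fst (gauss_back (y, z))" "fst (gauss_back (y, z)) < 1"
  using assms gauss_digit_ge_1[of z] unit_irrD[of z] by (auto simp: gauss_back_def)

lemma gauss_back_snd_irr: "z \<in> unit_irr \<Longrightarrow> snd (gauss_back (y, z)) \<in> unit_irr"
  by (simp add: gauss_back_def gauss_unit_irr)

lemma gauss_back_fst_irr:
  assumes "y \<in> unit_irr" "z \<in> unit_irr"
  shows "fst (gauss_back (y, z)) \<in> unit_irr"
proof -
  have "1 / (gauss_digit z + y) \<notin> \<rat>"
  proof
    assume "1 / (gauss_digit z + y) \<in> \<rat>"
    hence "inverse (1 / (gauss_digit z + y)) \<in> \<rat>" by (rule Rats_inverse)
    hence "gauss_digit z + y - gauss_digit z \<in> \<rat>"
      by (intro Rats_diff) (auto simp: gauss_digit_def)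
    thus False using assms by (simp add: unit_irr_def)
  qed
  moreover have "fst (gauss_back (y, z)) = 1 / (gauss_digit z + y)" by (simp add: gauss_back_def)
  ultimately have "fst (gauss_back (y, z)) \<notin> \<rat>" by metis
  moreover have "0 < fst (gauss_back (y, z))" "fst (gauss_back (y, z)) < 1"
    using gauss_back_fst_bounds[of y z] assms unit_irrD[of y] by blast+
  ultimately show ?thesis unfolding unit_irr_def by blast
qed

lemma gauss_gauss_back2:
  assumes "y \<in> unit_irr" "z \<in> unit_irr"
  shows "gauss (gauss (fst (gauss_back2 (y, z)))) = y"
proof -
  let ?p = "gauss_back (y, z)"
  have p: "fst ?p \<in> unit_irr" using gauss_back_fst_irr[OF assms] .
  have "gauss (fst (gauss_back (fst ?p, snd ?p))) = fst ?p"
    using unit_irrD[OF p] by (simp add: gauss_back_def gauss_of_branch)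
  moreover have "gauss (fst ?p) = y"
    using unit_irrD[OF assms(1)] by (simp add: gauss_back_def gauss_of_branch)
  ultimately show ?thesis by (simp add: gauss_back2_def)
qed

text \<open>A single inverse branch \<open>1 / (a + y)\<close> has derivative -1 at
  \<open>a = 1\<close>, \<open>y = 0\<close>, so it is no uniform contraction. Two of them compose
  to a Moebius map of determinant 1 whose denominators \<open>b (a + y) + 1\<close> are at least
  2.\<close>

lemma two_branch_contraction:
  fixes a b y y' :: real
  assumes "a \<ge> 1" "b \<ge> 1" "0 \<le> y" "0 \<le> y'"
  shows "\<bar>1 / (b + 1 / (a + y)) - 1 / (b + 1 / (a + y'))\<bar> \<le> \<bar>y - y'\<bar> / 4"
proof -
  have pos: "b * (a + y) + 1 \<ge> 2" "b * (a + y') + 1 \<ge> 2"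
    using mult_mono[of 1 b 1 "a + y"] mult_mono[of 1 b 1 "a + y'"] assms by auto
  have e: "1 / (b + 1 / (a + t)) = (a + t) / (b * (a + t) + 1)" if "t \<ge> 0" for t
    using that assms by (simp add: field_simps)
  have ne: "b * (a + y) + 1 \<noteq> 0" "b * (a + y') + 1 \<noteq> 0" using pos by linarith+
  have "1 / (b + 1 / (a + y)) - 1 / (b + 1 / (a + y'))
     = (y - y') / ((b * (a + y) + 1) * (b * (a + y') + 1))"
    unfolding e[OF assms(3)] e[OF assms(4)] diff_frac_eq[OF ne] by (simp add: algebra_simps)
  also have "\<bar>\<dots>\<bar> = \<bar>y - y'\<bar> / ((b * (a + y) + 1) * (b * (a + y') + 1))"
    using pos by (simp add: abs_mult)
  also have "\<dots> \<le> \<bar>y - y'\<bar> / 4"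
    using mult_mono[OF pos] pos by (intro divide_left_mono) auto
  finally show ?thesis .
qed

text \<open>The second coordinate evolves on its own and supplies the digits, so both starting
  points follow the same inverse branches and approach each other by a factor 4 per double
  step.\<close>

lemma gauss_back2_iterates:
  assumes "0 < y" "y < 1" "0 < y'" "y' < 1" "z \<in> unit_irr"
  shows "0 < fst ((gauss_back2 ^^ n) (y, z)) \<and> fst ((gauss_back2 ^^ n) (y, z)) < 1 \<and>
     snd ((gauss_back2 ^^ n) (y, z)) \<in> unit_irr \<and>
     snd ((gauss_back2 ^^ n) (y', z)) = snd ((gauss_back2 ^^ n) (y, z)) \<and>
     0 < fst ((gauss_back2 ^^ n) (y', z)) \<and> fst ((gauss_back2 ^^ n) (y', z)) < 1 \<and>
     \<bar>fst ((gauss_back2 ^^ n) (y, z)) - fst ((gauss_back2 ^^ n) (y', z))\<bar> \<le> (1 / 4) ^ n"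
proof (induction n)
  case (Suc n)
  obtain u w where 1: "(gauss_back2 ^^ n) (y, z) = (u, w)" by force
  obtain u' w' where 2: "(gauss_back2 ^^ n) (y', z) = (u', w')" by force
  have h: "0 < u" "u < 1" "0 < u'" "u' < 1" "w' = w" "w \<in> unit_irr" "\<bar>u - u'\<bar> \<le> (1/4)^n"
    using Suc.IH 1 2 by auto
  have g: "gauss w \<in> unit_irr" using h gauss_unit_irr by blast
  have b: "gauss_back2 (t, w) = (1 / (gauss_digit (gauss w) + 1 / (gauss_digit w + t)), gauss (gauss w))" for t
    by (simp add: gauss_back2_def gauss_back_def)
  have d: "gauss_digit w \<ge> 1" "gauss_digit (gauss w) \<ge> 1"
    using h g unit_irrD gauss_digit_ge_1 by blast+
  have "\<bar>1 / (gauss_digit (gauss w) + 1 / (gauss_digit w + u)) - 1 / (gauss_digit (gauss w) + 1 / (gauss_digit w + u'))\<bar> \<le> \<bar>u - u'\<bar> / 4"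
    by (rule two_branch_contraction) (use d h in auto)
  also have "\<dots> \<le> (1 / 4) ^ Suc n" using h by simp
  finally have c: "\<bar>1 / (gauss_digit (gauss w) + 1 / (gauss_digit w + u)) - 1 / (gauss_digit (gauss w) + 1 / (gauss_digit w + u'))\<bar> \<le> (1 / 4) ^ Suc n" .
  have pos: "0 < 1 / (gauss_digit (gauss w) + 1 / (gauss_digit w + t)) \<and>
      1 / (gauss_digit (gauss w) + 1 / (gauss_digit w + t)) < 1" if "t > 0" for t
  proof -
    have "0 < 1 / (gauss_digit w + t)" using d that by auto
    hence "gauss_digit (gauss w) + 1 / (gauss_digit w + t) > 1" using d by linarith
    thus ?thesis by simp
  qed
  show ?case using 1 2 h b c pos[of u] pos[of u'] gauss_unit_irr[OF g] by simp
qed (use assms in auto)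

lemma gauss_back2_measurable[measurable]:
  "gauss_back2 \<in> borel \<Otimes>\<^sub>M borel \<rightarrow>\<^sub>M borel \<Otimes>\<^sub>M borel"
  unfolding gauss_back2_def[abs_def] by measurable

lemma gauss_back2_funpow_measurable[measurable]:
  "(gauss_back2 ^^ n) \<in> borel \<Otimes>\<^sub>M borel \<rightarrow>\<^sub>M borel \<Otimes>\<^sub>M borel"
  by (induction n) (auto simp: o_def)

lemma nn_integral_gauss_back2_funpow:
  assumes f[measurable]: "f \<in> borel_measurable (borel \<Otimes>\<^sub>M borel)"
  shows "(\<integral>\<^sup>+p. f ((gauss_back2 ^^ n) p) \<partial>gauss_ext_measure) = (\<integral>\<^sup>+p. f p \<partial>gauss_ext_measure)"
proof (induction n)
  case (Suc n)
  have "(\<integral>\<^sup>+p. f ((gauss_back2 ^^ Suc n) p) \<partial>gauss_ext_measure)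
      = (\<integral>\<^sup>+p. f ((gauss_back2 ^^ n) (gauss_back (gauss_back p))) \<partial>gauss_ext_measure)"
    by (simp add: funpow_swap1 gauss_back2_def)
  also have "\<dots> = (\<integral>\<^sup>+p. f ((gauss_back2 ^^ n) (gauss_back p)) \<partial>gauss_ext_measure)"
    by (rule nn_integral_gauss_back[of "\<lambda>p. f ((gauss_back2 ^^ n) (gauss_back p))"]) measurable
  also have "\<dots> = (\<integral>\<^sup>+p. f ((gauss_back2 ^^ n) p) \<partial>gauss_ext_measure)"
    by (rule nn_integral_gauss_back[of "\<lambda>p. f ((gauss_back2 ^^ n) p)"]) measurable
  finally show ?case using Suc.IH by simp
qed simp

text \<open>Passes between the invariant measure, where iteration costs nothing, and Lebesgue
  measure on the unit square, where the two coordinates separate.\<close>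

lemma gauss_ext_measure_density_bounds:
  assumes [measurable]: "f \<in> borel_measurable (borel \<Otimes>\<^sub>M borel)"
  shows "(\<integral>\<^sup>+p. f p \<partial>gauss_ext_measure)
      \<le> (\<integral>\<^sup>+y. \<integral>\<^sup>+z. f (y, z) * indicator ({0<..<1} \<times> {0<..<1}) (y, z) \<partial>lborel \<partial>lborel)"
    and "(\<integral>\<^sup>+y. \<integral>\<^sup>+z. f (y, z) * indicator ({0<..<1} \<times> {0<..<1}) (y, z) \<partial>lborel \<partial>lborel)
      \<le> 4 * (\<integral>\<^sup>+p. f p \<partial>gauss_ext_measure)"
proof -
  let ?A = "indicator ({0<..<1} \<times> {0<..<1}) :: real \<times> real \<Rightarrow> ennreal"
  have e: "(\<integral>\<^sup>+p. f p \<partial>gauss_ext_measure)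
     = (\<integral>\<^sup>+p. f p * ((case p of (y, z) \<Rightarrow> ennreal (1 / (1 + y * z)\<^sup>2)) * ?A p) \<partial>(lborel \<Otimes>\<^sub>M lborel))"
    unfolding gauss_ext_measure_def
    by (subst nn_integral_density) (auto simp: split_beta' mult.commute)
  have i: "(\<integral>\<^sup>+y. \<integral>\<^sup>+z. f (y, z) * ?A (y, z) \<partial>lborel \<partial>lborel) = (\<integral>\<^sup>+p. f p * ?A p \<partial>(lborel \<Otimes>\<^sub>M lborel))"
    by (subst lborel.nn_integral_fst[symmetric]) auto
  have b: "1 / (1 + y * z)\<^sup>2 \<le> 1 \<and> 1 / 4 \<le> 1 / (1 + y * z)\<^sup>2" if "0 < y" "y < 1" "0 < z" "z < 1" for y z :: real
  proof -
    have "1 \<le> (1 + y * z)\<^sup>2" using that by (intro one_le_power) auto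
    moreover have "y * z < 1 * 1" using that by (intro mult_strict_mono) auto
    hence "(1 + y * z)\<^sup>2 \<le> 2\<^sup>2" using that by (intro power_mono) auto
    ultimately show ?thesis by (auto simp: divide_le_eq le_divide_eq)
  qed
  show "(\<integral>\<^sup>+p. f p \<partial>gauss_ext_measure)
      \<le> (\<integral>\<^sup>+y. \<integral>\<^sup>+z. f (y, z) * ?A (y, z) \<partial>lborel \<partial>lborel)"
    unfolding e i
  proof (intro nn_integral_mono mult_left_mono)
    fix p :: "real \<times> real"
    show "(case p of (y, z) \<Rightarrow> ennreal (1 / (1 + y * z)\<^sup>2)) * ?A p \<le> ?A p"
      using b[of "fst p" "snd p"] by (auto simp: indicator_def split_beta' ennreal_le_1)
  qed auto
  have "(\<integral>\<^sup>+p. f p * ?A p \<partial>(lborel \<Otimes>\<^sub>M lborel)) \<le> (\<integral>\<^sup>+p. 4 * (f p * ((case p of (y, z) \<Rightarrow> ennreal (1 / (1 + y * z)\<^sup>2)) * ?A p)) \<partial>(lborel \<Otimes>\<^sub>M lborel))"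
  proof (intro nn_integral_mono)
    fix p :: "real \<times> real"
    have "?A p \<le> 4 * ((case p of (y, z) \<Rightarrow> ennreal (1 / (1 + y * z)\<^sup>2)) * ?A p)"
    proof (cases "p \<in> {0<..<1} \<times> {0<..<1}")
      case True
      have "ennreal 1 \<le> ennreal (4 * (1 / (1 + fst p * snd p)\<^sup>2))"
        using b[of "fst p" "snd p"] True by (intro ennreal_leI) auto
      also have "\<dots> = 4 * ennreal (1 / (1 + fst p * snd p)\<^sup>2)" by (subst ennreal_mult) auto
      finally show ?thesis using True by (simp add: split_beta')
    qed auto
    hence "f p * ?A p \<le> f p * (4 * ((case p of (y, z) \<Rightarrow> ennreal (1 / (1 + y * z)\<^sup>2)) * ?A p))"
      by (rule mult_left_mono) auto
    thus "f p * ?A p \<le> 4 * (f p * ((case p of (y, z) \<Rightarrow> ennreal (1 / (1 + y * z)\<^sup>2)) * ?A p))"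
      by (simp add: mult_ac)
  qed
  also have "\<dots> = 4 * (\<integral>\<^sup>+p. f p * ((case p of (y, z) \<Rightarrow> ennreal (1 / (1 + y * z)\<^sup>2)) * ?A p) \<partial>(lborel \<Otimes>\<^sub>M lborel))"
    by (rule nn_integral_cmult) measurable
  finally show "(\<integral>\<^sup>+y. \<integral>\<^sup>+z. f (y, z) * ?A (y, z) \<partial>lborel \<partial>lborel)
      \<le> 4 * (\<integral>\<^sup>+p. f p \<partial>gauss_ext_measure)"
    unfolding e i .
qed

lemma gauss_back2_funpow_irr:
  assumes "y \<in> unit_irr" "z \<in> unit_irr"
  shows "fst ((gauss_back2 ^^ n) (y, z)) \<in> unit_irr \<and> snd ((gauss_back2 ^^ n) (y, z)) \<in> unit_irr"
proof (induction n)
  case (Suc n)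
  obtain u w where 1: "(gauss_back2 ^^ n) (y, z) = (u, w)" by (cases "(gauss_back2 ^^ n) (y, z)")
  obtain u' w' where 2: "gauss_back (u, w) = (u', w')" by (cases "gauss_back (u, w)")
  have "u \<in> unit_irr" "w \<in> unit_irr" using Suc.IH 1 by auto
  hence "u' \<in> unit_irr" "w' \<in> unit_irr"
    using gauss_back_fst_irr[of u w] gauss_back_snd_irr[of w u] 2 by auto
  hence "fst (gauss_back (u', w')) \<in> unit_irr" "snd (gauss_back (u', w')) \<in> unit_irr"
    using gauss_back_fst_irr[of u' w'] gauss_back_snd_irr[of w' u'] by auto
  moreover have "gauss_back2 (u, w) = gauss_back (u', w')" using 2 by (simp add: gauss_back2_def)
  ultimately show ?case using 1 by simp
qed (use assms in auto)

lemma invariant_funpow: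
  assumes inv: "\<And>y. y \<in> unit_irr \<Longrightarrow> P y \<longleftrightarrow> P (gauss (gauss y))"
    and "y \<in> unit_irr" "z \<in> unit_irr"
  shows "P (fst ((gauss_back2 ^^ n) (y, z))) \<longleftrightarrow> P y"
proof (induction n)
  case (Suc n)
  obtain u w where 1: "(gauss_back2 ^^ n) (y, z) = (u, w)" by (cases "(gauss_back2 ^^ n) (y, z)")
  have uw: "u \<in> unit_irr" "w \<in> unit_irr" using gauss_back2_funpow_irr[OF assms(2,3), of n] 1 by auto
  have "fst (gauss_back2 (u, w)) \<in> unit_irr"
    using gauss_back2_funpow_irr[OF uw, of 1] by simp
  hence "P (fst (gauss_back2 (u, w))) \<longleftrightarrow> P u"
    using inv gauss_gauss_back2[OF uw] by metis
  thus ?case using Suc.IH 1 by simp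
qed simp

text \<open>An invariant predicate of \<open>y\<close> is unchanged under backward iteration of the natural
  extension, whose first coordinate after many steps depends on \<open>z\<close> only, up to a small error.\<close>

lemma invariant_approx_const:
  fixes P :: "real \<Rightarrow> bool" and \<delta> :: real
  assumes [measurable]: "Measurable.pred borel P" and \<delta>: "\<delta> > 0"
    and inv: "\<And>y. y \<in> unit_irr \<Longrightarrow> P y \<longleftrightarrow> P (gauss (gauss y))"
  obtains c :: real where
    "(\<integral>\<^sup>+y. ennreal \<bar>of_bool (P y) - c\<bar> * indicator {0<..<1} y \<partial>lborel) \<le> ennreal (9 * \<delta>)"
proof -
  obtain \<phi> where \<phi>: "continuous_on UNIV \<phi>"
      "(\<integral>\<^sup>+y. ennreal \<bar>of_bool (P y) - \<phi> y\<bar> \<partial>lborel) \<le> ennreal \<delta>"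
    using continuous_approx_pred[OF assms(1) \<delta>] by blast
  have [measurable]: "\<phi> \<in> borel_measurable borel"
    using \<phi>(1) by (rule borel_measurable_continuous_onI)
  have "uniformly_continuous_on {0..1} \<phi>"
    using \<phi>(1) by (intro compact_uniformly_continuous) (auto intro: continuous_on_subset)
  then obtain \<eta> where \<eta>: "\<eta> > 0"
      "\<And>s t. s \<in> {0..1} \<Longrightarrow> t \<in> {0..1} \<Longrightarrow> dist t s < \<eta> \<Longrightarrow> dist (\<phi> t) (\<phi> s) < \<delta>"
    using \<delta> unfolding uniformly_continuous_on_def by metis
  obtain n where n: "(1 / 4 :: real) ^ n < \<eta>" using real_arch_pow_inv[of \<eta> "1 / 4"] \<eta>(1) by auto
  define B where "B = (gauss_back2 ^^ n)"
  have [measurable]: "B \<in> borel \<Otimes>\<^sub>M borel \<rightarrow>\<^sub>M borel \<Otimes>\<^sub>M borel" unfolding B_def by measurable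
  \<comment> \<open>After \<open>n\<close> double steps back the first coordinate depends on the
    starting \<open>y\<close> only up to \<eta>. Freezing the start at 1/2 therefore gives a
    function of \<open>z\<close> alone that tracks \<phi> along the pull-back within
    \<delta>.\<close>
  define \<psi> where "\<psi> z = \<phi> (fst (B (1 / 2, z)))" for z
  have [measurable]: "\<psi> \<in> borel_measurable borel" unfolding \<psi>_def[abs_def] by measurable
  define g where "g p = ennreal \<bar>of_bool (P (fst p)) - \<phi> (fst p)\<bar>" for p :: "real \<times> real"
  have g[measurable]: "g \<in> borel_measurable (borel \<Otimes>\<^sub>M borel)" unfolding g_def[abs_def] by measurable
  have "(\<integral>\<^sup>+p. ennreal \<bar>of_bool (P (fst p)) - \<psi> (snd p)\<bar> \<partial>gauss_ext_measure)
     \<le> (\<integral>\<^sup>+p. g (B p) + ennreal \<delta> \<partial>gauss_ext_measure)"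
  proof (rule nn_integral_mono_AE, rule AE_mp[OF AE_gauss_ext_measure_irr], rule AE_I2, rule impI)
    fix p :: "real \<times> real" assume p: "fst p \<in> unit_irr \<and> snd p \<in> unit_irr"
    define y z where "y = fst p" and "z = snd p"
    have yz: "p = (y, z)" "y \<in> unit_irr" "z \<in> unit_irr" using p by (auto simp: y_def z_def)
    note it = gauss_back2_iterates[of y "1 / 2" z n, folded B_def]
    have "\<bar>fst (B (y, z)) - fst (B (1 / 2, z))\<bar> < \<eta>"
      using it unit_irrD[of y] yz n by linarith
    hence "\<bar>\<phi> (fst (B (y, z))) - \<psi> z\<bar> < \<delta>"
      using \<eta>(2)[of "fst (B (1 / 2, z))" "fst (B (y, z))"] it unit_irrD[of y] yz
      by (auto simp: \<psi>_def dist_real_def)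
    moreover have "of_bool (P (fst (B (y, z)))) = (of_bool (P y) :: real)"
      using invariant_funpow[where P = P, OF inv yz(2,3), of n] by (simp add: B_def)
    ultimately have "\<bar>of_bool (P y) - \<psi> z\<bar> \<le> \<bar>of_bool (P (fst (B (y, z)))) - \<phi> (fst (B (y, z)))\<bar> + \<delta>"
      by simp
    hence "ennreal \<bar>of_bool (P y) - \<psi> z\<bar> \<le> ennreal (\<bar>of_bool (P (fst (B (y, z)))) - \<phi> (fst (B (y, z)))\<bar> + \<delta>)"
      by (rule ennreal_leI)
    also have "\<dots> = g (B (y, z)) + ennreal \<delta>" using \<delta> by (simp add: g_def ennreal_plus)
    finally show "ennreal \<bar>of_bool (P (fst p)) - \<psi> (snd p)\<bar> \<le> g (B p) + ennreal \<delta>"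
      by (simp add: yz)
  qed
  also have "\<dots> = (\<integral>\<^sup>+p. g (B p) \<partial>gauss_ext_measure) + ennreal \<delta> * emeasure gauss_ext_measure UNIV"
    by (subst nn_integral_add) auto
  also have "(\<integral>\<^sup>+p. g (B p) \<partial>gauss_ext_measure) = (\<integral>\<^sup>+p. g p \<partial>gauss_ext_measure)"
    unfolding B_def by (rule nn_integral_gauss_back2_funpow) measurable
  also have "\<dots> \<le> (\<integral>\<^sup>+y. \<integral>\<^sup>+z. g (y, z) * indicator ({0<..<1} \<times> {0<..<1}) (y, z) \<partial>lborel \<partial>lborel)"
    by (rule gauss_ext_measure_density_bounds) measurable
  also have "\<dots> \<le> (\<integral>\<^sup>+y. \<integral>\<^sup>+z. ennreal \<bar>of_bool (P y) - \<phi> y\<bar> * indicator {0<..<1::real} z \<partial>lborel \<partial>lborel)"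
  proof (rule nn_integral_mono, rule nn_integral_mono)
    fix y z :: real
    show "g (y, z) * indicator ({0<..<1} \<times> {0<..<1}) (y, z)
       \<le> ennreal \<bar>of_bool (P y) - \<phi> y\<bar> * indicator {0<..<1} z"
      unfolding g_def fst_conv by (intro mult_left_mono) (auto split: split_indicator)
  qed
  also have "\<dots> = (\<integral>\<^sup>+y. ennreal \<bar>of_bool (P y) - \<phi> y\<bar> \<partial>lborel)"
    by (simp add: nn_integral_cmult)
  also have "\<dots> \<le> ennreal \<delta>" by (rule \<phi>(2))
  also have "ennreal \<delta> * emeasure gauss_ext_measure UNIV \<le> ennreal \<delta> * 1"
    by (intro mult_left_mono emeasure_gauss_ext_measure_bounds) auto
  also have "ennreal \<delta> + ennreal \<delta> * 1 = ennreal (2 * \<delta>)" using \<delta> by (subst mult_2, subst ennreal_plus) auto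
  finally have le: "(\<integral>\<^sup>+p. ennreal \<bar>of_bool (P (fst p)) - \<psi> (snd p)\<bar> \<partial>gauss_ext_measure) \<le> ennreal (2 * \<delta>)"
    by (simp add: add_mono)
  define A where "A z = (\<integral>\<^sup>+y. ennreal \<bar>of_bool (P y) - \<psi> z\<bar> * indicator {0<..<1} y \<partial>lborel)" for z
  have "(\<integral>\<^sup>+z. A z * indicator {0<..<1} z \<partial>lborel)
     = (\<integral>\<^sup>+z. \<integral>\<^sup>+y. ennreal \<bar>of_bool (P y) - \<psi> z\<bar> * indicator {0<..<1} y * indicator {0<..<1} z \<partial>lborel \<partial>lborel)"
    unfolding A_def by (intro nn_integral_cong nn_integral_multc[symmetric]) auto
  also have "\<dots> = (\<integral>\<^sup>+y. \<integral>\<^sup>+z. ennreal \<bar>of_bool (P y) - \<psi> z\<bar> * indicator {0<..<1} y * indicator {0<..<1} z \<partial>lborel \<partial>lborel)"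
    by (rule lborel_pair.Fubini') measurable
  also have "\<dots> = (\<integral>\<^sup>+y. \<integral>\<^sup>+z. ennreal \<bar>of_bool (P (fst (y, z))) - \<psi> (snd (y, z))\<bar> * indicator ({0<..<1} \<times> {0<..<1}) (y, z) \<partial>lborel \<partial>lborel)"
    by (intro nn_integral_cong) (auto simp: indicator_def)
  also have "\<dots> \<le> 4 * (\<integral>\<^sup>+p. ennreal \<bar>of_bool (P (fst p)) - \<psi> (snd p)\<bar> \<partial>gauss_ext_measure)"
    by (rule gauss_ext_measure_density_bounds(2)) measurable
  also have "\<dots> \<le> 4 * ennreal (2 * \<delta>)" by (intro mult_left_mono le) auto
  also have "\<dots> = ennreal (8 * \<delta>)" using \<delta> by (subst ennreal_numeral[symmetric], subst ennreal_mult[symmetric]) auto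
  finally have I: "(\<integral>\<^sup>+z. A z * indicator {0<..<1} z \<partial>lborel) \<le> ennreal (8 * \<delta>)" .
  \<comment> \<open>The factor from \<open>2 * \<delta>\<close> to \<open>8 * \<delta>\<close> is
    the lower bound 1/4 of the density. If all slices exceeded \<open>9 * \<delta>\<close>, so would
    their mean; hence some slice is good, and its value \<open>\<psi> z\<close> is the
    constant.\<close>
  have "\<exists>z. A z \<le> ennreal (9 * \<delta>)"
  proof (rule ccontr)
    assume "\<not> ?thesis"
    hence "(\<integral>\<^sup>+z. ennreal (9 * \<delta>) * indicator {0<..<1::real} z \<partial>lborel) \<le> (\<integral>\<^sup>+z. A z * indicator {0<..<1::real} z \<partial>lborel)"
      by (intro nn_integral_mono mult_right_mono) (auto simp: not_le intro: less_imp_le)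
    hence "ennreal (9 * \<delta>) \<le> ennreal (8 * \<delta>)" using I by (simp add: nn_integral_cmult)
    thus False using \<delta> by (simp add: ennreal_le_iff)
  qed
  then obtain z where "A z \<le> ennreal (9 * \<delta>)" by blast
  thus ?thesis unfolding A_def by (rule that)
qed

lemma ennreal_pos_below:
  fixes a :: ennreal
  assumes "0 < a"
  shows "\<exists>e>0. ennreal e < a"
proof -
  obtain x where "0 < x" "x < a" using dense[OF assms] by blast
  thus ?thesis by (cases x rule: ennreal_cases) auto
qed

text \<open>A constant has distance at least 1/2 from 1 or from 0. An indicator within
  \<open>9 * \<delta>\<close> of a constant in mean thus has one of its two level sets of measure at
  most \<open>18 * \<delta>\<close>, and \<delta> is arbitrary.\<close>

theorem gauss_zero_one:
  fixes P :: "real \<Rightarrow> bool"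
  assumes [measurable]: "Measurable.pred borel P"
    and inv: "\<And>y. y \<in> unit_irr \<Longrightarrow> P y \<longleftrightarrow> P (gauss (gauss y))"
  shows "(AE y in lborel. 0 < y \<and> y < 1 \<longrightarrow> P y) \<or> (AE y in lborel. 0 < y \<and> y < 1 \<longrightarrow> \<not> P y)"
proof -
  define E1 where "E1 = {y. P y \<and> 0 < y \<and> y < 1}"
  define E2 where "E2 = {y. \<not> P y \<and> 0 < y \<and> y < 1}"
  have [measurable]: "E1 \<in> sets borel" "E2 \<in> sets borel" unfolding E1_def E2_def by measurable
  have alt: "emeasure lborel E1 \<le> ennreal (18 * \<delta>) \<or> emeasure lborel E2 \<le> ennreal (18 * \<delta>)" if \<delta>: "\<delta> > 0" for \<delta> :: real
  proof -
    obtain c where c: "(\<integral>\<^sup>+y. ennreal \<bar>of_bool (P y) - c\<bar> * indicator {0<..<1} y \<partial>lborel) \<le> ennreal (9 * \<delta>)"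
      using invariant_approx_const[OF assms(1) \<delta> inv] by blast
    have bound: "emeasure lborel E \<le> ennreal (18 * \<delta>)"
      if [measurable]: "E \<in> sets borel" and E: "\<And>y. y \<in> E \<Longrightarrow> 0 < y \<and> y < 1 \<and> 1 / 2 \<le> \<bar>of_bool (P y) - c\<bar>" for E
    proof -
      have "ennreal (1 / 2) * emeasure lborel E = (\<integral>\<^sup>+y. ennreal (1 / 2) * indicator E y \<partial>lborel)"
        by (simp add: nn_integral_cmult_indicator)
      also have "\<dots> \<le> (\<integral>\<^sup>+y. ennreal \<bar>of_bool (P y) - c\<bar> * indicator {0<..<1} y \<partial>lborel)"
      proof (rule nn_integral_mono)
        fix y
        show "ennreal (1 / 2) * indicator E y \<le> ennreal \<bar>of_bool (P y) - c\<bar> * indicator {0<..<1} y"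
        proof (cases "y \<in> E")
          case True
          have i: "indicator E y = (1 :: ennreal)" "indicator {0<..<1} y = (1 :: ennreal)"
            using True E[OF True] by auto
          show ?thesis unfolding i mult_1_right by (rule ennreal_leI) (use E[OF True] in blast)
        qed auto
      qed
      finally have "ennreal (1 / 2) * emeasure lborel E \<le> ennreal (9 * \<delta>)" using c by (rule order_trans)
      hence "ennreal 2 * (ennreal (1 / 2) * emeasure lborel E) \<le> ennreal 2 * ennreal (9 * \<delta>)"
        by (rule mult_left_mono) auto
      also have "ennreal 2 * (ennreal (1 / 2) * emeasure lborel E) = emeasure lborel E"
        by (subst mult.assoc[symmetric], subst ennreal_mult[symmetric]) auto
      also have "ennreal 2 * ennreal (9 * \<delta>) = ennreal (18 * \<delta>)" using \<delta> by (subst ennreal_mult[symmetric]) auto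
      finally show ?thesis .
    qed
    show ?thesis
    proof (cases "\<bar>1 - c\<bar> \<ge> 1 / 2")
      case True
      thus ?thesis by (intro disjI1 bound) (auto simp: E1_def)
    next
      case False
      hence "1 / 2 \<le> \<bar>c\<bar>" by linarith
      thus ?thesis by (intro disjI2 bound) (auto simp: E2_def)
    qed
  qed
  have "emeasure lborel E1 = 0 \<or> emeasure lborel E2 = 0"
  proof (rule ccontr)
    assume "\<not> ?thesis"
    hence pos: "0 < emeasure lborel E1" "0 < emeasure lborel E2" by (auto simp: zero_less_iff_neq_zero)
    obtain e1 e2 where e1: "0 < e1" "ennreal e1 < emeasure lborel E1"
      and e2: "0 < e2" "ennreal e2 < emeasure lborel E2"
      using ennreal_pos_below[OF pos(1)] ennreal_pos_below[OF pos(2)] by blast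
    have "ennreal (18 * (min e1 e2 / 18)) \<le> ennreal e1" "ennreal (18 * (min e1 e2 / 18)) \<le> ennreal e2"
      by (auto intro!: ennreal_leI)
    moreover have "min e1 e2 / 18 > 0" using e1 e2 by simp
    ultimately have "emeasure lborel E1 \<le> ennreal e1 \<or> emeasure lborel E2 \<le> ennreal e2"
      using alt[of "min e1 e2 / 18"] order_trans by blast
    thus False using e1(2) e2(2) by (auto simp: not_le[symmetric])
  qed
  thus ?thesis
  proof
    assume "emeasure lborel E1 = 0"
    hence "E1 \<in> null_sets lborel" by auto
    hence "AE y in lborel. y \<notin> E1" by (rule AE_not_in)
    thus ?thesis by (intro disjI2) (auto elim!: eventually_mono simp: E1_def)
  next
    assume "emeasure lborel E2 = 0"
    hence "E2 \<in> null_sets lborel" by auto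
    hence "AE y in lborel. y \<notin> E2" by (rule AE_not_in)
    thus ?thesis by (intro disjI1) (auto elim!: eventually_mono simp: E2_def)
  qed
qed

section \<open>Levy's constant\<close>

text \<open>Integration by parts gives the antiderivative \<open>F\<close>, whose logarithmic term
  vanishes at 1 and, since \<open>ln y * y\<close> tends to 0, also at 0.\<close>

lemma nn_integral_ln_power:
  "(\<integral>\<^sup>+y. ennreal (- ln y * y ^ n) * indicator {0<..<1} y \<partial>lborel) = ennreal (1 / (real n + 1)\<^sup>2)"
proof -
  define F where "F y = y ^ Suc n * (1 / (real n + 1)\<^sup>2) - ln y * y ^ Suc n / (real n + 1)" for y :: real
  have der: "(F has_real_derivative (- ln y * y ^ n)) (at y)" if "0 < y" for y
  proof -
    define c where "c = real n + 1"
    have c: "c > 0" by (simp add: c_def)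
    have d1: "((\<lambda>y. y ^ Suc n) has_real_derivative c * y ^ n) (at y)"
      using DERIV_pow[of "Suc n" y] by (simp add: c_def add.commute)
    have d2: "(ln has_real_derivative 1 / y) (at y)" by (rule DERIV_ln_divide[OF that])
    have eq: "(c * y ^ n) * (1 / c\<^sup>2) - (1 / y * y ^ Suc n + c * y ^ n * ln y) / c = - ln y * y ^ n"
      using that c by (simp add: field_simps power2_eq_square)
    from DERIV_diff[OF DERIV_cmult_right[OF d1, of "1 / c\<^sup>2"] DERIV_cdivide[OF DERIV_mult[OF d2 d1], of c]]
    have "((\<lambda>y. y ^ Suc n * (1 / c\<^sup>2) - ln y * y ^ Suc n / c) has_real_derivative - ln y * y ^ n) (at y)"
      unfolding eq .
    thus ?thesis unfolding F_def c_def .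
  qed
  have "((\<lambda>x :: real. ln (inverse x) * inverse x) \<longlongrightarrow> 0) at_top"
  proof (rule Lim_transform_eventually)
    show "((\<lambda>x :: real. - (ln x / x)) \<longlongrightarrow> 0) at_top"
      using tendsto_minus[OF ln_x_over_x_tendsto_0] by simp
    show "\<forall>\<^sub>F x in at_top. - (ln x / x) = ln (inverse x) * inverse (x :: real)"
      using eventually_gt_at_top[of 0] by eventually_elim (simp add: ln_inverse divide_inverse)
  qed
  hence l: "((\<lambda>y :: real. ln y * y) \<longlongrightarrow> 0) (at_right 0)"
    by (simp add: filterlim_at_right_to_top)
  have lim0: "(F \<longlongrightarrow> 0) (at_right 0)"
  proof -
    have "((\<lambda>y. y ^ n * y * (1 / (real n + 1)\<^sup>2) - y ^ n * (ln y * y) / (real n + 1)) \<longlongrightarrow>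
        0 ^ n * 0 * (1 / (real n + 1)\<^sup>2) - 0 ^ n * 0 / (real n + 1)) (at_right 0)"
      by (intro tendsto_intros l) auto
    moreover have "F = (\<lambda>y. y ^ n * y * (1 / (real n + 1)\<^sup>2) - y ^ n * (ln y * y) / (real n + 1))"
      by (simp add: F_def fun_eq_iff mult_ac)
    ultimately show ?thesis by simp
  qed
  have lim1: "(F \<longlongrightarrow> 1 / (real n + 1)\<^sup>2) (at_left 1)"
  proof -
    have "isCont F 1" using der[of 1] by (simp add: DERIV_isCont)
    hence "(F \<longlongrightarrow> F 1) (at_left 1)" by (simp add: isCont_def filterlim_at_split)
    thus ?thesis by (simp add: F_def)
  qed
  have nn: "0 \<le> - ln y * y ^ n" if "0 < y" "y < 1" for y :: real
    using that by (intro mult_nonneg_nonneg) auto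
  have "set_integrable lborel (einterval 0 1) (\<lambda>y. - ln y * y ^ n)"
    and I: "(LBINT y=0..1. - ln y * y ^ n) = 1 / (real n + 1)\<^sup>2 - 0"
    by (rule interval_integral_FTC_nonneg[where F = F];
        use der nn lim0 lim1 in \<open>auto simp: zero_ereal_def one_ereal_def ereal_tendsto_simps intro!: continuous_intros\<close>)+
  hence si: "set_integrable lborel {0<..<1} (\<lambda>y :: real. - ln y * y ^ n)"
    by (simp add: zero_ereal_def one_ereal_def)
  have "(LINT y:{0<..<1::real}|lborel. - ln y * y ^ n) = 1 / (real n + 1)\<^sup>2"
    using I by (simp add: interval_lebesgue_integral_def zero_ereal_def one_ereal_def)
  moreover have "(\<integral>\<^sup>+y. ennreal (indicator {0<..<1} y *\<^sub>R (- ln y * y ^ n)) \<partial>lborel)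
      = ennreal (LINT y:{0<..<1::real}|lborel. - ln y * y ^ n)"
    unfolding set_lebesgue_integral_def
    by (rule nn_integral_eq_integral) (use si nn in \<open>auto simp: set_integrable_def indicator_def\<close>)
  moreover have "(\<integral>\<^sup>+y. ennreal (indicator {0<..<1} y *\<^sub>R (- ln y * y ^ n)) \<partial>lborel)
     = (\<integral>\<^sup>+y. ennreal (- ln y * y ^ n) * indicator {0<..<1} y \<partial>lborel)"
    by (intro nn_integral_cong) (auto split: split_indicator)
  ultimately show ?thesis by simp
qed

text \<open>The even-indexed terms carry a quarter of the sum of all inverse squares; subtracting
  them twice halves \<open>pi\<^sup>2 / 6\<close>.\<close>

lemma alternating_inverse_squares:
  "(\<lambda>k. 1 / (real (2 * k) + 1)\<^sup>2 - 1 / (real (2 * k + 1) + 1)\<^sup>2) sums (pi\<^sup>2 / 12)"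
proof -
  have s: "(\<lambda>n. 1 / (real n + 1)\<^sup>2) sums (pi\<^sup>2 / 6)"
    using inverse_squares_sums by (simp add: add.commute)
  have 1: "(\<lambda>k. 1 / (real (2 * k) + 1)\<^sup>2 + 1 / (real (2 * k + 1) + 1)\<^sup>2) sums (pi\<^sup>2 / 6)"
    using sums_group[OF s, of 2] by (simp add: mult.commute)
  have 2: "(\<lambda>k. (1 / 2) * (1 / (real k + 1)\<^sup>2)) sums ((1 / 2) * (pi\<^sup>2 / 6))"
    by (rule sums_mult[OF s])
  have "1 / (real (2 * k + 1) + 1)\<^sup>2 = (1 / 4) * (1 / (real k + 1)\<^sup>2)" for k
  proof -
    have "real (2 * k + 1) + 1 = 2 * (real k + 1)" by simp
    thus ?thesis by (simp only: power_mult_distrib) simp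
  qed
  hence "1 / (real (2 * k) + 1)\<^sup>2 + 1 / (real (2 * k + 1) + 1)\<^sup>2 - (1 / 2) * (1 / (real k + 1)\<^sup>2)
     = 1 / (real (2 * k) + 1)\<^sup>2 - 1 / (real (2 * k + 1) + 1)\<^sup>2" for k by simp
  note eq = this
  have pi12: "pi\<^sup>2 / 6 - (1 / 2) * (pi\<^sup>2 / 6) = pi\<^sup>2 / 12" by simp
  show ?thesis using sums_diff[OF 1 2] unfolding eq pi12 .
qed

text \<open>Consecutive terms of the alternating expansion of \<open>1 / (1 + y)\<close> are joined
  into \<open>y ^ (2 * k) * (1 - y)\<close>, so that all terms are non-negative and may be
  integrated one by one.\<close>

lemma nn_integral_levy:
  "(\<integral>\<^sup>+y. ennreal (- ln y / (1 + y)) * indicator {0<..<1} y \<partial>lborel) = ennreal (pi\<^sup>2 / 12)"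
proof -
  have "(\<integral>\<^sup>+y. ennreal (- ln y / (1 + y)) * indicator {0<..<1} y \<partial>lborel)
     = (\<integral>\<^sup>+y. (\<Sum>k. ennreal (- ln y * y ^ (2 * k) * (1 - y)) * indicator {0<..<1} y) \<partial>lborel)"
  proof (rule nn_integral_cong)
    fix y :: real
    show "ennreal (- ln y / (1 + y)) * indicator {0<..<1} y
      = (\<Sum>k. ennreal (- ln y * y ^ (2 * k) * (1 - y)) * indicator {0<..<1} y)"
    proof (cases "0 < y \<and> y < 1")
      case True
      have y2: "y\<^sup>2 < 1" using True by (simp add: power_less_one_iff)
      have "(\<lambda>k. (y\<^sup>2) ^ k) sums (1 / (1 - y\<^sup>2))"
        using y2 True by (intro geometric_sums) auto
      hence "(\<lambda>k. - ln y * (1 - y) * (y\<^sup>2) ^ k) sums (- ln y * (1 - y) * (1 / (1 - y\<^sup>2)))"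
        by (rule sums_mult)
      moreover have "1 - y\<^sup>2 = (1 - y) * (1 + y)" by (simp add: algebra_simps power2_eq_square)
      hence "- ln y * (1 - y) * (1 / (1 - y\<^sup>2)) = - ln y / (1 + y)" using True by simp
      moreover have "- ln y * (1 - y) * (y\<^sup>2) ^ k = - ln y * y ^ (2 * k) * (1 - y)" for k
        by (subst power_mult) (simp only: mult_ac)
      ultimately have "(\<lambda>k. - ln y * y ^ (2 * k) * (1 - y)) sums (- ln y / (1 + y))" by (simp only:)
      moreover have "0 \<le> - ln y * y ^ (2 * k) * (1 - y)" for k
        using True by (intro mult_nonneg_nonneg) auto
      ultimately have "(\<Sum>k. ennreal (- ln y * y ^ (2 * k) * (1 - y))) = ennreal (- ln y / (1 + y))"
        by (intro suminf_ennreal_eq) auto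
      thus ?thesis using True by simp
    qed simp
  qed
  also have "\<dots> = (\<Sum>k. \<integral>\<^sup>+y. ennreal (- ln y * y ^ (2 * k) * (1 - y)) * indicator {0<..<1} y \<partial>lborel)"
    by (rule nn_integral_suminf) measurable
  also have "\<dots> = (\<Sum>k. ennreal (1 / (real (2 * k) + 1)\<^sup>2 - 1 / (real (2 * k + 1) + 1)\<^sup>2))"
  proof (rule suminf_cong)
    fix k :: nat
    let ?J = "\<lambda>n. \<integral>\<^sup>+y. ennreal (- ln y * y ^ n) * indicator {0<..<1} y \<partial>lborel"
    let ?X = "\<integral>\<^sup>+y. ennreal (- ln y * y ^ (2 * k) * (1 - y)) * indicator {0<..<1} y \<partial>lborel"
    have "?J (2 * k) = (\<integral>\<^sup>+y. ennreal (- ln y * y ^ (2 * k) * (1 - y)) * indicator {0<..<1} y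
        + ennreal (- ln y * y ^ (2 * k + 1)) * indicator {0<..<1} y \<partial>lborel)"
    proof (rule nn_integral_cong)
      fix y :: real
      show "ennreal (- ln y * y ^ (2 * k)) * indicator {0<..<1} y = ennreal (- ln y * y ^ (2 * k) * (1 - y)) * indicator {0<..<1} y
        + ennreal (- ln y * y ^ (2 * k + 1)) * indicator {0<..<1} y"
      proof (cases "0 < y \<and> y < 1")
        case True
        have "0 \<le> - ln y * y ^ (2 * k) * (1 - y)" "0 \<le> - ln y * y ^ (2 * k + 1)"
          using True by (intro mult_nonneg_nonneg; auto)+
        moreover have "- ln y * y ^ (2 * k) = - ln y * y ^ (2 * k) * (1 - y) + - ln y * y ^ (2 * k + 1)"
          by (simp add: algebra_simps)
        ultimately have "ennreal (- ln y * y ^ (2 * k)) = ennreal (- ln y * y ^ (2 * k) * (1 - y)) + ennreal (- ln y * y ^ (2 * k + 1))"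
          by (metis ennreal_plus)
        thus ?thesis using True by simp
      qed simp
    qed
    also have "\<dots> = ?X + ?J (2 * k + 1)" by (rule nn_integral_add) measurable
    finally have "ennreal (1 / (real (2 * k) + 1)\<^sup>2) = ?X + ennreal (1 / (real (2 * k + 1) + 1)\<^sup>2)"
      unfolding nn_integral_ln_power .
    hence "?X = ennreal (1 / (real (2 * k) + 1)\<^sup>2) - ennreal (1 / (real (2 * k + 1) + 1)\<^sup>2)"
      by simp
    also have "\<dots> = ennreal (1 / (real (2 * k) + 1)\<^sup>2 - 1 / (real (2 * k + 1) + 1)\<^sup>2)"
      by (rule ennreal_minus) simp
    finally show "?X = \<dots>" .
  qed
  also have "\<dots> = ennreal (pi\<^sup>2 / 12)"
  proof (rule suminf_ennreal_eq[OF _ alternating_inverse_squares])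
    fix k :: nat
    show "0 \<le> 1 / (real (2 * k) + 1)\<^sup>2 - 1 / (real (2 * k + 1) + 1)\<^sup>2"
      by (auto intro!: divide_left_mono power_mono)
  qed
  finally show ?thesis .
qed

text \<open>Integrating out the past leaves Gauss's density \<open>1 / (1 + y)\<close>.\<close>

lemma nn_integral_inverse_square_unit:
  assumes "y > 0"
  shows "(\<integral>\<^sup>+z. ennreal (1 / (1 + y * z)\<^sup>2) * indicator {0<..<1} z \<partial>lborel) = ennreal (1 / (1 + y))"
proof -
  have "(\<integral>\<^sup>+z. ennreal (1 / (1 + y * z)\<^sup>2) * indicator {0..1} z \<partial>lborel)
     = ennreal (1 / (1 + y * 1) - 0 / (1 + y * 0))"
  proof (rule nn_integral_FTC_Icc[where F = "\<lambda>z. z / (1 + y * z)"])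
    fix z :: real assume z: "z \<in> {0..1}"
    hence "0 \<le> y * z" using assms by simp
    hence ne: "1 + y * z \<noteq> 0" by linarith
    have d: "((\<lambda>z. 1 + y * z) has_real_derivative y) (at z)" by (auto intro!: derivative_eq_intros)
    have "(1 * (1 + y * z) - z * y) / ((1 + y * z) * (1 + y * z)) = 1 / (1 + y * z)\<^sup>2"
      by (simp add: power2_eq_square mult.commute)
    with DERIV_divide[OF DERIV_ident d ne]
    show "((\<lambda>z. z / (1 + y * z)) has_real_derivative 1 / (1 + y * z)\<^sup>2) (at z)" by simp
  qed auto
  thus ?thesis by (simp add: nn_integral_Icc_Ioo)
qed

lemma nn_integral_levy_gauss:
  "(\<integral>\<^sup>+p. ennreal (- ln (fst p)) \<partial>gauss_ext_measure) = ennreal (pi\<^sup>2 / 12)"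
proof -
  have "(\<integral>\<^sup>+p. ennreal (- ln (fst p)) \<partial>gauss_ext_measure)
    = (\<integral>\<^sup>+y. (\<integral>\<^sup>+z. ennreal (- ln (fst (y, z))) * ennreal (1 / (1 + y * z)\<^sup>2) * indicator {0<..<1} z \<partial>lborel)
          * indicator {0<..<1} y \<partial>lborel)"
    by (rule nn_integral_gauss_ext_measure) measurable
  also have "\<dots> = (\<integral>\<^sup>+y. ennreal (- ln y / (1 + y)) * indicator {0<..<1} y \<partial>lborel)"
  proof (rule nn_integral_cong)
    fix y :: real
    show "(\<integral>\<^sup>+z. ennreal (- ln (fst (y, z))) * ennreal (1 / (1 + y * z)\<^sup>2) * indicator {0<..<1} z \<partial>lborel) * indicator {0<..<1} y
      = ennreal (- ln y / (1 + y)) * indicator {0<..<1} y"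
    proof (cases "0 < y \<and> y < 1")
      case True
      have "(\<integral>\<^sup>+z. ennreal (- ln (fst (y, z))) * ennreal (1 / (1 + y * z)\<^sup>2) * indicator {0<..<1} z \<partial>lborel)
         = ennreal (- ln y) * (\<integral>\<^sup>+z. ennreal (1 / (1 + y * z)\<^sup>2) * indicator {0<..<1} z \<partial>lborel)"
        by (simp add: mult.assoc nn_integral_cmult)
      also have "\<dots> = ennreal (- ln y) * ennreal (1 / (1 + y))"
        using True by (simp add: nn_integral_inverse_square_unit)
      also have "\<dots> = ennreal (- ln y / (1 + y))"
        using True by (subst ennreal_mult[symmetric]) auto
      finally show ?thesis by simp
    qed simp
  qed
  also have "\<dots> = ennreal (pi\<^sup>2 / 12)" by (rule nn_integral_levy)
  finally show ?thesis .
qed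

section \<open>The spatial average\<close>

text \<open>Two lattice points with offsets \<open>1 - k y\<close> and \<open>-y\<close> from the line through the origin lie beyond the
  strip of offsets \<open>[-(1 + h') r, (1 - h') r]\<close>, and their sum, of offset \<open>1 - (k + 1) y\<close>, lies in it.\<close>

definition mediant_hit :: "real \<Rightarrow> nat \<Rightarrow> real \<Rightarrow> real \<Rightarrow> bool" where
  "mediant_hit h' k y r \<longleftrightarrow> 0 < r \<and> 0 < 1 - real (Suc k) * y \<and> 1 - real (Suc k) * y \<le> (1 - h') * r
     \<and> (1 - h') * r < 1 - real k * y \<and> (1 + h') * r < y"

text \<open>The share of one orbit step in the integral over \<open>dr / r\<close>, with
  \<open>k\<close> running over the semiconvergents of that step. The factor
  \<open>(z + k + 1) / (1 + y z)\<close> is the height of the point hit, for basis heights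
  \<open>z / (1 + y z)\<close> and \<open>1 / (1 + y z)\<close>, which make the determinant
  1.\<close>

definition mediant_integral :: "(real \<times> real \<Rightarrow> real) \<Rightarrow> real \<Rightarrow> real \<times> real \<Rightarrow> ennreal" where
  "mediant_integral \<Phi> h' = (\<lambda>(y, z). \<Sum>k. \<integral>\<^sup>+r.
     ennreal (\<Phi> (2 * r * ((z + real (Suc k)) / (1 + y * z)), h' + (1 - real (Suc k) * y) / r) / r)
       * indicator {r. mediant_hit h' k y r} r \<partial>lborel)"

text \<open>The integrand in terms of \<open>s = r (z + k + 1) / (1 + y z)\<close>, half the rescaled free path.\<close>

definition mediant_kernel :: "(real \<times> real \<Rightarrow> real) \<Rightarrow> real \<Rightarrow> real \<Rightarrow> real \<Rightarrow> real \<Rightarrow> ennreal" where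
  "mediant_kernel \<Phi> h' s c x = ennreal (\<Phi> (2 * s, h' + c / s) / s) *
     (if 0 < s \<and> 0 < c \<and> c \<le> (1 - h') * s \<and> (1 - h') * s < 1 + c * (1 - x) \<and> (1 + h') * s < 1 - c * x
      then 1 else 0)"

lemma mediant_hit_measurable[measurable]:
  "Measurable.pred (borel \<Otimes>\<^sub>M borel) (\<lambda>(y, r). mediant_hit h' k y r)"
  unfolding mediant_hit_def by measurable

lemma mediant_kernel_measurable:
  assumes [measurable]: "\<Phi> \<in> borel_measurable (borel \<Otimes>\<^sub>M borel)"
    and [measurable]: "s \<in> borel_measurable M" "c \<in> borel_measurable M" "x \<in> borel_measurable M"
  shows "(\<lambda>w. mediant_kernel \<Phi> h' (s w) (c w) (x w)) \<in> borel_measurable M"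
  unfolding mediant_kernel_def by measurable

text \<open>Scaling the radius by the height \<open>p\<close> of the point hit preserves
  \<open>dr / r\<close>. Because the basis has determinant 1, the two other offsets become functions
  of \<open>c\<close> and \<open>x\<close>: \<open>y p = 1 - c x\<close> and
  \<open>(1 - k y) p = 1 + c (1 - x)\<close>.\<close>

lemma mediant_rescale:
  assumes [measurable]: "\<Phi> \<in> borel_measurable (borel \<Otimes>\<^sub>M borel)" and y: "0 < y" and z: "0 < z"
  shows "(\<integral>\<^sup>+r. ennreal (\<Phi> (2 * r * ((z + real (Suc k)) / (1 + y * z)), h' + (1 - real (Suc k) * y) / r) / r)
       * indicator {r. mediant_hit h' k y r} r \<partial>lborel)
    = (\<integral>\<^sup>+s. mediant_kernel \<Phi> h' s ((1 - real (Suc k) * y) * (real (Suc k) + z) / (1 + y * z)) (1 / (real (Suc k) + z)) \<partial>lborel)"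
proof -
  define K where "K = real (Suc k)"
  have K: "K > 0" "real k = K - 1" by (auto simp: K_def)
  define p where "p = (z + K) / (1 + y * z)"
  have yz: "1 + y * z > 0" using y z by (simp add: add_pos_pos)
  have p: "p > 0" unfolding p_def using K z yz by (intro divide_pos_pos) auto
  define c where "c = (1 - K * y) * p"
  define x where "x = 1 / (K + z)"
  have x: "x > 0" using K z by (simp add: x_def)
  have "y * p = 1 - (1 - K * y) / (1 + y * z)" using yz by (simp add: p_def field_simps)
  also have "p * x = 1 / (1 + y * z)" using K z by (simp add: p_def x_def add.commute)
  hence "(1 - K * y) / (1 + y * z) = c * x" by (simp add: c_def mult.assoc)
  finally have yp: "y * p = 1 - c * x" .
  have kp: "(1 - real k * y) * p = 1 + c * (1 - x)"
    using yp by (simp add: c_def K(2) algebra_simps)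
  have [measurable]: "{r. mediant_hit h' k y r} \<in> sets borel" by measurable
  have "(\<integral>\<^sup>+r. ennreal (\<Phi> (2 * r * p, h' + (1 - K * y) / r) / r)
       * indicator {r. mediant_hit h' k y r} r \<partial>lborel)
     = ennreal \<bar>1 / p\<bar> * (\<integral>\<^sup>+s. ennreal (\<Phi> (2 * (0 + 1 / p * s) * p, h' + (1 - K * y) / (0 + 1 / p * s)) / (0 + 1 / p * s))
       * indicator {r. mediant_hit h' k y r} (0 + 1 / p * s) \<partial>lborel)"
    by (rule nn_integral_real_affine) (use p in auto)
  also have "\<dots> = (\<integral>\<^sup>+s. ennreal \<bar>1 / p\<bar> * (ennreal (\<Phi> (2 * (0 + 1 / p * s) * p, h' + (1 - K * y) / (0 + 1 / p * s)) / (0 + 1 / p * s))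
       * indicator {r. mediant_hit h' k y r} (0 + 1 / p * s)) \<partial>lborel)"
    by (rule nn_integral_cmult[symmetric]) measurable
  also have "\<dots> = (\<integral>\<^sup>+s. mediant_kernel \<Phi> h' s c x \<partial>lborel)"
  proof (rule nn_integral_cong)
    fix s :: real
    have "mediant_hit h' k y (1 / p * s) \<longleftrightarrow> 0 < s \<and> 0 < (1 - K * y) * p \<and> (1 - K * y) * p \<le> (1 - h') * s
       \<and> (1 - h') * s < (1 - real k * y) * p \<and> (1 + h') * s < y * p"
      using p unfolding mediant_hit_def K_def[symmetric]
      by (simp add: pos_le_divide_eq pos_divide_less_eq pos_divide_le_eq pos_less_divide_eq zero_less_mult_iff)
    hence hit: "mediant_hit h' k y (1 / p * s) \<longleftrightarrow> 0 < s \<and> 0 < c \<and> c \<le> (1 - h') * s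
       \<and> (1 - h') * s < 1 + c * (1 - x) \<and> (1 + h') * s < 1 - c * x"
      unfolding kp yp c_def .
    show "ennreal \<bar>1 / p\<bar> * (ennreal (\<Phi> (2 * (0 + 1 / p * s) * p, h' + (1 - K * y) / (0 + 1 / p * s)) / (0 + 1 / p * s))
       * indicator {r. mediant_hit h' k y r} (0 + 1 / p * s)) = mediant_kernel \<Phi> h' s c x"
    proof (cases "mediant_hit h' k y (1 / p * s)")
      case True
      have e: "2 * (0 + 1 / p * s) * p = 2 * s" "(1 - K * y) / (0 + 1 / p * s) = c / s"
        using p by (auto simp: c_def)
      have "ennreal \<bar>1 / p\<bar> * ennreal (\<Phi> (2 * s, h' + c / s) / (1 / p * s)) = ennreal (\<Phi> (2 * s, h' + c / s) / s)"
        using p by (subst ennreal_mult'[symmetric]) auto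
      thus ?thesis using True hit unfolding e by (simp add: mediant_kernel_def)
    next
      case False
      thus ?thesis using hit by (auto simp: mediant_kernel_def)
    qed
  qed
  also have "c = (1 - K * y) * (K + z) / (1 + y * z)" by (simp add: c_def p_def add.commute)
  finally show ?thesis unfolding x_def p_def K_def .
qed

text \<open>For fixed \<open>z\<close> the rescaled offset \<open>c\<close> is a Moebius function of
  \<open>y\<close> whose derivative is the invariant density times \<open>- (K + z)\<^sup>2\<close>,
  where \<open>K = k + 1\<close>. The factor \<open>1 / (K + z)\<^sup>2\<close> left over is the
  Jacobian of \<open>x = 1 / (K + z)\<close>.\<close>

lemma mediant_subst_y:
  fixes g :: "real \<Rightarrow> ennreal"
  assumes [measurable]: "g \<in> borel_measurable borel" and z: "0 < z"
    and g0: "\<And>c. c \<le> 0 \<Longrightarrow> g c = 0" and g1: "\<And>c. real (Suc k) + z < c \<Longrightarrow> g c = 0"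
  shows "(\<integral>\<^sup>+y. g ((1 - real (Suc k) * y) * (real (Suc k) + z) / (1 + y * z)) * ennreal (1 / (1 + y * z)\<^sup>2) * indicator {0<..<1} y \<partial>lborel)
      = ennreal (1 / (real (Suc k) + z)\<^sup>2) * (\<integral>\<^sup>+c. g c \<partial>lborel)"
proof -
  define K where "K = real (Suc k)"
  have K: "K \<ge> 1" by (auto simp: K_def)
  define c where "c y = (1 - K * y) * (K + z) / (1 + y * z)" for y
  define d where "d y = (K + z)\<^sup>2 / (1 + y * z)\<^sup>2" for y
  have sub: "(\<integral>\<^sup>+x. g x * indicator {c (1 / K)..c 0} x \<partial>lborel)
       = (\<integral>\<^sup>+y. g (c y) * ennreal (d y) * indicator {0..1 / K} y \<partial>lborel)"
  proof (rule nn_integral_substitution_antimono)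
    show "(c has_real_derivative - d y) (at y)" if "y \<in> {0..1 / K}" for y
    proof -
      have ne: "1 + y * z \<noteq> 0" using that z by (smt (verit) atLeastAtMost_iff mult_nonneg_nonneg)
      have a: "((\<lambda>y. (1 - K * y) * (K + z)) has_real_derivative (- K * (K + z))) (at y)"
        by (auto intro!: derivative_eq_intros)
      have b: "((\<lambda>y. 1 + y * z) has_real_derivative z) (at y)" by (auto intro!: derivative_eq_intros)
      have "((- K * (K + z)) * (1 + y * z) - (1 - K * y) * (K + z) * z) / ((1 + y * z) * (1 + y * z)) = - d y"
        by (simp add: d_def power2_eq_square algebra_simps minus_divide_left[symmetric] add_divide_distrib diff_divide_distrib)
      with DERIV_divide[OF a b ne] show ?thesis unfolding c_def[abs_def] by simp
    qed
    show "continuous_on {0..1 / K} d" unfolding d_def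
    proof (intro continuous_intros ballI)
      fix y assume "y \<in> {0..1 / K}"
      hence "1 + y * z \<noteq> 0" using z by (smt (verit) atLeastAtMost_iff mult_nonneg_nonneg)
      thus "(1 + y * z)\<^sup>2 \<noteq> 0" by simp
    qed
  qed (use K in \<open>auto simp: d_def\<close>)
  have "(\<integral>\<^sup>+x. g x \<partial>lborel) = (\<integral>\<^sup>+x. g x * indicator {c (1 / K)..c 0} x \<partial>lborel)"
  proof (rule nn_integral_cong)
    fix x
    have "c (1 / K) = 0" "c 0 = K + z" using K by (auto simp: c_def)
    thus "g x = g x * indicator {c (1 / K)..c 0} x"
      using g0[of x] g1[of x, folded K_def] by (auto simp: not_le not_less split: split_indicator)
  qed
  also note sub
  also have "(\<integral>\<^sup>+y. g (c y) * ennreal (d y) * indicator {0..1 / K} y \<partial>lborel)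
     = (\<integral>\<^sup>+y. ennreal ((K + z)\<^sup>2) * (g (c y) * ennreal (1 / (1 + y * z)\<^sup>2) * indicator {0<..<1} y) \<partial>lborel)"
  proof (rule nn_integral_cong_AE, rule AE_mp[OF AE_lborel_singleton[of 0]], rule AE_I2, rule impI)
    fix y :: real assume "y \<noteq> 0"
    show "g (c y) * ennreal (d y) * indicator {0..1 / K} y
      = ennreal ((K + z)\<^sup>2) * (g (c y) * ennreal (1 / (1 + y * z)\<^sup>2) * indicator {0<..<1} y)"
    proof (cases "0 < y \<and> y < 1 / K")
      case True
      have "1 / K \<le> 1" using K by simp
      hence "y < 1" using True by linarith
      have "ennreal (d y) = ennreal ((K + z)\<^sup>2) * ennreal (1 / (1 + y * z)\<^sup>2)"
        unfolding d_def by (subst ennreal_mult[symmetric]) auto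
      thus ?thesis using True \<open>y < 1\<close> by (simp add: mult_ac)
    next
      case False
      show ?thesis
      proof (cases "y < 0")
        case False
        hence y: "0 < y" "1 / K \<le> y" using \<open>\<not> (0 < y \<and> y < 1 / K)\<close> \<open>y \<noteq> 0\<close> by auto
        have "1 + y * z > 0" using y z by (simp add: add_pos_pos)
        moreover have "1 - K * y \<le> 0" using y K by (simp add: field_simps)
        ultimately have "c y \<le> 0" unfolding c_def using K z
          by (intro divide_nonpos_pos mult_nonpos_nonneg) auto
        thus ?thesis using g0 by simp
      qed auto
    qed
  qed
  also have "\<dots> = ennreal ((K + z)\<^sup>2) * (\<integral>\<^sup>+y. g (c y) * ennreal (1 / (1 + y * z)\<^sup>2) * indicator {0<..<1} y \<partial>lborel)"
    by (rule nn_integral_cmult) (simp add: c_def[abs_def])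
  finally have "ennreal (1 / (K + z)\<^sup>2) * (\<integral>\<^sup>+x. g x \<partial>lborel)
     = (ennreal (1 / (K + z)\<^sup>2) * ennreal ((K + z)\<^sup>2)) * (\<integral>\<^sup>+y. g (c y) * ennreal (1 / (1 + y * z)\<^sup>2) * indicator {0<..<1} y \<partial>lborel)"
    by (simp add: mult.assoc)
  also have "ennreal (1 / (K + z)\<^sup>2) * ennreal ((K + z)\<^sup>2) = 1"
    using K z by (subst ennreal_mult[symmetric]) auto
  finally show ?thesis by (simp add: c_def K_def)
qed

text \<open>Both conditions bound \<open>(h - h') x\<close> from above: the point of offset
  \<open>- y\<close> by \<open>1 / s - (1 + h')\<close>, the point of offset \<open>1 - k y\<close>
  by \<open>1 / s - (1 - h)\<close>. The admissible \<open>x\<close> form an initial interval of the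
  unit interval, whose length is \<open>void\<close>.\<close>

lemma nn_integral_void:
  assumes s: "0 < s" and h: "h' < h"
  shows "(\<integral>\<^sup>+x. (if (1 - h') * s < 1 + s * (h - h') * (1 - x) \<and> (1 + h') * s < 1 - s * (h - h') * x
        then 1 else 0) * indicator {0<..<1} x \<partial>lborel) = ennreal (void (2 * s) h h')"
proof -
  define q where "q = (1 / s - max (1 + h') (1 - h)) / (h - h')"
  have "(\<integral>\<^sup>+x. (if (1 - h') * s < 1 + s * (h - h') * (1 - x) \<and> (1 + h') * s < 1 - s * (h - h') * x
        then 1 else 0) * indicator {0<..<1} x \<partial>lborel)
     = (\<integral>\<^sup>+x. indicator {0<..<min 1 (max 0 q)} x \<partial>lborel)"
  proof (rule nn_integral_cong)
    fix x :: real
    have 1: "(1 + h') * s < 1 - s * (h - h') * x \<longleftrightarrow> (h - h') * x < 1 / s - (1 + h')"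
      using s by (simp add: field_simps)
    have 2: "(1 - h') * s < 1 + s * (h - h') * (1 - x) \<longleftrightarrow> (h - h') * x < 1 / s - (1 - h)"
      using s by (simp add: field_simps)
    have "x < q \<longleftrightarrow> (h - h') * x < 1 / s - max (1 + h') (1 - h)"
      using h by (simp add: q_def pos_less_divide_eq mult.commute)
    hence "x < q \<longleftrightarrow> (h - h') * x < 1 / s - (1 + h') \<and> (h - h') * x < 1 / s - (1 - h)"
      by (auto simp: max_def)
    thus "(if (1 - h') * s < 1 + s * (h - h') * (1 - x) \<and> (1 + h') * s < 1 - s * (h - h') * x
        then 1 else 0) * indicator {0<..<1} x = (indicator {0<..<min 1 (max 0 q)} x :: ennreal)"
      unfolding 1 2 by (auto split: split_indicator)
  qed
  also have "\<dots> = ennreal (min 1 (max 0 q))" by simp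
  also have "max 0 q = pos_part (1 / s - max (1 + h') (1 - h)) / (h - h')"
    using h by (auto simp: q_def pos_part_def max_def divide_le_0_iff zero_le_divide_iff)
  finally show ?thesis using s by (simp add: void_def)
qed

text \<open>With \<open>c = s (h - h')\<close> the second argument of \<Phi> becomes
  \<open>h\<close>, and the Jacobian \<open>s\<close> cancels the \<open>1 / s\<close> of the
  kernel.\<close>

lemma mediant_kernel_shift:
  assumes "0 < s"
  shows "ennreal s * mediant_kernel \<Phi> h' s (- s * h' + s * h) x
    = ennreal (\<Phi> (2 * s, h)) * indicator {h'<..1} h *
      (if (1 - h') * s < 1 + s * (h - h') * (1 - x) \<and> (1 + h') * s < 1 - s * (h - h') * x then 1 else 0)"
proof -
  have c: "- s * h' + s * h = s * (h - h')" by (simp add: algebra_simps)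
  have e: "h' + s * (h - h') / s = h" using assms by simp
  have m: "ennreal s * ennreal (\<Phi> (2 * s, h) / s) = ennreal (\<Phi> (2 * s, h))"
    using assms by (subst ennreal_mult'[symmetric]) auto
  have "0 < s * (h - h') \<longleftrightarrow> h' < h" using assms by (simp add: zero_less_mult_iff)
  moreover have "s * (h - h') \<le> (1 - h') * s \<longleftrightarrow> h \<le> 1" using assms by (simp add: mult.commute[of _ s])
  ultimately show ?thesis
    using assms m unfolding c mediant_kernel_def e
    by (auto simp: mult.assoc[symmetric] split: split_indicator)
qed

lemma nn_integral_double:
  fixes f :: "real \<Rightarrow> ennreal"
  assumes [measurable]: "f \<in> borel_measurable borel"
  shows "(\<integral>\<^sup>+s. f (2 * s) \<partial>lborel) = ennreal (1 / 2) * (\<integral>\<^sup>+s. f s \<partial>lborel)"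
proof -
  have "(\<integral>\<^sup>+s. f s \<partial>lborel) = ennreal 2 * (\<integral>\<^sup>+s. f (2 * s) \<partial>lborel)"
    using nn_integral_real_affine[OF assms, of 2 0] by simp
  hence "ennreal (1 / 2) * (\<integral>\<^sup>+s. f s \<partial>lborel) = (ennreal (1 / 2) * ennreal 2) * (\<integral>\<^sup>+s. f (2 * s) \<partial>lborel)"
    by (simp only: mult.assoc)
  also have "ennreal (1 / 2) * ennreal 2 = 1" by (subst ennreal_mult[symmetric]) auto
  finally show ?thesis by simp
qed

theorem nn_integral_mediant_integral:
  assumes \<Phi>[measurable]: "\<Phi> \<in> borel_measurable (borel \<Otimes>\<^sub>M borel)" and h': "-1 \<le> h'" "h' \<le> 1"
  shows "(\<integral>\<^sup>+p. mediant_integral \<Phi> h' p \<partial>gauss_ext_measure)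
    = ennreal (1 / 2) * (\<integral>\<^sup>+S. \<integral>\<^sup>+h. ennreal (\<Phi> (S, h)) * ennreal (void S h h') * indicator {h'<..1} h
         * indicator {0<..} S \<partial>lborel \<partial>lborel)"
proof -
  note [measurable] = mediant_kernel_measurable
  let ?I = "indicator {0<..<1} :: real \<Rightarrow> ennreal"
  let ?K = "\<lambda>k. real (Suc k)"
  let ?w = "\<lambda>y z. ennreal (1 / (1 + y * z)\<^sup>2)"
  let ?c = "\<lambda>k y z. (1 - ?K k * y) * (?K k + z) / (1 + y * z)"
  let ?x = "\<lambda>k z. 1 / (?K k + z)"
  let ?G = "mediant_kernel \<Phi> h'"
  define L where "L s x = (\<integral>\<^sup>+c. ?G s c x \<partial>lborel)" for s x
  have L[measurable]: "(\<lambda>w. L (a w) (b w)) \<in> borel_measurable M"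
    if [measurable]: "a \<in> borel_measurable M" "b \<in> borel_measurable M" for a b :: "_ \<Rightarrow> real" and M
    unfolding L_def by measurable
  have [measurable]: "mediant_integral \<Phi> h' \<in> borel_measurable (borel \<Otimes>\<^sub>M borel)"
    unfolding mediant_integral_def by measurable
  have "(\<integral>\<^sup>+p. mediant_integral \<Phi> h' p \<partial>gauss_ext_measure)
    = (\<integral>\<^sup>+y. (\<integral>\<^sup>+z. mediant_integral \<Phi> h' (y, z) * ?w y z * ?I z \<partial>lborel) * ?I y \<partial>lborel)"
    by (rule nn_integral_gauss_ext_measure) measurable
  also have "\<dots> = (\<integral>\<^sup>+y. \<integral>\<^sup>+z. mediant_integral \<Phi> h' (y, z) * ?w y z * ?I z * ?I y \<partial>lborel \<partial>lborel)"
    by (intro nn_integral_cong nn_integral_multc[symmetric]) measurable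
  also have "\<dots> = (\<integral>\<^sup>+y. \<integral>\<^sup>+z. (\<Sum>k. \<integral>\<^sup>+s. ?G s (?c k y z) (?x k z) * (?w y z * ?I z * ?I y) \<partial>lborel) \<partial>lborel \<partial>lborel)"
  proof (intro nn_integral_cong)
    fix y z :: real
    show "mediant_integral \<Phi> h' (y, z) * ?w y z * ?I z * ?I y
       = (\<Sum>k. \<integral>\<^sup>+s. ?G s (?c k y z) (?x k z) * (?w y z * ?I z * ?I y) \<partial>lborel)"
    proof (cases "0 < y \<and> y < 1 \<and> 0 < z \<and> z < 1")
      case True
      have "mediant_integral \<Phi> h' (y, z) * ?w y z * ?I z * ?I y = (\<Sum>k. \<integral>\<^sup>+s. ?G s (?c k y z) (?x k z) \<partial>lborel) * (?w y z * ?I z * ?I y)"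
        unfolding mediant_integral_def prod.case using True
        by (subst mediant_rescale[OF \<Phi>]) (auto simp: mult.assoc)
      also have "\<dots> = (\<Sum>k. (\<integral>\<^sup>+s. ?G s (?c k y z) (?x k z) \<partial>lborel) * (?w y z * ?I z * ?I y))"
        by (rule ennreal_suminf_multc[symmetric])
      also have "\<dots> = (\<Sum>k. \<integral>\<^sup>+s. ?G s (?c k y z) (?x k z) * (?w y z * ?I z * ?I y) \<partial>lborel)"
        by (intro suminf_cong nn_integral_multc[symmetric]) measurable
      finally show ?thesis .
    next
      case False
      hence "?I z * ?I y = 0" by auto
      hence w0: "?w y z * ?I z * ?I y = 0" by (simp only: mult.assoc mult_zero_right)
      have "mediant_integral \<Phi> h' (y, z) * ?w y z * ?I z * ?I y = mediant_integral \<Phi> h' (y, z) * (?w y z * ?I z * ?I y)"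
        by (simp only: mult.assoc)
      thus ?thesis unfolding w0 by simp
    qed
  qed
  also have "\<dots> = (\<integral>\<^sup>+y. (\<Sum>k. \<integral>\<^sup>+z. \<integral>\<^sup>+s. ?G s (?c k y z) (?x k z) * (?w y z * ?I z * ?I y) \<partial>lborel \<partial>lborel) \<partial>lborel)"
    by (intro nn_integral_cong nn_integral_suminf) measurable
  also have "\<dots> = (\<Sum>k. \<integral>\<^sup>+y. \<integral>\<^sup>+z. \<integral>\<^sup>+s. ?G s (?c k y z) (?x k z) * (?w y z * ?I z * ?I y) \<partial>lborel \<partial>lborel \<partial>lborel)"
    by (rule nn_integral_suminf) measurable
  \<comment> \<open>The order of integration is changed until \<open>y\<close> is innermost, since
    \<open>c\<close> is substituted for \<open>y\<close> at fixed \<open>s\<close> and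
    \<open>z\<close>.\<close>
  also have "\<dots> = (\<Sum>k. \<integral>\<^sup>+y. \<integral>\<^sup>+s. \<integral>\<^sup>+z. ?G s (?c k y z) (?x k z) * (?w y z * ?I z * ?I y) \<partial>lborel \<partial>lborel \<partial>lborel)"
    by (intro suminf_cong nn_integral_cong lborel_pair.Fubini') measurable
  also have "\<dots> = (\<Sum>k. \<integral>\<^sup>+s. \<integral>\<^sup>+y. \<integral>\<^sup>+z. ?G s (?c k y z) (?x k z) * (?w y z * ?I z * ?I y) \<partial>lborel \<partial>lborel \<partial>lborel)"
    by (intro suminf_cong lborel_pair.Fubini') measurable
  also have "\<dots> = (\<Sum>k. \<integral>\<^sup>+s. \<integral>\<^sup>+z. \<integral>\<^sup>+y. ?G s (?c k y z) (?x k z) * (?w y z * ?I z * ?I y) \<partial>lborel \<partial>lborel \<partial>lborel)"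
    by (intro suminf_cong nn_integral_cong lborel_pair.Fubini') measurable
  also have "\<dots> = (\<Sum>k. \<integral>\<^sup>+s. \<integral>\<^sup>+z. L s (?x k z) * ennreal (1 / (?K k + z)\<^sup>2) * ?I z \<partial>lborel \<partial>lborel)"
  proof (intro suminf_cong nn_integral_cong)
    fix k :: nat and s z :: real
    show "(\<integral>\<^sup>+y. ?G s (?c k y z) (?x k z) * (?w y z * ?I z * ?I y) \<partial>lborel) = L s (?x k z) * ennreal (1 / (?K k + z)\<^sup>2) * ?I z"
    proof (cases "0 < z \<and> z < 1")
      case True
      have "(\<integral>\<^sup>+y. ?G s (?c k y z) (?x k z) * (?w y z * ?I z * ?I y) \<partial>lborel)
         = (\<integral>\<^sup>+y. ?G s (?c k y z) (?x k z) * ?w y z * ?I y \<partial>lborel)"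
        using True by (simp add: mult.assoc)
      also have "\<dots> = ennreal (1 / (?K k + z)\<^sup>2) * (\<integral>\<^sup>+c. ?G s c (?x k z) \<partial>lborel)"
      proof (rule mediant_subst_y)
        \<comment> \<open>Beyond \<open>K + z\<close> one has \<open>c x > 1\<close>, so the
          condition \<open>(1 + h') s < 1 - c x\<close> fails, its left side being
          non-negative.\<close>
        show "?G s c (?x k z) = 0" if "?K k + z < c" for c
        proof -
          have "1 < c * ?x k z" using that True by (simp add: field_simps)
          moreover have "0 \<le> (1 + h') * s" if "0 < s" using h' that by simp
          ultimately show ?thesis by (auto simp: mediant_kernel_def)
        qed
      qed (use True in \<open>auto simp: mediant_kernel_def[of _ _ _ _ "1 / _"] intro!: mediant_kernel_measurable\<close>)
      finally show ?thesis using True by (simp add: L_def mult.commute)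
    qed auto
  qed
  also have "\<dots> = (\<integral>\<^sup>+s. (\<Sum>k. \<integral>\<^sup>+z. L s (?x k z) * ennreal (1 / (?K k + z)\<^sup>2) * ?I z \<partial>lborel) \<partial>lborel)"
    by (rule nn_integral_suminf[symmetric]) measurable
  \<comment> \<open>The ranges of \<open>x = 1 / (k + 1 + z)\<close> for the different
    \<open>k\<close> fit together to the unit interval: the branch decomposition read
    backwards.\<close>
  also have "\<dots> = (\<integral>\<^sup>+s. \<integral>\<^sup>+x. L s x * ?I x \<partial>lborel \<partial>lborel)"
    by (intro nn_integral_cong nn_integral_gauss_branches[symmetric]) measurable
  also have "\<dots> = (\<integral>\<^sup>+s. \<integral>\<^sup>+h. ennreal (\<Phi> (2 * s, h)) * ennreal (void (2 * s) h h') * indicator {h'<..1} h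
         * indicator {0<..} (2 * s) \<partial>lborel \<partial>lborel)"
  proof (rule nn_integral_cong)
    fix s :: real
    show "(\<integral>\<^sup>+x. L s x * ?I x \<partial>lborel) = (\<integral>\<^sup>+h. ennreal (\<Phi> (2 * s, h)) * ennreal (void (2 * s) h h') * indicator {h'<..1} h
         * indicator {0<..} (2 * s) \<partial>lborel)"
    proof (cases "0 < s")
      case True
      let ?Q = "\<lambda>h x. (if (1 - h') * s < 1 + s * (h - h') * (1 - x) \<and> (1 + h') * s < 1 - s * (h - h') * x then 1 else 0) :: ennreal"
      have "L s x = (\<integral>\<^sup>+h. ennreal (\<Phi> (2 * s, h)) * indicator {h'<..1} h * ?Q h x \<partial>lborel)" for x
      proof -
        have "L s x = ennreal \<bar>s\<bar> * (\<integral>\<^sup>+h. ?G s (- s * h' + s * h) x \<partial>lborel)"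
          unfolding L_def by (rule nn_integral_real_affine) (use True in \<open>auto intro!: mediant_kernel_measurable\<close>)
        also have "\<dots> = (\<integral>\<^sup>+h. ennreal s * ?G s (- s * h' + s * h) x \<partial>lborel)"
          using True by (subst nn_integral_cmult) (auto intro!: mediant_kernel_measurable)
        finally show ?thesis unfolding mediant_kernel_shift[OF True] .
      qed
      hence "(\<integral>\<^sup>+x. L s x * ?I x \<partial>lborel) = (\<integral>\<^sup>+x. (\<integral>\<^sup>+h. ennreal (\<Phi> (2 * s, h)) * indicator {h'<..1} h * ?Q h x \<partial>lborel) * ?I x \<partial>lborel)"
        by simp
      also have "\<dots> = (\<integral>\<^sup>+x. \<integral>\<^sup>+h. ennreal (\<Phi> (2 * s, h)) * indicator {h'<..1} h * ?Q h x * ?I x \<partial>lborel \<partial>lborel)"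
        by (intro nn_integral_cong nn_integral_multc[symmetric]) measurable
      also have "\<dots> = (\<integral>\<^sup>+h. \<integral>\<^sup>+x. ennreal (\<Phi> (2 * s, h)) * indicator {h'<..1} h * ?Q h x * ?I x \<partial>lborel \<partial>lborel)"
        by (rule lborel_pair.Fubini') measurable
      also have "\<dots> = (\<integral>\<^sup>+h. ennreal (\<Phi> (2 * s, h)) * ennreal (void (2 * s) h h') * indicator {h'<..1} h
         * indicator {0<..} (2 * s) \<partial>lborel)"
      proof (rule nn_integral_cong)
        fix h :: real
        have "(\<integral>\<^sup>+x. ennreal (\<Phi> (2 * s, h)) * indicator {h'<..1} h * ?Q h x * ?I x \<partial>lborel)
          = (ennreal (\<Phi> (2 * s, h)) * indicator {h'<..1} h) * (\<integral>\<^sup>+x. ?Q h x * ?I x \<partial>lborel)"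
          unfolding mult.assoc[of _ _ "?I _"] by (rule nn_integral_cmult) measurable
        also have "\<dots> = ennreal (\<Phi> (2 * s, h)) * ennreal (void (2 * s) h h') * indicator {h'<..1} h
         * indicator {0<..} (2 * s)"
        proof (cases "h' < h")
          case h: True
          show ?thesis unfolding nn_integral_void[OF True h] using True by (simp add: mult_ac)
        qed auto
        finally show "(\<integral>\<^sup>+x. ennreal (\<Phi> (2 * s, h)) * indicator {h'<..1} h * ?Q h x * ?I x \<partial>lborel) = \<dots>" .
      qed
      finally show ?thesis .
    next
      case False
      hence "L s x = 0" for x by (simp add: L_def mediant_kernel_def)
      thus ?thesis using False by simp
    qed
  qed
  also have "\<dots> = ennreal (1 / 2) * (\<integral>\<^sup>+S. \<integral>\<^sup>+h. ennreal (\<Phi> (S, h)) * ennreal (void S h h') * indicator {h'<..1} h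
         * indicator {0<..} S \<partial>lborel \<partial>lborel)"
    unfolding void_def pos_part_def by (rule nn_integral_double) measurable
  finally show ?thesis .
qed

section \<open>Collisions along an orbit of the Gauss map\<close>

definition gauss_orbit :: "real \<Rightarrow> nat \<Rightarrow> real" where
  "gauss_orbit y n = (gauss ^^ n) y"

text \<open>For \<open>n > 0\<close> this product is the classical
  \<open>\<bar>q y - p\<bar>\<close> for the convergent \<open>p / q\<close> of index
  \<open>n - 1\<close>. The product form makes its logarithm a Birkhoff sum.\<close>

definition offset_seq :: "real \<Rightarrow> nat \<Rightarrow> real" where
  "offset_seq y n = (\<Prod>i<n. gauss_orbit y i)"

text \<open>Offsets and heights of consecutive convergents: the initial heights are normalised so that the basis
  has determinant \<open>U n * V (n + 1) + U (n + 1) * V n = 1\<close> and the ratio of the heights is \<open>z\<close>.\<close>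

fun height_seq :: "real \<Rightarrow> real \<Rightarrow> nat \<Rightarrow> real" where
  "height_seq y z 0 = z / (1 + y * z)"
| "height_seq y z (Suc 0) = 1 / (1 + y * z)"
| "height_seq y z (Suc (Suc n)) = height_seq y z n + gauss_digit (gauss_orbit y n) * height_seq y z (Suc n)"

lemma gauss_orbit_0[simp]: "gauss_orbit y 0 = y"
  and gauss_orbit_Suc: "gauss_orbit y (Suc n) = gauss (gauss_orbit y n)"
  by (auto simp: gauss_orbit_def)

lemma gauss_orbit_irr: "y \<in> unit_irr \<Longrightarrow> gauss_orbit y n \<in> unit_irr"
  by (induction n) (auto simp: gauss_orbit_Suc gauss_unit_irr)

lemma offset_seq_0[simp]: "offset_seq y 0 = 1"
  and offset_seq_Suc: "offset_seq y (Suc n) = offset_seq y n * gauss_orbit y n"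
  by (auto simp: offset_seq_def)

locale gauss_lattice =
  fixes y :: real
  assumes y: "y \<in> unit_irr"
begin

abbreviation "Y \<equiv> gauss_orbit y"
abbreviation "U \<equiv> offset_seq y"
abbreviation "D n \<equiv> gauss_digit (Y n)"

lemma Y_bounds: "0 < Y n" "Y n < 1"
  using unit_irrD[OF gauss_orbit_irr[OF y]] by auto

lemma D_ge_1: "1 \<le> D n"
  using gauss_digit_ge_1 Y_bounds by blast

lemma U_pos: "0 < U n"
  unfolding offset_seq_def by (intro prod_pos ballI Y_bounds)

lemma U_Suc_less: "U (Suc n) < U n"
  using U_pos[of n] Y_bounds[of n] by (simp add: offset_seq_Suc)

lemma U_antimono: "m \<le> n \<Longrightarrow> U n \<le> U m"
  by (rule lift_Suc_antimono_le[of U]) (use U_Suc_less less_imp_le in auto)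

lemma U_rec: "U (Suc (Suc n)) = U n - D n * U (Suc n)"
proof -
  have "U (Suc (Suc n)) = U n * (Y n * gauss (Y n))" by (simp add: offset_seq_Suc gauss_orbit_Suc)
  also have "Y n * gauss (Y n) = 1 - D n * Y n"
    unfolding gauss_eq using Y_bounds[of n] by (simp add: field_simps)
  finally show ?thesis by (simp add: offset_seq_Suc algebra_simps)
qed

text \<open>Every digit is at least 1, so \<open>U (n + 2) \<le> U n - U (n + 1)\<close>, and also
  \<open>U (n + 2) < U (n + 1)\<close>; adding the two gives the factor 2.\<close>

lemma U_half: "U (Suc (Suc n)) \<le> U n / 2"
proof -
  have "U (Suc n) \<le> D n * U (Suc n)" using D_ge_1[of n] U_pos[of "Suc n"] by simp
  thus ?thesis using U_rec[of n] U_Suc_less[of "Suc n"] by linarith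
qed

lemma U_even_bound: "U (2 * n) \<le> (1 / 2) ^ n"
proof (induction n)
  case (Suc n)
  thus ?case using U_half[of "2 * n"] by simp
qed simp

lemma U_tendsto_0: "U \<longlonglongrightarrow> 0"
proof (rule LIMSEQ_I)
  fix e :: real assume "e > 0"
  then obtain n where n: "(1 / 2) ^ n < e" using real_arch_pow_inv[of e "1 / 2"] by auto
  have "norm (U m - 0) < e" if "m \<ge> 2 * n" for m
    using U_antimono[OF that] U_even_bound[of n] U_pos[of m] n by simp
  thus "\<exists>no. \<forall>m\<ge>no. norm (U m - 0) < e" by blast
qed

end

lemma D_floor: "0 < x \<Longrightarrow> real k * x < 1 \<Longrightarrow> real k \<le> gauss_digit x"
  unfolding gauss_digit_def by (metis floor_of_nat floor_mono less_imp_le of_int_le_iff of_int_of_nat_eq pos_less_divide_eq)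

locale gauss_lattice_heights = gauss_lattice +
  fixes z :: real
  assumes z: "0 < z" "z < 1"
begin

abbreviation "V \<equiv> height_seq y z"

lemma yz_pos: "0 < y * z" "y * z < 1"
  using z unit_irrD[OF y] by (auto intro: mult_pos_pos) (metis mult_strict_mono' mult_1 less_imp_le)

lemma V_pos: "0 < V n"
proof -
  have "0 < V n \<and> 0 < V (Suc n)"
  proof (induction n)
    case 0
    show ?case using yz_pos z by auto
  next
    case (Suc n)
    thus ?case using D_ge_1[of n] by (auto intro!: add_pos_pos mult_pos_pos)
  qed
  thus ?thesis by simp
qed

lemma V_Suc_le: "V n + V (Suc n) \<le> V (Suc (Suc n))"
  using D_ge_1[of n] V_pos[of "Suc n"] by simp

lemma V_less_Suc: "V n < V (Suc n)"
proof (cases n)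
  case 0
  thus ?thesis using z yz_pos by (auto intro!: divide_strict_right_mono)
next
  case (Suc m)
  thus ?thesis using V_Suc_le[of m] V_pos[of m] by simp
qed

lemma V_mono: "m \<le> n \<Longrightarrow> V m \<le> V n"
  by (rule lift_Suc_mono_le[of V]) (use V_less_Suc less_imp_le in auto)

text \<open>The determinant of consecutive basis vectors: one recursion subtracts the digit multiple
  and the other adds it, so the extra terms cancel.\<close>

lemma UV: "U n * V (Suc n) + U (Suc n) * V n = 1"
proof (induction n)
  case 0
  have "V (Suc 0) + y * V 0 = 1" using yz_pos by (simp add: field_simps)
  thus ?case by (simp add: offset_seq_Suc)
next
  case (Suc n)
  have "U (Suc n) * V (Suc (Suc n)) + U (Suc (Suc n)) * V (Suc n) = U n * V (Suc n) + U (Suc n) * V n"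
    unfolding U_rec by (simp add: algebra_simps)
  thus ?case using Suc.IH by simp
qed

text \<open>Of the two products in the determinant the first is the larger, since \<open>U\<close>
  decreases and \<open>V\<close> increases. Offsets and heights are thus reciprocal up to a factor
  2, which ties level \<open>n\<close> to radii of order \<open>U n\<close>.\<close>

lemma UV_bounds: "U n * V (Suc n) \<le> 1" "1 / 2 \<le> U n * V (Suc n)"
proof -
  have p: "0 < U (Suc n) * V n" using U_pos V_pos by simp
  show "U n * V (Suc n) \<le> 1" using UV[of n] p by linarith
  have "U (Suc n) * V n \<le> U n * V (Suc n)"
    using U_Suc_less[of n] V_less_Suc[of n] U_pos V_pos by (intro mult_mono) (auto intro: less_imp_le)
  thus "1 / 2 \<le> U n * V (Suc n)" using UV[of n] by linarith
qed

lemma V_1_ge: "1 / 2 \<le> V (Suc 0)"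
  using UV_bounds(2)[of 0] by simp

text \<open>The past coordinate is the ratio of consecutive heights. This is what makes a sum over
  the convergents of one slope a Birkhoff sum of the natural extension.\<close>

lemma gauss_ext_funpow: "(gauss_ext ^^ n) (y, z) = (Y n, V n / V (Suc n))"
proof (induction n)
  case 0
  show ?case using yz_pos by simp
next
  case (Suc n)
  have "1 / (D n + V n / V (Suc n)) = V (Suc n) / V (Suc (Suc n))"
    using V_pos[of "Suc n"] by (simp add: field_simps)
  thus ?case using Suc.IH by (simp add: gauss_ext_def gauss_orbit_Suc)
qed

end

text \<open>Both height sequences have determinant 1 against \<open>U\<close>, so their difference
  has determinant 0. It is therefore a multiple of the decaying solution
  \<open>(- 1) ^ n * U n\<close> of the common recursion, with the factor fixed by the initial
  values.\<close>

lemma height_seq_diff: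
  assumes "gauss_lattice_heights y z" "gauss_lattice_heights y z'"
  shows "height_seq y z n - height_seq y z' n
     = (- 1) ^ n * ((z - z') / ((1 + y * z) * (1 + y * z'))) * offset_seq y n"
proof -
  interpret a: gauss_lattice_heights y z by fact
  interpret b: gauss_lattice_heights y z' by fact
  define \<kappa> where "\<kappa> = (z - z') / ((1 + y * z) * (1 + y * z'))"
  have ne: "1 + y * z \<noteq> 0" "1 + y * z' \<noteq> 0" using a.yz_pos b.yz_pos by linarith+
  let ?P = "\<lambda>n. height_seq y z n - height_seq y z' n = (- 1) ^ n * \<kappa> * offset_seq y n"
  have "?P n \<and> ?P (Suc n)"
  proof (induction n)
    case 0
    have "z * (1 + y * z') - z' * (1 + y * z) = z - z'" "1 + y * z' - (1 + y * z) = - y * (z - z')"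
      by (simp_all add: algebra_simps)
    hence "z / (1 + y * z) - z' / (1 + y * z') = \<kappa>" "1 / (1 + y * z) - 1 / (1 + y * z') = - y * \<kappa>"
      using ne by (simp_all add: diff_frac_eq \<kappa>_def)
    thus ?case by (simp add: offset_seq_Suc)
  next
    case (Suc n)
    have "height_seq y z (Suc (Suc n)) - height_seq y z' (Suc (Suc n))
      = (height_seq y z n - height_seq y z' n) + a.D n * (height_seq y z (Suc n) - height_seq y z' (Suc n))"
      by (simp add: algebra_simps)
    also have "\<dots> = (- 1) ^ n * \<kappa> * offset_seq y n + a.D n * ((- 1) ^ Suc n * \<kappa> * offset_seq y (Suc n))"
      using Suc.IH by metis
    also have "\<dots> = (- 1) ^ n * \<kappa> * (offset_seq y n - a.D n * offset_seq y (Suc n))"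
      by (simp add: algebra_simps)
    also have "\<dots> = (- 1) ^ Suc (Suc n) * \<kappa> * offset_seq y (Suc (Suc n))"
      by (simp add: a.U_rec)
    finally show ?case using Suc.IH by blast
  qed
  thus ?thesis by (simp add: \<kappa>_def)
qed

text \<open>The offsets of the convergents alternate in sign. Reflecting at every second step makes the \<open>n\<close>-th
  offset positive, at the price of replacing \<open>h'\<close> by \<open>side h' n\<close>.\<close>

definition side :: "real \<Rightarrow> nat \<Rightarrow> real" where
  "side h' n = (if even n then h' else - h')"

text \<open>This is \<open>mediant_hit\<close> for the \<open>n\<close>-th iterate, reflected by
  \<open>side\<close> and with every inequality multiplied by \<open>offset_seq y n\<close>. In
  these units the radius refers to the original lattice, so that all levels can be compared at the
  same \<open>r\<close>.\<close>

definition orbit_hit :: "real \<Rightarrow> real \<Rightarrow> nat \<Rightarrow> nat \<Rightarrow> real \<Rightarrow> bool" where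
  "orbit_hit h' y n k r \<longleftrightarrow> 0 < r \<and> 0 < offset_seq y n - real (Suc k) * offset_seq y (Suc n) \<and>
     offset_seq y n - real (Suc k) * offset_seq y (Suc n) \<le> (1 - side h' n) * r \<and>
     (1 - side h' n) * r < offset_seq y n - real k * offset_seq y (Suc n) \<and>
     (1 + side h' n) * r < offset_seq y (Suc n)"

lemma side_Suc: "side h' (Suc n) = - side h' n"
  by (simp add: side_def)

lemma side_parity: "even m = even n \<Longrightarrow> side h' m = side h' n"
  by (simp add: side_def)

lemma side_abs: "\<bar>side h' n\<bar> = \<bar>h'\<bar>"
  by (simp add: side_def)

context gauss_lattice
begin

lemma orbit_hit_bounds:
  assumes "orbit_hit h' y n k r" "\<bar>h'\<bar> \<le> 1"
  shows "real (Suc k) \<le> D n" "(1 - side h' n) * r < U n" "(1 - side h' (Suc n)) * r < U (Suc n)"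
    "U (Suc (Suc n)) \<le> (1 - side h' n) * r"
proof -
  have "real (Suc k) * U (Suc n) < U n" using assms by (simp add: orbit_hit_def)
  hence "(real (Suc k) * Y n) * U n < 1 * U n" by (simp only: offset_seq_Suc mult_ac mult_1_left)
  hence "real (Suc k) * Y n < 1" using U_pos[of n] by (simp only: mult_less_cancel_right_pos)
  thus d: "real (Suc k) \<le> D n" using Y_bounds by (intro D_floor)
  have "0 \<le> real k * U (Suc n)" using U_pos[of "Suc n"] by simp
  thus "(1 - side h' n) * r < U n" using assms(1) unfolding orbit_hit_def by linarith
  show "(1 - side h' (Suc n)) * r < U (Suc n)" using assms(1) by (simp add: orbit_hit_def side_Suc)
  have "real (Suc k) * U (Suc n) \<le> D n * U (Suc n)"
    using d U_pos[of "Suc n"] by (intro mult_right_mono) auto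
  thus "U (Suc (Suc n)) \<le> (1 - side h' n) * r"
    using assms(1) unfolding orbit_hit_def U_rec by linarith
qed

text \<open>All convergents up to \<open>n + 1\<close> lie beyond the strip, each on its own side.
  Offsets decrease along either parity, so the last index of each parity decides.\<close>

lemma orbit_hit_earlier:
  assumes "orbit_hit h' y n k r" "\<bar>h'\<bar> \<le> 1" "j \<le> Suc n"
  shows "(1 - side h' j) * r < U j"
proof (cases "even j = even n")
  case True
  hence "j \<le> n" using assms(3) by (metis even_Suc le_SucE)
  thus ?thesis using orbit_hit_bounds(2)[OF assms(1,2)] side_parity[OF True, of h'] U_antimono[of j n] by simp
next
  case False
  hence "even j = even (Suc n)" by simp
  thus ?thesis using orbit_hit_bounds(3)[OF assms(1,2)] side_parity[of j "Suc n" h'] U_antimono[OF assms(3)] by simp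
qed

text \<open>A hit makes \<open>n + 2\<close> the first index whose convergent falls into the strip,
  and \<open>k + 1\<close> the first multiple at which the semiconvergents of this step do. Both are
  thus determined by \<open>r\<close>.\<close>

lemma orbit_hit_unique:
  assumes "orbit_hit h' y n k r" "orbit_hit h' y n' k' r" "\<bar>h'\<bar> \<le> 1"
  shows "n = n' \<and> k = k'"
proof -
  have A: "\<not> n < n'" if "orbit_hit h' y n k r" "orbit_hit h' y n' k' r" for n k n' k'
  proof
    assume "n < n'"
    hence "(1 - side h' (Suc (Suc n))) * r < U (Suc (Suc n))"
      by (intro orbit_hit_earlier[OF that(2) assms(3)]) simp
    thus False using orbit_hit_bounds(4)[OF that(1) assms(3)] side_parity[of "Suc (Suc n)" n h'] by simp
  qed
  have n: "n = n'" using A[OF assms(1,2)] A[OF assms(2,1)] by simp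
  have B: "\<not> k < k'" if "orbit_hit h' y n k r" "orbit_hit h' y n k' r" for k k'
  proof
    assume "k < k'"
    hence "real (Suc k) * U (Suc n) \<le> real k' * U (Suc n)"
      using U_pos[of "Suc n"] by (intro mult_right_mono) auto
    thus False using that unfolding orbit_hit_def by linarith
  qed
  show ?thesis using n B[of k k'] B[of k' k] assms(1,2) by auto
qed

lemma orbit_hit_exists:
  assumes h': "\<bar>h'\<bar> \<le> 1" and r: "0 < r" and r0: "(1 - h') * r < 1" and r1: "(1 + h') * r < y"
  shows "\<exists>n k. orbit_hit h' y n k r"
proof -
  define P where "P m \<longleftrightarrow> U m \<le> (1 - side h' m) * r" for m
  have "\<exists>m. P m"
  proof -
    obtain N where N: "U n < r" if "n \<ge> N" for n
      using order_tendstoD(2)[OF U_tendsto_0 r] by (auto simp: eventually_sequentially)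
    \<comment> \<open>The strip may have width 0 on one side of the line. The parity is chosen so
      that its width on the relevant side is at least \<open>r\<close>, and offsets tending to 0
      then fall into it.\<close>
    define m where "m = (if h' \<le> 0 then 2 * N else Suc (2 * N))"
    have "side h' m \<le> 0" by (auto simp: m_def side_def)
    hence "r \<le> (1 - side h' m) * r" using r by (simp add: mult_le_cancel_right1)
    moreover have "U m < r" by (rule N) (simp add: m_def)
    ultimately show ?thesis by (auto simp: P_def intro!: exI[of _ m])
  qed
  define m where "m = (LEAST m. P m)"
  have m: "P m" using \<open>\<exists>m. P m\<close> unfolding m_def by (rule LeastI_ex)
  have least: "\<not> P j" if "j < m" for j using that not_less_Least unfolding m_def by blast
  \<comment> \<open>The two size assumptions put the initial basis vectors beyond the strip, so the
    first convergent inside has index at least 2.\<close>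
  have "\<not> P 0" "\<not> P (Suc 0)" using r0 r1 by (auto simp: P_def side_def offset_seq_Suc)
  hence "m \<noteq> 0" "m \<noteq> Suc 0" using m by metis+
  then obtain n where n: "m = Suc (Suc n)" by (metis not0_implies_Suc)
  have 1: "(1 - side h' n) * r < U n" "(1 + side h' n) * r < U (Suc n)"
    using least[of n] least[of "Suc n"] n by (auto simp: P_def side_Suc)
  have 2: "U n - D n * U (Suc n) \<le> (1 - side h' n) * r"
    using m side_parity[of m n h'] by (simp add: P_def n U_rec)
  define d where "d = nat \<lfloor>1 / Y n\<rfloor>"
  have d: "D n = real d" using Y_bounds[of n] by (simp add: gauss_digit_def d_def)
  define Q where "Q K \<longleftrightarrow> U n - real K * U (Suc n) \<le> (1 - side h' n) * r" for K
  have Qd: "Q d" using 2 by (simp add: Q_def d)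
  define K where "K = (LEAST K. Q K)"
  have K: "Q K" unfolding K_def using Qd by (rule LeastI)
  have Kd: "K \<le> d" unfolding K_def using Qd by (rule Least_le)
  have "\<not> Q 0" using 1 by (simp add: Q_def)
  hence "K \<noteq> 0" using K by metis
  then obtain k where k: "K = Suc k" by (metis not0_implies_Suc)
  have nk: "\<not> Q k" using not_less_Least[of k Q] k unfolding K_def by simp
  have "real K * U (Suc n) \<le> D n * U (Suc n)" using Kd U_pos[of "Suc n"] d by (intro mult_right_mono) auto
  hence "0 < U n - real K * U (Suc n)" using U_rec[of n] U_pos[of "Suc (Suc n)"] by linarith
  hence "orbit_hit h' y n k r"
    using K nk 1 r unfolding orbit_hit_def Q_def k by (auto simp: not_le)
  thus ?thesis by blast
qed

end

lemma orbit_hit_measurable[measurable]: "Measurable.pred borel (\<lambda>r. orbit_hit h' y n k r)"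
  unfolding orbit_hit_def by measurable

section \<open>The contribution of a single collision and the sum over the orbit\<close>

definition orbit_offset :: "real \<Rightarrow> nat \<Rightarrow> nat \<Rightarrow> real" where
  "orbit_offset y n k = offset_seq y n - real (Suc k) * offset_seq y (Suc n)"

definition orbit_height :: "real \<Rightarrow> real \<Rightarrow> nat \<Rightarrow> nat \<Rightarrow> real" where
  "orbit_height y z n k = height_seq y z n + real (Suc k) * height_seq y z (Suc n)"

definition orbit_impact :: "real \<Rightarrow> real \<Rightarrow> nat \<Rightarrow> nat \<Rightarrow> real \<Rightarrow> real" where
  "orbit_impact h' y n k r = h' + (- 1) ^ n * (orbit_offset y n k / r)"

definition flip :: "(real \<times> real \<Rightarrow> real) \<Rightarrow> real \<times> real \<Rightarrow> real" where
  "flip \<Phi> = (\<lambda>(S, h). \<Phi> (S, - h))"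

definition flip_side :: "(real \<times> real \<Rightarrow> real) \<Rightarrow> nat \<Rightarrow> real \<times> real \<Rightarrow> real" where
  "flip_side \<Phi> n = (if even n then \<Phi> else flip \<Phi>)"

definition orbit_term :: "(real \<times> real \<Rightarrow> real) \<Rightarrow> real \<Rightarrow> real \<Rightarrow> real \<Rightarrow> nat \<Rightarrow> nat \<Rightarrow> real \<Rightarrow> ennreal" where
  "orbit_term \<Phi> h' y z n k r = ennreal (\<Phi> (2 * r * orbit_height y z n k, orbit_impact h' y n k r))
     * indicator {r. orbit_hit h' y n k r} r"

text \<open>At most one pair \<open>(n, k)\<close> is hit for a given \<open>r\<close>, so the
  double sum selects the value of \<Phi> at that collision. Written as a sum it is measurable and
  splits by level.\<close>

definition orbit_flight :: "(real \<times> real \<Rightarrow> real) \<Rightarrow> real \<Rightarrow> real \<Rightarrow> real \<Rightarrow> real \<Rightarrow> ennreal" where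
  "orbit_flight \<Phi> h' y z r = (\<Sum>n. \<Sum>k. orbit_term \<Phi> h' y z n k r)"

definition orbit_flight_upto :: "(real \<times> real \<Rightarrow> real) \<Rightarrow> real \<Rightarrow> real \<Rightarrow> real \<Rightarrow> nat \<Rightarrow> real \<Rightarrow> ennreal" where
  "orbit_flight_upto \<Phi> h' y z M r = (\<Sum>n<M. \<Sum>k. orbit_term \<Phi> h' y z n k r)"

definition log_flight :: "(real \<times> real \<Rightarrow> real) \<Rightarrow> real \<Rightarrow> real \<Rightarrow> real \<Rightarrow> real \<Rightarrow> ennreal" where
  "log_flight \<Phi> h' y z \<epsilon> = (\<integral>\<^sup>+r. orbit_flight \<Phi> h' y z r * ennreal (1 / r) * indicator {\<epsilon><..} r \<partial>lborel)"

lemma flip_measurable[measurable (raw)]: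
  assumes [measurable]: "\<Phi> \<in> borel_measurable (borel \<Otimes>\<^sub>M borel)"
  shows "flip \<Phi> \<in> borel_measurable (borel \<Otimes>\<^sub>M borel)"
  unfolding flip_def by measurable

lemma flip_side_measurable[measurable (raw)]:
  assumes "\<Phi> \<in> borel_measurable (borel \<Otimes>\<^sub>M borel)"
  shows "flip_side \<Phi> n \<in> borel_measurable (borel \<Otimes>\<^sub>M borel)"
  using assms flip_measurable[OF assms] by (simp add: flip_side_def)

lemma orbit_term_measurable[measurable (raw)]:
  assumes [measurable]: "\<Phi> \<in> borel_measurable (borel \<Otimes>\<^sub>M borel)"
  shows "orbit_term \<Phi> h' y z n k \<in> borel_measurable borel"
  unfolding orbit_term_def[abs_def] orbit_impact_def by measurable

lemma orbit_flight_measurable[measurable (raw)]: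
  assumes [measurable]: "\<Phi> \<in> borel_measurable (borel \<Otimes>\<^sub>M borel)"
  shows "orbit_flight \<Phi> h' y z \<in> borel_measurable borel"
    "orbit_flight_upto \<Phi> h' y z M \<in> borel_measurable borel"
  unfolding orbit_flight_def[abs_def] orbit_flight_upto_def[abs_def] by measurable

lemma suminf_single:
  fixes f :: "nat \<Rightarrow> ennreal"
  assumes "\<And>j. j \<noteq> k \<Longrightarrow> f j = 0"
  shows "(\<Sum>j. f j) = f k"
proof -
  have "(\<Sum>j. f j) = (\<Sum>j\<in>{k}. f j)" by (rule suminf_finite) (use assms in auto)
  thus ?thesis by simp
qed

context gauss_lattice
begin

lemma orbit_term_other:
  assumes "\<bar>h'\<bar> \<le> 1" "orbit_hit h' y n k r" "(n', k') \<noteq> (n, k)"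
  shows "orbit_term \<Phi> h' y z n' k' r = 0"
proof -
  have "\<not> orbit_hit h' y n' k' r" using orbit_hit_unique[OF assms(2) _ assms(1)] assms(3) by blast
  thus ?thesis by (simp add: orbit_term_def)
qed

lemma orbit_flight_eq:
  assumes "\<bar>h'\<bar> \<le> 1" "orbit_hit h' y n k r"
  shows "orbit_flight \<Phi> h' y z r = ennreal (\<Phi> (2 * r * orbit_height y z n k, orbit_impact h' y n k r))"
    "orbit_flight_upto \<Phi> h' y z M r
      = (if n < M then ennreal (\<Phi> (2 * r * orbit_height y z n k, orbit_impact h' y n k r)) else 0)"
proof -
  let ?t = "orbit_term \<Phi> h' y z"
  have in1: "(\<Sum>j. ?t n j r) = ?t n k r"
    by (rule suminf_single) (use orbit_term_other[OF assms] in auto)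
  have in0: "(\<Sum>j. ?t m j r) = 0" if "m \<noteq> n" for m
    using orbit_term_other[OF assms] that by (simp add: suminf_zero)
  have t: "?t n k r = ennreal (\<Phi> (2 * r * orbit_height y z n k, orbit_impact h' y n k r))"
    using assms(2) by (simp add: orbit_term_def)
  show "orbit_flight \<Phi> h' y z r = ennreal (\<Phi> (2 * r * orbit_height y z n k, orbit_impact h' y n k r))"
    unfolding orbit_flight_def t[symmetric] in1[symmetric] by (rule suminf_single) (rule in0)
  have "orbit_flight_upto \<Phi> h' y z M r = (\<Sum>m<M. if m = n then ?t n k r else 0)"
    unfolding orbit_flight_upto_def by (intro sum.cong refl) (auto simp: in1 in0)
  thus "orbit_flight_upto \<Phi> h' y z M r
      = (if n < M then ennreal (\<Phi> (2 * r * orbit_height y z n k, orbit_impact h' y n k r)) else 0)"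
    by (simp add: t)
qed

lemma orbit_flight_no_hit:
  assumes "\<nexists>n k. orbit_hit h' y n k r"
  shows "orbit_flight \<Phi> h' y z r = 0" "orbit_flight_upto \<Phi> h' y z M r = 0"
  using assms by (simp_all add: orbit_flight_def orbit_flight_upto_def orbit_term_def)

lemma orbit_impact_bounds:
  assumes "\<bar>h'\<bar> \<le> 1" "orbit_hit h' y n k r"
  shows "\<bar>orbit_impact h' y n k r\<bar> \<le> 1" "0 < orbit_offset y n k" "orbit_offset y n k \<le> 2 * r"
proof -
  have o: "0 < orbit_offset y n k" "orbit_offset y n k \<le> (1 - side h' n) * r" "0 < r"
    using assms(2) by (auto simp: orbit_hit_def orbit_offset_def)
  have s: "\<bar>side h' n\<bar> \<le> 1" using assms(1) by (simp add: side_abs)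
  have "(1 - side h' n) * r \<le> 2 * r" using s o(3) by (intro mult_right_mono) auto
  thus "orbit_offset y n k \<le> 2 * r" using o by linarith
  have q: "0 < orbit_offset y n k / r" "orbit_offset y n k / r \<le> 1 - side h' n"
    using o by (auto simp: divide_le_eq)
  show "\<bar>orbit_impact h' y n k r\<bar> \<le> 1"
    using q s unfolding orbit_impact_def side_def by (cases "even n") auto
  show "0 < orbit_offset y n k" by (rule o)
qed

end

lemma nn_integral_inverse_Icc:
  assumes "0 < a" "a \<le> b"
  shows "(\<integral>\<^sup>+r. ennreal (1 / r) * indicator {a..b} r \<partial>lborel) = ennreal (ln (b / a))"
proof -
  have "(\<integral>\<^sup>+r. ennreal (1 / r) * indicator {a..b} r \<partial>lborel) = ennreal (ln b - ln a)"
    by (rule nn_integral_FTC_Icc) (use assms in \<open>auto intro!: DERIV_ln_divide\<close>)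
  thus ?thesis using assms by (simp add: ln_div)
qed

context gauss_lattice_heights
begin

lemma orbit_height_bounds:
  assumes "orbit_hit h' y n k r" "\<bar>h'\<bar> \<le> 1"
  shows "V (Suc n) \<le> orbit_height y z n k" "orbit_height y z n k \<le> V (Suc (Suc n))"
proof -
  have "V (Suc n) \<le> real (Suc k) * V (Suc n)" using V_pos[of "Suc n"] by simp
  thus "V (Suc n) \<le> orbit_height y z n k" using V_pos[of n] unfolding orbit_height_def by linarith
  have "real (Suc k) * V (Suc n) \<le> D n * V (Suc n)"
    using orbit_hit_bounds(1)[OF assms] V_pos[of "Suc n"] by (intro mult_right_mono) auto
  thus "orbit_height y z n k \<le> V (Suc (Suc n))" by (simp add: orbit_height_def)
qed

text \<open>Dividing the radius by \<open>U n\<close> preserves \<open>dr / r\<close> and turns the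
  conditions of level \<open>n\<close> into \<open>mediant_hit\<close> at the iterate
  \<open>Y n\<close>; the heights match through the determinant identity. Reflecting
  \<open>h'\<close> and \<Phi> together at odd \<open>n\<close> accounts for the alternating
  side.\<close>

lemma mediant_integral_orbit:
  assumes [measurable]: "\<Phi> \<in> borel_measurable (borel \<Otimes>\<^sub>M borel)"
  shows "mediant_integral (flip_side \<Phi> n) (side h' n) ((gauss_ext ^^ n) (y, z))
    = (\<integral>\<^sup>+r. (\<Sum>k. orbit_term \<Phi> h' y z n k r) * ennreal (1 / r) \<partial>lborel)"
proof -
  let ?h = "side h' n" and ?\<Psi> = "flip_side \<Phi> n" and ?w = "V n / V (Suc n)"
  have Un: "0 < U n" "0 < V (Suc n)" using U_pos V_pos by auto
  have w: "(1 + Y n * ?w) * (U n * V (Suc n)) = 1"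
  proof -
    have "?w * V (Suc n) = V n" using Un by simp
    moreover have "(1 + a * b) * (c * d) = c * d + (c * a) * (b * d)" for a b c d :: real
      by (simp add: algebra_simps)
    ultimately show ?thesis using UV[of n] by (simp only: offset_seq_Suc)
  qed
  have yw: "0 < 1 + Y n * ?w" using Y_bounds[of n] V_pos[of n] Un by (intro add_pos_pos mult_pos_pos divide_pos_pos) auto
  have H: "(?w + real (Suc k)) / (1 + Y n * ?w) = U n * orbit_height y z n k" for k
  proof -
    have "(?w + real (Suc k)) = (?w + real (Suc k)) * ((1 + Y n * ?w) * (U n * V (Suc n)))" unfolding w by simp
    also have "\<dots> = (1 + Y n * ?w) * (U n * ((?w + real (Suc k)) * V (Suc n)))" by (simp only: mult_ac)
    also have "(?w + real (Suc k)) * V (Suc n) = orbit_height y z n k"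
      using Un by (simp add: orbit_height_def distrib_right)
    finally show ?thesis using yw by (metis nonzero_mult_div_cancel_left order_less_irrefl)
  qed
  have O: "1 - real (Suc k) * Y n = orbit_offset y n k / U n" for k
    using Un by (simp add: orbit_offset_def offset_seq_Suc diff_divide_distrib)
  have O': "1 - real k * Y n = (U n - real k * U (Suc n)) / U n" for k
    using Un by (simp add: offset_seq_Suc diff_divide_distrib)
  have hit: "mediant_hit ?h k (Y n) (0 + 1 / U n * r) \<longleftrightarrow> orbit_hit h' y n k r" for k r
  proof -
    have a: "(1 - ?h) * (0 + 1 / U n * r) = ((1 - ?h) * r) / U n" "(1 + ?h) * (0 + 1 / U n * r) = ((1 + ?h) * r) / U n"
      "Y n = U (Suc n) / U n" "0 + 1 / U n * r = r / U n"
      using Un by (auto simp: offset_seq_Suc)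
    have c: "p / U n \<le> q / U n \<longleftrightarrow> p \<le> q" "p / U n < q / U n \<longleftrightarrow> p < q" "0 < p / U n \<longleftrightarrow> 0 < p" for p q
      using Un by (auto simp: divide_le_cancel divide_less_cancel zero_less_divide_iff)
    have e: "0 < 0 + 1 / U n * r \<longleftrightarrow> 0 < r"
      "0 < 1 - real (Suc k) * Y n \<longleftrightarrow> 0 < orbit_offset y n k"
      "1 - real (Suc k) * Y n \<le> (1 - ?h) * (0 + 1 / U n * r) \<longleftrightarrow> orbit_offset y n k \<le> (1 - ?h) * r"
      "(1 - ?h) * (0 + 1 / U n * r) < 1 - real k * Y n \<longleftrightarrow> (1 - ?h) * r < U n - real k * U (Suc n)"
      by (simp only: a(4) c, simp only: O c, simp only: O a(1) c, simp only: O' a(1) c)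
    have e': "(1 + ?h) * (0 + 1 / U n * r) < Y n \<longleftrightarrow> (1 + ?h) * r < U (Suc n)"
      by (subst a(2), subst a(3)) (simp only: c)
    show ?thesis
      unfolding mediant_hit_def e e' orbit_hit_def orbit_offset_def ..
  qed
  have val: "?\<Psi> (2 * (0 + 1 / U n * r) * (U n * orbit_height y z n k), ?h + orbit_offset y n k / U n / (0 + 1 / U n * r))
     = \<Phi> (2 * r * orbit_height y z n k, orbit_impact h' y n k r)" for k r
  proof -
    have "2 * (0 + 1 / U n * r) * (U n * orbit_height y z n k) = 2 * r * orbit_height y z n k"
      "orbit_offset y n k / U n / (0 + 1 / U n * r) = orbit_offset y n k / r" using Un by auto
    thus ?thesis by (auto simp: flip_side_def flip_def orbit_impact_def side_def)
  qed
  have "mediant_integral ?\<Psi> ?h ((gauss_ext ^^ n) (y, z))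
     = (\<Sum>k. \<integral>\<^sup>+r. ennreal (?\<Psi> (2 * r * (U n * orbit_height y z n k), ?h + orbit_offset y n k / U n / r) / r)
       * indicator {r. mediant_hit ?h k (Y n) r} r \<partial>lborel)"
    unfolding gauss_ext_funpow mediant_integral_def prod.case H O ..
  also have "\<dots> = (\<Sum>k. \<integral>\<^sup>+r. orbit_term \<Phi> h' y z n k r * ennreal (1 / r) \<partial>lborel)"
  proof (rule suminf_cong)
    fix k
    have [measurable]: "{r. mediant_hit ?h k (Y n) r} \<in> sets borel" by measurable
    have [measurable]: "?\<Psi> \<in> borel_measurable (borel \<Otimes>\<^sub>M borel)"
      by (rule flip_side_measurable) measurable
    have "(\<integral>\<^sup>+r. ennreal (?\<Psi> (2 * r * (U n * orbit_height y z n k), ?h + orbit_offset y n k / U n / r) / r)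
       * indicator {r. mediant_hit ?h k (Y n) r} r \<partial>lborel)
      = ennreal \<bar>1 / U n\<bar> * (\<integral>\<^sup>+r. ennreal (?\<Psi> (2 * (0 + 1 / U n * r) * (U n * orbit_height y z n k), ?h + orbit_offset y n k / U n / (0 + 1 / U n * r)) / (0 + 1 / U n * r))
       * indicator {r. mediant_hit ?h k (Y n) r} (0 + 1 / U n * r) \<partial>lborel)"
    proof (rule nn_integral_real_affine)
      show "1 / U n \<noteq> 0" using Un by simp
    qed measurable
    also have "\<dots> = (\<integral>\<^sup>+r. ennreal \<bar>1 / U n\<bar> * (ennreal (?\<Psi> (2 * (0 + 1 / U n * r) * (U n * orbit_height y z n k), ?h + orbit_offset y n k / U n / (0 + 1 / U n * r)) / (0 + 1 / U n * r))
       * indicator {r. mediant_hit ?h k (Y n) r} (0 + 1 / U n * r)) \<partial>lborel)"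
      by (rule nn_integral_cmult[symmetric]) measurable
    also have "\<dots> = (\<integral>\<^sup>+r. orbit_term \<Phi> h' y z n k r * ennreal (1 / r) \<partial>lborel)"
    proof (rule nn_integral_cong)
      fix r :: real
      show "ennreal \<bar>1 / U n\<bar> * (ennreal (?\<Psi> (2 * (0 + 1 / U n * r) * (U n * orbit_height y z n k), ?h + orbit_offset y n k / U n / (0 + 1 / U n * r)) / (0 + 1 / U n * r))
       * indicator {r. mediant_hit ?h k (Y n) r} (0 + 1 / U n * r)) = orbit_term \<Phi> h' y z n k r * ennreal (1 / r)"
      proof (cases "orbit_hit h' y n k r")
        case True
        hence r: "0 < r" by (simp add: orbit_hit_def)
        have "ennreal \<bar>1 / U n\<bar> * ennreal (\<Phi> (2 * r * orbit_height y z n k, orbit_impact h' y n k r) / (0 + 1 / U n * r))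
          = ennreal (\<Phi> (2 * r * orbit_height y z n k, orbit_impact h' y n k r) * (1 / r))"
          using Un by (subst ennreal_mult'[symmetric]) auto
        also have "\<dots> = ennreal (\<Phi> (2 * r * orbit_height y z n k, orbit_impact h' y n k r)) * ennreal (1 / r)"
          using r by (subst ennreal_mult'') auto
        finally show ?thesis unfolding val using True hit by (simp add: orbit_term_def)
      next
        case False
        thus ?thesis using hit by (simp add: orbit_term_def)
      qed
    qed
    finally show "(\<integral>\<^sup>+r. ennreal (?\<Psi> (2 * r * (U n * orbit_height y z n k), ?h + orbit_offset y n k / U n / r) / r)
       * indicator {r. mediant_hit ?h k (Y n) r} r \<partial>lborel) = (\<integral>\<^sup>+r. orbit_term \<Phi> h' y z n k r * ennreal (1 / r) \<partial>lborel)" .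
  qed
  also have "\<dots> = (\<integral>\<^sup>+r. (\<Sum>k. orbit_term \<Phi> h' y z n k r * ennreal (1 / r)) \<partial>lborel)"
    by (rule nn_integral_suminf[symmetric]) measurable
  finally show ?thesis by simp
qed

lemma sum_mediant_integral_orbit:
  assumes [measurable]: "\<Phi> \<in> borel_measurable (borel \<Otimes>\<^sub>M borel)"
  shows "(\<Sum>n<M. mediant_integral (flip_side \<Phi> n) (side h' n) ((gauss_ext ^^ n) (y, z)))
    = (\<integral>\<^sup>+r. orbit_flight_upto \<Phi> h' y z M r * ennreal (1 / r) \<partial>lborel)"
  unfolding mediant_integral_orbit[OF assms] orbit_flight_upto_def sum_distrib_right
  by (rule nn_integral_sum[symmetric]) measurable

end

text \<open>Continuity is asked for in \<open>S\<close> only, uniformly over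
  \<open>\<bar>h\<bar> \<le> 1\<close>: a function extended by 0 may jump at \<open>h = 1\<close>
  and \<open>h = -1\<close>, while the approximations made below move \<open>S\<close> and keep
  \<open>h\<close> fixed. Non-negativity permits work in \<open>ennreal\<close>.\<close>

locale test_function =
  fixes \<Phi> :: "real \<times> real \<Rightarrow> real" and s0 S0 B :: real
  assumes \<Phi>[measurable]: "\<Phi> \<in> borel_measurable (borel \<Otimes>\<^sub>M borel)"
    and nonneg: "0 \<le> \<Phi> p" and bound: "\<Phi> p \<le> B"
    and s0: "0 < s0" and supp: "\<Phi> (S, h) \<noteq> 0 \<Longrightarrow> s0 \<le> S \<and> S \<le> S0"
    and unif: "0 < \<delta> \<Longrightarrow> \<exists>\<eta>>0. \<forall>S S' h. \<bar>h\<bar> \<le> 1 \<longrightarrow> \<bar>S - S'\<bar> \<le> \<eta> \<longrightarrow> \<bar>\<Phi> (S, h) - \<Phi> (S', h)\<bar> \<le> \<delta>"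

lemma test_function_flip: "test_function \<Phi> s0 S0 B \<Longrightarrow> test_function (flip \<Phi>) s0 S0 B"
proof -
  assume "test_function \<Phi> s0 S0 B"
  then interpret test_function \<Phi> s0 S0 B .
  show ?thesis
  proof
    fix \<delta> :: real assume "0 < \<delta>"
    from unif[OF this] obtain \<eta> where "\<eta> > 0" "\<And>S S' h. \<bar>h\<bar> \<le> 1 \<Longrightarrow> \<bar>S - S'\<bar> \<le> \<eta> \<Longrightarrow> \<bar>\<Phi> (S, h) - \<Phi> (S', h)\<bar> \<le> \<delta>"
      by blast
    thus "\<exists>\<eta>>0. \<forall>S S' h. \<bar>h\<bar> \<le> 1 \<longrightarrow> \<bar>S - S'\<bar> \<le> \<eta> \<longrightarrow> \<bar>flip \<Phi> (S, h) - flip \<Phi> (S', h)\<bar> \<le> \<delta>"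
      by (intro exI[of _ \<eta>]) (auto simp: flip_def)
  qed (use nonneg bound s0 supp in \<open>auto simp: flip_def split: prod.splits\<close>)
qed

context test_function
begin

lemma B_nonneg: "0 \<le> B"
  using nonneg[of "(0, 0)"] bound[of "(0, 0)"] by linarith

text \<open>The window \<open>[lo * U M, hi * U M]\<close> contains the radii at which a cut at
  level \<open>M\<close> and a cut at radius \<open>U M\<close> can disagree. The integral of
  \<open>B / r\<close> over it is \<open>gap\<close>, whatever \<open>M\<close> is.\<close>

definition lo :: real where "lo = min (s0 / 2) 1"
definition hi :: real where "hi = max S0 1"
definition gap :: real where "gap = B * ln (hi / lo)"

lemma lo_hi: "0 < lo" "lo \<le> 1" "1 \<le> hi" "lo \<le> hi" "lo \<le> s0 / 2" "S0 \<le> hi"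
  using s0 by (auto simp: lo_def hi_def)

end

locale test_orbit = test_function \<Phi> s0 S0 B + gauss_lattice_heights y z
  for \<Phi> s0 S0 B y z +
  fixes h' :: real
  assumes h': "\<bar>h'\<bar> \<le> 1"
begin

abbreviation "F \<equiv> orbit_flight \<Phi> h' y z"
abbreviation "FM \<equiv> orbit_flight_upto \<Phi> h' y z"
abbreviation "J \<equiv> log_flight \<Phi> h' y z"

lemma F_cases:
  obtains "F r = 0" "\<And>M. FM M r = 0"
  | n k v where "orbit_hit h' y n k r" "0 < r" "0 < v" "v \<le> B"
      "v = \<Phi> (2 * r * orbit_height y z n k, orbit_impact h' y n k r)"
      "F r = ennreal v" "\<And>M. FM M r = (if n < M then ennreal v else 0)"
      "s0 \<le> 2 * r * orbit_height y z n k" "2 * r * orbit_height y z n k \<le> S0"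
proof (cases "\<exists>n k. orbit_hit h' y n k r")
  case True
  then obtain n k where hit: "orbit_hit h' y n k r" by blast
  define v where "v = \<Phi> (2 * r * orbit_height y z n k, orbit_impact h' y n k r)"
  note eqs = orbit_flight_eq[OF h' hit, of \<Phi> z, folded v_def]
  show ?thesis
  proof (cases "v = 0")
    case True
    thus ?thesis using eqs by (intro that(1)) auto
  next
    case False
    hence "0 < v" using nonneg unfolding v_def by (metis order_le_less)
    moreover have "0 < r" using hit by (simp add: orbit_hit_def)
    ultimately show ?thesis using eqs hit bound[of "(2 * r * orbit_height y z n k, orbit_impact h' y n k r)"]
        supp[of "2 * r * orbit_height y z n k" "orbit_impact h' y n k r"] False
      by (intro that(2)[of n k v]) (auto simp: v_def)
  qed
next
  case False
  show ?thesis by (rule that(1)) (use orbit_flight_no_hit[OF False] in auto)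
qed

lemma F_le_B: "F r \<le> ennreal B"
  by (rule F_cases[of r]) (auto intro: ennreal_leI)

lemma F_outside: assumes "S0 < r" shows "F r = 0"
proof (rule F_cases[of r])
  fix n k v assume *: "orbit_hit h' y n k r" "0 < r" "2 * r * orbit_height y z n k \<le> S0"
  have "1 / 2 \<le> orbit_height y z n k"
    using orbit_height_bounds(1)[OF *(1) h'] V_mono[of "Suc 0" "Suc n"] V_1_ge by simp
  hence "2 * r * (1 / 2) \<le> 2 * r * orbit_height y z n k" using *(2) by (intro mult_left_mono) auto
  thus "F r = 0" using *(3) assms by simp
qed auto

lemma nn_integral_gap:
  assumes "0 < u"
  shows "(\<integral>\<^sup>+r. ennreal B * (ennreal (1 / r) * indicator {lo * u..hi * u} r) \<partial>lborel) = ennreal gap"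
proof -
  have "(\<integral>\<^sup>+r. ennreal B * (ennreal (1 / r) * indicator {lo * u..hi * u} r) \<partial>lborel)
     = ennreal B * (\<integral>\<^sup>+r. ennreal (1 / r) * indicator {lo * u..hi * u} r \<partial>lborel)"
    by (rule nn_integral_cmult) measurable
  also have "\<dots> = ennreal B * ennreal (ln (hi * u / (lo * u)))"
    using assms lo_hi by (subst nn_integral_inverse_Icc) auto
  also have "\<dots> = ennreal gap"
    using assms lo_hi B_nonneg by (simp add: gap_def ennreal_mult')
  finally show ?thesis .
qed

text \<open>A collision of level \<open>n < M\<close> at a radius \<open>r \<le> U M\<close> has
  height at most \<open>V (M + 1)\<close>, while the support of \<Phi> forces \<open>r\<close> times
  the height to be at least \<open>s0 / 2\<close>. With \<open>U M * V (M + 1) \<le> 1\<close> this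
  gives \<open>r \<ge> lo * U M\<close>.\<close>

lemma FM_le_J: "(\<integral>\<^sup>+r. FM M r * ennreal (1 / r) \<partial>lborel) \<le> J (U M) + ennreal gap"
proof -
  have "(\<integral>\<^sup>+r. FM M r * ennreal (1 / r) \<partial>lborel)
    \<le> (\<integral>\<^sup>+r. F r * ennreal (1 / r) * indicator {U M<..} r + ennreal B * (ennreal (1 / r) * indicator {lo * U M..hi * U M} r) \<partial>lborel)"
  proof (rule nn_integral_mono)
    fix r :: real
    show "FM M r * ennreal (1 / r) \<le> F r * ennreal (1 / r) * indicator {U M<..} r + ennreal B * (ennreal (1 / r) * indicator {lo * U M..hi * U M} r)"
    proof (rule F_cases[of r])
      fix n k v assume *: "orbit_hit h' y n k r" "0 < r" "0 < v" "v \<le> B" "F r = ennreal v"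
        "\<And>M. FM M r = (if n < M then ennreal v else 0)" "s0 \<le> 2 * r * orbit_height y z n k"
      show ?thesis
      proof (cases "n < M")
        case n: True
        show ?thesis
        proof (cases "U M < r")
          case True
          thus ?thesis using * n by simp
        next
          case False
          have "orbit_height y z n k \<le> V (Suc M)"
            using orbit_height_bounds(2)[OF *(1) h'] V_mono[of "Suc (Suc n)" "Suc M"] n by simp
          hence "2 * r * orbit_height y z n k \<le> 2 * r * V (Suc M)" using *(2) by (intro mult_left_mono) auto
          hence "s0 / 2 \<le> r * V (Suc M)" using *(7) by simp
          hence "s0 / 2 * U M \<le> r * V (Suc M) * U M" using U_pos[of M] by (intro mult_right_mono) auto
          also have "\<dots> \<le> r" using UV_bounds(1)[of M] *(2) by (simp add: mult_left_le mult.assoc mult.commute[of "V _"])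
          finally have "lo * U M \<le> r" using mult_right_mono[OF lo_hi(5), of "U M"] U_pos[of M] by linarith
          moreover have "r \<le> hi * U M" using False lo_hi(3) U_pos[of M] mult_right_mono[of 1 hi "U M"] by linarith
          ultimately have "indicator {lo * U M..hi * U M} r = (1 :: ennreal)" by simp
          moreover have "ennreal v * ennreal (1 / r) \<le> ennreal B * ennreal (1 / r)"
            using *(4) by (intro mult_right_mono ennreal_leI) auto
          ultimately show ?thesis using * n False by simp
        qed
      qed (use * in auto)
    qed auto
  qed
  also have "\<dots> = J (U M) + (\<integral>\<^sup>+r. ennreal B * (ennreal (1 / r) * indicator {lo * U M..hi * U M} r) \<partial>lborel)"
    unfolding log_flight_def by (rule nn_integral_add) measurable
  finally show ?thesis unfolding nn_integral_gap[OF U_pos] .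
qed

text \<open>Conversely, a collision of level \<open>n \<ge> M\<close> at a radius
  \<open>r > U M\<close> has height at least \<open>V (M + 1)\<close>. With
  \<open>U M * V (M + 1) \<ge> 1 / 2\<close> the upper end of the support gives
  \<open>r \<le> hi * U M\<close>.\<close>

lemma J_le_FM: "J (U M) \<le> (\<integral>\<^sup>+r. FM M r * ennreal (1 / r) \<partial>lborel) + ennreal gap"
proof -
  have "J (U M) \<le> (\<integral>\<^sup>+r. FM M r * ennreal (1 / r) + ennreal B * (ennreal (1 / r) * indicator {lo * U M..hi * U M} r) \<partial>lborel)"
    unfolding log_flight_def
  proof (rule nn_integral_mono)
    fix r :: real
    show "F r * ennreal (1 / r) * indicator {U M<..} r \<le> FM M r * ennreal (1 / r) + ennreal B * (ennreal (1 / r) * indicator {lo * U M..hi * U M} r)"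
    proof (rule F_cases[of r])
      fix n k v assume *: "orbit_hit h' y n k r" "0 < r" "0 < v" "v \<le> B" "F r = ennreal v"
        "\<And>M. FM M r = (if n < M then ennreal v else 0)" "2 * r * orbit_height y z n k \<le> S0"
      show ?thesis
      proof (cases "n < M \<or> r \<le> U M")
        case True
        thus ?thesis using * by (auto split: split_indicator)
      next
        case False
        hence n: "M \<le> n" "U M < r" by auto
        have "V (Suc M) \<le> orbit_height y z n k"
          using orbit_height_bounds(1)[OF *(1) h'] V_mono[of "Suc M" "Suc n"] n by simp
        hence "2 * r * V (Suc M) \<le> 2 * r * orbit_height y z n k" using *(2) by (intro mult_left_mono) auto
        hence "2 * r * V (Suc M) \<le> S0" using *(7) by simp
        hence "2 * r * V (Suc M) * U M \<le> S0 * U M" using U_pos[of M] by (intro mult_right_mono) auto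
        moreover have "r * (1 / 2) \<le> r * (U M * V (Suc M))" using UV_bounds(2)[of M] *(2) by (intro mult_left_mono) auto
        ultimately have "r \<le> S0 * U M" by (simp add: mult_ac)
        also have "\<dots> \<le> hi * U M" using lo_hi U_pos[of M] by (intro mult_right_mono) auto
        finally have "r \<le> hi * U M" .
        moreover have "lo * U M \<le> r" using n lo_hi(2) U_pos[of M] mult_right_mono[of lo 1 "U M"] by linarith
        ultimately have "indicator {lo * U M..hi * U M} r = (1 :: ennreal)" by simp
        moreover have "ennreal v * ennreal (1 / r) \<le> ennreal B * ennreal (1 / r)"
          using *(4) by (intro mult_right_mono ennreal_leI) auto
        ultimately show ?thesis using * n by simp
      qed
    qed auto
  qed
  also have "\<dots> = (\<integral>\<^sup>+r. FM M r * ennreal (1 / r) \<partial>lborel) + (\<integral>\<^sup>+r. ennreal B * (ennreal (1 / r) * indicator {lo * U M..hi * U M} r) \<partial>lborel)"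
    by (rule nn_integral_add) measurable
  finally show ?thesis unfolding nn_integral_gap[OF U_pos] .
qed

lemma J_bound:
  assumes "0 < \<epsilon>" "\<epsilon> \<le> hi"
  shows "J \<epsilon> \<le> ennreal (B * ln (hi / \<epsilon>))"
proof -
  have "J \<epsilon> \<le> (\<integral>\<^sup>+r. ennreal B * (ennreal (1 / r) * indicator {\<epsilon>..hi} r) \<partial>lborel)"
    unfolding log_flight_def
  proof (rule nn_integral_mono)
    fix r :: real
    show "F r * ennreal (1 / r) * indicator {\<epsilon><..} r \<le> ennreal B * (ennreal (1 / r) * indicator {\<epsilon>..hi} r)"
    proof (cases "\<epsilon> < r \<and> r \<le> hi")
      case True
      thus ?thesis using F_le_B[of r] by (auto intro: mult_right_mono)
    next
      case False
      thus ?thesis using F_outside[of r] lo_hi by (auto split: split_indicator)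
    qed
  qed
  also have "\<dots> = ennreal B * (\<integral>\<^sup>+r. ennreal (1 / r) * indicator {\<epsilon>..hi} r \<partial>lborel)"
    by (rule nn_integral_cmult) measurable
  also have "\<dots> = ennreal (B * ln (hi / \<epsilon>))"
    using assms B_nonneg by (subst nn_integral_inverse_Icc) (auto simp: ennreal_mult')
  finally show ?thesis .
qed

lemma J_antimono: "\<epsilon> \<le> \<epsilon>' \<Longrightarrow> J \<epsilon>' \<le> J \<epsilon>"
  unfolding log_flight_def by (intro nn_integral_mono mult_left_mono) (auto split: split_indicator)

end

text \<open>By \<open>height_seq_diff\<close> and linearity the heights differ by a factor of
  modulus at most 1 times the offset of the point hit, which is at most \<open>2 * r\<close> because
  the point lies in the strip.\<close>

lemma orbit_height_diff:
  assumes "gauss_lattice_heights y z" "gauss_lattice_heights y z'"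
    and "\<bar>h'\<bar> \<le> 1" "orbit_hit h' y n k r"
  shows "\<bar>2 * r * orbit_height y z n k - 2 * r * orbit_height y z' n k\<bar> \<le> 4 * r\<^sup>2"
proof -
  interpret a: gauss_lattice_heights y z by fact
  interpret b: gauss_lattice_heights y z' by fact
  define \<kappa> where "\<kappa> = (z - z') / ((1 + y * z) * (1 + y * z'))"
  have "\<bar>(1 + y * z) * (1 + y * z')\<bar> \<ge> 1" using a.yz_pos b.yz_pos
    by (simp add: abs_mult mult_ge1_I)
  moreover have "\<bar>z - z'\<bar> \<le> 1" using a.z b.z by auto
  ultimately have \<kappa>: "\<bar>\<kappa>\<bar> \<le> 1" unfolding \<kappa>_def abs_divide by (auto simp: divide_le_eq)
  have "orbit_height y z n k - orbit_height y z' n k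
     = (height_seq y z n - height_seq y z' n) + real (Suc k) * (height_seq y z (Suc n) - height_seq y z' (Suc n))"
    by (simp add: orbit_height_def algebra_simps)
  also have "\<dots> = (- 1) ^ n * \<kappa> * orbit_offset y n k"
    unfolding height_seq_diff[OF assms(1,2)] \<kappa>_def[symmetric] orbit_offset_def by (simp add: algebra_simps)
  finally have "\<bar>orbit_height y z n k - orbit_height y z' n k\<bar> = \<bar>\<kappa>\<bar> * \<bar>orbit_offset y n k\<bar>"
    by (simp add: abs_mult)
  also have "\<dots> \<le> 1 * (2 * r)" using \<kappa> a.orbit_impact_bounds[OF assms(3,4)] by (intro mult_mono) auto
  finally have "\<bar>orbit_height y z n k - orbit_height y z' n k\<bar> \<le> 2 * r" by simp
  moreover have "0 < r" using assms(4) by (simp add: orbit_hit_def)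
  ultimately have "2 * r * \<bar>orbit_height y z n k - orbit_height y z' n k\<bar> \<le> 2 * r * (2 * r)"
    by (intro mult_left_mono) auto
  thus ?thesis using \<open>0 < r\<close> by (simp add: right_diff_distrib[symmetric] abs_mult power2_eq_square)
qed

text \<open>The obstacles hit do not depend on \<open>z\<close>, and the heights for two values of \<open>z\<close> differ
  by a multiple of the offset, hence by \<open>O(r)\<close>.\<close>

lemma (in test_function) log_flight_compare:
  assumes \<delta>: "\<delta> > 0"
  obtains C where "\<And>y z z' h' \<epsilon>. gauss_lattice_heights y z \<Longrightarrow> gauss_lattice_heights y z' \<Longrightarrow> \<bar>h'\<bar> \<le> 1 \<Longrightarrow>
     0 < \<epsilon> \<Longrightarrow> \<epsilon> \<le> 1 \<Longrightarrow>
     log_flight \<Phi> h' y z \<epsilon> \<le> log_flight \<Phi> h' y z' \<epsilon> + ennreal (\<delta> * ln (hi / \<epsilon>)) + ennreal C"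
proof -
  obtain \<eta> where \<eta>: "\<eta> > 0" "\<And>S S' h. \<bar>h\<bar> \<le> 1 \<Longrightarrow> \<bar>S - S'\<bar> \<le> \<eta> \<Longrightarrow> \<bar>\<Phi> (S, h) - \<Phi> (S', h)\<bar> \<le> \<delta>"
    using unif[OF \<delta>] by blast
  \<comment> \<open>Below \<rho> the shift \<open>4 * r\<^sup>2\<close> stays within \<eta> and
    costs \<delta>. Radii in \<open>[\<rho>, hi]\<close> are estimated by \<open>B\<close> and give
    a constant that depends neither on the lattice nor on \<epsilon>.\<close>
  define \<rho> where "\<rho> = min hi (sqrt (\<eta> / 4))"
  have \<rho>: "0 < \<rho>" "\<rho> \<le> hi" using \<eta> lo_hi by (auto simp: \<rho>_def)
  have \<rho>2: "4 * r\<^sup>2 \<le> \<eta>" if "0 < r" "r \<le> \<rho>" for r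
  proof -
    have "r \<le> sqrt (\<eta> / 4)" using that by (simp add: \<rho>_def)
    hence "r\<^sup>2 \<le> (sqrt (\<eta> / 4))\<^sup>2" using that by (intro power_mono) auto
    thus ?thesis using \<eta> by simp
  qed
  show ?thesis
  proof (rule that[of "B * ln (hi / \<rho>)"])
    fix y z z' h' \<epsilon> :: real
    assume gl: "gauss_lattice_heights y z" "gauss_lattice_heights y z'" and h': "\<bar>h'\<bar> \<le> 1" and \<epsilon>: "0 < \<epsilon>" "\<epsilon> \<le> 1"
    interpret a: test_orbit \<Phi> s0 S0 B y z h'
      using gl h' test_function_axioms unfolding test_orbit_def test_orbit_axioms_def by blast
    interpret b: test_orbit \<Phi> s0 S0 B y z' h'
      using gl h' test_function_axioms unfolding test_orbit_def test_orbit_axioms_def by blast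
    have "a.J \<epsilon> \<le> (\<integral>\<^sup>+r. (b.F r * ennreal (1 / r) * indicator {\<epsilon><..} r + ennreal \<delta> * (ennreal (1 / r) * indicator {\<epsilon>..hi} r))
        + ennreal B * (ennreal (1 / r) * indicator {\<rho>..hi} r) \<partial>lborel)"
      unfolding log_flight_def
    proof (rule nn_integral_mono)
      fix r :: real
      show "a.F r * ennreal (1 / r) * indicator {\<epsilon><..} r \<le> (b.F r * ennreal (1 / r) * indicator {\<epsilon><..} r + ennreal \<delta> * (ennreal (1 / r) * indicator {\<epsilon>..hi} r))
        + ennreal B * (ennreal (1 / r) * indicator {\<rho>..hi} r)"
      proof (cases "\<epsilon> < r \<and> r \<le> hi")
        case out: False
        thus ?thesis using a.F_outside[of r] lo_hi by (auto split: split_indicator)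
      next
        case True
        hence r: "0 < r" using \<epsilon> by simp
        show ?thesis
        proof (cases "\<rho> \<le> r")
          case big: True
          have "a.F r * ennreal (1 / r) \<le> ennreal B * ennreal (1 / r)" by (intro mult_right_mono a.F_le_B) simp
          thus ?thesis using True big by (simp add: add_increasing)
        next
          case False
          have "a.F r \<le> b.F r + ennreal \<delta>"
          proof (cases "\<exists>n k. orbit_hit h' y n k r")
            case hit: True
            then obtain n k where hit: "orbit_hit h' y n k r" by blast
            let ?S = "2 * r * orbit_height y z n k" and ?S' = "2 * r * orbit_height y z' n k" and ?h = "orbit_impact h' y n k r"
            have "\<bar>?S - ?S'\<bar> \<le> \<eta>" using orbit_height_diff[OF gl h' hit] \<rho>2[of r] r False by linarith
            hence "\<bar>\<Phi> (?S, ?h) - \<Phi> (?S', ?h)\<bar> \<le> \<delta>" using a.orbit_impact_bounds(1)[OF h' hit] by (intro \<eta>(2)) auto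
            hence "\<Phi> (?S, ?h) \<le> \<Phi> (?S', ?h) + \<delta>" by linarith
            hence "ennreal (\<Phi> (?S, ?h)) \<le> ennreal (\<Phi> (?S', ?h) + \<delta>)" by (rule ennreal_leI)
            also have "\<dots> = ennreal (\<Phi> (?S', ?h)) + ennreal \<delta>" using \<delta> nonneg by (intro ennreal_plus) auto
            finally show ?thesis using a.orbit_flight_eq(1)[OF h' hit] a.orbit_flight_eq(1)[OF h' hit] by simp
          next
            case False
            thus ?thesis using a.orbit_flight_no_hit by simp
          qed
          hence "a.F r * ennreal (1 / r) \<le> (b.F r + ennreal \<delta>) * ennreal (1 / r)" by (rule mult_right_mono) simp
          thus ?thesis using True by (simp add: distrib_right add_increasing2)
        qed
      qed
    qed
    also have "\<dots> = (\<integral>\<^sup>+r. b.F r * ennreal (1 / r) * indicator {\<epsilon><..} r + ennreal \<delta> * (ennreal (1 / r) * indicator {\<epsilon>..hi} r) \<partial>lborel)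
        + (\<integral>\<^sup>+r. ennreal B * (ennreal (1 / r) * indicator {\<rho>..hi} r) \<partial>lborel)"
      by (rule nn_integral_add) measurable
    also have "(\<integral>\<^sup>+r. b.F r * ennreal (1 / r) * indicator {\<epsilon><..} r + ennreal \<delta> * (ennreal (1 / r) * indicator {\<epsilon>..hi} r) \<partial>lborel)
      = b.J \<epsilon> + (\<integral>\<^sup>+r. ennreal \<delta> * (ennreal (1 / r) * indicator {\<epsilon>..hi} r) \<partial>lborel)"
      unfolding log_flight_def by (rule nn_integral_add) measurable
    also have "(\<integral>\<^sup>+r. ennreal \<delta> * (ennreal (1 / r) * indicator {\<epsilon>..hi} r) \<partial>lborel) = ennreal (\<delta> * ln (hi / \<epsilon>))"
      using \<epsilon> \<delta> lo_hi by (subst nn_integral_cmult) (auto simp: nn_integral_inverse_Icc ennreal_mult')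
    also have "(\<integral>\<^sup>+r. ennreal B * (ennreal (1 / r) * indicator {\<rho>..hi} r) \<partial>lborel) = ennreal (B * ln (hi / \<rho>))"
      using \<rho> B_nonneg by (subst nn_integral_cmult) (auto simp: nn_integral_inverse_Icc ennreal_mult')
    finally show "a.J \<epsilon> \<le> b.J \<epsilon> + ennreal (\<delta> * ln (hi / \<epsilon>)) + ennreal (B * ln (hi / \<rho>))" .
  qed
qed

section \<open>Birkhoff averages along slopes\<close>

text \<open>Countable quantifiers in place of the real \<open>d\<close> give measurability.\<close>

lemma freq_above_countable:
  "freq_above S f c x \<longleftrightarrow>
     (\<exists>k::nat. \<forall>m. \<exists>n\<ge>m. (c + 1 / real (Suc k)) * real n < (\<Sum>i<n. f ((S ^^ i) x)))"
  (is "?L \<longleftrightarrow> ?R")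
proof
  assume ?L
  then obtain d where d: "d > c" "\<exists>\<^sub>F n in sequentially. d * real n < (\<Sum>i<n. f ((S ^^ i) x))"
    by (auto simp: freq_above_def)
  obtain k where k: "1 / real (Suc k) < d - c" using nat_approx_posE[of "d - c"] d by auto
  have "(c + 1 / real (Suc k)) * real n \<le> d * real n" for n
    using k by (intro mult_right_mono) auto
  hence "\<exists>n\<ge>m. (c + 1 / real (Suc k)) * real n < (\<Sum>i<n. f ((S ^^ i) x))" for m
    using d(2) unfolding frequently_sequentially by (meson le_less_trans)
  thus ?R by blast
next
  assume ?R
  then obtain k :: nat where "\<forall>m. \<exists>n\<ge>m. (c + 1 / real (Suc k)) * real n < (\<Sum>i<n. f ((S ^^ i) x))" by blast
  thus ?L unfolding freq_above_def frequently_sequentially by (intro exI[of _ "c + 1 / real (Suc k)"]) auto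
qed

text \<open>Of the margin \<open>d - c\<close>, one third pays for \<open>\<delta> * N\<close>, one
  third for the constant once \<open>N\<close> is large, and one third remains.\<close>

lemma frequently_linear_transfer:
  fixes a b :: "nat \<Rightarrow> real"
  assumes ab: "\<And>\<delta>. 0 < \<delta> \<Longrightarrow> \<exists>C. \<forall>N. a N \<le> b N + \<delta> * real N + C"
    and a: "\<exists>d>c. \<exists>\<^sub>F N in sequentially. d * real N < a N"
  shows "\<exists>d>c. \<exists>\<^sub>F N in sequentially. d * real N < b N"
proof -
  obtain d where d: "d > c" "\<exists>\<^sub>F N in sequentially. d * real N < a N" using a by blast
  define \<delta> where "\<delta> = (d - c) / 3"
  have \<delta>: "\<delta> > 0" using d by (simp add: \<delta>_def)
  obtain C where C: "\<And>N. a N \<le> b N + \<delta> * real N + C" using ab[OF \<delta>] by blast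
  obtain N0 :: nat where N0: "C / \<delta> < real N0" using reals_Archimedean2 by blast
  have ev: "\<forall>\<^sub>F N in sequentially. d * real N < a N \<longrightarrow> (c + \<delta>) * real N < b N"
  proof (rule eventually_sequentiallyI[of N0], rule impI)
    fix N assume N: "N0 \<le> N" "d * real N < a N"
    have "C < \<delta> * real N0" using N0 \<delta> by (simp add: divide_less_eq mult.commute)
    also have "\<dots> \<le> \<delta> * real N" using N \<delta> by (intro mult_left_mono) auto
    finally have "C < \<delta> * real N" .
    moreover have "d = c + 3 * \<delta>" unfolding \<delta>_def by (simp add: field_simps)
    ultimately show "(c + \<delta>) * real N < b N" using N(2) C[of N] by (simp add: algebra_simps)
  qed
  have "\<exists>\<^sub>F N in sequentially. (c + \<delta>) * real N < b N"
    using frequently_mp[OF ev d(2)] .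
  thus ?thesis using \<delta> by (intro exI[of _ "c + \<delta>"]) auto
qed

text \<open>Starting one step later changes the sum by the fixed term \<open>f x\<close> and the
  number of terms by one; both effects are bounded and are absorbed by the margin.\<close>

lemma freq_above_shift: "freq_above S f c (S x) \<longleftrightarrow> freq_above S f c x"
proof -
  let ?s = "\<lambda>x N. \<Sum>i<N. f ((S ^^ i) x)"
  have e: "?s x (Suc N) = f x + ?s (S x) N" for N
    by (subst sum.lessThan_Suc_shift) (simp add: funpow_swap1)
  have e': "?s x N = f x + ?s (S x) N - f ((S ^^ N) x)" for N
    using e[of N] by simp
  have sh: "(\<exists>d>c. \<exists>\<^sub>F N in sequentially. d * real N < a (Suc N)) \<longleftrightarrow>
     (\<exists>d>c. \<exists>\<^sub>F N in sequentially. d * real N < a N)" (is "?A \<longleftrightarrow> ?B") for a :: "nat \<Rightarrow> real"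
  proof -
    have sq: "(\<exists>\<^sub>F N in sequentially. P (Suc N)) \<longleftrightarrow> (\<exists>\<^sub>F N in sequentially. P N)" for P
      unfolding frequently_def eventually_sequentially_Suc[of "\<lambda>N. \<not> P N"] ..
    have "?B \<longleftrightarrow> (\<exists>d>c. \<exists>\<^sub>F N in sequentially. d * real (Suc N) < a (Suc N))"
      unfolding sq[of "\<lambda>N. _ * real N < a N"] ..
    also have "\<dots> \<longleftrightarrow> (\<exists>d>c. \<exists>\<^sub>F N in sequentially. d * real N < a (Suc N) - d)"
      by (simp add: algebra_simps)
    also have "\<dots> \<longleftrightarrow> ?A"
    proof
      assume "\<exists>d>c. \<exists>\<^sub>F N in sequentially. d * real N < a (Suc N) - d"
      then obtain d where d: "d > c" "\<exists>\<^sub>F N in sequentially. d * real N < a (Suc N) - d" by blast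
      show ?A
      proof (rule frequently_linear_transfer[where a = "\<lambda>N. a (Suc N) - d"])
        fix \<delta> :: real assume "0 < \<delta>"
        thus "\<exists>C. \<forall>N. a (Suc N) - d \<le> a (Suc N) + \<delta> * real N + C"
          by (intro exI[of _ "\<bar>d\<bar>"] allI) (smt (verit) mult_nonneg_nonneg of_nat_0_le_iff)
      qed (use d in blast)
    next
      assume ?A
      then obtain d where d: "d > c" "\<exists>\<^sub>F N in sequentially. d * real N < a (Suc N)" by blast
      \<comment> \<open>The shift of index costs the rate itself. Subtracting
        \<open>\<bar>c\<bar> + \<bar>d\<bar>\<close> beforehand covers the rate
        \<open>d'' \<le> d\<close> used in the end, whatever \<open>d'\<close> comes out.\<close>
      have "\<exists>d1>c. \<exists>\<^sub>F N in sequentially. d1 * real N < a (Suc N) - \<bar>c\<bar> - \<bar>d\<bar>"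
      proof (rule frequently_linear_transfer[where a = "\<lambda>N. a (Suc N)"])
        fix \<delta> :: real assume "0 < \<delta>"
        thus "\<exists>C. \<forall>N. a (Suc N) \<le> a (Suc N) - \<bar>c\<bar> - \<bar>d\<bar> + \<delta> * real N + C"
          by (intro exI[of _ "\<bar>c\<bar> + \<bar>d\<bar>"] allI) simp
      qed (use d in blast)
      then obtain d' where d': "d' > c" "\<exists>\<^sub>F N in sequentially. d' * real N < a (Suc N) - \<bar>c\<bar> - \<bar>d\<bar>" by blast
      define d'' where "d'' = min d d'"
      have "\<exists>\<^sub>F N in sequentially. d'' * real N < a (Suc N) - d''"
        using d'(2)
      proof (rule frequently_elim1)
        fix N assume "d' * real N < a (Suc N) - \<bar>c\<bar> - \<bar>d\<bar>"
        moreover have "d'' * real N \<le> d' * real N" unfolding d''_def by (intro mult_right_mono) auto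
        moreover have "d'' \<le> \<bar>c\<bar> + \<bar>d\<bar>" unfolding d''_def by linarith
        ultimately show "d'' * real N < a (Suc N) - d''" by linarith
      qed
      thus "\<exists>d>c. \<exists>\<^sub>F N in sequentially. d * real N < a (Suc N) - d"
        using d d' by (intro exI[of _ d'']) (auto simp: d''_def)
    qed
    finally show ?thesis by blast
  qed
  have "freq_above S f c x \<longleftrightarrow> (\<exists>d>c. \<exists>\<^sub>F N in sequentially. d * real N < ?s x (Suc N))"
    unfolding freq_above_def sh[of "?s x"] ..
  also have "\<dots> \<longleftrightarrow> freq_above S f c (S x)"
    unfolding freq_above_def
  proof
    assume "\<exists>d>c. \<exists>\<^sub>F N in sequentially. d * real N < ?s x (Suc N)"
    thus "\<exists>d>c. \<exists>\<^sub>F N in sequentially. d * real N < ?s (S x) N"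
      by (rule frequently_linear_transfer[rotated])
        (unfold e, intro exI[of _ "f x"] allI, simp)
  next
    assume "\<exists>d>c. \<exists>\<^sub>F N in sequentially. d * real N < ?s (S x) N"
    thus "\<exists>d>c. \<exists>\<^sub>F N in sequentially. d * real N < ?s x (Suc N)"
      by (rule frequently_linear_transfer[rotated])
        (unfold e, intro exI[of _ "- f x"] allI, simp)
  qed
  finally show ?thesis by blast
qed

abbreviation gauss_ext2 :: "real \<times> real \<Rightarrow> real \<times> real" where
  "gauss_ext2 \<equiv> gauss_ext \<circ> gauss_ext"

lemma gauss_ext2_funpow: "(gauss_ext2 ^^ i) p = (gauss_ext ^^ (2 * i)) p"
proof -
  have "gauss_ext2 = gauss_ext ^^ 2" by (simp add: numeral_2_eq_2)
  thus ?thesis by (simp add: funpow_mult)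
qed

lemma freq_above_gauss_measurable:
  assumes [measurable]: "f \<in> borel_measurable (borel \<Otimes>\<^sub>M borel)"
  shows "Measurable.pred (borel \<Otimes>\<^sub>M borel) (freq_above gauss_ext2 f c)"
proof -
  have [measurable]: "(gauss_ext ^^ n) \<in> borel \<Otimes>\<^sub>M borel \<rightarrow>\<^sub>M borel \<Otimes>\<^sub>M borel" for n
    by (induction n) (auto simp: o_def)
  show ?thesis unfolding freq_above_countable[abs_def] gauss_ext2_funpow by measurable
qed

text \<open>On \<open>G\<close> the event does not depend on the past, so it is decided by its slice
  at \<open>z = 1 / 2\<close>. A double step moves the slice to another past over
  \<open>gauss (gauss y)\<close>, which may be set back to 1/2. The slice is thus an invariant
  predicate of the slope, to which \<open>gauss_zero_one\<close> applies.\<close>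

lemma freq_above_gauss_zero_one:
  assumes f[measurable]: "f \<in> borel_measurable (borel \<Otimes>\<^sub>M borel)"
    and G[measurable]: "Measurable.pred borel G" and AE_G: "AE y in lborel. 0 < y \<and> y < 1 \<longrightarrow> G y"
    and inv: "\<And>y. y \<in> unit_irr \<Longrightarrow> G y \<longleftrightarrow> G (gauss (gauss y))"
    and z: "\<And>y z z'. y \<in> unit_irr \<Longrightarrow> G y \<Longrightarrow> 0 < z \<Longrightarrow> z < 1 \<Longrightarrow> 0 < z' \<Longrightarrow> z' < 1 \<Longrightarrow>
       freq_above gauss_ext2 f c (y, z) \<Longrightarrow> freq_above gauss_ext2 f c (y, z')"
  shows "(AE p in gauss_ext_measure. freq_above gauss_ext2 f c p) \<or>
    (AE p in gauss_ext_measure. \<not> freq_above gauss_ext2 f c p)"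
proof -
  note [measurable] = freq_above_gauss_measurable[OF f]
  let ?Q = "freq_above gauss_ext2 f c"
  define P where "P y \<longleftrightarrow> G y \<and> ?Q (y, 1 / 2)" for y
  have P[measurable]: "Measurable.pred borel P" unfolding P_def[abs_def] by measurable
  have invP: "P y \<longleftrightarrow> P (gauss (gauss y))" if y: "y \<in> unit_irr" for y
  proof (cases "G y")
    case True
    have g: "gauss y \<in> unit_irr" "gauss (gauss y) \<in> unit_irr" using gauss_unit_irr y by auto
    define z where "z = 1 / (gauss_digit (gauss y) + 1 / (gauss_digit y + 1 / 2))"
    have d: "gauss_digit y \<ge> 1" "gauss_digit (gauss y) \<ge> 1"
      using gauss_digit_ge_1 unit_irrD g y by blast+
    have z01: "0 < z" "z < 1"
    proof -
      have "0 < 1 / (gauss_digit y + 1 / 2)" using d by auto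
      hence "gauss_digit (gauss y) + 1 / (gauss_digit y + 1 / 2) > 1" using d by linarith
      thus "0 < z" "z < 1" by (auto simp: z_def)
    qed
    have "?Q (y, 1 / 2) \<longleftrightarrow> ?Q (gauss_ext2 (y, 1 / 2))" by (simp only: freq_above_shift)
    also have "gauss_ext2 (y, 1 / 2) = (gauss (gauss y), z)" by (simp add: gauss_ext_def z_def)
    also have "?Q \<dots> \<longleftrightarrow> ?Q (gauss (gauss y), 1 / 2)"
    proof
      have Gy: "G (gauss (gauss y))" using True inv[OF y] by blast
      show "?Q (gauss (gauss y), 1 / 2)" if "?Q (gauss (gauss y), z)"
        by (rule z[OF g(2) Gy z01 _ _ that]) simp_all
      show "?Q (gauss (gauss y), z)" if "?Q (gauss (gauss y), 1 / 2)"
        by (rule z[OF g(2) Gy _ _ z01 that]) simp_all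
    qed
    finally show ?thesis using True inv[OF y] unfolding P_def by blast
  qed (use inv[OF y] in \<open>simp add: P_def\<close>)
  have alt: "(AE y in lborel. 0 < y \<and> y < 1 \<longrightarrow> P y) \<or> (AE y in lborel. 0 < y \<and> y < 1 \<longrightarrow> \<not> P y)"
    by (rule gauss_zero_one[where P = P, OF P]) (rule invP)
  have Qz: "?Q (y, z) \<longleftrightarrow> ?Q (y, 1 / 2)" if "y \<in> unit_irr" "G y" "0 < z" "z < 1" for y z
  proof
    show "?Q (y, 1 / 2)" if "?Q (y, z)"
      by (rule z[OF \<open>y \<in> unit_irr\<close> \<open>G y\<close> \<open>0 < z\<close> \<open>z < 1\<close> _ _ that]) simp_all
    show "?Q (y, z)" if "?Q (y, 1 / 2)"
      by (rule z[OF \<open>y \<in> unit_irr\<close> \<open>G y\<close> _ _ \<open>0 < z\<close> \<open>z < 1\<close> that]) simp_all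
  qed
  from alt show ?thesis
  proof
    assume "AE y in lborel. 0 < y \<and> y < 1 \<longrightarrow> P y"
    with AE_G AE_unit_irr have "AE y in lborel. 0 < y \<and> y < 1 \<longrightarrow> (AE z in lborel. 0 < z \<and> z < 1 \<longrightarrow> ?Q (y, z))"
    proof eventually_elim
      case (elim y)
      show ?case using elim Qz unfolding P_def by (intro impI AE_I2) blast
    qed
    thus ?thesis by (intro disjI1, subst AE_gauss_ext_measure_iff) (measurable, blast?)
  next
    assume "AE y in lborel. 0 < y \<and> y < 1 \<longrightarrow> \<not> P y"
    with AE_G AE_unit_irr have "AE y in lborel. 0 < y \<and> y < 1 \<longrightarrow> (AE z in lborel. 0 < z \<and> z < 1 \<longrightarrow> \<not> ?Q (y, z))"
    proof eventually_elim
      case (elim y)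
      show ?case using elim Qz unfolding P_def by (intro impI AE_I2) blast
    qed
    thus ?thesis by (intro disjI2, subst AE_gauss_ext_measure_iff) (measurable, blast?)
  qed
qed

text \<open>Holds for an arbitrary predicate, such as convergence of averages, without a separate
  measurability proof.\<close>

lemma AE_gauss_ext_measureD:
  assumes "AE p in gauss_ext_measure. P p"
  shows "AE y in lborel. 0 < y \<and> y < 1 \<longrightarrow> (AE z in lborel. 0 < z \<and> z < 1 \<longrightarrow> P (y, z))"
proof -
  have pos: "1 + y * z \<noteq> 0" if "0 < y" "0 < z" for y z :: real
    using that by (smt (verit) mult_pos_pos)
  have "AE p in lborel \<Otimes>\<^sub>M lborel. 0 < (case p of (y, z) \<Rightarrow> ennreal (1 / (1 + y * z)\<^sup>2) * indicator ({0<..<1} \<times> {0<..<1}) (y, z)) \<longrightarrow> P p"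
    using assms unfolding gauss_ext_measure_def by (subst (asm) AE_density) auto
  hence "AE p in lborel \<Otimes>\<^sub>M lborel. 0 < fst p \<and> fst p < 1 \<longrightarrow> 0 < snd p \<and> snd p < 1 \<longrightarrow> P (fst p, snd p)"
    by eventually_elim (auto simp: indicator_def ennreal_zero_less_mult_iff pos)
  from lborel_pair.AE_pair[OF this] show ?thesis by simp
qed

text \<open>The comparison \<open>z\<close> of two pasts yields the zero-one alternatives, for
  \<open>f\<close> as given and for \<open>- f\<close> with the pasts exchanged. Almost every pair
  has the limit, so for almost every slope at least one past does.\<close>

lemma birkhoff_gauss:
  assumes f: "f \<in> borel_measurable (borel \<Otimes>\<^sub>M borel)" and int: "integrable gauss_ext_measure f"
    and G: "Measurable.pred borel G" "AE y in lborel. 0 < y \<and> y < 1 \<longrightarrow> G y"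
    and inv: "\<And>y. y \<in> unit_irr \<Longrightarrow> G y \<longleftrightarrow> G (gauss (gauss y))"
    and z: "\<And>y z z' \<delta>. y \<in> unit_irr \<Longrightarrow> G y \<Longrightarrow> 0 < z \<Longrightarrow> z < 1 \<Longrightarrow> 0 < z' \<Longrightarrow> z' < 1 \<Longrightarrow> 0 < \<delta> \<Longrightarrow>
       \<exists>C. \<forall>N. (\<Sum>i<N. f ((gauss_ext2 ^^ i) (y, z))) \<le> (\<Sum>i<N. f ((gauss_ext2 ^^ i) (y, z'))) + \<delta> * real N + C"
  shows "AE y in lborel. 0 < y \<and> y < 1 \<longrightarrow> (\<exists>z. 0 < z \<and> z < 1 \<and>
     (\<lambda>N. (\<Sum>i<N. f ((gauss_ext2 ^^ i) (y, z))) / real N)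
       \<longlonglongrightarrow> (\<integral>p. f p \<partial>gauss_ext_measure) / measure gauss_ext_measure UNIV)"
proof -
  interpret mpt gauss_ext_measure gauss_ext2 by (rule mpt_gauss_ext2)
  let ?lim = "\<lambda>p. (\<lambda>N. (\<Sum>i<N. f ((gauss_ext2 ^^ i) p)) / real N)
       \<longlonglongrightarrow> (\<integral>p. f p \<partial>gauss_ext_measure) / measure gauss_ext_measure UNIV"
  have "AE p in gauss_ext_measure. ?lim p"
  proof (rule birkhoff_zero_one[OF int, unfolded space_gauss_ext_measure])
    show "0 < measure gauss_ext_measure UNIV" by (rule measure_gauss_ext_measure_pos)
    fix c :: real
    show "(AE p in gauss_ext_measure. freq_above gauss_ext2 f c p) \<or>
      (AE p in gauss_ext_measure. \<not> freq_above gauss_ext2 f c p)"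
      using f G inv
    proof (rule freq_above_gauss_zero_one)
      fix y z z' :: real
      assume *: "y \<in> unit_irr" "G y" "0 < z" "z < 1" "0 < z'" "z' < 1" "freq_above gauss_ext2 f c (y, z)"
      show "freq_above gauss_ext2 f c (y, z')"
        unfolding freq_above_def
        by (rule frequently_linear_transfer[OF z[OF *(1-6)] *(7)[unfolded freq_above_def]])
    qed
    show "(AE p in gauss_ext_measure. freq_above gauss_ext2 (\<lambda>p. - f p) c p) \<or>
      (AE p in gauss_ext_measure. \<not> freq_above gauss_ext2 (\<lambda>p. - f p) c p)"
    proof (rule freq_above_gauss_zero_one[OF _ G inv])
      show "(\<lambda>p. - f p) \<in> borel_measurable (borel \<Otimes>\<^sub>M borel)" using f by measurable
      fix y z z' :: real
      assume *: "y \<in> unit_irr" "G y" "0 < z" "z < 1" "0 < z'" "z' < 1" "freq_above gauss_ext2 (\<lambda>p. - f p) c (y, z)"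
      show "freq_above gauss_ext2 (\<lambda>p. - f p) c (y, z')"
        unfolding freq_above_def
      proof (rule frequently_linear_transfer[OF _ *(7)[unfolded freq_above_def]])
        fix \<delta> :: real assume "0 < \<delta>"
        from z[OF *(1,2,5,6,3,4) this]
        show "\<exists>C. \<forall>N. (\<Sum>i<N. - f ((gauss_ext2 ^^ i) (y, z))) \<le> (\<Sum>i<N. - f ((gauss_ext2 ^^ i) (y, z'))) + \<delta> * real N + C"
          by (simp add: sum_negf algebra_simps)
      qed
    qed
  qed
  hence "AE y in lborel. 0 < y \<and> y < 1 \<longrightarrow> (AE z in lborel. 0 < z \<and> z < 1 \<longrightarrow> ?lim (y, z))"
    by (rule AE_gauss_ext_measureD)
  thus ?thesis
  proof eventually_elim
    case (elim y)
    show ?case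
    proof
      assume "0 < y \<and> y < 1"
      hence l: "AE z in lborel. 0 < z \<and> z < 1 \<longrightarrow> ?lim (y, z)" using elim by blast
      have n: "\<not> (AE z in lborel. \<not> (0 < z \<and> z < (1 :: real)))"
      proof
        assume "AE z in lborel. \<not> (0 < z \<and> z < (1 :: real))"
        hence "emeasure lborel {0<..<1::real} = 0"
          by (subst (asm) AE_iff_measurable[of "{0<..<1}"]) auto
        thus False by simp
      qed
      show "\<exists>z. 0 < z \<and> z < 1 \<and> ?lim (y, z)"
      proof (rule ccontr)
        assume c: "\<not> ?thesis"
        have "AE z in lborel. \<not> (0 < z \<and> z < (1 :: real))"
          by (rule eventually_mono[OF l]) (use c in blast)
        thus False using n by blast
      qed
    qed
  qed
qed

section \<open>Levy's theorem and the passage from steps to radii\<close>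

lemma mpt_gauss_ext: "mpt gauss_ext_measure gauss_ext"
proof -
  interpret finite_measure gauss_ext_measure by (rule finite_gauss_ext_measure)
  show ?thesis
  proof
    show "gauss_ext \<in> gauss_ext_measure \<rightarrow>\<^sub>M gauss_ext_measure" by measurable
  qed (rule distr_gauss_ext)
qed

lemma integrable_enn2real:
  assumes [measurable]: "g \<in> borel_measurable M" and fin: "(\<integral>\<^sup>+x. g x \<partial>M) < \<infinity>"
  shows "integrable M (\<lambda>x. enn2real (g x))"
    and "(\<integral>x. enn2real (g x) \<partial>M) = enn2real (\<integral>\<^sup>+x. g x \<partial>M)"
proof -
  have "AE x in M. g x \<noteq> \<infinity>"
    by (rule nn_integral_PInf_AE) (use fin in auto)
  hence "AE x in M. ennreal (enn2real (g x)) = g x"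
    by eventually_elim (simp add: less_top)
  hence eq: "(\<integral>\<^sup>+x. ennreal (enn2real (g x)) \<partial>M) = (\<integral>\<^sup>+x. g x \<partial>M)"
    by (rule nn_integral_cong_AE)
  show "integrable M (\<lambda>x. enn2real (g x))"
    by (rule integrableI_nonneg) (use fin eq in auto)
  show "(\<integral>x. enn2real (g x) \<partial>M) = enn2real (\<integral>\<^sup>+x. g x \<partial>M)"
    by (subst integral_eq_nn_integral) (auto simp: eq)
qed

lemma integrable_neg_ln_gauss:
  "integrable gauss_ext_measure (\<lambda>p. - ln (fst p))"
  "(\<integral>p. - ln (fst p) \<partial>gauss_ext_measure) = pi\<^sup>2 / 12"
proof -
  have nn: "AE p in gauss_ext_measure. 0 \<le> - ln (fst p)"
    using AE_gauss_ext_measure_irr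
  proof eventually_elim
    case (elim p)
    thus ?case using unit_irrD[of "fst p"] by auto
  qed
  show "integrable gauss_ext_measure (\<lambda>p. - ln (fst p))"
    by (rule integrableI_nonneg[OF _ nn]) (auto simp: nn_integral_levy_gauss)
  show "(\<integral>p. - ln (fst p) \<partial>gauss_ext_measure) = pi\<^sup>2 / 12"
    by (subst integral_eq_nn_integral[OF _ nn]) (auto simp: nn_integral_levy_gauss)
qed

lemma (in gauss_lattice_heights) sum_neg_ln:
  "(\<Sum>i<N. - ln (fst ((gauss_ext2 ^^ i) (y, z))) - ln (gauss (fst ((gauss_ext2 ^^ i) (y, z)))))
     = - ln (U (2 * N))"
  unfolding gauss_ext2_funpow gauss_ext_funpow fst_conv
proof (induction N)
  case (Suc N)
  have "ln (U (2 * Suc N)) = ln (U (2 * N)) + ln (Y (2 * N)) + ln (Y (Suc (2 * N)))"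
    using U_pos[of "2 * N"] Y_bounds[of "2 * N"] Y_bounds[of "Suc (2 * N)"]
    by (simp add: offset_seq_Suc ln_mult)
  thus ?case using Suc.IH by (simp add: gauss_orbit_Suc)
qed simp

lemma gauss_lattice_heightsI:
  "y \<in> unit_irr \<Longrightarrow> 0 < z \<Longrightarrow> z < 1 \<Longrightarrow> gauss_lattice_heights y z"
  by (simp add: gauss_lattice_heights_def gauss_lattice_def gauss_lattice_heights_axioms_def)

definition gauss_mass :: real where
  "gauss_mass = measure gauss_ext_measure UNIV"

text \<open>The observable adds \<open>- ln\<close> over the two Gauss steps contained in one double
  step, so its integral is twice \<open>pi\<^sup>2 / 12\<close>, and its Birkhoff sums telescope to
  \<open>- ln\<close> of the offset. It is a function of the slope alone, so two pasts give equal
  sums.\<close>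

theorem levy:
  "AE y in lborel. 0 < y \<and> y < 1 \<longrightarrow>
     (\<lambda>N. - ln (offset_seq y (2 * N)) / real N) \<longlonglongrightarrow> (pi\<^sup>2 / 6) / gauss_mass"
proof -
  interpret mpt gauss_ext_measure gauss_ext by (rule mpt_gauss_ext)
  define f where "f p = - ln (fst p) - ln (gauss (fst p))" for p :: "real \<times> real"
  have f_alt: "f = (\<lambda>p. - ln (fst p) + (- ln (fst (gauss_ext p))))"
    by (auto simp: f_def gauss_ext_def split: prod.splits)
  note int = integrable_comp_S[OF integrable_neg_ln_gauss(1)] integral_comp_S[OF integrable_neg_ln_gauss(1)]
  have fi: "integrable gauss_ext_measure f"
    unfolding f_alt by (rule Bochner_Integration.integrable_add[OF integrable_neg_ln_gauss(1) int(1)])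
  have "(\<integral>p. f p \<partial>gauss_ext_measure) = pi\<^sup>2 / 12 + pi\<^sup>2 / 12"
    unfolding f_alt
    by (subst Bochner_Integration.integral_add[OF integrable_neg_ln_gauss(1) int(1)])
       (simp only: int(2) integrable_neg_ln_gauss(2))
  hence I: "(\<integral>p. f p \<partial>gauss_ext_measure) = pi\<^sup>2 / 6" by simp
  have sum_eq: "(\<Sum>i<N. f ((gauss_ext2 ^^ i) (y, z))) = - ln (offset_seq y (2 * N))"
    if "y \<in> unit_irr" "0 < z" "z < 1" for y z N
  proof -
    interpret gauss_lattice_heights y z by (rule gauss_lattice_heightsI[OF that])
    show ?thesis unfolding f_def by (rule sum_neg_ln)
  qed
  have "AE y in lborel. 0 < y \<and> y < 1 \<longrightarrow> (\<exists>z. 0 < z \<and> z < 1 \<and>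
     (\<lambda>N. (\<Sum>i<N. f ((gauss_ext2 ^^ i) (y, z))) / real N)
       \<longlonglongrightarrow> (\<integral>p. f p \<partial>gauss_ext_measure) / measure gauss_ext_measure UNIV)"
  proof (rule birkhoff_gauss[where G = "\<lambda>_. True"])
    show "f \<in> borel_measurable (borel \<Otimes>\<^sub>M borel)" unfolding f_def[abs_def] by measurable
    fix y z z' \<delta> :: real
    assume *: "y \<in> unit_irr" "0 < z" "z < 1" "0 < z'" "z' < 1" "0 < \<delta>"
    show "\<exists>C. \<forall>N. (\<Sum>i<N. f ((gauss_ext2 ^^ i) (y, z))) \<le> (\<Sum>i<N. f ((gauss_ext2 ^^ i) (y, z'))) + \<delta> * real N + C"
      unfolding sum_eq[OF *(1-3)] sum_eq[OF *(1,4,5)] using *(6) by (intro exI[of _ 0]) simp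
  qed (use fi in auto)
  with AE_unit_irr show ?thesis
  proof eventually_elim
    case (elim y)
    show ?case
    proof
      assume y: "0 < y \<and> y < 1"
      then obtain z where z: "0 < z" "z < 1"
        "(\<lambda>N. (\<Sum>i<N. f ((gauss_ext2 ^^ i) (y, z))) / real N)
           \<longlonglongrightarrow> (\<integral>p. f p \<partial>gauss_ext_measure) / measure gauss_ext_measure UNIV"
        using elim by blast
      have "y \<in> unit_irr" using elim y by blast
      from z(3) show "(\<lambda>N. - ln (offset_seq y (2 * N)) / real N) \<longlonglongrightarrow> (pi\<^sup>2 / 6) / gauss_mass"
        unfolding sum_eq[OF \<open>y \<in> unit_irr\<close> z(1,2)] I gauss_mass_def .
    qed
  qed
qed

text \<open>Monotonicity of \<open>j\<close> and of the logarithm encloses the quotient at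
  \<epsilon> between quotients formed from the neighbouring terms \<open>u N\<close> and
  \<open>u (N + 1)\<close>. The mismatch of indices disappears as \<open>(N + 1) / N\<close> tends
  to 1.\<close>

lemma ratio_limit:
  fixes j :: "real \<Rightarrow> real" and u :: "nat \<Rightarrow> real"
  assumes u: "\<And>N. 0 < u N" "\<And>M N. M \<le> N \<Longrightarrow> u N \<le> u M" "u \<longlonglongrightarrow> 0"
    and j: "\<And>\<epsilon> \<epsilon>'. 0 < \<epsilon> \<Longrightarrow> \<epsilon> \<le> \<epsilon>' \<Longrightarrow> j \<epsilon>' \<le> j \<epsilon>" "\<And>\<epsilon>. 0 \<le> j \<epsilon>"
    and a: "(\<lambda>N. j (u N) / real N) \<longlonglongrightarrow> a"
    and l: "(\<lambda>N. - ln (u N) / real N) \<longlonglongrightarrow> l" "l > 0"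
  shows "((\<lambda>\<epsilon>. j \<epsilon> / - ln \<epsilon>) \<longlongrightarrow> a / l) (at_right 0)"
proof -
  define r1 where "r1 N = j (u N) / - ln (u (Suc N))" for N
  define r2 where "r2 N = j (u (Suc N)) / - ln (u N)" for N
  have q: "(\<lambda>N. real (Suc N) / real N) \<longlonglongrightarrow> 1" by (rule LIMSEQ_Suc_n_over_n)
  have "(\<lambda>N. (j (u N) / real N) / (- ln (u (Suc N)) / real (Suc N)) / (real (Suc N) / real N)) \<longlonglongrightarrow> a / l / 1"
    by (intro tendsto_divide a LIMSEQ_Suc[OF l(1)] q) (use l in auto)
  moreover have "\<forall>\<^sub>F N in sequentially. (j (u N) / real N) / (- ln (u (Suc N)) / real (Suc N)) / (real (Suc N) / real N) = r1 N"
    using eventually_gt_at_top[of 0] by eventually_elim (simp add: r1_def del: of_nat_Suc)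
  ultimately have r1: "r1 \<longlonglongrightarrow> a / l" by (simp add: tendsto_cong)
  have "(\<lambda>N. (j (u (Suc N)) / real (Suc N)) / (- ln (u N) / real N) * (real (Suc N) / real N)) \<longlonglongrightarrow> a / l * 1"
    by (intro tendsto_divide tendsto_mult LIMSEQ_Suc[OF a] l(1) q) (use l in auto)
  moreover have "\<forall>\<^sub>F N in sequentially. (j (u (Suc N)) / real (Suc N)) / (- ln (u N) / real N) * (real (Suc N) / real N) = r2 N"
    using eventually_gt_at_top[of 0] by eventually_elim (simp add: r2_def del: of_nat_Suc)
  ultimately have r2: "r2 \<longlonglongrightarrow> a / l" by (simp add: tendsto_cong)
  show ?thesis
  proof (rule tendstoI)
    fix e :: real assume e: "e > 0"
    have "\<forall>\<^sub>F N in sequentially. dist (r1 N) (a / l) < e \<and> dist (r2 N) (a / l) < e \<and> u N < 1"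
      using tendstoD[OF r1 e] tendstoD[OF r2 e] order_tendstoD(2)[OF u(3) zero_less_one] by eventually_elim auto
    then obtain N0 where N0: "\<And>N. N \<ge> N0 \<Longrightarrow> dist (r1 N) (a / l) < e \<and> dist (r2 N) (a / l) < e \<and> u N < 1"
      by (auto simp: eventually_sequentially)
    have "\<forall>\<^sub>F \<epsilon> in at_right 0. \<epsilon> < u N0" using u(1)[of N0] by (auto simp: eventually_at_right_field)
    moreover have "\<forall>\<^sub>F \<epsilon> in at_right (0::real). 0 < \<epsilon>" by (simp add: eventually_at_right_less)
    ultimately show "\<forall>\<^sub>F \<epsilon> in at_right 0. dist (j \<epsilon> / - ln \<epsilon>) (a / l) < e"
    proof eventually_elim
      case (elim \<epsilon>)
      have ex: "\<exists>M. u M < \<epsilon>" using order_tendstoD(2)[OF u(3) elim(2)] by (auto simp: eventually_sequentially)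
      define M where "M = (LEAST M. u M < \<epsilon>)"
      have M: "u M < \<epsilon>" unfolding M_def using ex by (rule LeastI_ex)
      have "N0 < M"
      proof (rule ccontr)
        assume "\<not> ?thesis"
        hence "u N0 \<le> u M" by (intro u(2)) simp
        thus False using M elim by simp
      qed
      then obtain N where N: "M = Suc N" "N0 \<le> N" by (cases M) auto
      have "\<not> u N < \<epsilon>" using not_less_Least[of N "\<lambda>M. u M < \<epsilon>"] N unfolding M_def by simp
      hence N': "\<epsilon> \<le> u N" "u (Suc N) < \<epsilon>" using M N by auto
      have jb: "j (u N) \<le> j \<epsilon>" "j \<epsilon> \<le> j (u (Suc N))" using j(1) N' elim u(1)[of "Suc N"] by auto
      have lb: "0 < - ln (u N)" using N0[OF N(2)] u(1)[of N] by simp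
      have lb2: "- ln (u N) \<le> - ln \<epsilon>" "- ln \<epsilon> \<le> - ln (u (Suc N))"
        using N' elim u(1)[of "Suc N"] by auto
      have "r1 N \<le> j \<epsilon> / - ln \<epsilon>" unfolding r1_def using jb lb lb2 j(2) by (intro frac_le) auto
      moreover have "j \<epsilon> / - ln \<epsilon> \<le> r2 N" unfolding r2_def using jb lb lb2 j(2) by (intro frac_le) auto
      moreover have "dist (r1 N) (a / l) < e" "dist (r2 N) (a / l) < e" using N0[OF N(2)] by auto
      ultimately show ?case by (auto simp: dist_real_def abs_less_iff)
    qed
  qed
qed

context test_orbit
begin

lemma J_finite: "0 < \<epsilon> \<Longrightarrow> J \<epsilon> < \<infinity>"
proof -
  assume e: "0 < \<epsilon>"
  have "J \<epsilon> \<le> J (min \<epsilon> hi)" by (rule J_antimono) simp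
  also have "\<dots> \<le> ennreal (B * ln (hi / min \<epsilon> hi))" using e lo_hi by (intro J_bound) auto
  also have "\<dots> < \<infinity>" by simp
  finally show ?thesis .
qed

definition j :: "real \<Rightarrow> real" where "j \<epsilon> = enn2real (J \<epsilon>)"
definition A :: "nat \<Rightarrow> real" where "A M = enn2real (\<integral>\<^sup>+r. FM M r * ennreal (1 / r) \<partial>lborel)"

lemma gap_nonneg: "0 \<le> gap"
  using B_nonneg lo_hi unfolding gap_def by (intro mult_nonneg_nonneg ln_ge_zero) auto

lemma FM_finite: "(\<integral>\<^sup>+r. FM M r * ennreal (1 / r) \<partial>lborel) < \<infinity>"
  using FM_le_J[of M] J_finite[OF U_pos[of M]] by (metis ennreal_add_less_top ennreal_less_top infinity_ennreal_def le_less_trans)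

lemma A_j: "A M \<le> j (U M) + gap" "j (U M) \<le> A M + gap"
proof -
  have e: "J (U M) = ennreal (j (U M))" "(\<integral>\<^sup>+r. FM M r * ennreal (1 / r) \<partial>lborel) = ennreal (A M)"
    using J_finite[OF U_pos[of M]] FM_finite[of M] by (auto simp: j_def A_def)
  have n: "0 \<le> j (U M)" "0 \<le> A M" by (auto simp: j_def A_def)
  show "A M \<le> j (U M) + gap" using FM_le_J[of M] unfolding e
    using n gap_nonneg by (simp add: ennreal_plus[symmetric] del: ennreal_plus)
  show "j (U M) \<le> A M + gap" using J_le_FM[of M] unfolding e
    using n gap_nonneg by (simp add: ennreal_plus[symmetric] del: ennreal_plus)
qed

lemma j_antimono: "0 < \<epsilon> \<Longrightarrow> \<epsilon> \<le> \<epsilon>' \<Longrightarrow> j \<epsilon>' \<le> j \<epsilon>"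
  unfolding j_def using J_antimono J_finite by (intro enn2real_mono) auto

text \<open>Levels \<open>2 i\<close> and \<open>2 i + 1\<close> make up one double step; the odd
  one sees \<open>h'\<close> and \<Phi> reflected.\<close>

lemma sum_mediant_A:
  "(\<Sum>i<N. enn2real (mediant_integral \<Phi> h' ((gauss_ext2 ^^ i) (y, z))) +
       enn2real (mediant_integral (flip \<Phi>) (- h') (gauss_ext ((gauss_ext2 ^^ i) (y, z))))) = A (2 * N)"
proof -
  let ?m = "\<lambda>n. mediant_integral (flip_side \<Phi> n) (side h' n) ((gauss_ext ^^ n) (y, z))"
  have s: "(\<Sum>n<2 * N. ?m n) = (\<integral>\<^sup>+r. FM (2 * N) r * ennreal (1 / r) \<partial>lborel)"
    by (rule sum_mediant_integral_orbit) measurable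
  have fin: "?m n < \<infinity>" if "n < 2 * N" for n
  proof -
    have "?m n \<le> (\<Sum>n<2 * N. ?m n)" by (rule member_le_sum) (use that in auto)
    thus ?thesis using s FM_finite[of "2 * N"] by simp
  qed
  have "(\<Sum>n<2 * N. ?m n) = (\<Sum>n<2 * N. ennreal (enn2real (?m n)))"
    by (intro sum.cong refl) (use fin in simp)
  also have "\<dots> = ennreal (\<Sum>n<2 * N. enn2real (?m n))" by (rule sum_ennreal) simp
  finally have "A (2 * N) = (\<Sum>n<2 * N. enn2real (?m n))"
    unfolding A_def s[symmetric] by (simp add: sum_nonneg)
  also have "\<dots> = (\<Sum>i<N. enn2real (?m (2 * i)) + enn2real (?m (Suc (2 * i))))"
    by (induction N) auto
  also have "\<dots> = (\<Sum>i<N. enn2real (mediant_integral \<Phi> h' ((gauss_ext2 ^^ i) (y, z))) +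
       enn2real (mediant_integral (flip \<Phi>) (- h') (gauss_ext ((gauss_ext2 ^^ i) (y, z)))))"
    by (intro sum.cong refl) (simp add: gauss_ext2_funpow flip_side_def side_def)
  finally show ?thesis by simp
qed

end

lemma (in test_function) log_flight_compare_real:
  assumes \<delta>: "\<delta> > 0"
  obtains C where "\<And>y z z' h' \<epsilon>. gauss_lattice_heights y z \<Longrightarrow> gauss_lattice_heights y z' \<Longrightarrow> \<bar>h'\<bar> \<le> 1 \<Longrightarrow>
     0 < \<epsilon> \<Longrightarrow> \<epsilon> \<le> 1 \<Longrightarrow>
     enn2real (log_flight \<Phi> h' y z \<epsilon>) \<le> enn2real (log_flight \<Phi> h' y z' \<epsilon>) + \<delta> * (- ln \<epsilon>) + C"
proof -
  obtain C where C: "\<And>y z z' h' \<epsilon>. gauss_lattice_heights y z \<Longrightarrow> gauss_lattice_heights y z' \<Longrightarrow> \<bar>h'\<bar> \<le> 1 \<Longrightarrow>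
     0 < \<epsilon> \<Longrightarrow> \<epsilon> \<le> 1 \<Longrightarrow>
     log_flight \<Phi> h' y z \<epsilon> \<le> log_flight \<Phi> h' y z' \<epsilon> + ennreal (\<delta> * ln (hi / \<epsilon>)) + ennreal C"
    using log_flight_compare[OF \<delta>] by blast
  show ?thesis
  proof (rule that[of "\<delta> * ln hi + max C 0"])
    fix y z z' h' \<epsilon> :: real
    assume gl: "gauss_lattice_heights y z" "gauss_lattice_heights y z'" and h': "\<bar>h'\<bar> \<le> 1" and \<epsilon>: "0 < \<epsilon>" "\<epsilon> \<le> 1"
    interpret a: test_orbit \<Phi> s0 S0 B y z h'
      using gl h' test_function_axioms unfolding test_orbit_def test_orbit_axioms_def by blast
    interpret b: test_orbit \<Phi> s0 S0 B y z' h'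
      using gl h' test_function_axioms unfolding test_orbit_def test_orbit_axioms_def by blast
    have ln: "ln (hi / \<epsilon>) = ln hi - ln \<epsilon>" "0 \<le> ln (hi / \<epsilon>)" using \<epsilon> lo_hi by (auto simp: ln_div)
    have "a.J \<epsilon> \<le> b.J \<epsilon> + ennreal (\<delta> * ln (hi / \<epsilon>)) + ennreal (max C 0)"
    proof -
      have "ennreal C = ennreal (max C 0)" by (auto simp: max_def ennreal_neg)
      thus ?thesis using C[OF gl h' \<epsilon>] by metis
    qed
    also have "b.J \<epsilon> = ennreal (b.j \<epsilon>)" using b.J_finite[OF \<epsilon>(1)] by (simp add: b.j_def)
    also have "ennreal (b.j \<epsilon>) + ennreal (\<delta> * ln (hi / \<epsilon>)) + ennreal (max C 0) = ennreal (b.j \<epsilon> + \<delta> * ln (hi / \<epsilon>) + max C 0)"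
      using \<delta> ln by (subst ennreal_plus[symmetric] | simp add: b.j_def)+
    finally have "a.j \<epsilon> \<le> b.j \<epsilon> + \<delta> * ln (hi / \<epsilon>) + max C 0"
      unfolding a.j_def by (intro enn2real_leI) (use \<delta> ln in \<open>auto simp: b.j_def\<close>)
    thus "enn2real (a.J \<epsilon>) \<le> enn2real (b.J \<epsilon>) + \<delta> * (- ln \<epsilon>) + (\<delta> * ln hi + max C 0)"
      unfolding a.j_def b.j_def ln(1) by (simp add: algebra_simps)
  qed
qed

section \<open>The mean flight and the limit along almost every slope\<close>

definition mean_flight :: "(real \<times> real \<Rightarrow> real) \<Rightarrow> real \<Rightarrow> ennreal" where
  "mean_flight \<Phi> h' = (\<integral>\<^sup>+S. \<integral>\<^sup>+h. ennreal (\<Phi> (S, h)) * ennreal (void S h h') * indicator {h'<..1} h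
         * indicator {0<..} S \<partial>lborel \<partial>lborel)"

lemma void_le_1: "void S h h' \<le> 1"
  by (simp add: void_def)

lemma mediant_integral_measurable[measurable (raw)]:
  assumes [measurable]: "\<Phi> \<in> borel_measurable (borel \<Otimes>\<^sub>M borel)"
  shows "mediant_integral \<Phi> h' \<in> borel_measurable (borel \<Otimes>\<^sub>M borel)"
  unfolding mediant_integral_def by measurable

context test_function
begin

lemma mean_flight_finite:
  assumes "\<bar>h'\<bar> \<le> 1"
  shows "mean_flight \<Phi> h' < \<infinity>"
proof -
  have "mean_flight \<Phi> h' \<le> (\<integral>\<^sup>+S. (\<integral>\<^sup>+h. ennreal B * indicator {-1..1::real} h \<partial>lborel) * indicator {0..hi} S \<partial>lborel)"
    unfolding mean_flight_def
  proof (rule nn_integral_mono)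
    fix S :: real
    have "(\<integral>\<^sup>+h. ennreal (\<Phi> (S, h)) * ennreal (void S h h') * indicator {h'<..1} h * indicator {0<..} S \<partial>lborel)
       \<le> (\<integral>\<^sup>+h. (ennreal B * indicator {-1..1::real} h) * indicator {0..hi} S \<partial>lborel)"
    proof (rule nn_integral_mono)
      fix h :: real
      show "ennreal (\<Phi> (S, h)) * ennreal (void S h h') * indicator {h'<..1} h * indicator {0<..} S
        \<le> (ennreal B * indicator {-1..1::real} h) * indicator {0..hi} S"
      proof (cases "\<Phi> (S, h) = 0 \<or> h \<notin> {h'<..1} \<or> S \<le> 0")
        case False
        hence i: "indicator {-1..1::real} h = (1 :: ennreal)" "indicator {0..hi} S = (1 :: ennreal)"
          using supp[of S h] lo_hi assms by auto
        have "ennreal (\<Phi> (S, h)) * ennreal (void S h h') \<le> ennreal B * ennreal 1"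
          by (intro mult_mono ennreal_leI bound void_le_1) auto
        thus ?thesis unfolding i using False by simp
      qed auto
    qed
    also have "\<dots> = (\<integral>\<^sup>+h. ennreal B * indicator {-1..1::real} h \<partial>lborel) * indicator {0..hi} S"
      by (rule nn_integral_multc) measurable
    finally show "(\<integral>\<^sup>+h. ennreal (\<Phi> (S, h)) * ennreal (void S h h') * indicator {h'<..1} h * indicator {0<..} S \<partial>lborel)
       \<le> (\<integral>\<^sup>+h. ennreal B * indicator {-1..1::real} h \<partial>lborel) * indicator {0..hi} S" .
  qed
  also have "\<dots> = ennreal B * 2 * ennreal hi"
    using lo_hi by (simp add: nn_integral_cmult)
  also have "\<dots> < \<infinity>" by (simp add: ennreal_mult_less_top)
  finally show ?thesis .
qed

lemma integrable_mediant:
  assumes "\<bar>h'\<bar> \<le> 1"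
  shows "integrable gauss_ext_measure (\<lambda>p. enn2real (mediant_integral \<Phi> h' p))"
    "(\<integral>p. enn2real (mediant_integral \<Phi> h' p) \<partial>gauss_ext_measure) = enn2real (mean_flight \<Phi> h') / 2"
proof -
  have e: "(\<integral>\<^sup>+p. mediant_integral \<Phi> h' p \<partial>gauss_ext_measure) = ennreal (1 / 2) * mean_flight \<Phi> h'"
    unfolding mean_flight_def by (rule nn_integral_mediant_integral) (use assms in auto)
  have m: "mediant_integral \<Phi> h' \<in> borel_measurable gauss_ext_measure" by measurable
  have fin: "(\<integral>\<^sup>+p. mediant_integral \<Phi> h' p \<partial>gauss_ext_measure) < \<infinity>"
  proof -
    have "ennreal (1 / 2) < top" by (rule ennreal_less_top)
    thus ?thesis unfolding e using mean_flight_finite[OF assms]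
      by (simp only: ennreal_mult_less_top infinity_ennreal_def) blast
  qed
  show "integrable gauss_ext_measure (\<lambda>p. enn2real (mediant_integral \<Phi> h' p))"
    by (rule integrable_enn2real[OF m fin])
  show "(\<integral>p. enn2real (mediant_integral \<Phi> h' p) \<partial>gauss_ext_measure) = enn2real (mean_flight \<Phi> h') / 2"
  proof -
    have "enn2real (ennreal (1 / 2)) = 1 / 2" by (rule enn2real_ennreal) simp
    thus ?thesis unfolding integrable_enn2real(2)[OF m fin] e enn2real_mult by simp
  qed
qed

text \<open>Even levels produce collisions with \<open>h > h'\<close>; odd levels, after reflection,
  those with \<open>h < h'\<close>. The halves stem from \<open>S = 2 s\<close> in the spatial
  average.\<close>

definition mean_value :: "real \<Rightarrow> real" where
  "mean_value h' = enn2real (mean_flight \<Phi> h') / 2 + enn2real (mean_flight (flip \<Phi>) (- h')) / 2"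

lemma gauss_mass_pos: "0 < gauss_mass"
  unfolding gauss_mass_def by (rule measure_gauss_ext_measure_pos)

text \<open>Per double step the flight integral gains \<open>mean_value h'\<close> and
  \<open>- ln\<close> of the radius gains \<open>pi\<^sup>2 / 6\<close>, both divided by the mass;
  \<open>ratio_limit\<close> forms the quotient. Comparison of pasts then extends the limit from one
  \<open>z\<close> to all.\<close>

theorem log_flight_limit:
  assumes h': "\<bar>h'\<bar> \<le> 1"
  shows "AE y in lborel. 0 < y \<and> y < 1 \<longrightarrow> (\<forall>z. 0 < z \<and> z < 1 \<longrightarrow>
    ((\<lambda>\<epsilon>. enn2real (log_flight \<Phi> h' y z \<epsilon>) / - ln \<epsilon>) \<longlongrightarrow> mean_value h' / (pi\<^sup>2 / 6)) (at_right 0))"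
proof -
  interpret E: mpt gauss_ext_measure gauss_ext by (rule mpt_gauss_ext)
  interpret fl: test_function "flip \<Phi>" s0 S0 B by (rule test_function_flip) unfold_locales
  define f where "f p = enn2real (mediant_integral \<Phi> h' p) + enn2real (mediant_integral (flip \<Phi>) (- h') (gauss_ext p))" for p
  have h'': "\<bar>- h'\<bar> \<le> 1" using h' by simp
  note i1 = integrable_mediant[OF h'] and i2 = fl.integrable_mediant[OF h'']
  have [measurable]: "mediant_integral (flip \<Phi>) (- h') \<in> borel_measurable (borel \<Otimes>\<^sub>M borel)"
    by (rule mediant_integral_measurable[OF fl.\<Phi>])
  have fm: "f \<in> borel_measurable (borel \<Otimes>\<^sub>M borel)" unfolding f_def[abs_def] by measurable
  have fi: "integrable gauss_ext_measure f"
    unfolding f_def by (intro Bochner_Integration.integrable_add i1 E.integrable_comp_S[OF i2(1)])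
  have fI: "(\<integral>p. f p \<partial>gauss_ext_measure) = mean_value h'"
    unfolding f_def mean_value_def
    by (subst Bochner_Integration.integral_add[OF i1(1) E.integrable_comp_S[OF i2(1)]])
       (simp only: i1(2) E.integral_comp_S[OF i2(1)] i2(2))
  have sum_eq: "(\<Sum>i<N. f ((gauss_ext2 ^^ i) (y, z))) = test_orbit.A \<Phi> y z h' (2 * N)"
    if "y \<in> unit_irr" "0 < z" "z < 1" for y z N
  proof -
    interpret test_orbit \<Phi> s0 S0 B y z h'
      using gauss_lattice_heightsI[OF that] h' test_function_axioms unfolding test_orbit_def test_orbit_axioms_def by blast
    show ?thesis unfolding f_def by (rule sum_mediant_A)
  qed
  \<comment> \<open>Comparing pasts at radius \<open>U (2 * N)\<close> costs
    \<open>\<delta> * (- ln (U (2 * N)))\<close>, which is linear in \<open>N\<close> only where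
    offsets do not decay too fast; by Levy's theorem this is so almost everywhere. A natural number
    as bound keeps \<open>G\<close> measurable, and \<open>Suc N\<close> leaves room for the index
    shift in its invariance.\<close>
  define G where "G y \<longleftrightarrow> (\<exists>C::nat. \<forall>N. - ln (offset_seq y (2 * N)) \<le> real C * real (Suc N))" for y
  have off[measurable]: "(\<lambda>y. offset_seq y n) \<in> borel_measurable borel" for n
  proof -
    have [measurable]: "(\<lambda>y. gauss_orbit y i) \<in> borel_measurable borel" for i
      by (induction i) (auto simp: gauss_orbit_Suc)
    show ?thesis unfolding offset_seq_def by measurable
  qed
  have G1: "Measurable.pred borel G" unfolding G_def[abs_def] by measurable
  have G2: "AE y in lborel. 0 < y \<and> y < 1 \<longrightarrow> G y"
    using levy
  proof eventually_elim
    case (elim y)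
    show ?case
    proof
      assume "0 < y \<and> y < 1"
      hence "Bseq (\<lambda>N. - ln (offset_seq y (2 * N)) / real N)" using elim convergent_imp_Bseq convergentI by blast
      then obtain K where K: "K > 0" "\<And>N. norm (- ln (offset_seq y (2 * N)) / real N) \<le> K" unfolding Bseq_def by blast
      obtain C :: nat where C: "K \<le> real C" using real_arch_simple by blast
      have "- ln (offset_seq y (2 * N)) \<le> real C * real (Suc N)" for N
      proof (cases "N = 0")
        case False
        have "- ln (offset_seq y (2 * N)) / real N \<le> real C"
          using order_trans[OF abs_ge_self K(2)[of N, unfolded real_norm_def]] C by linarith
        hence "- ln (offset_seq y (2 * N)) \<le> real C * real N" using False
          by (subst (asm) pos_divide_le_eq) auto
        thus ?thesis by (simp add: algebra_simps)
      qed simp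
      thus "G y" unfolding G_def by blast
    qed
  qed
  have G3: "G y \<longleftrightarrow> G (gauss (gauss y))" if y: "y \<in> unit_irr" for y
  proof -
    interpret gauss_lattice y by unfold_locales (rule y)
    define T where "T = gauss (gauss y)"
    interpret T: gauss_lattice T by unfold_locales (simp add: T_def gauss_unit_irr y)
    have sh: "gauss_orbit T i = Y (Suc (Suc i))" for i
      by (induction i) (simp_all add: T_def gauss_orbit_Suc)
    have off2: "U (Suc (Suc n)) = U (Suc (Suc 0)) * offset_seq T n" for n
      by (induction n) (simp_all add: offset_seq_Suc sh)
    have ln: "- ln (U (2 * Suc N)) = - ln (U 2) - ln (offset_seq T (2 * N))" for N
    proof -
      have "U (2 * Suc N) = U 2 * offset_seq T (2 * N)"
        using off2[of "2 * N"] by (metis One_nat_def Suc_1 mult_Suc_right add_2_eq_Suc)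
      thus ?thesis using U_pos[of 2] T.U_pos[of "2 * N"] by (simp only: ln_mult_pos)
    qed
    have neg: "ln (U n) \<le> 0" "ln (offset_seq T n) \<le> 0" for n
      using U_antimono[of 0 n] T.U_antimono[of 0 n] U_pos[of n] T.U_pos[of n] by simp_all
    have "G T" if Gy: "G y"
    proof -
      obtain C :: nat where C: "\<And>N. - ln (U (2 * N)) \<le> real C * real (Suc N)" using Gy unfolding G_def by blast
      have "- ln (offset_seq T (2 * N)) \<le> real (2 * C) * real (Suc N)" for N
      proof -
        have "real C * real (Suc (Suc N)) \<le> real C * (2 * real (Suc N))" by (intro mult_left_mono) auto
        also have "\<dots> = real (2 * C) * real (Suc N)" by simp
        finally show ?thesis using C[of "Suc N"] ln[of N] neg(1)[of 2] by linarith
      qed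
      thus ?thesis unfolding G_def by blast
    qed
    moreover have "G y" if GT: "G T"
    proof -
      obtain C :: nat where C: "\<And>N. - ln (offset_seq T (2 * N)) \<le> real C * real (Suc N)" using GT unfolding G_def by blast
      obtain C' :: nat where C': "- ln (U 2) \<le> real C'" using real_arch_simple by blast
      have "- ln (U (2 * N)) \<le> real (C + C') * real (Suc N)" for N
      proof (cases N)
        case (Suc M)
        have "real C' \<le> real C' * real (Suc (Suc M))" by (simp add: mult_le_cancel_left1)
        moreover have "real C * real (Suc M) \<le> real C * real (Suc (Suc M))" by (intro mult_left_mono) auto
        ultimately show ?thesis using C[of M] ln[of M] C' unfolding Suc by (simp only: of_nat_add distrib_right)
      qed simp
      thus ?thesis unfolding G_def by blast
    qed
    ultimately show ?thesis unfolding T_def by blast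
  qed
  have "AE y in lborel. 0 < y \<and> y < 1 \<longrightarrow> (\<exists>z. 0 < z \<and> z < 1 \<and>
     (\<lambda>N. (\<Sum>i<N. f ((gauss_ext2 ^^ i) (y, z))) / real N)
       \<longlonglongrightarrow> (\<integral>p. f p \<partial>gauss_ext_measure) / measure gauss_ext_measure UNIV)"
  proof (rule birkhoff_gauss[OF fm fi G1 G2 G3])
    fix y z z' \<delta> :: real
    assume *: "y \<in> unit_irr" "G y" "0 < z" "z < 1" "0 < z'" "z' < 1" "0 < \<delta>"
    interpret a: test_orbit \<Phi> s0 S0 B y z h'
      using gauss_lattice_heightsI[OF *(1,3,4)] h' test_function_axioms unfolding test_orbit_def test_orbit_axioms_def by blast
    interpret b: test_orbit \<Phi> s0 S0 B y z' h'
      using gauss_lattice_heightsI[OF *(1,5,6)] h' test_function_axioms unfolding test_orbit_def test_orbit_axioms_def by blast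
    obtain K :: nat where K: "\<And>N. - ln (offset_seq y (2 * N)) \<le> real K * real (Suc N)" using *(2) unfolding G_def by blast
    \<comment> \<open>Chosen so that \<open>\<delta>' * ((K + 1) * (N + 1))\<close> is exactly
      \<open>\<delta> * N + \<delta>\<close>.\<close>
    define \<delta>' where "\<delta>' = \<delta> / real (Suc K)"
    have \<delta>': "\<delta>' > 0" using *(7) by (simp add: \<delta>'_def)
    obtain C where C: "\<And>y z z' h' \<epsilon>. gauss_lattice_heights y z \<Longrightarrow> gauss_lattice_heights y z' \<Longrightarrow> \<bar>h'\<bar> \<le> 1 \<Longrightarrow>
     0 < \<epsilon> \<Longrightarrow> \<epsilon> \<le> 1 \<Longrightarrow>
     enn2real (log_flight \<Phi> h' y z \<epsilon>) \<le> enn2real (log_flight \<Phi> h' y z' \<epsilon>) + \<delta>' * (- ln \<epsilon>) + C"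
      using log_flight_compare_real[OF \<delta>'] by blast
    have "a.A (2 * N) \<le> b.A (2 * N) + \<delta> * real N + (\<delta> + C + 2 * gap)" for N
    proof -
      have "a.A (2 * N) \<le> a.j (a.U (2 * N)) + gap" by (rule a.A_j)
      also have "a.j (a.U (2 * N)) \<le> b.j (a.U (2 * N)) + \<delta>' * (- ln (a.U (2 * N))) + C"
        unfolding a.j_def b.j_def
        by (rule C) (use a.gauss_lattice_heights_axioms b.gauss_lattice_heights_axioms h' a.U_pos a.U_antimono[of 0] in auto)
      also have "b.j (a.U (2 * N)) \<le> b.A (2 * N) + gap" by (rule b.A_j)
      also have "\<delta>' * (- ln (a.U (2 * N))) \<le> \<delta>' * (real (Suc K) * real (Suc N))"
      proof (rule mult_left_mono)
        have "real K * real (Suc N) \<le> real (Suc K) * real (Suc N)" by (intro mult_right_mono) auto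
        thus "- ln (a.U (2 * N)) \<le> real (Suc K) * real (Suc N)" using K[of N] by linarith
      qed (use \<delta>' in simp)
      also have "\<delta>' * (real (Suc K) * real (Suc N)) = \<delta> * real N + \<delta>"
        unfolding \<delta>'_def by (simp add: algebra_simps del: of_nat_Suc) (simp add: algebra_simps)
      finally show ?thesis by simp
    qed
    thus "\<exists>C. \<forall>N. (\<Sum>i<N. f ((gauss_ext2 ^^ i) (y, z))) \<le> (\<Sum>i<N. f ((gauss_ext2 ^^ i) (y, z'))) + \<delta> * real N + C"
      unfolding sum_eq[OF *(1,3,4)] sum_eq[OF *(1,5,6)] by blast
  qed
  with levy AE_unit_irr show ?thesis
  proof eventually_elim
    case (elim y)
    show ?case
    proof (intro impI allI)
      fix z :: real assume y: "0 < y \<and> y < 1" and z: "0 < z \<and> z < 1"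
      then obtain z0 where z0: "0 < z0" "z0 < 1"
        "(\<lambda>N. (\<Sum>i<N. f ((gauss_ext2 ^^ i) (y, z0))) / real N) \<longlonglongrightarrow> mean_value h' / gauss_mass"
        using elim unfolding fI gauss_mass_def by blast
      have yi: "y \<in> unit_irr" and lv: "(\<lambda>N. - ln (offset_seq y (2 * N)) / real N) \<longlonglongrightarrow> (pi\<^sup>2 / 6) / gauss_mass"
        using elim y by auto
      interpret b: test_orbit \<Phi> s0 S0 B y z0 h'
        using gauss_lattice_heightsI[OF yi z0(1,2)] h' test_function_axioms unfolding test_orbit_def test_orbit_axioms_def by blast
      interpret a: test_orbit \<Phi> s0 S0 B y z h'
        using gauss_lattice_heightsI[OF yi] z h' test_function_axioms unfolding test_orbit_def test_orbit_axioms_def by blast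
      have bA: "(\<lambda>N. b.A (2 * N) / real N) \<longlonglongrightarrow> mean_value h' / gauss_mass"
        using z0(3) unfolding sum_eq[OF yi z0(1,2)] .
      \<comment> \<open>Here \<open>A\<close> counts steps and \<open>j\<close> radii; they differ
        by at most \<open>gap\<close>, which disappears after division by \<open>N\<close>.\<close>
      have "(\<lambda>N. (b.j (b.U (2 * N)) - b.A (2 * N)) / real N) \<longlonglongrightarrow> 0"
      proof (rule Lim_null_comparison)
        show "\<forall>\<^sub>F N in sequentially. norm ((b.j (b.U (2 * N)) - b.A (2 * N)) / real N) \<le> gap / real N"
          by (rule always_eventually) (use b.A_j in \<open>auto intro!: divide_right_mono simp: abs_le_iff algebra_simps\<close>)
        show "(\<lambda>N. gap / real N) \<longlonglongrightarrow> 0" by (rule lim_const_over_n)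
      qed
      from tendsto_add[OF this bA]
      have bj: "(\<lambda>N. b.j (b.U (2 * N)) / real N) \<longlonglongrightarrow> mean_value h' / gauss_mass"
        by (simp add: diff_divide_distrib)
      have "((\<lambda>\<epsilon>. b.j \<epsilon> / - ln \<epsilon>) \<longlongrightarrow> (mean_value h' / gauss_mass) / ((pi\<^sup>2 / 6) / gauss_mass)) (at_right 0)"
      proof (rule ratio_limit[where u = "\<lambda>N. b.U (2 * N)"])
        show "(\<lambda>N. b.U (2 * N)) \<longlonglongrightarrow> 0"
          using LIMSEQ_subseq_LIMSEQ[OF b.U_tendsto_0, of "\<lambda>N. 2 * N"] by (simp add: strict_mono_def o_def)
        show "0 < (pi\<^sup>2 / 6) / gauss_mass" using gauss_mass_pos by simp
      qed (use b.U_pos b.U_antimono b.j_antimono bj lv in \<open>auto simp: b.j_def\<close>)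
      also have "(mean_value h' / gauss_mass) / ((pi\<^sup>2 / 6) / gauss_mass) = mean_value h' / (pi\<^sup>2 / 6)"
        using gauss_mass_pos by simp
      finally have blim: "((\<lambda>\<epsilon>. b.j \<epsilon> / - ln \<epsilon>) \<longlongrightarrow> mean_value h' / (pi\<^sup>2 / 6)) (at_right 0)" .
      have "((\<lambda>\<epsilon>. a.j \<epsilon> / - ln \<epsilon> - b.j \<epsilon> / - ln \<epsilon>) \<longlongrightarrow> 0) (at_right 0)"
      proof (rule tendstoI)
        fix e :: real assume e: "e > 0"
        obtain C where C: "\<And>y z z' h' \<epsilon>. gauss_lattice_heights y z \<Longrightarrow> gauss_lattice_heights y z' \<Longrightarrow> \<bar>h'\<bar> \<le> 1 \<Longrightarrow>
         0 < \<epsilon> \<Longrightarrow> \<epsilon> \<le> 1 \<Longrightarrow>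
         enn2real (log_flight \<Phi> h' y z \<epsilon>) \<le> enn2real (log_flight \<Phi> h' y z' \<epsilon>) + e / 2 * (- ln \<epsilon>) + C"
          using log_flight_compare_real[of "e / 2"] e by (metis half_gt_zero)
        \<comment> \<open>At such \<epsilon> the constant is below
          \<open>e / 2 * (- ln \<epsilon>)\<close> in modulus; the extra -1 in the exponent makes
          \<open>- ln \<epsilon>\<close> positive also for \<open>C = 0\<close>.\<close>
        have "\<forall>\<^sub>F \<epsilon> in at_right (0::real). \<epsilon> < exp (- 2 * \<bar>C\<bar> / e - 1)"
          by (auto simp: eventually_at_right_field intro!: exI[of _ "exp (- 2 * \<bar>C\<bar> / e - 1)"])
        moreover have "\<forall>\<^sub>F \<epsilon> in at_right (0::real). 0 < \<epsilon>" by (simp add: eventually_at_right_less)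
        ultimately show "\<forall>\<^sub>F \<epsilon> in at_right 0. dist (a.j \<epsilon> / - ln \<epsilon> - b.j \<epsilon> / - ln \<epsilon>) 0 < e"
        proof eventually_elim
          case (elim \<epsilon>)
          have "ln \<epsilon> < - 2 * \<bar>C\<bar> / e - 1" using elim by (metis exp_gt_zero ln_exp ln_less_cancel_iff)
          moreover have "0 \<le> 2 * \<bar>C\<bar> / e" "- 2 * \<bar>C\<bar> / e = - (2 * \<bar>C\<bar> / e)" using e by simp_all
          ultimately have l: "2 * \<bar>C\<bar> / e < - ln \<epsilon>" "0 < - ln \<epsilon>" by linarith+
          have C2: "\<bar>C\<bar> < e / 2 * (- ln \<epsilon>)" using mult_strict_left_mono[OF l(1), of "e / 2"] e by simp
          have "\<epsilon> < 1" using l elim by simp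
          hence "a.j \<epsilon> \<le> b.j \<epsilon> + e / 2 * (- ln \<epsilon>) + C" "b.j \<epsilon> \<le> a.j \<epsilon> + e / 2 * (- ln \<epsilon>) + C"
            unfolding a.j_def b.j_def
            using C[OF a.gauss_lattice_heights_axioms b.gauss_lattice_heights_axioms h' elim(2)]
              C[OF b.gauss_lattice_heights_axioms a.gauss_lattice_heights_axioms h' elim(2)] by simp_all
          hence "\<bar>a.j \<epsilon> - b.j \<epsilon>\<bar> < e * (- ln \<epsilon>)" using C2 by (simp add: abs_less_iff)
          hence "\<bar>a.j \<epsilon> - b.j \<epsilon>\<bar> / (- ln \<epsilon>) < e" using l(2) by (simp only: pos_divide_less_eq)
          moreover have "a.j \<epsilon> / - ln \<epsilon> - b.j \<epsilon> / - ln \<epsilon> = (a.j \<epsilon> - b.j \<epsilon>) / (- ln \<epsilon>)"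
            by (simp only: diff_divide_distrib)
          ultimately show ?case using l(2) by (simp only: dist_real_def abs_divide) simp
        qed
      qed
      from tendsto_add[OF this blim]
      show "((\<lambda>\<epsilon>. enn2real (a.J \<epsilon>) / - ln \<epsilon>) \<longlongrightarrow> mean_value h' / (pi\<^sup>2 / 6)) (at_right 0)"
        by (simp add: a.j_def)
    qed
  qed
qed

end

section \<open>Geometry of the transfer map\<close>

text \<open>Coordinates in the orthonormal frame of a unit vector \<omega>, with the sign for which
  \<open>impact\<close> is the \<open>cross_coord\<close> of the normal.\<close>

definition cross_coord :: "real \<times> real \<Rightarrow> real \<times> real \<Rightarrow> real" where
  "cross_coord \<omega> x = fst x * snd \<omega> - snd x * fst \<omega>"

definition along_coord :: "real \<times> real \<Rightarrow> real \<times> real \<Rightarrow> real" where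
  "along_coord \<omega> x = fst x * fst \<omega> + snd x * snd \<omega>"

lemma coord_simps:
  "cross_coord \<omega> (x + x') = cross_coord \<omega> x + cross_coord \<omega> x'"
  "along_coord \<omega> (x + x') = along_coord \<omega> x + along_coord \<omega> x'"
  "cross_coord \<omega> (x - x') = cross_coord \<omega> x - cross_coord \<omega> x'"
  "along_coord \<omega> (x - x') = along_coord \<omega> x - along_coord \<omega> x'"
  "cross_coord \<omega> (t *\<^sub>R x) = t * cross_coord \<omega> x"
  "along_coord \<omega> (t *\<^sub>R x) = t * along_coord \<omega> x"
  "cross_coord \<omega> 0 = 0" "along_coord \<omega> 0 = 0"
  by (auto simp: cross_coord_def along_coord_def algebra_simps)

locale direction =
  fixes \<omega> :: "real \<times> real"
  assumes unit: "(fst \<omega>)\<^sup>2 + (snd \<omega>)\<^sup>2 = 1"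
begin

abbreviation "u \<equiv> cross_coord \<omega>"
abbreviation "v \<equiv> along_coord \<omega>"

lemma coord_norm: "(norm x)\<^sup>2 = (u x)\<^sup>2 + (v x)\<^sup>2"
proof -
  have "(u x)\<^sup>2 + (v x)\<^sup>2 = ((fst x)\<^sup>2 + (snd x)\<^sup>2) * ((fst \<omega>)\<^sup>2 + (snd \<omega>)\<^sup>2)"
    by (simp add: cross_coord_def along_coord_def algebra_simps power2_eq_square)
  also have "\<dots> = (norm x)\<^sup>2" unfolding unit by (simp add: norm_prod_def)
  finally show ?thesis ..
qed

lemma dist_eq_iff: "0 \<le> r \<Longrightarrow> dist x p = r \<longleftrightarrow> (u x - u p)\<^sup>2 + (v x - v p)\<^sup>2 = r\<^sup>2"
  using coord_norm[of "x - p"] by (simp add: dist_norm coord_simps) (metis norm_ge_zero power2_eq_iff_nonneg)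

lemma coord_omega: "u \<omega> = 0" "v \<omega> = 1"
  using unit by (auto simp: cross_coord_def along_coord_def power2_eq_square)

lemma coord_ext: "u x = u x' \<Longrightarrow> v x = v x' \<Longrightarrow> x = x'"
  using coord_norm[of "x - x'"] by (simp add: coord_simps)

lemma coord_ex: "\<exists>x. u x = a \<and> v x = b"
proof (intro exI conjI)
  let ?x = "(a * snd \<omega> + b * fst \<omega>, b * snd \<omega> - a * fst \<omega>)"
  have "u ?x = a * ((fst \<omega>)\<^sup>2 + (snd \<omega>)\<^sup>2)" "v ?x = b * ((fst \<omega>)\<^sup>2 + (snd \<omega>)\<^sup>2)"
    by (simp_all add: cross_coord_def along_coord_def algebra_simps power2_eq_square)
  thus "u ?x = a" "v ?x = b" by (simp_all add: unit)
qed

end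

section \<open>The integer lattice and the boundary of the obstacles\<close>

lemma lattice_0[simp]: "0 \<in> lattice"
  by (auto simp: lattice_def zero_prod_def intro: exI[of _ 0])

lemma lattice_dist_ge_1:
  assumes "p \<in> lattice" "q \<in> lattice" "p \<noteq> q"
  shows "1 \<le> dist p q"
proof -
  obtain a b c d :: int where p: "p = (of_int a, of_int b)" and q: "q = (of_int c, of_int d)"
    using assms by (auto simp: lattice_def)
  have "(dist p q)\<^sup>2 = (of_int a - of_int c)\<^sup>2 + (of_int b - of_int d)\<^sup>2"
    by (simp add: p q dist_Pair_Pair dist_real_def)
  also have "\<dots> = of_int ((a - c)\<^sup>2 + (b - d)\<^sup>2)" by simp
  finally have e: "(dist p q)\<^sup>2 = of_int ((a - c)\<^sup>2 + (b - d)\<^sup>2)" .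
  have "0 < (dist p q)\<^sup>2" using assms(3) by simp
  hence "1 \<le> (a - c)\<^sup>2 + (b - d)\<^sup>2" unfolding e of_int_0_less_iff by simp
  hence "1\<^sup>2 \<le> (dist p q)\<^sup>2" unfolding e by (metis of_int_1_le_iff one_power2)
  thus ?thesis by (rule power2_le_imp_le) simp
qed

lemma closed_lattice: "closed lattice"
  by (rule discrete_imp_closed[of 1]) (use lattice_dist_ge_1 in force)+

lemma lattice_near_unique:
  assumes "p \<in> lattice" "q \<in> lattice" "dist x p \<le> r" "dist x q \<le> r" "r \<le> 1 / 4"
  shows "p = q"
proof (rule ccontr)
  assume "p \<noteq> q"
  hence "1 \<le> dist p q" using lattice_dist_ge_1 assms by blast
  also have "\<dots> \<le> dist x p + dist x q" by (metis dist_commute dist_triangle)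
  finally show False using assms by linarith
qed

lemma obst_center_eq:
  assumes "p \<in> lattice" "dist x p = r" "r \<le> 1 / 4"
  shows "obst_center r x = p"
  unfolding obst_center_def
proof (rule some_equality)
  fix q assume "q \<in> lattice \<and> dist x q = r"
  thus "q = p" using assms by (intro lattice_near_unique[of q p x r]) simp_all
qed (use assms in simp)

text \<open>The boundary is a topological frontier, so a point at distance \<open>r\<close> from a
  lattice point has to be approached from the domain. Pushing it radially outwards does this: up to
  a factor 2 it stays within \<open>2 r \<le> 1 / 2\<close> of its own centre, hence at distance at
  least 1/2 from all others.\<close>

lemma bdryZ_iff:
  assumes r: "0 < r" "r \<le> 1 / 4"
  shows "x \<in> bdryZ r \<longleftrightarrow> (\<exists>p\<in>lattice. dist x p = r)"
proof -
  have ne: "lattice \<noteq> {}" using lattice_0 by blast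
  have openZ: "open (Zr r)" unfolding Zr_def by (intro open_Collect_less continuous_intros)
  have clZ: "closure (Zr r) \<subseteq> {x. r \<le> infdist x lattice}"
    by (rule closure_minimal) (auto simp: Zr_def intro!: closed_Collect_le continuous_intros)
  have fr: "bdryZ r = closure (Zr r) - Zr r"
    unfolding bdryZ_def frontier_def using openZ by (simp add: interior_open)
  show ?thesis
  proof
    assume "x \<in> bdryZ r"
    hence d: "infdist x lattice = r" using clZ fr by (auto simp: Zr_def)
    obtain p where p: "p \<in> lattice" "infdist x lattice = dist x p"
      by (rule infdist_attains_inf[OF closed_lattice ne])
    show "\<exists>p\<in>lattice. dist x p = r" using p d by (intro bexI[of _ p]) simp_all
  next
    assume "\<exists>p\<in>lattice. dist x p = r"
    then obtain p where p: "p \<in> lattice" "dist x p = r" by blast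
    have far: "r < infdist (p + (1 + t) *\<^sub>R (x - p)) lattice" if t: "0 < t" "t \<le> 1" for t
    proof -
      let ?x = "p + (1 + t) *\<^sub>R (x - p)"
      obtain q where q: "q \<in> lattice" "infdist ?x lattice = dist ?x q"
        by (rule infdist_attains_inf[OF closed_lattice ne])
      have d: "dist ?x p = (1 + t) * r" using p t by (simp add: dist_norm)
      show ?thesis
      proof (cases "q = p")
        case True
        thus ?thesis using q d t r by simp
      next
        case False
        hence "1 \<le> dist p q" using lattice_dist_ge_1 p q by blast
        also have "\<dots> \<le> dist ?x p + dist ?x q" by (metis dist_commute dist_triangle)
        finally have "1 - (1 + t) * r \<le> dist ?x q" using d by simp
        moreover have "(1 + t) * r \<le> 2 * (1 / 4)" using t r by (intro mult_mono) auto
        ultimately show ?thesis using q r by simp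
      qed
    qed
    have "infdist x lattice \<le> r" using infdist_le[OF p(1), of x] p(2) by simp
    hence "x \<notin> Zr r" by (simp add: Zr_def)
    moreover have "x \<in> closure (Zr r)"
      unfolding closure_approachable
    proof (intro allI impI)
      fix e :: real assume e: "e > 0"
      define t where "t = min 1 (e / (2 * r))"
      have t: "0 < t" "t \<le> 1" using e r by (auto simp: t_def)
      have "p + (1 + t) *\<^sub>R (x - p) - x = t *\<^sub>R (x - p)" by (simp add: algebra_simps)
      hence "dist (p + (1 + t) *\<^sub>R (x - p)) x = t * r" using p(2) t by (simp add: dist_norm)
      also have "\<dots> \<le> e / (2 * r) * r" using r by (intro mult_right_mono) (auto simp: t_def)
      also have "\<dots> < e" using r e by simp
      finally show "\<exists>y\<in>Zr r. dist y x < e"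
        using far[OF t] by (intro bexI[of _ "p + (1 + t) *\<^sub>R (x - p)"]) (auto simp: Zr_def)
    qed
    ultimately show "x \<in> bdryZ r" unfolding fr by blast
  qed
qed

text \<open>Obstacles are ordered by their centres along the direction instead of by points of
  impact; \<open>chords_disjoint\<close> shows that the two orders agree.\<close>

definition first_hit :: "real \<Rightarrow> real \<Rightarrow> real \<times> real \<Rightarrow> real \<times> real \<Rightarrow> bool" where
  "first_hit r h' \<omega> p \<longleftrightarrow> p \<in> lattice \<and> \<bar>r * h' - cross_coord \<omega> p\<bar> \<le> r \<and> 0 < along_coord \<omega> p \<and>
     (\<forall>q\<in>lattice. \<bar>r * h' - cross_coord \<omega> q\<bar> \<le> r \<longrightarrow> 0 < along_coord \<omega> q \<longrightarrow>
        along_coord \<omega> p \<le> along_coord \<omega> q)"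

text \<open>Half the chord that the line of offset \<open>r * h'\<close> cuts out of a disc of
  radius \<open>r\<close> whose centre has offset \<open>a\<close>.\<close>

definition half_chord :: "real \<Rightarrow> real \<Rightarrow> real \<Rightarrow> real" where
  "half_chord r h' a = sqrt (r\<^sup>2 - (r * h' - a)\<^sup>2)"

lemma half_chord:
  assumes "\<bar>r * h' - a\<bar> \<le> r"
  shows "0 \<le> half_chord r h' a" "(half_chord r h' a)\<^sup>2 = r\<^sup>2 - (r * h' - a)\<^sup>2" "half_chord r h' a \<le> r"
proof -
  have r: "0 \<le> r" using assms by linarith
  have "\<bar>r * h' - a\<bar>\<^sup>2 \<le> r\<^sup>2" using assms by (intro power_mono) auto
  hence *: "(r * h' - a)\<^sup>2 \<le> r\<^sup>2" by simp
  show "0 \<le> half_chord r h' a" "(half_chord r h' a)\<^sup>2 = r\<^sup>2 - (r * h' - a)\<^sup>2"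
    using * by (auto simp: half_chord_def)
  show "half_chord r h' a \<le> r" unfolding half_chord_def
    by (rule real_le_lsqrt) (use r in auto)
qed

context direction
begin

text \<open>Otherwise some point of the trajectory's line would be within
  \<open>r \<le> 1 / 4\<close> of two lattice points.\<close>

lemma chords_disjoint:
  assumes r: "r \<le> 1 / 4" and p: "p \<in> lattice" "\<bar>r * h' - u p\<bar> \<le> r"
    and q: "q \<in> lattice" "\<bar>r * h' - u q\<bar> \<le> r" and pq: "p \<noteq> q" "v p \<le> v q"
  shows "half_chord r h' (u p) + half_chord r h' (u q) < v q - v p"
proof (rule ccontr)
  assume "\<not> ?thesis"
  hence le: "v q - half_chord r h' (u q) \<le> v p + half_chord r h' (u p)" by linarith
  \<comment> \<open>The position of a common point: the end of the first chord, or the second centre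
    if that comes earlier.\<close>
  define t where "t = min (v p + half_chord r h' (u p)) (v q)"
  have r0: "0 \<le> r" using p by linarith
  obtain x where x: "u x = r * h'" "v x = t" using coord_ex by blast
  have near: "dist x w \<le> r" if "\<bar>r * h' - u w\<bar> \<le> r" "\<bar>t - v w\<bar> \<le> half_chord r h' (u w)" for w
  proof -
    have "\<bar>t - v w\<bar>\<^sup>2 \<le> (half_chord r h' (u w))\<^sup>2" using that by (intro power_mono) auto
    hence "(dist x w)\<^sup>2 \<le> r\<^sup>2"
      using coord_norm[of "x - w"] half_chord(2)[OF that(1)] x by (simp add: dist_norm coord_simps)
    thus ?thesis using r0 by (rule power2_le_imp_le)
  qed
  have "dist x p \<le> r" "dist x q \<le> r"
    using half_chord(1)[OF p(2)] half_chord(1)[OF q(2)] pq le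
    by (auto intro!: near p q simp: t_def)
  thus False using lattice_near_unique[OF p(1) q(1) _ _ r] pq by blast
qed

text \<open>The impact parameter fixes the transversal coordinate, the distance \<open>r\<close>
  from the centre fixes the other one up to sign, and leaving the obstacle selects the non-negative
  sign.\<close>

lemma Yr_coords:
  assumes r: "0 < r" "r \<le> 1 / 4" and h': "\<bar>h'\<bar> \<le> 1"
  shows "u (Yr r h' \<omega>) = r * h'" "v (Yr r h' \<omega>) = half_chord r h' 0"
proof -
  obtain x0 where x0: "u x0 = r * h'" "v x0 = half_chord r h' 0" using coord_ex by blast
  have strip: "\<bar>r * h' - 0\<bar> \<le> r" using r h' by (simp add: abs_mult mult_left_le)
  have d0: "dist x0 0 = r"
    using r half_chord(2)[OF strip] x0 by (subst dist_eq_iff) (auto simp: coord_simps)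
  have center: "obst_center r x0 = 0" by (rule obst_center_eq[OF lattice_0 d0 r(2)])
  have imp: "impact r x \<omega> = u x / r" if "obst_center r x = 0" for x
    using that by (simp add: impact_def normal_def cross_coord_def diff_divide_distrib)
  have dot: "\<omega> \<bullet> normal r x = v x / r" if "obst_center r x = 0" for x
    using that by (simp add: normal_def along_coord_def inner_prod_def add_divide_distrib mult.commute)
  have "Yr r h' \<omega> = x0"
    unfolding Yr_def
  proof (rule the_equality)
    show "x0 \<in> bdryZ r \<and> obst_center r x0 = 0 \<and> 0 \<le> \<omega> \<bullet> normal r x0 \<and> impact r x0 \<omega> = h'"
    proof (intro conjI)
      show "x0 \<in> bdryZ r" using bdryZ_iff[OF r] d0 lattice_0 by blast
      show "0 \<le> \<omega> \<bullet> normal r x0" unfolding dot[OF center] x0 using half_chord(1)[OF strip] r by simp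
      show "impact r x0 \<omega> = h'" unfolding imp[OF center] x0 using r by simp
    qed (rule center)
    fix x assume *: "x \<in> bdryZ r \<and> obst_center r x = 0 \<and> 0 \<le> \<omega> \<bullet> normal r x \<and> impact r x \<omega> = h'"
    then obtain p where p: "p \<in> lattice" "dist x p = r" using bdryZ_iff[OF r] by blast
    have "p = 0" using obst_center_eq[OF p r(2)] * by simp
    hence d: "(u x)\<^sup>2 + (v x)\<^sup>2 = r\<^sup>2" using p r dist_eq_iff[of r x 0] by (simp add: coord_simps)
    have ux: "u x = r * h'" using * imp[of x] r by (auto simp: field_simps)
    have "0 \<le> v x" using * dot[of x] r by (auto simp: zero_le_divide_iff)
    moreover have "(v x)\<^sup>2 = (half_chord r h' 0)\<^sup>2" using d ux half_chord(2)[OF strip] by simp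
    ultimately have "v x = half_chord r h' 0"
      using half_chord(1)[OF strip] by (simp add: power2_eq_iff_nonneg)
    thus "x = x0" using ux x0 by (intro coord_ext) auto
  qed
  thus "u (Yr r h' \<omega>) = r * h'" "v (Yr r h' \<omega>) = half_chord r h' 0" using x0 by auto
qed

text \<open>The flight runs from the end of the chord at the origin to the beginning of the chord at
  \<open>p\<close>, both on the line of offset \<open>r * h'\<close>.\<close>

theorem transfer_first_hit:
  assumes r: "0 < r" "r \<le> 1 / 4" and h': "\<bar>h'\<bar> \<le> 1" and fh: "first_hit r h' \<omega> p"
  shows "transfer r h' \<omega> = (2 * r * (v p - half_chord r h' (u p) - half_chord r h' 0), h' - u p / r)"
    "0 < v p - half_chord r h' (u p) - half_chord r h' 0"
proof -
  define x0 where "x0 = Yr r h' \<omega>"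
  define \<tau> where "\<tau> = v p - half_chord r h' (u p) - half_chord r h' 0"
  note x0 = Yr_coords[OF r h', folded x0_def]
  have p: "p \<in> lattice" "\<bar>r * h' - u p\<bar> \<le> r" "0 < v p"
    and first: "\<And>q. q \<in> lattice \<Longrightarrow> \<bar>r * h' - u q\<bar> \<le> r \<Longrightarrow> 0 < v q \<Longrightarrow> v p \<le> v q"
    using fh by (auto simp: first_hit_def)
  have z: "u 0 = 0" "v 0 = 0" by (auto simp: coord_simps)
  have strip0: "\<bar>r * h' - u 0\<bar> \<le> r" using r h' by (simp add: abs_mult mult_left_le z)
  have p0: "p \<noteq> 0" using p by (auto simp: z)
  have \<tau>: "0 < \<tau>"
    using chords_disjoint[OF r(2) lattice_0 strip0 p(1,2) p0[symmetric]] p(3) by (simp add: \<tau>_def z)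
  thus "0 < v p - half_chord r h' (u p) - half_chord r h' 0" by (simp add: \<tau>_def)
  have on: "x0 + t *\<^sub>R \<omega> \<in> bdryZ r \<longleftrightarrow>
     (\<exists>q\<in>lattice. (r * h' - u q)\<^sup>2 + (half_chord r h' 0 + t - v q)\<^sup>2 = r\<^sup>2)" for t
    using r by (simp add: bdryZ_iff dist_eq_iff coord_simps coord_omega x0)
  have dp: "(r * h' - u p)\<^sup>2 + (half_chord r h' 0 + \<tau> - v p)\<^sup>2 = r\<^sup>2"
    using half_chord(2)[OF p(2)] by (simp add: \<tau>_def)
  have exit: "exit_time r x0 \<omega> = \<tau>"
    unfolding exit_time_def
  proof (rule cInf_eq_minimum)
    show "\<tau> \<in> {t. t > 0 \<and> x0 + t *\<^sub>R \<omega> \<in> bdryZ r}" using \<tau> dp on p(1) by blast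
    fix t assume "t \<in> {t. t > 0 \<and> x0 + t *\<^sub>R \<omega> \<in> bdryZ r}"
    then obtain q where q: "q \<in> lattice" "(r * h' - u q)\<^sup>2 + (half_chord r h' 0 + t - v q)\<^sup>2 = r\<^sup>2" and t: "t > 0"
      using on by blast
    have "(r * h' - u q)\<^sup>2 \<le> r\<^sup>2" using q(2) by (smt (verit) zero_le_power2)
    hence sq: "\<bar>r * h' - u q\<bar> \<le> r" using r by (simp add: abs_le_square_iff[symmetric])
    have "(half_chord r h' 0 + t - v q)\<^sup>2 = (half_chord r h' (u q))\<^sup>2" using q(2) half_chord(2)[OF sq] by simp
    hence tq: "\<bar>half_chord r h' 0 + t - v q\<bar> = half_chord r h' (u q)"
      using half_chord(1)[OF sq] by (metis abs_of_nonneg power2_eq_iff abs_minus_cancel)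
    \<comment> \<open>Any other obstacle ahead has its whole chord beyond that of \<open>p\<close>,
      and any obstacle behind has its chord before the starting point. What remains are the chord
      ends at \<open>p\<close> and at the origin.\<close>
    show "\<tau> \<le> t"
    proof (cases "0 < v q")
      case True
      show ?thesis
      proof (cases "q = p")
        case True
        thus ?thesis using tq by (simp add: \<tau>_def abs_if split: if_splits)
      next
        case False
        have "half_chord r h' (u p) + half_chord r h' (u q) < v q - v p"
          using False first[OF q(1) sq True] by (intro chords_disjoint[OF r(2) p(1,2) q(1) sq]) auto
        thus ?thesis using tq half_chord(1)[OF p(2)] unfolding \<tau>_def by linarith
      qed
    next
      case False
      have "t \<le> 0"
      proof (cases "q = 0")
        case True
        thus ?thesis using tq by (simp add: z abs_if split: if_splits)
      next
        case nz: False
        have "half_chord r h' (u q) + half_chord r h' (u 0) < v 0 - v q"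
          using False nz by (intro chords_disjoint[OF r(2) q(1) sq lattice_0 strip0]) (auto simp: z)
        thus ?thesis using tq half_chord(1)[OF strip0] by (simp add: z)
      qed
      thus ?thesis using t by simp
    qed
  qed
  define x1 where "x1 = x0 + \<tau> *\<^sub>R \<omega>"
  have x1: "u x1 = r * h'" by (simp add: x1_def coord_simps coord_omega x0)
  have "dist x1 p = r" using dp r by (subst dist_eq_iff) (auto simp: x1_def coord_simps coord_omega x0)
  hence center: "obst_center r x1 = p" using obst_center_eq[OF p(1) _ r(2)] by blast
  \<comment> \<open>Reflection changes the direction by a multiple of the normal, which contributes
    nothing to the cross product with the normal.\<close>
  have "impact r x1 (reflect r x1 \<omega>) = impact r x1 \<omega>"
    by (simp add: impact_def reflect_def algebra_simps)
  also have "\<dots> = u ((1 / r) *\<^sub>R (x1 - p))"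
    by (simp only: impact_def normal_def center cross_coord_def)
  also have "\<dots> = u (x1 - p) / r" by (simp only: coord_simps(5)) simp
  also have "\<dots> = h' - u p / r" using r by (simp add: coord_simps x1 diff_divide_distrib)
  finally have imp: "impact r x1 (reflect r x1 \<omega>) = h' - u p / r" .
  show "transfer r h' \<omega> = (2 * r * (v p - half_chord r h' (u p) - half_chord r h' 0), h' - u p / r)"
    unfolding transfer_def Let_def x0_def[symmetric] exit x1_def[symmetric] imp by (simp only: \<tau>_def)
qed

end

section \<open>Unimodular bases of the lattice and the first obstacle\<close>

definition lattice_basis :: "real \<times> real \<Rightarrow> real \<times> real \<Rightarrow> bool" where
  "lattice_basis p q \<longleftrightarrow> p \<in> lattice \<and> q \<in> lattice \<and> \<bar>fst p * snd q - snd p * fst q\<bar> = 1"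

lemma lattice_iff: "p \<in> lattice \<longleftrightarrow> fst p \<in> \<int> \<and> snd p \<in> \<int>"
  by (cases p) (auto simp: lattice_def Ints_def)

lemma lattice_add: "p \<in> lattice \<Longrightarrow> q \<in> lattice \<Longrightarrow> p + q \<in> lattice"
  by (auto simp: lattice_iff)

lemma lattice_scale: "p \<in> lattice \<Longrightarrow> k \<in> \<int> \<Longrightarrow> k *\<^sub>R p \<in> lattice"
  by (auto simp: lattice_iff)

lemma countable_lattice: "countable lattice"
proof -
  have eq: "lattice = (\<lambda>(a, b). (of_int a, of_int b)) ` (UNIV :: (int \<times> int) set)"
    by (auto simp: lattice_def)
  show ?thesis unfolding eq by (rule countable_image) (rule countableI_type)
qed

lemma lattice_basis_swap: "lattice_basis p q \<Longrightarrow> lattice_basis q p"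
  unfolding lattice_basis_def by (simp add: abs_minus_commute mult.commute)

lemma lattice_basis_add: "lattice_basis p q \<Longrightarrow> k \<in> \<int> \<Longrightarrow> lattice_basis (p + k *\<^sub>R q) q"
  unfolding lattice_basis_def by (simp add: lattice_add lattice_scale algebra_simps)

text \<open>Cramer's rule with a determinant \<open>D\<close> that is its own inverse.\<close>

lemma lattice_basis_span:
  assumes "lattice_basis p q" "m \<in> lattice"
  obtains i j :: int where "m = of_int i *\<^sub>R p + of_int j *\<^sub>R q"
proof -
  define D where "D = fst p * snd q - snd p * fst q"
  have "D\<^sup>2 = \<bar>D\<bar>\<^sup>2" by simp
  also have "\<bar>D\<bar> = 1" using assms(1) by (simp add: lattice_basis_def D_def)
  finally have DD: "D * D = 1" by (simp add: power2_eq_square)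
  define a b where "a = D * (fst m * snd q - snd m * fst q)" and "b = D * (fst p * snd m - snd p * fst m)"
  have "a \<in> \<int>" "b \<in> \<int>" using assms by (auto simp: a_def b_def D_def lattice_basis_def lattice_iff)
  then obtain i j :: int where ij: "a = of_int i" "b = of_int j" by (auto simp: Ints_def)
  have "a * fst p + b * fst q = D * D * fst m" "a * snd p + b * snd q = D * D * snd m"
    unfolding a_def b_def by (simp_all only: D_def) (simp_all add: algebra_simps)
  hence "m = a *\<^sub>R p + b *\<^sub>R q" unfolding DD by (intro prod_eqI) simp_all
  thus ?thesis using that ij by simp
qed

context direction
begin

text \<open>If \<open>p\<close> and \<open>q\<close> lie beyond the two sides of the strip while \<open>p + q\<close> lies in it, any lattice
  point \<open>i p + j q\<close> in the strip ahead of the origin has \<open>i, j \<ge> 1\<close>.\<close>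

lemma first_hit_basis:
  assumes b: "lattice_basis p q" and s: "s = 1 \<or> s = -1" and r: "0 \<le> r" and h': "\<bar>h'\<bar> \<le> 1"
    and p: "r < s * (u p - r * h')" and q: "s * (u q - r * h') < - r"
    and strip: "\<bar>r * h' - u (p + q)\<bar> \<le> r" and v: "0 < v p" "0 < v q"
  shows "first_hit r h' \<omega> (p + q)"
  unfolding first_hit_def
proof (intro conjI ballI impI)
  show "p + q \<in> lattice" using b lattice_add by (simp add: lattice_basis_def)
  show "0 < v (p + q)" using v by (simp add: coord_simps)
  have "\<bar>s * (r * h')\<bar> \<le> r" using s r h' by (auto simp: abs_mult mult_left_le)
  hence w: "0 \<le> s * u p" "s * u q \<le> 0" using p q by (simp_all add: algebra_simps)
  fix m assume m: "m \<in> lattice" "\<bar>r * h' - u m\<bar> \<le> r" "0 < v m"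
  obtain i j :: int where ij: "m = of_int i *\<^sub>R p + of_int j *\<^sub>R q" by (rule lattice_basis_span[OF b m(1)])
  have um: "s * u m = of_int i * (s * u p) + of_int j * (s * u q)" and vm: "v m = of_int i * v p + of_int j * v q"
    by (simp_all add: ij coord_simps algebra_simps)
  have ms: "\<bar>s * (u m - r * h')\<bar> \<le> r" using m(2) s by (auto simp: abs_mult abs_minus_commute)
  \<comment> \<open>With exactly one positive coefficient the point lies at least as far out as
    \<open>p\<close> or \<open>q\<close> on that side, outside the strip; with none it is not ahead
    of the origin.\<close>
  consider "1 \<le> i" "1 \<le> j" | "1 \<le> i" "j \<le> 0" | "i \<le> 0" "1 \<le> j" | "i \<le> 0" "j \<le> 0" by linarith
  thus "v (p + q) \<le> v m"
  proof cases
    case 1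
    hence "(1 :: real) \<le> of_int i" "(1 :: real) \<le> of_int j" by simp_all
    hence "1 * v p \<le> of_int i * v p" "1 * v q \<le> of_int j * v q"
      using v by (intro mult_right_mono; simp)+
    thus ?thesis unfolding vm coord_simps by linarith
  next
    case 2
    hence ij: "(1 :: real) \<le> of_int i" "of_int j \<le> (0 :: real)" by simp_all
    from mult_right_mono[OF ij(1) w(1)] mult_nonpos_nonpos[OF ij(2) w(2)]
    have "s * u p \<le> s * u m" unfolding um by linarith
    thus ?thesis using p ms by (simp add: right_diff_distrib)
  next
    case 3
    hence ij: "of_int i \<le> (0 :: real)" "(1 :: real) \<le> of_int j" by simp_all
    from mult_right_mono_neg[OF ij(2) w(2)] mult_nonpos_nonneg[OF ij(1) w(1)]
    have "s * u m \<le> s * u q" unfolding um by linarith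
    thus ?thesis using q ms by (simp add: right_diff_distrib)
  next
    case 4
    hence ij: "of_int i \<le> (0 :: real)" "of_int j \<le> (0 :: real)" by simp_all
    have "of_int i * v p \<le> 0" "of_int j * v q \<le> 0"
      using mult_nonpos_nonneg[OF ij(1)] mult_nonpos_nonneg[OF ij(2)] v by simp_all
    thus ?thesis using m(3) unfolding vm by linarith
  qed
qed (rule strip)

lemma finite_lattice_box: "finite {q \<in> lattice. \<bar>u q\<bar> \<le> a \<and> \<bar>v q\<bar> \<le> a}"
proof -
  have bd: "norm q \<le> \<bar>u q\<bar> + \<bar>v q\<bar>" for q
  proof (rule power2_le_imp_le)
    show "(norm q)\<^sup>2 \<le> (\<bar>u q\<bar> + \<bar>v q\<bar>)\<^sup>2"
      unfolding coord_norm by (simp add: power2_sum)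
  qed simp
  obtain N :: int where N: "2 * a \<le> of_int N" using ex_le_of_int by blast
  have "{q \<in> lattice. \<bar>u q\<bar> \<le> a \<and> \<bar>v q\<bar> \<le> a} \<subseteq> (\<lambda>(i, j). (of_int i, of_int j)) ` ({-N..N} \<times> {-N..N})"
  proof
    fix q assume "q \<in> {q \<in> lattice. \<bar>u q\<bar> \<le> a \<and> \<bar>v q\<bar> \<le> a}"
    hence q: "q \<in> lattice" "norm q \<le> of_int N" using bd[of q] N by auto
    then obtain i j :: int where ij: "q = (of_int i, of_int j)" by (auto simp: lattice_def)
    have "\<bar>of_int i\<bar> \<le> norm q" "\<bar>of_int j\<bar> \<le> norm q"
      using norm_fst_le[of "of_int i :: real" "of_int j :: real"] norm_snd_le[of "of_int j :: real" "of_int i :: real"] by (auto simp: ij)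
    hence "\<bar>of_int i :: real\<bar> \<le> of_int N" "\<bar>of_int j :: real\<bar> \<le> of_int N" using q by linarith+
    hence "\<bar>i\<bar> \<le> N" "\<bar>j\<bar> \<le> N" by (simp_all only: of_int_abs[symmetric] of_int_le_iff)
    thus "q \<in> (\<lambda>(i, j). (of_int i, of_int j)) ` ({-N..N} \<times> {-N..N})"
      by (intro image_eqI[of _ _ "(i, j)"]) (auto simp: ij)
  qed
  thus ?thesis by (rule finite_subset) simp
qed

text \<open>The strips increase with the radius, and up to the known height \<open>v p\<close> only
  finitely many lattice points compete. A first obstacle at a small radius thus yields one at every
  larger radius.\<close>

lemma first_hit_mono_exists:
  assumes "first_hit r h' \<omega> p" "0 < r" "r \<le> r'" "\<bar>h'\<bar> \<le> 1"
  shows "\<exists>q. first_hit r' h' \<omega> q"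
proof -
  define C where "C = {q \<in> lattice. \<bar>r' * h' - u q\<bar> \<le> r' \<and> 0 < v q \<and> v q \<le> v p}"
  have "\<bar>r' * h' - u p\<bar> \<le> \<bar>r * h' - u p\<bar> + \<bar>(r' - r) * h'\<bar>"
    by (simp add: algebra_simps)
  also have "\<bar>(r' - r) * h'\<bar> \<le> r' - r" using assms by (simp add: abs_mult mult_left_le)
  finally have "\<bar>r' * h' - u p\<bar> \<le> r'" using assms(1) by (simp add: first_hit_def)
  hence pC: "p \<in> C" using assms(1) by (simp add: C_def first_hit_def)
  have "finite C"
  proof (rule finite_subset[OF _ finite_lattice_box[of "2 * r' + v p"]])
    show "C \<subseteq> {q \<in> lattice. \<bar>u q\<bar> \<le> 2 * r' + v p \<and> \<bar>v q\<bar> \<le> 2 * r' + v p}"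
    proof
      fix q assume q: "q \<in> C"
      have "\<bar>r' * h'\<bar> \<le> r'" using assms by (simp add: abs_mult mult_left_le)
      thus "q \<in> {q \<in> lattice. \<bar>u q\<bar> \<le> 2 * r' + v p \<and> \<bar>v q\<bar> \<le> 2 * r' + v p}"
        using q assms(2,3) by (auto simp: C_def)
    qed
  qed
  hence fin: "finite (v ` C)" by simp
  obtain q where q: "q \<in> C" "v q = Min (v ` C)" using Min_in[OF fin] pC by fastforce
  have "v q \<le> v m" if "m \<in> lattice" "\<bar>r' * h' - u m\<bar> \<le> r'" "0 < v m" for m
  proof (cases "v m \<le> v p")
    case True
    hence "m \<in> C" using that by (simp add: C_def)
    thus ?thesis using q(2) fin by simp
  next
    case False
    thus ?thesis using q(1) by (simp add: C_def)
  qed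
  hence "first_hit r' h' \<omega> q" using q(1) by (auto simp: first_hit_def C_def)
  thus ?thesis by blast
qed

lemma first_hit_measurable[measurable]: "Measurable.pred borel (\<lambda>r. first_hit r h' \<omega> p)"
  unfolding first_hit_def using countable_lattice by measurable

end

fun orbit_point :: "real \<Rightarrow> real \<times> real \<Rightarrow> real \<times> real \<Rightarrow> nat \<Rightarrow> real \<times> real" where
  "orbit_point y e f 0 = e"
| "orbit_point y e f (Suc 0) = f"
| "orbit_point y e f (Suc (Suc n)) = orbit_point y e f n + gauss_digit (gauss_orbit y n) *\<^sub>R orbit_point y e f (Suc n)"

text \<open>\<open>A\<close> is the larger of \<open>\<bar>fst \<omega>\<bar>\<close> and \<open>\<bar>snd \<omega>\<bar>\<close>, and \<open>\<sigma>\<close> records on which side of the line the unit vector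
  \<open>e\<close> lies. The radius \<open>r\<close> corresponds to \<open>r / A\<close> in the normalisation of \<open>height_seq\<close>, with \<open>z = y\<close>.\<close>

locale lattice_orbit = direction \<omega> for \<omega> +
  fixes \<sigma> A y :: real and e f :: "real \<times> real"
  assumes \<sigma>: "\<sigma> = 1 \<or> \<sigma> = -1" and A: "0 < A" and y: "y \<in> unit_irr" and AA: "A\<^sup>2 * (1 + y\<^sup>2) = 1"
    and ef: "lattice_basis e f"
    and ue: "u e = - \<sigma> * A" and uf: "u f = \<sigma> * A * y" and ve: "v e = A * y" and vf: "v f = A"
begin

sublocale gauss_lattice_heights y y
  by (rule gauss_lattice_heightsI[OF y]) (use unit_irrD[OF y] in auto)

abbreviation "P \<equiv> orbit_point y e f"

lemma orbit_point_basis: "lattice_basis (P n) (P (Suc n))"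
proof (induction n)
  case (Suc n)
  have "gauss_digit (gauss_orbit y n) \<in> \<int>" by (simp add: gauss_digit_def)
  from lattice_basis_swap[OF lattice_basis_add[OF Suc.IH this]] show ?case by simp
qed (use ef in simp)

text \<open>The points obey the recursion of \<open>V\<close>, and that of \<open>U\<close> up to
  alternating sign. By \<open>A\<^sup>2 * (1 + y\<^sup>2) = 1\<close> the initial heights
  \<open>A * y\<close> and \<open>A\<close> are those of \<open>height_seq\<close> with
  \<open>z = y\<close>, divided by \<open>A\<close>.\<close>

lemma orbit_point_coords:
  "cross_coord \<omega> (P n) = - \<sigma> * (- 1) ^ n * A * U n" "along_coord \<omega> (P n) = V n / A"
proof -
  have "(cross_coord \<omega> (P n) = - \<sigma> * (- 1) ^ n * A * U n \<and> along_coord \<omega> (P n) = V n / A) \<and>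
     (cross_coord \<omega> (P (Suc n)) = - \<sigma> * (- 1) ^ Suc n * A * U (Suc n) \<and> along_coord \<omega> (P (Suc n)) = V (Suc n) / A)"
  proof (induction n)
    case 0
    have "1 / (1 + y * y) = A\<^sup>2"
      using AA by (metis mult.commute nonzero_eq_divide_eq power2_eq_square mult_zero_left zero_neq_one)
    hence "V 0 = A\<^sup>2 * y" "V (Suc 0) = A\<^sup>2" by (auto simp: divide_inverse)
    thus ?case using A by (simp add: ue uf ve vf offset_seq_Suc power2_eq_square)
  next
    case (Suc n)
    thus ?case
      by (simp add: coord_simps U_rec algebra_simps add_divide_distrib)
  qed
  thus "cross_coord \<omega> (P n) = - \<sigma> * (- 1) ^ n * A * U n" "along_coord \<omega> (P n) = V n / A" by auto
qed

text \<open>The basis is \<open>P (n + 1)\<close> and \<open>P n + k P (n + 1)\<close>: the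
  conditions of \<open>orbit_hit\<close> put these beyond opposite sides of the strip and their sum
  into it. The sign \<open>s\<close> records which side belongs to level \<open>n\<close>.\<close>

lemma orbit_hit_first_hit:
  assumes h': "\<bar>h'\<bar> \<le> 1" and r: "0 < r" and hit: "orbit_hit (\<sigma> * h') y n k (r / A)"
  obtains p where "first_hit r h' \<omega> p" "cross_coord \<omega> p = - \<sigma> * (- 1) ^ n * A * orbit_offset y n k"
    "along_coord \<omega> p = orbit_height y y n k / A"
proof -
  define q where "q = P n + real k *\<^sub>R P (Suc n)"
  define s where "s = \<sigma> * (- 1) ^ n"
  have s: "s = 1 \<or> s = -1" using \<sigma> by (cases "even n") (auto simp: s_def)
  have ss: "s * s = 1" using s by auto
  have sd: "side (\<sigma> * h') n = s * h'" by (simp add: side_def s_def)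
  have uq: "cross_coord \<omega> q = - s * A * (U n - real k * U (Suc n))"
    and vq: "along_coord \<omega> q = (V n + real k * V (Suc n)) / A"
    and up: "cross_coord \<omega> (P (Suc n)) = s * A * U (Suc n)" and vp: "along_coord \<omega> (P (Suc n)) = V (Suc n) / A"
    by (simp_all add: q_def coord_simps orbit_point_coords s_def algebra_simps add_divide_distrib del: orbit_point.simps)
  have sum: "cross_coord \<omega> (P (Suc n) + q) = - s * A * orbit_offset y n k"
    "along_coord \<omega> (P (Suc n) + q) = orbit_height y y n k / A"
    unfolding coord_simps uq vq up vp orbit_offset_def orbit_height_def
    by (simp_all add: algebra_simps add_divide_distrib)
  have H: "0 < orbit_offset y n k" "orbit_offset y n k * A \<le> (1 - s * h') * r"
    "(1 - s * h') * r < (U n - real k * U (Suc n)) * A" "(1 + s * h') * r < U (Suc n) * A"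
    using hit A unfolding orbit_hit_def sd orbit_offset_def by (simp_all add: pos_le_divide_eq pos_divide_less_eq)
  have sh: "\<bar>s * h'\<bar> \<le> 1" using s h' by auto
  have "first_hit r h' \<omega> (P (Suc n) + q)"
  proof (rule first_hit_basis[where s = s])
    have "lattice_basis q (P (Suc n))"
      unfolding q_def by (rule lattice_basis_add[OF orbit_point_basis]) simp
    thus "lattice_basis (P (Suc n)) q" by (rule lattice_basis_swap)
    have e1: "s * (s * A * U (Suc n) - r * h') = A * U (Suc n) - s * h' * r" using s by (auto simp: algebra_simps)
    show "r < s * (cross_coord \<omega> (P (Suc n)) - r * h')" unfolding up e1 using H(4) by (simp add: algebra_simps)
    have e2: "s * (- s * A * (U n - real k * U (Suc n)) - r * h') = - A * (U n - real k * U (Suc n)) - s * h' * r"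
      using s by (auto simp: algebra_simps)
    show "s * (cross_coord \<omega> q - r * h') < - r" unfolding uq e2 using H(3) by (simp add: algebra_simps)
    have "\<bar>r * h' - (- s * A * orbit_offset y n k)\<bar> = \<bar>s * h' * r + A * orbit_offset y n k\<bar>"
      using s by (auto simp: abs_if algebra_simps)
    also have "\<dots> \<le> r"
    proof -
      have "0 \<le> A * orbit_offset y n k" using A H(1) by simp
      moreover have "- r \<le> s * h' * r" using sh r mult_right_mono[of "-1" "s * h'" r] by simp
      ultimately show ?thesis using H(2) by (simp add: abs_le_iff algebra_simps)
    qed
    finally show "\<bar>r * h' - cross_coord \<omega> (P (Suc n) + q)\<bar> \<le> r" unfolding sum .
    show "0 < along_coord \<omega> (P (Suc n))" unfolding vp using V_pos A by simp
    show "0 < along_coord \<omega> q" unfolding vq using V_pos A by (simp add: add_pos_nonneg less_imp_le)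
  qed (use s r h' in auto)
  thus ?thesis using that sum by (simp add: s_def)
qed

text \<open>A radius of at most \<open>A * y / 4\<close> satisfies the size conditions of
  \<open>orbit_hit_exists\<close>, because the factors in front of it there are at most 2. Larger
  radii follow by monotonicity of the strips.\<close>

lemma first_hit_exists:
  assumes h': "\<bar>h'\<bar> \<le> 1" and r: "0 < r"
  shows "\<exists>p. first_hit r h' \<omega> p"
proof -
  define \<rho> where "\<rho> = min r (A * y / 4)"
  have "\<rho> / A \<le> (A * y / 4) / A" using A by (intro divide_right_mono) (auto simp: \<rho>_def)
  hence \<rho>: "0 < \<rho>" "\<rho> \<le> r" "\<rho> / A \<le> y / 4" using r A Y_bounds[of 0] by (auto simp: \<rho>_def)
  have \<sigma>h: "\<bar>\<sigma> * h'\<bar> \<le> 1" using \<sigma> h' by auto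
  have b: "t * (\<rho> / A) < y" if "t \<le> 2" for t
  proof -
    have "t * (\<rho> / A) \<le> 2 * (\<rho> / A)" using that \<rho> A by (intro mult_right_mono) auto
    thus ?thesis using \<rho>(3) unit_irrD(1)[OF y] by linarith
  qed
  have "\<exists>n k. orbit_hit (\<sigma> * h') y n k (\<rho> / A)"
  proof (rule orbit_hit_exists[OF \<sigma>h])
    have "(1 - \<sigma> * h') * (\<rho> / A) < y" by (rule b) (use \<sigma>h in simp)
    thus "(1 - \<sigma> * h') * (\<rho> / A) < 1" using unit_irrD(2)[OF y] by linarith
    show "(1 + \<sigma> * h') * (\<rho> / A) < y" using b[of "1 + \<sigma> * h'"] \<sigma>h by simp
  qed (use \<rho> A in simp)
  then obtain n k where "orbit_hit (\<sigma> * h') y n k (\<rho> / A)" by blast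
  then obtain p where "first_hit \<rho> h' \<omega> p" using orbit_hit_first_hit[OF h' \<rho>(1)] by blast
  thus ?thesis using first_hit_mono_exists[OF _ \<rho>(1,2) h'] by blast
qed

end

section \<open>Measurability of the transfer map in the radius\<close>

lemma measurable_countable_cases:
  assumes I: "countable I" and P: "\<And>i. i \<in> I \<Longrightarrow> {x \<in> space M. P i x} \<in> sets M"
    and F: "\<And>i. i \<in> I \<Longrightarrow> F i \<in> M \<rightarrow>\<^sub>M N"
    and ex: "\<And>x. x \<in> space M \<Longrightarrow> \<exists>i\<in>I. P i x"
    and eq: "\<And>i x. i \<in> I \<Longrightarrow> x \<in> space M \<Longrightarrow> P i x \<Longrightarrow> f x = F i x"
  shows "f \<in> M \<rightarrow>\<^sub>M N"
proof (rule measurableI)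
  fix x assume "x \<in> space M"
  thus "f x \<in> space N" using ex[of x] eq F measurable_space by metis
next
  fix S assume S: "S \<in> sets N"
  have "f -` S \<inter> space M = (\<Union>i\<in>I. {x \<in> space M. P i x} \<inter> (F i -` S \<inter> space M))"
  proof (intro equalityI subsetI)
    fix x assume x: "x \<in> f -` S \<inter> space M"
    then obtain i where i: "i \<in> I" "P i x" using ex[of x] by blast
    hence "F i x \<in> S" using x eq[of i x] by simp
    thus "x \<in> (\<Union>i\<in>I. {x \<in> space M. P i x} \<inter> (F i -` S \<inter> space M))" using x i by blast
  next
    fix x assume "x \<in> (\<Union>i\<in>I. {x \<in> space M. P i x} \<inter> (F i -` S \<inter> space M))"
    then obtain i where "i \<in> I" "x \<in> space M" "P i x" "F i x \<in> S" by blast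
    thus "x \<in> f -` S \<inter> space M" using eq[of i x] by simp
  qed
  also have "\<dots> \<in> sets M"
    by (intro sets.countable_UN'' I sets.Int P measurable_sets[OF F S])
  finally show "f -` S \<inter> space M \<in> sets M" .
qed

context lattice_orbit
begin

text \<open>Being built from description operators and an infimum, \<open>transfer\<close> shows
  nothing of its dependence on \<open>r\<close>. On each of the countably many sets where a given
  lattice point is hit first it has an explicit formula.\<close>

lemma transfer_measurable:
  fixes \<Phi> :: "real \<times> real \<Rightarrow> real"
  assumes [measurable]: "\<Phi> \<in> borel_measurable (borel \<Otimes>\<^sub>M borel)" and h': "\<bar>h'\<bar> \<le> 1"
  shows "(\<lambda>r. \<Phi> (transfer r h' \<omega>) * indicator {0<..1/4} r) \<in> borel_measurable borel"
proof (rule measurable_countable_cases[where I = "insert None (Some ` lattice)" and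
      P = "\<lambda>i r. case i of None \<Rightarrow> r \<notin> {0<..1/4} | Some p \<Rightarrow> r \<in> {0<..1/4} \<and> first_hit r h' \<omega> p" and
      F = "\<lambda>i r. case i of None \<Rightarrow> 0 | Some p \<Rightarrow> \<Phi> (2 * r * (along_coord \<omega> p - half_chord r h' (cross_coord \<omega> p) - half_chord r h' 0), h' - cross_coord \<omega> p / r)"])
  show "countable (insert None (Some ` lattice))" using countable_lattice by auto
  fix i assume "i \<in> insert None (Some ` lattice)"
  show "{r \<in> space borel. case i of None \<Rightarrow> r \<notin> {0<..1/4} | Some p \<Rightarrow> r \<in> {0<..1/4} \<and> first_hit r h' \<omega> p} \<in> sets borel"
    by (cases i) auto
  show "(\<lambda>r. case i of None \<Rightarrow> 0 | Some p \<Rightarrow> \<Phi> (2 * r * (along_coord \<omega> p - half_chord r h' (cross_coord \<omega> p) - half_chord r h' 0), h' - cross_coord \<omega> p / r)) \<in> borel_measurable borel"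
    unfolding half_chord_def by (cases i) auto
next
  fix r :: real
  show "\<exists>i\<in>insert None (Some ` lattice). case i of None \<Rightarrow> r \<notin> {0<..1/4} | Some p \<Rightarrow> r \<in> {0<..1/4} \<and> first_hit r h' \<omega> p"
  proof (cases "r \<in> {0<..1/4}")
    case True
    then obtain p where p: "first_hit r h' \<omega> p" using first_hit_exists[OF h', of r] by auto
    hence "p \<in> lattice" by (simp add: first_hit_def)
    thus ?thesis using p True by (intro bexI[of _ "Some p"]) auto
  qed (auto intro!: bexI[of _ None])
next
  fix i and r :: real
  assume "case i of None \<Rightarrow> r \<notin> {0<..1/4} | Some p \<Rightarrow> r \<in> {0<..1/4} \<and> first_hit r h' \<omega> p"
  thus "\<Phi> (transfer r h' \<omega>) * indicator {0<..1/4} r = (case i of None \<Rightarrow> 0 | Some p \<Rightarrow> \<Phi> (2 * r * (along_coord \<omega> p - half_chord r h' (cross_coord \<omega> p) - half_chord r h' 0), h' - cross_coord \<omega> p / r))"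
    using transfer_first_hit(1)[OF _ _ h'] by (cases i) auto
qed

end

section \<open>The transfer map compared with the orbit sum\<close>

definition orient :: "real \<Rightarrow> (real \<times> real \<Rightarrow> real) \<Rightarrow> real \<times> real \<Rightarrow> real" where
  "orient \<sigma> \<Phi> = (if \<sigma> = 1 then \<Phi> else flip \<Phi>)"

locale lattice_orbit_test = lattice_orbit \<omega> \<sigma> A y e f + test_function \<Phi> s0 S0 B
  for \<omega> \<sigma> A y e f \<Phi> s0 S0 B +
  fixes h' :: real
  assumes h': "\<bar>h'\<bar> \<le> 1"
begin

abbreviation "\<Psi> \<equiv> orient \<sigma> \<Phi>"

lemma \<sigma>h: "\<bar>\<sigma> * h'\<bar> \<le> 1"
  using \<sigma> h' by auto

sublocale flow: test_orbit \<Psi> s0 S0 B y y "\<sigma> * h'"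
proof -
  have "test_function \<Psi> s0 S0 B"
    using test_function_axioms test_function_flip by (simp add: orient_def)
  thus "test_orbit \<Psi> s0 S0 B y y (\<sigma> * h')"
    using gauss_lattice_heights_axioms \<sigma>h unfolding test_orbit_def test_orbit_axioms_def by blast
qed

definition G :: "real \<Rightarrow> real" where "G r = \<Phi> (transfer r h' \<omega>) * indicator {0<..1/4} r"

lemma G_measurable[measurable]: "G \<in> borel_measurable borel"
  unfolding G_def[abs_def] by (rule transfer_measurable[OF \<Phi> h'])

lemma G_bounds: "0 \<le> G r" "G r \<le> B"
  using nonneg bound B_nonneg by (auto simp: G_def split: split_indicator)

definition r0 :: real where "r0 = min (1 / 4) (A * y / 4)"

lemma r0_pos: "0 < r0"
  using A unit_irrD[OF y] by (simp add: r0_def)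

lemma A_le_1: "A \<le> 1"
proof -
  have "A\<^sup>2 * 1 \<le> A\<^sup>2 * (1 + y\<^sup>2)" by (intro mult_left_mono) auto
  hence "A\<^sup>2 \<le> 1\<^sup>2" using AA by simp
  thus ?thesis by (rule power2_le_imp_le) simp
qed

text \<open>The orbit measures the path from centre to centre along the direction; the true path
  omits two half chords of length at most \<open>r\<close>. After multiplication by
  \<open>2 * r\<close> this is at most \<open>4 * r\<^sup>2\<close>, within the modulus of
  continuity for small \<open>r\<close>.\<close>

lemma flight_compare:
  assumes \<delta>: "\<delta> > 0"
  obtains \<rho> where "0 < \<rho>" "\<rho> \<le> r0"
    "\<And>r. 0 < r \<Longrightarrow> r < \<rho> \<Longrightarrow> ennreal (G r) \<le> flow.F (r / A) + ennreal \<delta>"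
    "\<And>r. 0 < r \<Longrightarrow> r < \<rho> \<Longrightarrow> flow.F (r / A) \<le> ennreal (G r) + ennreal \<delta>"
proof -
  obtain \<eta> where \<eta>: "\<eta> > 0" "\<And>S S' h. \<bar>h\<bar> \<le> 1 \<Longrightarrow> \<bar>S - S'\<bar> \<le> \<eta> \<Longrightarrow> \<bar>\<Phi> (S, h) - \<Phi> (S', h)\<bar> \<le> \<delta>"
    using unif[OF \<delta>] by blast
  define \<rho> where "\<rho> = min r0 (sqrt (\<eta> / 4))"
  have \<rho>: "0 < \<rho>" "\<rho> \<le> r0" using \<eta> r0_pos by (auto simp: \<rho>_def)
  have main: "\<exists>a b. G r = a \<and> flow.F (r / A) = ennreal b \<and> \<bar>a - b\<bar> \<le> \<delta> \<and> 0 \<le> b" if r: "0 < r" "r < \<rho>" for r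
  proof -
    have r4: "r \<le> 1 / 4" and ry: "r / A < y / 4"
      using r \<rho> A by (auto simp: r0_def pos_divide_less_eq mult.commute)
    have b: "t * (r / A) < y" if "t \<le> 2" for t
    proof -
      have "t * (r / A) \<le> 2 * (r / A)" using that r A by (intro mult_right_mono) auto
      thus ?thesis using ry unit_irrD[OF y] by linarith
    qed
    have "\<exists>n k. orbit_hit (\<sigma> * h') y n k (r / A)"
    proof (rule orbit_hit_exists[OF \<sigma>h])
      have "(1 - \<sigma> * h') * (r / A) < y" by (rule b) (use \<sigma>h in simp)
      thus "(1 - \<sigma> * h') * (r / A) < 1" using unit_irrD(2)[OF y] by linarith
      show "(1 + \<sigma> * h') * (r / A) < y" by (rule b) (use \<sigma>h in simp)
    qed (use r A in simp)
    then obtain n k where hit: "orbit_hit (\<sigma> * h') y n k (r / A)" by blast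
    obtain p where p: "first_hit r h' \<omega> p" "cross_coord \<omega> p = - \<sigma> * (- 1) ^ n * A * orbit_offset y n k"
      "along_coord \<omega> p = orbit_height y y n k / A"
      by (rule orbit_hit_first_hit[OF h' r(1) hit])
    let ?S = "2 * (r / A) * orbit_height y y n k" and ?h = "orbit_impact (\<sigma> * h') y n k (r / A)"
    let ?c = "half_chord r h' (cross_coord \<omega> p)" and ?d = "half_chord r h' 0"
    have F: "flow.F (r / A) = ennreal (\<Psi> (?S, ?h))" by (rule orbit_flight_eq(1)[OF \<sigma>h hit])
    have imp: "h' - cross_coord \<omega> p / r = \<sigma> * ?h"
      using \<sigma> A r by (auto simp: p(2) orbit_impact_def)
    have \<Psi>: "\<Psi> (?S, ?h) = \<Phi> (?S, \<sigma> * ?h)" using \<sigma> by (auto simp: orient_def flip_def)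
    have S: "2 * r * along_coord \<omega> p = ?S" by (simp add: p(3))
    have G: "G r = \<Phi> (2 * r * (along_coord \<omega> p - ?c - ?d), \<sigma> * ?h)"
      using r r4 transfer_first_hit(1)[OF r(1) r4 h' p(1)] by (simp add: G_def imp)
    have c: "0 \<le> ?c" "?c \<le> r" "0 \<le> ?d" "?d \<le> r"
      using half_chord[of r h' "cross_coord \<omega> p"] half_chord[of r h' 0] p(1) r h'
      by (auto simp: first_hit_def abs_mult mult_left_le)
    have "2 * r * (along_coord \<omega> p - ?c - ?d) - ?S = - (2 * r * (?c + ?d))"
      unfolding S[symmetric] by (simp add: algebra_simps)
    also have "\<bar>\<dots>\<bar> = 2 * r * (?c + ?d)" using r c by simp
    also have "\<dots> \<le> 2 * r * (2 * r)" using r c by (intro mult_left_mono) auto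
    also have "\<dots> = 4 * r\<^sup>2" by (simp add: power2_eq_square)
    also have "\<dots> \<le> \<eta>"
    proof -
      have "r \<le> sqrt (\<eta> / 4)" using r by (simp add: \<rho>_def)
      hence "r\<^sup>2 \<le> (sqrt (\<eta> / 4))\<^sup>2" using r by (intro power_mono) auto
      thus ?thesis using \<eta> by simp
    qed
    finally have "\<bar>\<Phi> (2 * r * (along_coord \<omega> p - ?c - ?d), \<sigma> * ?h) - \<Phi> (?S, \<sigma> * ?h)\<bar> \<le> \<delta>"
      using orbit_impact_bounds(1)[OF \<sigma>h hit] \<sigma> by (intro \<eta>(2)) auto
    thus ?thesis using F \<Psi> G nonneg by auto
  qed
  show ?thesis
  proof (rule that[OF \<rho>])
    fix r assume r: "0 < r" "r < \<rho>"
    obtain a b where ab: "G r = a" "flow.F (r / A) = ennreal b" "\<bar>a - b\<bar> \<le> \<delta>" "0 \<le> b" using main[OF r] by blast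
    have a0: "0 \<le> a" using G_bounds(1)[of r] ab by simp
    have e: "ennreal b + ennreal \<delta> = ennreal (b + \<delta>)" "ennreal a + ennreal \<delta> = ennreal (a + \<delta>)"
      using ab(4) a0 \<delta> by (simp_all add: ennreal_plus)
    show "ennreal (G r) \<le> flow.F (r / A) + ennreal \<delta>" "flow.F (r / A) \<le> ennreal (G r) + ennreal \<delta>"
      unfolding ab(1,2) e using ab(3) by (auto intro!: ennreal_leI)
  qed
qed

definition N :: "real \<Rightarrow> ennreal" where
  "N \<epsilon> = (\<integral>\<^sup>+r. ennreal (G r) * ennreal (1 / r) * indicator {\<epsilon><..} r \<partial>lborel)"

lemma J_scaled: "flow.J (\<epsilon> / A) = (\<integral>\<^sup>+r. flow.F (r / A) * ennreal (1 / r) * indicator {\<epsilon><..} r \<partial>lborel)"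
proof -
  have [measurable]: "flow.F \<in> borel_measurable borel" by (rule orbit_flight_measurable(1)[OF flow.\<Phi>])
  have "(\<integral>\<^sup>+r. flow.F (r / A) * ennreal (1 / r) * indicator {\<epsilon><..} r \<partial>lborel)
    = ennreal \<bar>A\<bar> * (\<integral>\<^sup>+\<rho>. flow.F ((0 + A * \<rho>) / A) * ennreal (1 / (0 + A * \<rho>)) * indicator {\<epsilon><..} (0 + A * \<rho>) \<partial>lborel)"
    by (rule nn_integral_real_affine) (use A in auto)
  also have "\<dots> = (\<integral>\<^sup>+\<rho>. ennreal \<bar>A\<bar> * (flow.F ((0 + A * \<rho>) / A) * ennreal (1 / (0 + A * \<rho>)) * indicator {\<epsilon><..} (0 + A * \<rho>)) \<partial>lborel)"
    by (rule nn_integral_cmult[symmetric]) measurable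
  also have "\<dots> = flow.J (\<epsilon> / A)"
    unfolding log_flight_def
  proof (rule nn_integral_cong)
    fix \<rho> :: real
    have e1: "ennreal A * ennreal (1 / (A * \<rho>)) = ennreal (1 / \<rho>)"
      using A by (subst ennreal_mult'[symmetric]) auto
    have e2: "indicator {\<epsilon><..} (A * \<rho>) = (indicator {\<epsilon> / A<..} \<rho> :: ennreal)"
      using A by (auto simp: pos_divide_less_eq mult.commute split: split_indicator)
    have e3: "a * (b * c * d) = b * (a * c) * d" for a b c d :: ennreal by (simp only: mult_ac)
    have e4: "0 + A * \<rho> = A * \<rho>" "(A * \<rho>) / A = \<rho>" "\<bar>A\<bar> = A" using A by auto
    show "ennreal \<bar>A\<bar> * (flow.F ((0 + A * \<rho>) / A) * ennreal (1 / (0 + A * \<rho>)) * indicator {\<epsilon><..} (0 + A * \<rho>))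
        = flow.F \<rho> * ennreal (1 / \<rho>) * indicator {\<epsilon> / A<..} \<rho>"
      unfolding e3 e4 e1 e2 ..
  qed
  finally show ?thesis ..
qed

text \<open>Radii are split at \<rho> as in the comparison of pasts. The estimate \<open>gen\<close>
  is stated for two functions so that it serves both directions.\<close>

lemma N_compare:
  assumes \<delta>: "\<delta> > 0"
  obtains C where "0 \<le> C" "\<And>\<epsilon>. 0 < \<epsilon> \<Longrightarrow> \<epsilon> \<le> 1 \<Longrightarrow> N \<epsilon> \<le> flow.J (\<epsilon> / A) + ennreal (\<delta> * (- ln \<epsilon>) + C)"
    "\<And>\<epsilon>. 0 < \<epsilon> \<Longrightarrow> \<epsilon> \<le> 1 \<Longrightarrow> flow.J (\<epsilon> / A) \<le> N \<epsilon> + ennreal (\<delta> * (- ln \<epsilon>) + C)"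
proof -
  obtain \<rho> where \<rho>: "0 < \<rho>" "\<rho> \<le> r0"
    "\<And>r. 0 < r \<Longrightarrow> r < \<rho> \<Longrightarrow> ennreal (G r) \<le> flow.F (r / A) + ennreal \<delta>"
    "\<And>r. 0 < r \<Longrightarrow> r < \<rho> \<Longrightarrow> flow.F (r / A) \<le> ennreal (G r) + ennreal \<delta>"
    using flight_compare[OF \<delta>] by blast
  have \<rho>hi: "\<rho> \<le> 1" "\<rho> \<le> hi" using \<rho>(2) lo_hi by (auto simp: r0_def)
  define C where "C = B * ln (hi / \<rho>)"
  have C: "0 \<le> C" unfolding C_def using B_nonneg \<rho> \<rho>hi by (intro mult_nonneg_nonneg ln_ge_zero) auto
  have gen: "(\<integral>\<^sup>+r. a r * ennreal (1 / r) * indicator {\<epsilon><..} r \<partial>lborel)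
     \<le> (\<integral>\<^sup>+r. b r * ennreal (1 / r) * indicator {\<epsilon><..} r \<partial>lborel) + ennreal (\<delta> * (- ln \<epsilon>) + C)"
    if [measurable]: "a \<in> borel_measurable borel" "b \<in> borel_measurable borel"
      and ab: "\<And>r. 0 < r \<Longrightarrow> r < \<rho> \<Longrightarrow> a r \<le> b r + ennreal \<delta>" and aB: "\<And>r. a r \<le> ennreal B"
      and a0: "\<And>r. hi < r \<Longrightarrow> a r = 0" and \<epsilon>: "0 < \<epsilon>" "\<epsilon> \<le> 1" for a b :: "real \<Rightarrow> ennreal" and \<epsilon>
  proof -
    have "(\<integral>\<^sup>+r. a r * ennreal (1 / r) * indicator {\<epsilon><..} r \<partial>lborel)
      \<le> (\<integral>\<^sup>+r. (b r * ennreal (1 / r) * indicator {\<epsilon><..} r + ennreal \<delta> * (ennreal (1 / r) * indicator {\<epsilon>..1} r))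
        + ennreal B * (ennreal (1 / r) * indicator {\<rho>..hi} r) \<partial>lborel)"
    proof (rule nn_integral_mono)
      fix r :: real
      show "a r * ennreal (1 / r) * indicator {\<epsilon><..} r \<le> (b r * ennreal (1 / r) * indicator {\<epsilon><..} r + ennreal \<delta> * (ennreal (1 / r) * indicator {\<epsilon>..1} r))
        + ennreal B * (ennreal (1 / r) * indicator {\<rho>..hi} r)"
      proof (cases "\<epsilon> < r \<and> r \<le> hi")
        case False
        thus ?thesis using a0[of r] by (auto split: split_indicator)
      next
        case True
        show ?thesis
        proof (cases "\<rho> \<le> r")
          case big: True
          have "a r * ennreal (1 / r) \<le> ennreal B * ennreal (1 / r)" by (intro mult_right_mono aB) simp
          thus ?thesis using True big by (simp add: add_increasing)
        next
          case False
          have "a r * ennreal (1 / r) \<le> (b r + ennreal \<delta>) * ennreal (1 / r)"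
            using True False \<epsilon> by (intro mult_right_mono ab) auto
          thus ?thesis using True False \<rho>hi by (simp add: distrib_right add_increasing2)
        qed
      qed
    qed
    also have "\<dots> = (\<integral>\<^sup>+r. b r * ennreal (1 / r) * indicator {\<epsilon><..} r + ennreal \<delta> * (ennreal (1 / r) * indicator {\<epsilon>..1} r) \<partial>lborel)
        + (\<integral>\<^sup>+r. ennreal B * (ennreal (1 / r) * indicator {\<rho>..hi} r) \<partial>lborel)"
      by (rule nn_integral_add) measurable
    also have "(\<integral>\<^sup>+r. b r * ennreal (1 / r) * indicator {\<epsilon><..} r + ennreal \<delta> * (ennreal (1 / r) * indicator {\<epsilon>..1} r) \<partial>lborel)
      = (\<integral>\<^sup>+r. b r * ennreal (1 / r) * indicator {\<epsilon><..} r \<partial>lborel) + (\<integral>\<^sup>+r. ennreal \<delta> * (ennreal (1 / r) * indicator {\<epsilon>..1} r) \<partial>lborel)"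
      by (rule nn_integral_add) measurable
    also have "(\<integral>\<^sup>+r. ennreal \<delta> * (ennreal (1 / r) * indicator {\<epsilon>..1} r) \<partial>lborel) = ennreal (\<delta> * (- ln \<epsilon>))"
      using \<epsilon> \<delta> by (subst nn_integral_cmult) (auto simp: nn_integral_inverse_Icc ennreal_mult'[symmetric] ln_div)
    also have "(\<integral>\<^sup>+r. ennreal B * (ennreal (1 / r) * indicator {\<rho>..hi} r) \<partial>lborel) = ennreal C"
      using \<rho> \<rho>hi B_nonneg unfolding C_def by (subst nn_integral_cmult) (auto simp: nn_integral_inverse_Icc ennreal_mult')
    finally show ?thesis using C \<epsilon> \<delta> by (simp add: add.assoc ennreal_plus[symmetric] mult_nonneg_nonpos del: ennreal_plus)
  qed
  have [measurable]: "flow.F \<in> borel_measurable borel" by (rule orbit_flight_measurable(1)[OF flow.\<Phi>])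
  have Fm: "(\<lambda>r. flow.F (r / A)) \<in> borel_measurable borel" by measurable
  show ?thesis
  proof (rule that[OF C])
    fix \<epsilon> :: real assume \<epsilon>: "0 < \<epsilon>" "\<epsilon> \<le> 1"
    show "N \<epsilon> \<le> flow.J (\<epsilon> / A) + ennreal (\<delta> * (- ln \<epsilon>) + C)"
      unfolding N_def J_scaled
    proof (rule gen[OF _ Fm _ _ _ \<epsilon>])
      show "ennreal (G r) \<le> ennreal B" for r by (intro ennreal_leI G_bounds)
      show "ennreal (G r) = 0" if "hi < r" for r using that lo_hi by (simp add: G_def)
    qed (use \<rho> in auto)
    show "flow.J (\<epsilon> / A) \<le> N \<epsilon> + ennreal (\<delta> * (- ln \<epsilon>) + C)"
      unfolding N_def J_scaled
    proof (rule gen[OF Fm _ _ _ _ \<epsilon>])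
      show "flow.F (r / A) = 0" if "hi < r" for r
      proof (rule flow.F_outside)
        have "r * A \<le> r * 1" using A_le_1 that lo_hi by (intro mult_left_mono) auto
        hence "r \<le> r / A" using A by (simp add: pos_le_divide_eq)
        thus "S0 < r / A" using that lo_hi by linarith
      qed
    qed (use \<rho> flow.F_le_B in auto)
  qed
qed

end

context lattice_orbit_test
begin

lemma N_finite: "0 < \<epsilon> \<Longrightarrow> N \<epsilon> < \<infinity>"
proof -
  assume \<epsilon>: "0 < \<epsilon>"
  have "N \<epsilon> \<le> N (min \<epsilon> 1)"
    unfolding N_def by (intro nn_integral_mono mult_left_mono) (auto split: split_indicator)
  also obtain C where "0 \<le> C" "\<And>\<epsilon>. 0 < \<epsilon> \<Longrightarrow> \<epsilon> \<le> 1 \<Longrightarrow> N \<epsilon> \<le> flow.J (\<epsilon> / A) + ennreal (1 * (- ln \<epsilon>) + C)"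
    using N_compare[of 1] by (metis zero_less_one)
  hence "N (min \<epsilon> 1) \<le> flow.J (min \<epsilon> 1 / A) + ennreal (1 * (- ln (min \<epsilon> 1)) + C)" using \<epsilon> by auto
  also have "\<dots> < \<infinity>" using flow.J_finite[of "min \<epsilon> 1 / A"] \<epsilon> A by simp
  finally show ?thesis .
qed

lemma transfer_integrand:
  assumes "0 < \<epsilon>"
  shows "(\<lambda>r. indicator {\<epsilon>..1/4} r *\<^sub>R (\<Phi> (transfer r h' \<omega>) / r)) = (\<lambda>r. G r / r * indicator {\<epsilon>..} r)"
  using assms by (auto simp: fun_eq_iff G_def split: split_indicator)

lemma nn_integral_transfer:
  assumes \<epsilon>: "0 < \<epsilon>"
  shows "(\<integral>\<^sup>+r. ennreal (indicator {\<epsilon>..1/4} r *\<^sub>R (\<Phi> (transfer r h' \<omega>) / r)) \<partial>lborel) = N \<epsilon>"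
  unfolding N_def
proof (rule nn_integral_cong_AE, rule AE_mp[OF AE_lborel_singleton[of \<epsilon>]], rule AE_I2, rule impI)
  fix r :: real assume r: "r \<noteq> \<epsilon>"
  have "indicator {\<epsilon>..1/4} r *\<^sub>R (\<Phi> (transfer r h' \<omega>) / r) = G r * (1 / r) * indicator {\<epsilon><..} r"
    using \<epsilon> r by (auto simp: G_def split: split_indicator)
  thus "ennreal (indicator {\<epsilon>..1/4} r *\<^sub>R (\<Phi> (transfer r h' \<omega>) / r)) = ennreal (G r) * ennreal (1 / r) * indicator {\<epsilon><..} r"
    using \<epsilon> G_bounds(1)[of r] by (cases "\<epsilon> < r") (auto simp: ennreal_mult'[symmetric])
qed

lemma transfer_integrable:
  assumes \<epsilon>: "0 < \<epsilon>"
  shows "set_integrable lborel {\<epsilon>..1/4} (\<lambda>r. \<Phi> (transfer r h' \<omega>) / r)"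
    and "(LINT r:{\<epsilon>..1/4}|lborel. \<Phi> (transfer r h' \<omega>) / r) = enn2real (N \<epsilon>)"
proof -
  have m: "(\<lambda>r. indicator {\<epsilon>..1/4} r *\<^sub>R (\<Phi> (transfer r h' \<omega>) / r)) \<in> borel_measurable lborel"
    unfolding transfer_integrand[OF \<epsilon>] by measurable
  have nn: "AE r in lborel. 0 \<le> indicator {\<epsilon>..1/4} r *\<^sub>R (\<Phi> (transfer r h' \<omega>) / r)"
    using \<epsilon> nonneg by (intro AE_I2) (auto split: split_indicator)
  show "set_integrable lborel {\<epsilon>..1/4} (\<lambda>r. \<Phi> (transfer r h' \<omega>) / r)"
    unfolding set_integrable_def
    by (rule integrableI_nonneg[OF m nn]) (use N_finite[OF \<epsilon>] in \<open>simp only: nn_integral_transfer[OF \<epsilon>]\<close>)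
  show "(LINT r:{\<epsilon>..1/4}|lborel. \<Phi> (transfer r h' \<omega>) / r) = enn2real (N \<epsilon>)"
    unfolding set_lebesgue_integral_def
    by (subst integral_eq_nn_integral[OF m nn]) (simp only: nn_integral_transfer[OF \<epsilon>])
qed

lemma N_compare_real:
  assumes \<delta>: "\<delta> > 0"
  obtains C where "\<And>\<epsilon>. 0 < \<epsilon> \<Longrightarrow> \<epsilon> \<le> 1 \<Longrightarrow> \<bar>enn2real (N \<epsilon>) - flow.j (\<epsilon> / A)\<bar> \<le> \<delta> * (- ln \<epsilon>) + C"
proof -
  obtain C where C: "0 \<le> C" "\<And>\<epsilon>. 0 < \<epsilon> \<Longrightarrow> \<epsilon> \<le> 1 \<Longrightarrow> N \<epsilon> \<le> flow.J (\<epsilon> / A) + ennreal (\<delta> * (- ln \<epsilon>) + C)"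
    "\<And>\<epsilon>. 0 < \<epsilon> \<Longrightarrow> \<epsilon> \<le> 1 \<Longrightarrow> flow.J (\<epsilon> / A) \<le> N \<epsilon> + ennreal (\<delta> * (- ln \<epsilon>) + C)"
    using N_compare[OF \<delta>] by blast
  show ?thesis
  proof (rule that[of C])
    fix \<epsilon> :: real assume \<epsilon>: "0 < \<epsilon>" "\<epsilon> \<le> 1"
    define n j t where "n = enn2real (N \<epsilon>)" and "j = flow.j (\<epsilon> / A)" and "t = \<delta> * (- ln \<epsilon>) + C"
    have "0 \<le> \<delta> * (- ln \<epsilon>)" using \<epsilon> \<delta> by (intro mult_nonneg_nonneg) auto
    hence t: "0 \<le> t" using C(1) by (simp add: t_def)
    have e: "N \<epsilon> = ennreal n" "flow.J (\<epsilon> / A) = ennreal j"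
      using N_finite[OF \<epsilon>(1)] flow.J_finite[of "\<epsilon> / A"] \<epsilon> A by (simp_all add: n_def j_def flow.j_def)
    have nn: "0 \<le> n" "0 \<le> j" by (simp_all add: n_def j_def flow.j_def)
    have "n \<le> j + t" using C(2)[OF \<epsilon>, folded t_def] unfolding e
      using nn t by (simp add: ennreal_plus[symmetric] del: ennreal_plus)
    moreover have "j \<le> n + t" using C(3)[OF \<epsilon>, folded t_def] unfolding e
      using nn t by (simp add: ennreal_plus[symmetric] del: ennreal_plus)
    ultimately show "\<bar>n - j\<bar> \<le> t" by linarith
  qed
qed

text \<open>Scaling by \<open>A\<close> replaces \<open>ln \<epsilon>\<close> by
  \<open>ln (\<epsilon> / A)\<close>, and their quotient tends to 1. The error
  \<open>\<delta> * (- ln \<epsilon>) + C\<close> with arbitrary \<delta> vanishes after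
  normalisation.\<close>

theorem log_average_limit:
  assumes lim: "((\<lambda>\<epsilon>. enn2real (flow.J \<epsilon>) / - ln \<epsilon>) \<longlongrightarrow> L) (at_right 0)"
  shows "((\<lambda>\<epsilon>. (1 / \<bar>ln \<epsilon>\<bar>) * (LINT r:{\<epsilon>..1/4}|lborel. \<Phi> (transfer r h' \<omega>) / r)) \<longlongrightarrow> L) (at_right 0)"
proof -
  have small: "\<forall>\<^sub>F \<epsilon> in at_right (0::real). 0 < \<epsilon> \<and> \<epsilon> < b" if "0 < b" for b
    using that by (auto simp: eventually_at_right_field)
  have ln_top: "LIM \<epsilon> at_right (0::real). - ln \<epsilon> :> at_top"
    by (subst filterlim_uminus_at_top) (simp add: ln_at_0)
  have sc: "filterlim (\<lambda>\<epsilon>. \<epsilon> / A) (at_right 0) (at_right 0)"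
    unfolding filterlim_at
  proof
    show "((\<lambda>\<epsilon>. \<epsilon> / A) \<longlongrightarrow> 0) (at_right 0)" using A by (auto intro!: tendsto_eq_intros)
    show "\<forall>\<^sub>F \<epsilon> in at_right 0. \<epsilon> / A \<in> {0<..} \<and> \<epsilon> / A \<noteq> 0"
      using small[OF zero_less_one] A by (auto elim!: eventually_mono)
  qed
  have l1: "((\<lambda>\<epsilon>. flow.j (\<epsilon> / A) / - ln (\<epsilon> / A)) \<longlongrightarrow> L) (at_right 0)"
    using filterlim_compose[OF lim sc] by (simp add: flow.j_def)
  have "((\<lambda>\<epsilon>. 1 + ln A / - ln \<epsilon>) \<longlongrightarrow> 1 + 0) (at_right 0)"
    by (intro tendsto_add tendsto_const tendsto_divide_0[OF tendsto_const] filterlim_at_top_imp_at_infinity ln_top)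
  moreover have "\<forall>\<^sub>F \<epsilon> in at_right 0. 1 + ln A / - ln \<epsilon> = ln (\<epsilon> / A) / ln \<epsilon>"
    using small[OF zero_less_one] by eventually_elim (use A in \<open>simp add: ln_div diff_divide_distrib\<close>)
  ultimately have l2: "((\<lambda>\<epsilon>. ln (\<epsilon> / A) / ln \<epsilon>) \<longlongrightarrow> 1) (at_right 0)"
    by (simp add: tendsto_cong)
  have ev: "\<forall>\<^sub>F \<epsilon> in at_right 0. flow.j (\<epsilon> / A) / - ln (\<epsilon> / A) * (ln (\<epsilon> / A) / ln \<epsilon>) = flow.j (\<epsilon> / A) / - ln \<epsilon>"
  proof -
    have "\<forall>\<^sub>F \<epsilon> in at_right (0::real). 0 < \<epsilon> \<and> \<epsilon> < min 1 A" by (rule small) (use A in simp)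
    thus ?thesis
    proof eventually_elim
      case (elim \<epsilon>)
      hence "\<epsilon> / A < 1" "0 < \<epsilon> / A" using A by auto
      hence "ln (\<epsilon> / A) < 0" by (intro ln_less_zero)
      moreover have "b / - p * (p / q) = b / - q" if "p < 0" for b p q :: real using that by simp
      ultimately show ?case by blast
    qed
  qed
  have l3: "((\<lambda>\<epsilon>. flow.j (\<epsilon> / A) / - ln \<epsilon>) \<longlongrightarrow> L) (at_right 0)"
    using Lim_transform_eventually[OF tendsto_mult[OF l1 l2] ev] by (simp only: mult_1_right)
  have "((\<lambda>\<epsilon>. (enn2real (N \<epsilon>) - flow.j (\<epsilon> / A)) / - ln \<epsilon>) \<longlongrightarrow> 0) (at_right 0)"
  proof (rule tendstoI)
    fix e :: real assume e: "e > 0"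
    obtain C where C: "\<And>\<epsilon>. 0 < \<epsilon> \<Longrightarrow> \<epsilon> \<le> 1 \<Longrightarrow> \<bar>enn2real (N \<epsilon>) - flow.j (\<epsilon> / A)\<bar> \<le> e / 2 * (- ln \<epsilon>) + C"
      using N_compare_real[of "e / 2"] e by (metis half_gt_zero)
    have "\<forall>\<^sub>F \<epsilon> in at_right (0::real). 2 * \<bar>C\<bar> / e < - ln \<epsilon>"
      using ln_top by (simp add: filterlim_at_top_dense)
    thus "\<forall>\<^sub>F \<epsilon> in at_right 0. dist ((enn2real (N \<epsilon>) - flow.j (\<epsilon> / A)) / - ln \<epsilon>) 0 < e"
      using small[OF zero_less_one]
    proof eventually_elim
      case (elim \<epsilon>)
      have l: "0 < - ln \<epsilon>" using elim by simp
      have "\<bar>C\<bar> < e / 2 * (- ln \<epsilon>)" using mult_strict_left_mono[OF elim(1), of "e / 2"] e by simp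
      hence "\<bar>enn2real (N \<epsilon>) - flow.j (\<epsilon> / A)\<bar> < e * (- ln \<epsilon>)" using C[of \<epsilon>] elim by (simp add: abs_if split: if_splits)
      hence "\<bar>enn2real (N \<epsilon>) - flow.j (\<epsilon> / A)\<bar> / (- ln \<epsilon>) < e" using l by (simp only: pos_divide_less_eq)
      thus ?case using l by (simp only: dist_real_def abs_divide) simp
    qed
  qed
  from tendsto_add[OF this l3]
  have "((\<lambda>\<epsilon>. enn2real (N \<epsilon>) / - ln \<epsilon>) \<longlongrightarrow> L) (at_right 0)"
    by (simp add: diff_divide_distrib)
  moreover have "\<forall>\<^sub>F \<epsilon> in at_right 0. enn2real (N \<epsilon>) / - ln \<epsilon>
      = (1 / \<bar>ln \<epsilon>\<bar>) * (LINT r:{\<epsilon>..1/4}|lborel. \<Phi> (transfer r h' \<omega>) / r)"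
    using small[OF zero_less_one]
  proof eventually_elim
    case (elim \<epsilon>)
    thus ?case using transfer_integrable(2)[of \<epsilon>] by (simp add: abs_of_neg)
  qed
  ultimately show ?thesis by (rule Lim_transform_eventually)
qed

end

section \<open>The limit for almost every direction\<close>

text \<open>Bad angles are multiples of \<open>pi / 2\<close> or translates by multiples of
  \<open>pi\<close> of \<open>arctan\<close> of a null set \<open>Z\<close>. Differentiable maps
  send null sets to null sets, and countably many translates suffice.\<close>

lemma AE_direction:
  assumes Q: "AE y in lborel. 0 < y \<and> y < 1 \<longrightarrow> Q (y :: real)"
  shows "AE \<theta> in lborel. 0 < \<bar>cos \<theta>\<bar> \<and> 0 < \<bar>sin \<theta>\<bar> \<and> \<bar>cos \<theta>\<bar> \<noteq> \<bar>sin \<theta>\<bar> \<and>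
    Q (min \<bar>cos \<theta>\<bar> \<bar>sin \<theta>\<bar> / max \<bar>cos \<theta>\<bar> \<bar>sin \<theta>\<bar>)"
proof -
  define W where "W = {y. 0 < y \<and> y < 1 \<and> \<not> Q y}"
  obtain M where M: "\<And>y. y \<in> space lborel - M \<Longrightarrow> 0 < y \<and> y < 1 \<longrightarrow> Q y" "M \<in> null_sets lborel"
    using AE_E3[OF Q] by blast
  have "negligible M" using M(2) by (simp add: negligible_iff_null_sets null_sets_completionI)
  moreover have "W \<subseteq> M" using M(1) by (auto simp: W_def)
  ultimately have W: "negligible W" by (rule negligible_subset)
  have W1: "negligible (uminus ` W)"
    by (rule negligible_differentiable_image_negligible[OF order_refl W])
       (auto simp: differentiable_on_def intro!: derivative_intros)
  have W2: "negligible ((\<lambda>x. 1 / x) ` W)"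
    by (rule negligible_differentiable_image_negligible[OF order_refl W])
       (auto simp: W_def differentiable_on_def intro!: derivative_intros)
  have W3: "negligible (uminus ` (\<lambda>x. 1 / x) ` W)"
    by (rule negligible_differentiable_image_negligible[OF order_refl W2])
       (auto simp: differentiable_on_def intro!: derivative_intros)
  \<comment> \<open>The three points exclude axes and diagonals; the four copies of \<open>W\<close>
    cover both signs of the tangent and both orders of \<open>\<bar>cos \<theta>\<bar>\<close> and
    \<open>\<bar>sin \<theta>\<bar>\<close>.\<close>
  define Z where "Z = {0, 1, -1} \<union> W \<union> uminus ` W \<union> (\<lambda>x. 1 / x) ` W \<union> uminus ` (\<lambda>x. 1 / x) ` W"
  have Z: "negligible Z"
    unfolding Z_def by (intro negligible_Un W W1 W2 W3 negligible_finite) simp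
  define T where "T = range (\<lambda>i::int. of_int i * (pi / 2)) \<union> (\<Union>k::int. (\<lambda>x. arctan x + of_int k * pi) ` Z)"
  have T: "negligible T"
    unfolding T_def
  proof (intro negligible_Un negligible_countable_Union)
    show "negligible (range (\<lambda>i::int. of_int i * (pi / 2)))"
      by (simp add: negligible_iff_null_sets null_sets_completionI countable_imp_null_set_lborel)
    fix S assume "S \<in> range (\<lambda>k::int. (\<lambda>x. arctan x + of_int k * pi) ` Z)"
    then obtain k :: int where k: "S = (\<lambda>x. arctan x + of_int k * pi) ` Z" by blast
    show "negligible S" unfolding k
    proof (rule negligible_differentiable_image_negligible[OF order_refl Z])
      have "((\<lambda>x. arctan x + of_int k * pi) has_real_derivative inverse (1 + x\<^sup>2)) (at x within Z)" for x
        by (auto intro!: derivative_eq_intros)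
      thus "(\<lambda>x. arctan x + of_int k * pi) differentiable_on Z"
        unfolding differentiable_on_def real_differentiable_def by blast
    qed
  qed auto
  have "AE \<theta> in lebesgue. \<theta> \<notin> T" using T by (intro AE_not_in) (simp add: negligible_iff_null_sets)
  hence "AE \<theta> in lborel. \<theta> \<notin> T" by (simp add: AE_completion_iff)
  thus ?thesis
  proof (rule eventually_mono)
    fix \<theta> assume \<theta>: "\<theta> \<notin> T"
    define a b x where "a = \<bar>cos \<theta>\<bar>" and "b = \<bar>sin \<theta>\<bar>" and "x = tan \<theta>"
    have c: "cos \<theta> \<noteq> 0"
    proof
      assume "cos \<theta> = 0"
      then obtain i :: int where "\<theta> = of_int i * (pi / 2)" using cos_zero_iff_int by blast
      thus False using \<theta> by (auto simp: T_def)
    qed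
    obtain k :: int where k: "arctan x = \<theta> - of_int k * pi"
      unfolding x_def by (rule arctan_tan_eq_abs_pi[OF c])
    have xZ: "x \<notin> Z"
    proof
      assume "x \<in> Z"
      hence "arctan x + of_int k * pi \<in> T" unfolding T_def by blast
      thus False using \<theta> k by simp
    qed
    have x01: "x \<noteq> 0" "x \<noteq> 1" "x \<noteq> -1" "x \<notin> W" using xZ by (auto simp: Z_def)
    have "- x \<notin> W" using xZ unfolding Z_def by (metis UnI1 UnI2 image_eqI minus_minus)
    moreover have i: "1 / x \<notin> W"
    proof
      assume "1 / x \<in> W"
      hence "1 / (1 / x) \<in> (\<lambda>x. 1 / x) ` W" by (rule imageI)
      thus False using xZ by (simp add: Z_def)
    qed
    moreover have "- (1 / x) \<notin> W"
    proof
      assume "- (1 / x) \<in> W"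
      hence "- (1 / (- (1 / x))) \<in> uminus ` (\<lambda>x. 1 / x) ` W" by (intro imageI)
      thus False using xZ by (simp add: Z_def)
    qed
    ultimately have t: "\<bar>x\<bar> \<notin> W" "1 / \<bar>x\<bar> \<notin> W" using x01(4) i by (auto simp: abs_if)
    have xt: "\<bar>x\<bar> = b / a" by (simp add: x_def tan_def a_def b_def)
    have a: "0 < a" using c by (simp add: a_def)
    have b: "0 < b" using x01(1) c by (auto simp: x_def tan_def b_def)
    have ab: "a \<noteq> b"
    proof
      assume "a = b"
      hence "\<bar>x\<bar> = 1" using xt a by simp
      thus False using x01 by (auto simp: abs_if split: if_splits)
    qed
    have "Q (min a b / max a b)"
    proof (cases "b < a")
      case True
      hence "0 < b / a" "b / a < 1" using a b by auto
      hence "Q (b / a)" using t(1) xt by (simp add: W_def)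
      thus ?thesis using True by (simp add: min_def max_def)
    next
      case False
      hence "0 < a / b" "a / b < 1" using a b ab by auto
      moreover have "1 / \<bar>x\<bar> = a / b" using xt by simp
      ultimately have "Q (a / b)" using t(2) by (simp add: W_def)
      thus ?thesis using False ab by (simp add: min_def max_def)
    qed
    thus "0 < \<bar>cos \<theta>\<bar> \<and> 0 < \<bar>sin \<theta>\<bar> \<and> \<bar>cos \<theta>\<bar> \<noteq> \<bar>sin \<theta>\<bar> \<and>
      Q (min \<bar>cos \<theta>\<bar> \<bar>sin \<theta>\<bar> / max \<bar>cos \<theta>\<bar> \<bar>sin \<theta>\<bar>)"
      using a b ab by (simp add: a_def b_def)
  qed
qed

text \<open>Here \<open>e\<close> is the signed unit vector along the smaller component of the
  direction and \<open>f\<close> the one along the larger. The signs make both heights positive, and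
  \<sigma> is then forced by the side on which \<open>e\<close> lies.\<close>

lemma lattice_orbit_exists:
  fixes c s :: real
  assumes unit: "c\<^sup>2 + s\<^sup>2 = 1" and pos: "0 < \<bar>c\<bar>" "0 < \<bar>s\<bar>" and ne: "\<bar>c\<bar> \<noteq> \<bar>s\<bar>"
    and y: "min \<bar>c\<bar> \<bar>s\<bar> / max \<bar>c\<bar> \<bar>s\<bar> \<in> unit_irr"
  shows "\<exists>\<sigma> A e f. lattice_orbit (c, s) \<sigma> A (min \<bar>c\<bar> \<bar>s\<bar> / max \<bar>c\<bar> \<bar>s\<bar>) e f"
proof -
  have sg: "sgn c \<in> \<int>" "sgn s \<in> \<int>" "\<bar>sgn c * sgn s\<bar> = 1" "sgn c * sgn s = 1 \<or> sgn c * sgn s = -1"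
    "c = sgn c * \<bar>c\<bar>" "s = sgn s * \<bar>s\<bar>" "sgn c * c = \<bar>c\<bar>" "sgn s * s = \<bar>s\<bar>"
    using pos by (auto simp: sgn_if abs_if)
  show ?thesis
  proof (cases "\<bar>s\<bar> < \<bar>c\<bar>")
    case True
    hence m: "min \<bar>c\<bar> \<bar>s\<bar> / max \<bar>c\<bar> \<bar>s\<bar> = \<bar>s\<bar> / \<bar>c\<bar>" by simp
    have "lattice_orbit (c, s) (sgn c * sgn s) \<bar>c\<bar> (\<bar>s\<bar> / \<bar>c\<bar>) (0, sgn s) (sgn c, 0)"
    proof
      show "\<bar>c\<bar>\<^sup>2 * (1 + (\<bar>s\<bar> / \<bar>c\<bar>)\<^sup>2) = 1" using unit pos by (simp add: power_divide distrib_left)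
      show "lattice_basis (0, sgn s) (sgn c, 0)" using sg by (simp add: lattice_basis_def lattice_iff abs_mult mult.commute)
      show "cross_coord (c, s) (0, sgn s) = - (sgn c * sgn s) * \<bar>c\<bar>"
        using sg(5) by (simp add: cross_coord_def)
      show "cross_coord (c, s) (sgn c, 0) = sgn c * sgn s * \<bar>c\<bar> * (\<bar>s\<bar> / \<bar>c\<bar>)"
        using sg(6) pos by (simp add: cross_coord_def)
    qed (use unit pos y[unfolded m] sg(4,7,8) in \<open>simp_all add: along_coord_def mult.commute\<close>)
    thus ?thesis unfolding m by blast
  next
    case False
    hence m: "min \<bar>c\<bar> \<bar>s\<bar> / max \<bar>c\<bar> \<bar>s\<bar> = \<bar>c\<bar> / \<bar>s\<bar>" using ne by (simp add: min_def max_def)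
    have "lattice_orbit (c, s) (- (sgn c * sgn s)) \<bar>s\<bar> (\<bar>c\<bar> / \<bar>s\<bar>) (sgn c, 0) (0, sgn s)"
    proof
      show "\<bar>s\<bar>\<^sup>2 * (1 + (\<bar>c\<bar> / \<bar>s\<bar>)\<^sup>2) = 1" using unit pos by (simp add: power_divide distrib_left add.commute)
      show "lattice_basis (sgn c, 0) (0, sgn s)" using sg by (simp add: lattice_basis_def lattice_iff abs_mult)
      show "cross_coord (c, s) (sgn c, 0) = - (- (sgn c * sgn s)) * \<bar>s\<bar>"
        using sg(6) by (simp add: cross_coord_def)
      show "cross_coord (c, s) (0, sgn s) = - (sgn c * sgn s) * \<bar>s\<bar> * (\<bar>c\<bar> / \<bar>s\<bar>)"
        using sg(5) pos by (simp add: cross_coord_def)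
      show "- (sgn c * sgn s) = 1 \<or> - (sgn c * sgn s) = - 1" using sg(4) by auto
    qed (use unit pos y[unfolded m] sg(4,7,8) in \<open>simp_all add: along_coord_def mult.commute\<close>)
    thus ?thesis unfolding m by blast
  qed
qed

lemma flip_flip[simp]: "flip (flip \<Phi>) = \<Phi>"
  by (auto simp: flip_def)

context test_function
begin

abbreviation "impact_domain \<equiv> {0<..} \<times> {-1..1::real}"

lemma log_average_direction:
  fixes \<theta> :: real
  defines "y \<equiv> min \<bar>cos \<theta>\<bar> \<bar>sin \<theta>\<bar> / max \<bar>cos \<theta>\<bar> \<bar>sin \<theta>\<bar>"
  assumes h': "\<bar>h'\<bar> \<le> 1"
    and nz: "0 < \<bar>cos \<theta>\<bar>" "0 < \<bar>sin \<theta>\<bar>" "\<bar>cos \<theta>\<bar> \<noteq> \<bar>sin \<theta>\<bar>" and yi: "y \<in> unit_irr"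
    and lim: "((\<lambda>\<epsilon>. enn2real (log_flight \<Phi> h' y y \<epsilon>) / - ln \<epsilon>) \<longlongrightarrow> L) (at_right 0)"
      "((\<lambda>\<epsilon>. enn2real (log_flight (flip \<Phi>) (- h') y y \<epsilon>) / - ln \<epsilon>) \<longlongrightarrow> L) (at_right 0)"
  shows "((\<lambda>\<epsilon>. (1 / \<bar>ln \<epsilon>\<bar>) * (LINT r:{\<epsilon>..1/4}|lborel. \<Phi> (transfer r h' (dir \<theta>)) / r)) \<longlongrightarrow> L) (at_right 0)"
    and "0 < \<epsilon> \<Longrightarrow> set_integrable lborel {\<epsilon>..1/4} (\<lambda>r. \<Phi> (transfer r h' (dir \<theta>)) / r)"
    and "0 < r \<Longrightarrow> r \<le> 1 / 4 \<Longrightarrow> transfer r h' (dir \<theta>) \<in> impact_domain"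
proof -
  have "\<exists>\<sigma> A e f. lattice_orbit (dir \<theta>) \<sigma> A y e f"
    unfolding dir_def y_def by (rule lattice_orbit_exists[OF _ nz]) (use yi in \<open>simp_all add: y_def\<close>)
  then obtain \<sigma> A e f where lo: "lattice_orbit (dir \<theta>) \<sigma> A y e f" by blast
  interpret lattice_orbit_test "dir \<theta>" \<sigma> A y e f \<Phi> s0 S0 B h'
    by (intro lattice_orbit_test.intro lattice_orbit_test_axioms.intro lo h' test_function_axioms)
  have lim': "((\<lambda>\<epsilon>. enn2real (flow.J \<epsilon>) / - ln \<epsilon>) \<longlongrightarrow> L) (at_right 0)"
  proof (cases "\<sigma> = 1")
    case True
    show ?thesis using lim(1) unfolding orient_def True by (simp only: if_True mult_1_left simp_thms)
  next
    case False
    hence \<sigma>1: "\<sigma> = -1" using \<sigma> by blast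
    have "(-1::real) \<noteq> 1" by simp
    thus ?thesis using lim(2) unfolding orient_def \<sigma>1 by (simp only: if_False mult_minus1)
  qed
  show "((\<lambda>\<epsilon>. (1 / \<bar>ln \<epsilon>\<bar>) * (LINT r:{\<epsilon>..1/4}|lborel. \<Phi> (transfer r h' (dir \<theta>)) / r)) \<longlongrightarrow> L) (at_right 0)"
    by (rule log_average_limit[OF lim'])
  show "set_integrable lborel {\<epsilon>..1/4} (\<lambda>r. \<Phi> (transfer r h' (dir \<theta>)) / r)" if "0 < \<epsilon>"
    by (rule transfer_integrable(1)[OF that])
  show "transfer r h' (dir \<theta>) \<in> impact_domain" if r: "0 < r" "r \<le> 1 / 4"
  proof -
    obtain p where p: "first_hit r h' (dir \<theta>) p" using first_hit_exists[OF h' r(1)] by blast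
    have "\<bar>h' - cross_coord (dir \<theta>) p / r\<bar> = \<bar>r * h' - cross_coord (dir \<theta>) p\<bar> / r"
      using r by (simp add: abs_if field_simps)
    also have "\<dots> \<le> 1" using p r by (simp add: first_hit_def divide_le_eq)
    finally show ?thesis using transfer_first_hit[OF r h' p] r by (auto simp: abs_le_iff)
  qed
qed

text \<open>Directions with \<open>\<sigma> = -1\<close> see the mirror image, so the limit is
  needed both for \<Phi> with \<open>h'\<close> and for the reflected pair. The two summands of
  \<open>mean_value\<close> trade places under the reflection, so the limits agree.\<close>

theorem log_average_AE:
  assumes h': "\<bar>h'\<bar> \<le> 1"
  shows "AE \<theta> in lborel.
    ((\<lambda>\<epsilon>. (1 / \<bar>ln \<epsilon>\<bar>) * (LINT r:{\<epsilon>..1/4}|lborel. \<Phi> (transfer r h' (dir \<theta>)) / r)) \<longlongrightarrow> mean_value h' / (pi\<^sup>2 / 6)) (at_right 0)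
    \<and> (\<forall>\<epsilon>>0. set_integrable lborel {\<epsilon>..1/4} (\<lambda>r. \<Phi> (transfer r h' (dir \<theta>)) / r))
    \<and> (\<forall>r. 0 < r \<longrightarrow> r \<le> 1 / 4 \<longrightarrow> transfer r h' (dir \<theta>) \<in> impact_domain)"
proof -
  interpret fl: test_function "flip \<Phi>" s0 S0 B by (rule test_function_flip) unfold_locales
  let ?lim = "\<lambda>\<Phi> h y. ((\<lambda>\<epsilon>. enn2real (log_flight \<Phi> h y y \<epsilon>) / - ln \<epsilon>) \<longlongrightarrow> mean_value h' / (pi\<^sup>2 / 6)) (at_right 0)"
  define Q where "Q y \<longleftrightarrow> y \<in> unit_irr \<and> ?lim \<Phi> h' y \<and> ?lim (flip \<Phi>) (- h') y" for y
  have h'': "\<bar>- h'\<bar> \<le> 1" using h' by simp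
  have fm: "fl.mean_value (- h') = mean_value h'"
    by (simp add: fl.mean_value_def mean_value_def)
  have "AE y in lborel. 0 < y \<and> y < 1 \<longrightarrow> Q y"
    using log_flight_limit[OF h'] fl.log_flight_limit[OF h''] AE_unit_irr
  proof eventually_elim
    case (elim y)
    show ?case
    proof
      assume y: "0 < y \<and> y < 1"
      have "y \<in> unit_irr" using elim(3) y by blast
      moreover have "?lim \<Phi> h' y" using elim(1) y by blast
      moreover have "?lim (flip \<Phi>) (- h') y" using elim(2) y unfolding fm by blast
      ultimately show "Q y" unfolding Q_def by blast
    qed
  qed
  hence "AE \<theta> in lborel. 0 < \<bar>cos \<theta>\<bar> \<and> 0 < \<bar>sin \<theta>\<bar> \<and> \<bar>cos \<theta>\<bar> \<noteq> \<bar>sin \<theta>\<bar> \<and>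
    Q (min \<bar>cos \<theta>\<bar> \<bar>sin \<theta>\<bar> / max \<bar>cos \<theta>\<bar> \<bar>sin \<theta>\<bar>)" by (rule AE_direction)
  thus ?thesis
  proof eventually_elim
    case (elim \<theta>)
    note Q = elim[unfolded Q_def, THEN conjunct2, THEN conjunct2, THEN conjunct2]
    note * = log_average_direction[OF h' conjunct1[OF elim] conjunct1[OF conjunct2[OF elim]]
        conjunct1[OF conjunct2[OF conjunct2[OF elim]]] conjunct1[OF Q] conjunct1[OF conjunct2[OF Q]] conjunct2[OF conjunct2[OF Q]]]
    show ?case by (intro conjI allI impI *)
  qed
qed

section \<open>The limit as an integral against the kernel\<close>

lemma Pker_nonneg: "0 \<le> S \<Longrightarrow> 0 \<le> Pker S h h'"
  unfolding Pker_def Let_def pos_part_def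
  by (intro mult_nonneg_nonneg divide_nonneg_nonneg add_nonneg_nonneg) auto

lemma Pker_split:
  assumes "0 < S" "\<bar>h\<bar> \<le> 1" "\<bar>h'\<bar> \<le> 1" "h \<noteq> h'"
  shows "Pker S h h' = 3 / pi\<^sup>2 * (if h' < h then void S h h' else void S (- h) (- h'))"
proof (cases "h' < h")
  case False
  have "Pker S h h' = 3 / pi\<^sup>2 * void S h' h"
    using Pker_eq_void[of S h h'] False assms by (simp add: Pker_swap[of S h])
  also have "void S h' h = void S (- h) (- h')"
    by (simp add: void_def max.commute)
  finally show ?thesis using False by simp
qed (use Pker_eq_void assms in simp)

lemma void_nonneg: "h' < h \<Longrightarrow> 0 \<le> void S h h'"
  by (simp add: void_def pos_part_def)

lemma nn_integral_Pker:
  assumes h': "\<bar>h'\<bar> \<le> 1"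
  shows "(\<integral>\<^sup>+z. ennreal (indicator impact_domain z *\<^sub>R (\<Phi> z * Pker (fst z) (snd z) h')) \<partial>lborel)
     = ennreal (3 / pi\<^sup>2) * (mean_flight \<Phi> h' + mean_flight (flip \<Phi>) (- h'))"
proof -
  let ?a = "\<lambda>S h. ennreal (\<Phi> (S, h)) * ennreal (void S h h') * indicator {h'<..1} h * indicator {0<..} S"
  let ?b = "\<lambda>S h. ennreal (\<Phi> (S, h)) * ennreal (void S (- h) (- h')) * indicator {-1..<h'} h * indicator {0<..} S"
  have [measurable]: "(\<lambda>z. void (fst z) (snd z) h') \<in> borel_measurable (borel \<Otimes>\<^sub>M borel)"
    "(\<lambda>z. void (fst z) (- snd z) (- h')) \<in> borel_measurable (borel \<Otimes>\<^sub>M borel)"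
    "(\<lambda>z. Pker (fst z) (snd z) h') \<in> borel_measurable (borel \<Otimes>\<^sub>M borel)"
    unfolding void_def Pker_def Let_def pos_part_def by measurable
  have am[measurable]: "(\<lambda>(S, h). ?a S h) \<in> borel_measurable (borel \<Otimes>\<^sub>M borel)"
    "(\<lambda>(S, h). ?b S h) \<in> borel_measurable (borel \<Otimes>\<^sub>M borel)"
    unfolding void_def pos_part_def by measurable
  have flip: "mean_flight (flip \<Phi>) (- h') = (\<integral>\<^sup>+S. \<integral>\<^sup>+h. ?b S h \<partial>lborel \<partial>lborel)"
    unfolding mean_flight_def
  proof (rule nn_integral_cong)
    fix S :: real
    have "(\<integral>\<^sup>+h. ennreal (flip \<Phi> (S, h)) * ennreal (void S h (- h')) * indicator {- h'<..1} h * indicator {0<..} S \<partial>lborel)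
      = ennreal \<bar>- 1\<bar> * (\<integral>\<^sup>+h. ennreal (flip \<Phi> (S, 0 + - 1 * h)) * ennreal (void S (0 + - 1 * h) (- h')) * indicator {- h'<..1} (0 + - 1 * h) * indicator {0<..} S \<partial>lborel)"
      unfolding void_def pos_part_def flip_def by (rule nn_integral_real_affine) auto
    also have "\<dots> = (\<integral>\<^sup>+h. ?b S h \<partial>lborel)"
      by (simp, intro nn_integral_cong) (auto simp: flip_def split: split_indicator)
    finally show "(\<integral>\<^sup>+h. ennreal (flip \<Phi> (S, h)) * ennreal (void S h (- h')) * indicator {- h'<..1} h * indicator {0<..} S \<partial>lborel)
      = (\<integral>\<^sup>+h. ?b S h \<partial>lborel)" .
  qed
  have "(\<integral>\<^sup>+z. ennreal (indicator impact_domain z *\<^sub>R (\<Phi> z * Pker (fst z) (snd z) h')) \<partial>lborel)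
    = (\<integral>\<^sup>+z. ennreal (indicator impact_domain z *\<^sub>R (\<Phi> z * Pker (fst z) (snd z) h')) \<partial>(lborel \<Otimes>\<^sub>M lborel))"
    by (simp only: lborel_prod)
  also have "\<dots> = (\<integral>\<^sup>+S. \<integral>\<^sup>+h. ennreal (indicator impact_domain (S, h) *\<^sub>R (\<Phi> (S, h) * Pker (fst (S, h)) (snd (S, h)) h')) \<partial>lborel \<partial>lborel)"
    by (rule lborel.nn_integral_fst[symmetric]) measurable
  also have "\<dots> = (\<integral>\<^sup>+S. \<integral>\<^sup>+h. ennreal (3 / pi\<^sup>2) * (?a S h + ?b S h) \<partial>lborel \<partial>lborel)"
  proof (rule nn_integral_cong, rule nn_integral_cong_AE, rule AE_mp[OF AE_lborel_singleton[of h']], rule AE_I2, rule impI)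
    fix S h :: real assume h: "h \<noteq> h'"
    show "ennreal (indicator impact_domain (S, h) *\<^sub>R (\<Phi> (S, h) * Pker (fst (S, h)) (snd (S, h)) h')) = ennreal (3 / pi\<^sup>2) * (?a S h + ?b S h)"
    proof (cases "0 < S \<and> \<bar>h\<bar> \<le> 1")
      case False
      thus ?thesis using h' by (auto split: split_indicator)
    next
      case True
      hence P: "Pker S h h' = 3 / pi\<^sup>2 * (if h' < h then void S h h' else void S (- h) (- h'))"
        using h h' by (intro Pker_split) auto
      have dom: "(S, h) \<in> impact_domain" using True by auto
      have m: "ennreal (\<Phi> (S, h) * (3 / pi\<^sup>2 * w)) = ennreal (3 / pi\<^sup>2) * (ennreal (\<Phi> (S, h)) * ennreal w)" if "0 \<le> w" for w
        using nonneg[of "(S, h)"] that by (simp add: ennreal_mult[symmetric] mult_ac)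
      show ?thesis
      proof (cases "h' < h")
        case lt: True
        have "?a S h = ennreal (\<Phi> (S, h)) * ennreal (void S h h')" "?b S h = 0" using True lt by auto
        thus ?thesis using m[OF void_nonneg[OF lt, of S]] dom P lt by simp
      next
        case ge: False
        hence lt: "- h' < - h" using h by simp
        have "?b S h = ennreal (\<Phi> (S, h)) * ennreal (void S (- h) (- h'))" "?a S h = 0" using True lt by auto
        thus ?thesis using m[OF void_nonneg[OF lt, of S]] dom P ge by simp
      qed
    qed
  qed
  also have "\<dots> = (\<integral>\<^sup>+S. ennreal (3 / pi\<^sup>2) * ((\<integral>\<^sup>+h. ?a S h \<partial>lborel) + (\<integral>\<^sup>+h. ?b S h \<partial>lborel)) \<partial>lborel)"
    using am by (intro nn_integral_cong) (simp add: nn_integral_cmult nn_integral_add)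
  also have "\<dots> = ennreal (3 / pi\<^sup>2) * ((\<integral>\<^sup>+S. \<integral>\<^sup>+h. ?a S h \<partial>lborel \<partial>lborel) + (\<integral>\<^sup>+S. \<integral>\<^sup>+h. ?b S h \<partial>lborel \<partial>lborel))"
    using am by (simp add: nn_integral_cmult nn_integral_add)
  finally show ?thesis unfolding flip unfolding mean_flight_def .
qed

lemma Pker_integral:
  assumes h': "\<bar>h'\<bar> \<le> 1"
  shows "set_integrable lborel impact_domain (\<lambda>z. \<Phi> z * Pker (fst z) (snd z) h')"
    "(LINT z:impact_domain|lborel. \<Phi> z * Pker (fst z) (snd z) h') = mean_value h' / (pi\<^sup>2 / 6)"
proof -
  interpret fl: test_function "flip \<Phi>" s0 S0 B by (rule test_function_flip) unfold_locales
  let ?g = "\<lambda>z. indicator impact_domain z *\<^sub>R (\<Phi> z * Pker (fst z) (snd z) h')"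
  have [measurable]: "(\<lambda>z. Pker (fst z) (snd z) h') \<in> borel_measurable (borel \<Otimes>\<^sub>M borel)"
    unfolding Pker_def Let_def pos_part_def by measurable
  have "?g \<in> borel_measurable (borel \<Otimes>\<^sub>M borel)" by measurable
  hence m: "?g \<in> borel_measurable lborel" by (simp add: borel_prod)
  have nn: "AE z in lborel. 0 \<le> ?g z"
    by (intro AE_I2) (auto split: split_indicator intro!: mult_nonneg_nonneg nonneg Pker_nonneg)
  have f1: "mean_flight \<Phi> h' < \<infinity>" "mean_flight (flip \<Phi>) (- h') < \<infinity>"
    using mean_flight_finite[OF h'] fl.mean_flight_finite[of "- h'"] h' by auto
  define a b where "a = enn2real (mean_flight \<Phi> h')" and "b = enn2real (mean_flight (flip \<Phi>) (- h'))"
  have ab: "mean_flight \<Phi> h' = ennreal a" "mean_flight (flip \<Phi>) (- h') = ennreal b" "0 \<le> a" "0 \<le> b"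
    using f1 by (simp_all add: a_def b_def)
  have I: "(\<integral>\<^sup>+z. ennreal (?g z) \<partial>lborel) = ennreal (3 / pi\<^sup>2 * (a + b))"
    unfolding nn_integral_Pker[OF h'] ab(1,2) using ab(3,4)
    by (simp add: ennreal_plus[symmetric] ennreal_mult[symmetric] del: ennreal_plus)
  show "set_integrable lborel impact_domain (\<lambda>z. \<Phi> z * Pker (fst z) (snd z) h')"
    unfolding set_integrable_def by (rule integrableI_nonneg[OF m nn]) (simp only: I ennreal_less_top infinity_ennreal_def)
  have "(LINT z:impact_domain|lborel. \<Phi> z * Pker (fst z) (snd z) h') = enn2real (ennreal (3 / pi\<^sup>2 * (a + b)))"
    unfolding set_lebesgue_integral_def by (subst integral_eq_nn_integral[OF m nn]) (simp only: I)
  \<comment> \<open>The constant \<open>3 / pi\<^sup>2\<close> of the kernel is the half in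
    \<open>mean_value\<close> divided by \<open>pi\<^sup>2 / 6\<close>.\<close>
  also have "\<dots> = mean_value h' / (pi\<^sup>2 / 6)"
    using ab(3,4) by (simp add: mean_value_def a_def[symmetric] b_def[symmetric] field_simps)
  finally show "(LINT z:impact_domain|lborel. \<Phi> z * Pker (fst z) (snd z) h') = mean_value h' / (pi\<^sup>2 / 6)" .
qed

end

text \<open>The function \<kappa> stands for the positive or the negative part. Being 1-Lipschitz
  and 0 at 0, it does not enlarge the support or the modulus of continuity.\<close>

lemma test_function_of_compact_support:
  fixes \<Phi> :: "real \<times> real \<Rightarrow> real" and \<kappa> :: "real \<Rightarrow> real"
  assumes cont: "continuous_on ({0<..} \<times> {-1..1}) \<Phi>"
    and K: "compact K" "K \<subseteq> {0<..} \<times> {-1..1}" and zero: "\<And>z. z \<in> {0<..} \<times> {-1..1} - K \<Longrightarrow> \<Phi> z = 0"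
    and \<kappa>: "\<And>x. 0 \<le> \<kappa> x" "\<And>x. \<kappa> x \<le> \<bar>x\<bar>" "\<And>x x'. \<bar>\<kappa> x - \<kappa> x'\<bar> \<le> \<bar>x - x'\<bar>"
      and [measurable]: "\<kappa> \<in> borel_measurable borel"
  shows "\<exists>s0 S0 B. test_function (\<lambda>z. \<kappa> (indicator ({0<..} \<times> {-1..1}) z *\<^sub>R \<Phi> z)) s0 S0 B"
proof -
  let ?D = "{0<..} \<times> {-1..1} :: (real \<times> real) set"
  define \<Psi> where "\<Psi> z = indicator ?D z *\<^sub>R \<Phi> z" for z
  have \<kappa>0: "\<kappa> 0 = 0" using \<kappa>(1,2)[of 0] by simp
  have "?D \<in> sets borel" by (simp add: borel_prod[symmetric])
  hence "\<Psi> \<in> borel_measurable borel"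
    unfolding \<Psi>_def[abs_def] by (rule borel_measurable_continuous_on_indicator[OF _ cont])
  hence [measurable]: "\<Psi> \<in> borel_measurable (borel \<Otimes>\<^sub>M borel)" by (simp only: borel_prod)
  have \<Psi>K: "z \<in> K" if "\<Psi> z \<noteq> 0" for z
    using that zero[of z] by (auto simp: \<Psi>_def split: split_indicator_asm)
  obtain B where B: "\<And>z. z \<in> K \<Longrightarrow> \<bar>\<Phi> z\<bar> \<le> B" "0 < B"
  proof -
    have "bounded (\<Phi> ` K)"
      using K cont by (intro compact_imp_bounded compact_continuous_image continuous_on_subset[OF cont]) auto
    then obtain b where "\<forall>x\<in>\<Phi> ` K. norm x \<le> b" "0 < b" by (auto simp: bounded_pos)
    thus ?thesis by (intro that[of b]) auto
  qed
  obtain s0 S0 where s: "0 < s0" "\<And>z. z \<in> K \<Longrightarrow> s0 \<le> fst z \<and> fst z \<le> S0"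
  proof (cases "K = {}")
    case True
    thus ?thesis by (intro that[of 1 1]) auto
  next
    case False
    have f: "continuous_on K fst" for K :: "(real \<times> real) set" by (intro continuous_intros)
    obtain p where p: "p \<in> K" "\<And>z. z \<in> K \<Longrightarrow> fst p \<le> fst z"
      using continuous_attains_inf[OF K(1) False f] by blast
    obtain q where q: "q \<in> K" "\<And>z. z \<in> K \<Longrightarrow> fst z \<le> fst q"
      using continuous_attains_sup[OF K(1) False f] by blast
    show ?thesis by (rule that[of "fst p" "fst q"]) (use p q K(2) in auto)
  qed
  have "test_function (\<lambda>z. \<kappa> (\<Psi> z)) s0 S0 B"
  proof
    show "\<kappa> (\<Psi> p) \<le> B" for p
    proof (cases "\<Psi> p = 0")
      case False
      hence "\<bar>\<Psi> p\<bar> \<le> B" using B(1)[OF \<Psi>K[OF False]] by (auto simp: \<Psi>_def split: split_indicator)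
      thus ?thesis using \<kappa>(2)[of "\<Psi> p"] by linarith
    qed (use \<kappa>0 B in simp)
    show "s0 \<le> S \<and> S \<le> S0" if "\<kappa> (\<Psi> (S, h)) \<noteq> 0" for S h
    proof -
      have "\<Psi> (S, h) \<noteq> 0" using that \<kappa>0 by metis
      thus ?thesis using s(2)[OF \<Psi>K, of "(S, h)"] by simp
    qed
    fix \<delta> :: real assume \<delta>: "0 < \<delta>"
    let ?C = "{s0 / 2..S0 + 1} \<times> {-1..1} :: (real \<times> real) set"
    have "?C \<subseteq> ?D" using s(1) by auto
    hence "uniformly_continuous_on ?C \<Phi>"
      by (intro compact_uniformly_continuous continuous_on_subset[OF cont] compact_Times) auto
    then obtain \<eta> where \<eta>: "\<eta> > 0" "\<And>z z'. z \<in> ?C \<Longrightarrow> z' \<in> ?C \<Longrightarrow> dist z' z < \<eta> \<Longrightarrow> dist (\<Phi> z') (\<Phi> z) < \<delta>"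
      using \<delta> unfolding uniformly_continuous_on_def by metis
    \<comment> \<open>With shifts below \<open>s0 / 2\<close> and 1, as soon as one of
      \<open>S\<close>, \<open>S'\<close> leaves \<open>[s0 / 2, S0 + 1]\<close> both lie outside
      \<open>[s0, S0]\<close>, where the function vanishes.\<close>
    define \<eta>' where "\<eta>' = min (\<eta> / 2) (min (s0 / 4) (1 / 2))"
    have \<eta>': "0 < \<eta>'" "\<eta>' < \<eta>" "\<eta>' < s0 / 2" "\<eta>' < 1" using \<eta> s(1) by (auto simp: \<eta>'_def min_def)
    show "\<exists>\<eta>>0. \<forall>S S' h. \<bar>h\<bar> \<le> 1 \<longrightarrow> \<bar>S - S'\<bar> \<le> \<eta> \<longrightarrow> \<bar>\<kappa> (\<Psi> (S, h)) - \<kappa> (\<Psi> (S', h))\<bar> \<le> \<delta>"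
    proof (intro exI[of _ \<eta>'] conjI allI impI \<eta>'(1))
      fix S S' h :: real assume h: "\<bar>h\<bar> \<le> 1" and S: "\<bar>S - S'\<bar> \<le> \<eta>'"
      show "\<bar>\<kappa> (\<Psi> (S, h)) - \<kappa> (\<Psi> (S', h))\<bar> \<le> \<delta>"
      proof (cases "S \<in> {s0 / 2..S0 + 1} \<and> S' \<in> {s0 / 2..S0 + 1}")
        case True
        have "dist (\<Phi> (S, h)) (\<Phi> (S', h)) < \<delta>"
          by (rule \<eta>(2)) (use True h S \<eta>' in \<open>auto simp: dist_Pair_Pair dist_real_def abs_le_iff\<close>)
        moreover have "\<Psi> (S, h) = \<Phi> (S, h)" "\<Psi> (S', h) = \<Phi> (S', h)"
          using True h s(1) by (auto simp: \<Psi>_def abs_le_iff)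
        ultimately show ?thesis using \<kappa>(3)[of "\<Psi> (S, h)" "\<Psi> (S', h)"] by (simp add: dist_real_def)
      next
        case False
        have z: "\<Psi> (T, h) = 0" if "\<not> (s0 \<le> T \<and> T \<le> S0)" for T
          using s(2)[OF \<Psi>K, of "(T, h)"] that by auto
        have "\<not> (s0 \<le> S \<and> S \<le> S0)" "\<not> (s0 \<le> S' \<and> S' \<le> S0)"
          using False S \<eta>' s(1) by (auto simp: abs_le_iff)
        thus ?thesis using z \<delta> by simp
      qed
    qed
  qed (use \<kappa> s B in auto)
  thus ?thesis unfolding \<Psi>_def by blast
qed

theorem theorem2p1:
  fixes \<Phi> :: "real \<times> real \<Rightarrow> real" and h' :: real
  assumes cont: "continuous_on ({0<..} \<times> {-1..1}) \<Phi>"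
    and supp: "\<exists>K. compact K \<and> K \<subseteq> {0<..} \<times> {-1..1} \<and>
                  (\<forall>z \<in> ({0<..} \<times> {-1..1}) - K. \<Phi> z = 0)"
    and hp: "h' \<in> {-1..1}"
  shows "(AE \<theta> in lborel.
           ((\<lambda>\<epsilon>. (1 / \<bar>ln \<epsilon>\<bar>) *
                 (LINT r:{\<epsilon>..1/4}|lborel. \<Phi> (transfer r h' (dir \<theta>)) / r))
            \<longlongrightarrow> (LINT z:({0<..} \<times> {-1..1})|lborel. \<Phi> z * Pker (fst z) (snd z) h'))
           (at_right 0))
       \<and> (\<forall>S h h'. S \<ge> 0 \<and> h \<in> {-1<..<1} \<and> h' \<in> {-1<..<1} \<and> \<bar>h'\<bar> \<le> h \<longrightarrow>
            Pker S h h' = 3 / pi ^ 2 * min 1 ((1 / (h - h')) * pos_part (2 / S - (1 + h'))))"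
proof (intro conjI)
  let ?D = "{0<..} \<times> {-1..1} :: (real \<times> real) set"
  from supp obtain K where K0: "compact K \<and> K \<subseteq> ?D \<and> (\<forall>z \<in> ?D - K. \<Phi> z = 0)" by (elim exE)
  note K = conjunct1[OF K0] conjunct1[OF conjunct2[OF K0]] bspec[OF conjunct2[OF conjunct2[OF K0]]]
  have h': "\<bar>h'\<bar> \<le> 1" using hp by (auto simp: abs_le_iff)
  \<comment> \<open>The limit is known for non-negative functions; the two parts are treated
    separately and subtracted.\<close>
  define p n where "p z = max 0 (indicator ?D z *\<^sub>R \<Phi> z)" and "n z = max 0 (- (indicator ?D z *\<^sub>R \<Phi> z))" for z
  have "\<exists>s0 S0 B. test_function p s0 S0 B"
    unfolding p_def[abs_def]
  proof (rule test_function_of_compact_support[OF cont K, where \<kappa> = "max 0"])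
    show "max 0 \<in> borel_measurable (borel :: real measure)" by measurable
  qed (simp_all add: max_def abs_if)
  then obtain s0 S0 B where "test_function p s0 S0 B" by (elim exE)
  then interpret p: test_function p s0 S0 B .
  have "\<exists>s0 S0 B. test_function n s0 S0 B"
    unfolding n_def[abs_def]
  proof (rule test_function_of_compact_support[OF cont K, where \<kappa> = "\<lambda>x. max 0 (- x)"])
    show "(\<lambda>x. max 0 (- x)) \<in> borel_measurable (borel :: real measure)" by measurable
  qed (simp_all add: max_def abs_if)
  then obtain s1 S1 B1 where "test_function n s1 S1 B1" by (elim exE)
  then interpret n: test_function n s1 S1 B1 .
  have pn: "\<Phi> z = p z - n z" if "z \<in> ?D" for z
    using that by (simp add: p_def n_def max_def)
  have "(LINT z:?D|lborel. \<Phi> z * Pker (fst z) (snd z) h')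
      = (LINT z:?D|lborel. p z * Pker (fst z) (snd z) h' - n z * Pker (fst z) (snd z) h')"
    unfolding set_lebesgue_integral_def
    by (rule Bochner_Integration.integral_cong[OF refl]) (auto simp: pn left_diff_distrib split: split_indicator)
  also have "\<dots> = p.mean_value h' / (pi\<^sup>2 / 6) - n.mean_value h' / (pi\<^sup>2 / 6)"
    by (subst set_integral_diff) (simp_all only: p.Pker_integral[OF h'] n.Pker_integral[OF h'])
  finally have rhs: "(LINT z:?D|lborel. \<Phi> z * Pker (fst z) (snd z) h')
      = p.mean_value h' / (pi\<^sup>2 / 6) - n.mean_value h' / (pi\<^sup>2 / 6)" .
  show "AE \<theta> in lborel.
           ((\<lambda>\<epsilon>. (1 / \<bar>ln \<epsilon>\<bar>) *
                 (LINT r:{\<epsilon>..1/4}|lborel. \<Phi> (transfer r h' (dir \<theta>)) / r))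
            \<longlongrightarrow> (LINT z:?D|lborel. \<Phi> z * Pker (fst z) (snd z) h')) (at_right 0)"
    using p.log_average_AE[OF h'] n.log_average_AE[OF h']
  proof eventually_elim
    case (elim \<theta>)
    let ?T = "\<lambda>r. transfer r h' (dir \<theta>)"
    have int: "set_integrable lborel {\<epsilon>..1/4} (\<lambda>r. p (?T r) / r)" "set_integrable lborel {\<epsilon>..1/4} (\<lambda>r. n (?T r) / r)"
      if "0 < \<epsilon>" for \<epsilon>
      using elim that by blast+
    \<comment> \<open>Both parts are cut off outside the domain of \<Phi>; almost surely the
      transfer map takes its values inside it for all radii considered.\<close>
    have T: "\<Phi> (?T r) = p (?T r) - n (?T r)" if "0 < r" "r \<le> 1 / 4" for r
      using elim that by (intro pn) blast
    have "((\<lambda>\<epsilon>. (1 / \<bar>ln \<epsilon>\<bar>) * (LINT r:{\<epsilon>..1/4}|lborel. p (?T r) / r) - (1 / \<bar>ln \<epsilon>\<bar>) * (LINT r:{\<epsilon>..1/4}|lborel. n (?T r) / r))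
       \<longlongrightarrow> p.mean_value h' / (pi\<^sup>2 / 6) - n.mean_value h' / (pi\<^sup>2 / 6)) (at_right 0)"
      using elim by (intro tendsto_diff) blast+
    moreover have "\<forall>\<^sub>F \<epsilon> in at_right 0. (1 / \<bar>ln \<epsilon>\<bar>) * (LINT r:{\<epsilon>..1/4}|lborel. p (?T r) / r) - (1 / \<bar>ln \<epsilon>\<bar>) * (LINT r:{\<epsilon>..1/4}|lborel. n (?T r) / r)
       = (1 / \<bar>ln \<epsilon>\<bar>) * (LINT r:{\<epsilon>..1/4}|lborel. \<Phi> (?T r) / r)"
    proof -
      have "\<forall>\<^sub>F \<epsilon> in at_right (0::real). 0 < \<epsilon>" by (simp add: eventually_at_right_less)
      thus ?thesis
      proof eventually_elim
        case (elim \<epsilon>)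
        have "(LINT r:{\<epsilon>..1/4}|lborel. \<Phi> (?T r) / r) = (LINT r:{\<epsilon>..1/4}|lborel. p (?T r) / r - n (?T r) / r)"
          unfolding set_lebesgue_integral_def
        proof (rule Bochner_Integration.integral_cong[OF refl])
          fix r :: real
          show "indicator {\<epsilon>..1/4} r *\<^sub>R (\<Phi> (?T r) / r) = indicator {\<epsilon>..1/4} r *\<^sub>R (p (?T r) / r - n (?T r) / r)"
            using T[of r] elim by (cases "r \<in> {\<epsilon>..1/4}") (simp_all add: diff_divide_distrib)
        qed
        also have "\<dots> = (LINT r:{\<epsilon>..1/4}|lborel. p (?T r) / r) - (LINT r:{\<epsilon>..1/4}|lborel. n (?T r) / r)"
          by (rule set_integral_diff(2)[OF int[OF elim]])
        finally show ?case by (simp add: right_diff_distrib)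
      qed
    qed
    ultimately show ?case unfolding rhs by (rule Lim_transform_eventually)
  qed
  show "\<forall>S h h'. S \<ge> 0 \<and> h \<in> {-1<..<1} \<and> h' \<in> {-1<..<1} \<and> \<bar>h'\<bar> \<le> h \<longrightarrow>
            Pker S h h' = 3 / pi ^ 2 * min 1 ((1 / (h - h')) * pos_part (2 / S - (1 + h')))"
    using Pker_explicit by blast
qed

end
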